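(* Assume the existence and smoothness of a critical point $\varphi\in\mathcal K$ for the functional $I$ (with $\mathcal K$, $I$ and critical points as described in the context), and assume that the coincidence set $A_R\setminus\Omega_\varphi$ (where $\varphi=\varphi^{sup}$) has a smooth boundary $\Sigma$. Then the critical point $\varphi$ satisfies $$\operatorname{div}\big(\rho(|\nabla\varphi|^2)\nabla\varphi\big)=0\quad\text{in }\{\mathbf x\in A_R:\ \varphi>\varphi^{sup},\ |\nabla\varphi|<\hat q_0\},$$ $$p+\rho\left(\frac{\partial\varphi}{\partial n}\right)^2=p^{sup}+\rho\,\frac{\partial\varphi}{\partial n}\,\frac{\partial\varphi^{sup}}{\partial n}\quad\text{on }\Sigma,$$ $$\rho\,\frac{\partial\varphi}{\partial n}=-m(s)\quad\text{on }\Gamma,$$ where, in $\Omega_\varphi=\{\mathbf x\in A_R:\varphi(\mathbf x)>\varphi^{sup}(\mathbf x)\}$, $$\rho=\rho(|\nabla\varphi|^2)=\left(\frac{1}{k_a}\,\frac{\gamma-1}{2\gamma}\,(\hat q_0^2-|\nabla\varphi|^2)\right)^{1/(\gamma-1)},\qquad p=k_a\rho^\gamma,$$ and $m$ is a given function that satisfies $$\int_\Sigma\rho\frac{\partial\varphi}{\partial n}=-\int_\Gamma\rho\frac{\partial\varphi}{\partial n}=\int_\Gamma m(s)\,ds=2\pi M_0=\int_\Sigma\rho^{sup}\frac{\partial\varphi^{sup}}{\partial n}.$$ On $\Sigma$, the values of $\rho,p,\partial\varphi/\partial n$ are those taken from the $\Omega_\varphi$ side, and $p^{sup},\rho^{sup},\partial\varphi^{sup}/\partial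 n$ are those of the given supersonic flow.
   Context: Constants: $\gamma>1$, $k_0>0$, $k_a>k_0$, $\hat q_0>0$, $M_0>0$, and $c_*^2=\frac{\gamma-1}{\gamma+1}\hat q_0^2$. Domain: $N\ge1$ is arbitrary, $B_R\subset\mathbb R^N$ is the ball of radius $R$ centred at the origin, $\Gamma$ is a smooth inner boundary inside $B_R$ enclosing a domain $D\subset\mathbb R^N$, and $A_R=B_R\setminus\overline D$. The symbols $dx\,dy$ and $ds$ denote the volume element in the domain and the surface element on boundaries (written in planar notation). Given supersonic flow: $\varphi^{sup}$ is a given potential on $A_R$, normalised by $\varphi^{sup}=0$ on $|\mathbf x|=R$, whose velocity $\mathbf u=-\nabla\varphi^{sup}$ is supersonic ($|\nabla\varphi^{sup}|>c_*$) throughout $A_R$. Its density is $\rho^{sup}=\left(\frac1{k_0}\frac{\gamma-1}{2\gamma}(\hat q_0^2-|\nabla\varphi^{sup}|^2)\right)^{1/(\gamma-1)}$ and its pressure is $p^{sup}=k_0(\rho^{sup})^\gamma$. It solves the steady compressible Euler system (in particular $\operatorname{div}(\rho^{sup}\nabla\varphi^{sup})=0$), moves inward from $|\mathbf x|=R$ towards $\Gamma$, and has total inward flux $2\pi M_0$. Admissible set: the non-empty closed convex set $\mathcal K=\{w\in W^{1,\infty}(A_R): w\ge\varphi^{sup},\ |\nabla w|\le\hat q_0\}$. Functional: for $w\in\mathcal K$, let $c^2=\frac{\gamma-1}{2}(\hat q_0^2-|\nabla w|^2)$, $\Omega_w=\{\mathbf x\in A_R:w(\mathbf x)>\varphi^{sup}(\mathbf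 x)\}$, and $$I(w)=-\int_{\Omega_w}(c^2)^{\gamma/(\gamma-1)}\,dx\,dy-\int_{A_R\setminus\Omega_w}\gamma^{\gamma/(\gamma-1)}k_a^{1/(\gamma-1)}p^{sup}\,dx\,dy+\int_\Gamma\gamma^{\gamma/(\gamma-1)}k_a^{1/(\gamma-1)}m(s)\,w\,ds,$$ where $m$ is a given smooth function on $\Gamma$ with $\int_\Gamma m\,ds=2\pi M_0$. Free boundary and normals: $\Sigma$ is the part of $\partial(A_R\setminus\Omega_\varphi)$ lying in the interior of $A_R$ (the shock); there is only one continuous shock and it encloses $\Gamma$. On $\Sigma$, $\partial/\partial n$ is the normal derivative in the direction of increasing $r=|\mathbf x|$; on $\Gamma$ (and on $\partial B_R$) it is the normal derivative in the direction outward from $A_R$. Critical point: $\varphi$ is a critical point of $I$ if the first variation (Fréchet derivative) $\delta I$ vanishes for admissible small variations $\delta\varphi$, which may be arbitrary, as long as they are small enough, where $|\nabla\varphi|<\hat q_0$. The first variation includes the effect of the free boundary moving: when $\varphi$ changes to $\varphi+\delta\varphi$, $\Sigma$ is displaced in the direction $n$, to leading order, by $\alpha=\delta\varphi/(\partial\varphi^{sup}/\partial n-\partial\varphi/\partial n)$.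
   Formalization: Assumes in addition that |∇φ|<q̂₀ (limit from Ω_φ) on Σ and Γ, without which the conditions there can fail; also makes explicit that ∂φ/∂n≠∂φ^sup/∂n on Σ and that φ^sup is C² with |∇φ^sup|<q̂₀ up to the boundary. *)

theory Defs
  imports "HOL-Analysis.Analysis"
begin

subsection \<open>Differential operators and smoothness\<close>

definition grad :: "('a::euclidean_space \<Rightarrow> real) \<Rightarrow> 'a \<Rightarrow> 'a" where
  "grad f x = (THE D. GDERIV f x :> D)"

definition divergence :: "('a::euclidean_space \<Rightarrow> 'a) \<Rightarrow> 'a \<Rightarrow> real" where
  "divergence V x = (\<Sum>b\<in>Basis. frechet_derivative V (at x) b \<bullet> b)"

text \<open>\<open>Ck_on k U f\<close>: all partial derivatives of \<open>f\<close> up to order \<open>k\<close> exist and are continuous on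
  the open set \<open>U\<close>.\<close>

primrec Ck_on :: "nat \<Rightarrow> 'a::euclidean_space set \<Rightarrow> ('a \<Rightarrow> real) \<Rightarrow> bool" where
  "Ck_on 0 U f \<longleftrightarrow> continuous_on U f"
| "Ck_on (Suc k) U f \<longleftrightarrow> (\<forall>x\<in>U. f differentiable (at x)) \<and>
     (\<forall>b\<in>Basis. Ck_on k U (\<lambda>x. frechet_derivative f (at x) b))"

definition smooth_on :: "'a::euclidean_space set \<Rightarrow> ('a \<Rightarrow> real) \<Rightarrow> bool" where
  "smooth_on U f \<longleftrightarrow> (\<forall>k. Ck_on k U f)"


subsection \<open>Smooth boundaries, normals and surface integrals\<close>

text \<open>\<open>boundary_chart E x U \<psi>\<close>: inside the neighbourhood \<open>U\<close> of the boundary point \<open>x\<close>, the set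
  \<open>E\<close> is exactly one side of the regular smooth level set \<open>\<psi> = 0\<close>.\<close>

definition boundary_chart ::
    "'a::euclidean_space set \<Rightarrow> 'a \<Rightarrow> 'a set \<Rightarrow> ('a \<Rightarrow> real) \<Rightarrow> bool" where
  "boundary_chart E x U \<psi> \<longleftrightarrow> open U \<and> x \<in> U \<and> smooth_on U \<psi> \<and> (\<forall>y\<in>U. grad \<psi> y \<noteq> 0) \<and>
     \<psi> x = 0 \<and> E \<inter> U = {y \<in> U. \<psi> y < 0}"

definition smooth_boundary_on :: "'a::euclidean_space set \<Rightarrow> 'a set \<Rightarrow> bool" where
  "smooth_boundary_on E S \<longleftrightarrow> (\<forall>x\<in>S. \<exists>U \<psi>. boundary_chart E x U \<psi>)"

definition outer_normal :: "'a::euclidean_space set \<Rightarrow> 'a \<Rightarrow> 'a" where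
  "outer_normal E x = (THE \<nu>. \<exists>U \<psi>. boundary_chart E x U \<psi> \<and> \<nu> = sgn (grad \<psi> x))"

text \<open>Lebesgue measure of the coordinate hyperplane orthogonal to the basis vector \<open>b\<close>, regarded
  as a measure on the whole space. In dimension one it is the unit point mass at the origin.\<close>

definition hyperplane_measure :: "'a::euclidean_space \<Rightarrow> 'a measure" where
  "hyperplane_measure b =
     distr (\<Pi>\<^sub>M i\<in>Basis - {b}. lborel) borel (\<lambda>f. \<Sum>i\<in>Basis - {b}. f i *\<^sub>R i)"

text \<open>The surface element \<open>ds\<close>: wherever \<open>S\<close> is the graph \<open>x \<bullet> b = g x\<close> of a smooth function \<open>g\<close>
  of the coordinates orthogonal to \<open>b\<close>, it is \<open>sqrt (1 + |\<nabla>g|\<^sup>2)\<close> times Lebesgue measure in those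
  coordinates. A smooth closed hypersurface is covered by such graphs, and the expressions
  agree on overlaps, so that the measure exists and is unique. In dimension one it is the
  counting measure on \<open>S\<close>.\<close>

definition is_surface_measure :: "'a::euclidean_space set \<Rightarrow> 'a measure \<Rightarrow> bool" where
  "is_surface_measure S \<sigma> \<longleftrightarrow> sets \<sigma> = sets borel \<and> emeasure \<sigma> (- S) = 0 \<and>
     (\<forall>b\<in>Basis. \<forall>U g. open U \<and> smooth_on U g \<and> (\<forall>x t. g (x + t *\<^sub>R b) = g x) \<and>
        S \<inter> U = {x \<in> U. x \<bullet> b = g x} \<longrightarrow>
        (\<forall>E\<in>sets borel. E \<subseteq> S \<inter> U \<longrightarrow>
           emeasure \<sigma> E =
             (\<integral>\<^sup>+ y. indicator E (y + g y *\<^sub>R b) * ennreal (sqrt (1 + (norm (grad g y))\<^sup>2))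
                \<partial>hyperplane_measure b)))"

definition surface_measure :: "'a::euclidean_space set \<Rightarrow> 'a measure" where
  "surface_measure S = (SOME \<sigma>. is_surface_measure S \<sigma>)"

definition surface_integral :: "'a::euclidean_space set \<Rightarrow> ('a \<Rightarrow> real) \<Rightarrow> real" where
  "surface_integral S f = (LINT x:S|surface_measure S. f x)"


subsection \<open>The Sobolev space $W^{1,\infty}$\<close>

definition test_function :: "'a::euclidean_space set \<Rightarrow> ('a \<Rightarrow> real) \<Rightarrow> bool" where
  "test_function A \<zeta> \<longleftrightarrow>
     smooth_on UNIV \<zeta> \<and> (\<exists>K. compact K \<and> K \<subseteq> A \<and> (\<forall>x. x \<notin> K \<longrightarrow> \<zeta> x = 0))"

definition L_inf :: "'a::euclidean_space set \<Rightarrow> ('a \<Rightarrow> 'b::euclidean_space) \<Rightarrow> bool" where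
  "L_inf A f \<longleftrightarrow>
     set_borel_measurable lebesgue A f \<and> (\<exists>B. AE x in lebesgue. x \<in> A \<longrightarrow> norm (f x) \<le> B)"

definition weak_gradient :: "'a::euclidean_space set \<Rightarrow> ('a \<Rightarrow> real) \<Rightarrow> ('a \<Rightarrow> 'a) \<Rightarrow> bool" where
  "weak_gradient A w g \<longleftrightarrow> (\<forall>\<zeta>. test_function A \<zeta> \<longrightarrow> (\<forall>b\<in>Basis.
     (LINT x:A|lebesgue. w x * (grad \<zeta> x \<bullet> b)) = - (LINT x:A|lebesgue. (g x \<bullet> b) * \<zeta> x)))"

definition W1_inf :: "'a::euclidean_space set \<Rightarrow> ('a \<Rightarrow> real) set" where
  "W1_inf A = {w. L_inf A w \<and> (\<exists>g. L_inf A g \<and> weak_gradient A w g)}"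

text \<open>For \<open>w \<in> W1_inf A\<close> the choice is unique up to a null set.\<close>

definition weak_grad :: "'a::euclidean_space set \<Rightarrow> ('a \<Rightarrow> real) \<Rightarrow> 'a \<Rightarrow> 'a" where
  "weak_grad A w = (SOME g. L_inf A g \<and> weak_gradient A w g)"


subsection \<open>Gas dynamics\<close>

text \<open>The density \<open>\<rho>(|\<nabla>\<phi>|\<^sup>2)\<close> given by Bernoulli's law; the argument \<open>v2\<close> is the squared speed
  and \<open>k\<close> the constant in \<open>p = k \<rho>\<^sup>\<gamma>\<close>.\<close>

definition gas_density :: "real \<Rightarrow> real \<Rightarrow> real \<Rightarrow> real \<Rightarrow> real" where
  "gas_density \<gamma> k q v2 = (1 / k * ((\<gamma> - 1) / (2 * \<gamma>)) * (q\<^sup>2 - v2)) powr (1 / (\<gamma> - 1))"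

definition pressure :: "real \<Rightarrow> real \<Rightarrow> real \<Rightarrow> real" where
  "pressure \<gamma> k \<rho> = k * \<rho> powr \<gamma>"

definition critical_speed :: "real \<Rightarrow> real \<Rightarrow> real" where
  "critical_speed \<gamma> q = sqrt ((\<gamma> - 1) / (\<gamma> + 1) * q\<^sup>2)"

text \<open>Conservation of mass, momentum and energy. For the potential flows considered below, mass
  conservation and Bernoulli's law imply the other two equations.\<close>

definition steady_euler ::
    "real \<Rightarrow> 'a::euclidean_space set \<Rightarrow> ('a \<Rightarrow> real) \<Rightarrow> ('a \<Rightarrow> 'a) \<Rightarrow> ('a \<Rightarrow> real) \<Rightarrow> bool" where
  "steady_euler \<gamma> A \<rho> u p \<longleftrightarrow> (\<forall>x\<in>A.
     divergence (\<lambda>y. \<rho> y *\<^sub>R u y) x = 0 \<and>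
     \<rho> x *\<^sub>R frechet_derivative u (at x) (u x) + grad p x = 0 \<and>
     divergence (\<lambda>y. (\<rho> y * (norm (u y))\<^sup>2 / 2 + \<gamma> / (\<gamma> - 1) * p y) *\<^sub>R u y) x = 0)"


subsection \<open>The variational problem\<close>

text \<open>Elements of $W^{1,\infty}$ are represented by functions that are continuous up to the
  boundary, which gives a meaning to pointwise inequalities and to boundary values.\<close>

definition admissible_set ::
    "'a::euclidean_space set \<Rightarrow> ('a \<Rightarrow> real) \<Rightarrow> real \<Rightarrow> ('a \<Rightarrow> real) set" where
  "admissible_set A \<phi>s q = {w \<in> W1_inf A. continuous_on (closure A) w \<and>
     (\<forall>x\<in>A. \<phi>s x \<le> w x) \<and> (AE x in lebesgue. x \<in> A \<longrightarrow> norm (weak_grad A w x) \<le> q)}"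

definition noncoincidence ::
    "'a::euclidean_space set \<Rightarrow> ('a \<Rightarrow> real) \<Rightarrow> ('a \<Rightarrow> real) \<Rightarrow> 'a set" where
  "noncoincidence A \<phi>s w = {x \<in> A. \<phi>s x < w x}"

text \<open>The normal to the shock pointing away from the inner boundary, i.e. towards increasing \<open>|x|\<close>,
  is the outer normal of the noncoincidence set, which lies between the inner boundary and the
  shock.\<close>

definition shock ::
    "'a::euclidean_space set \<Rightarrow> ('a \<Rightarrow> real) \<Rightarrow> ('a \<Rightarrow> real) \<Rightarrow> 'a set" where
  "shock A \<phi>s w = frontier (A - noncoincidence A \<phi>s w) \<inter> A"

definition functional ::
    "real \<Rightarrow> real \<Rightarrow> real \<Rightarrow> real \<Rightarrow> 'a::euclidean_space set \<Rightarrow> 'a set \<Rightarrow> ('a \<Rightarrow> real) \<Rightarrow> ('a \<Rightarrow> real) \<Rightarrow>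
     ('a \<Rightarrow> real) \<Rightarrow> real" where
  "functional \<gamma> k0 ka q A \<Gamma> \<phi>s m w =
     - (LINT x:noncoincidence A \<phi>s w|lebesgue.
          ((\<gamma> - 1) / 2 * (q\<^sup>2 - (norm (weak_grad A w x))\<^sup>2)) powr (\<gamma> / (\<gamma> - 1)))
     - (LINT x:A - noncoincidence A \<phi>s w|lebesgue.
          \<gamma> powr (\<gamma> / (\<gamma> - 1)) * ka powr (1 / (\<gamma> - 1)) *
          pressure \<gamma> k0 (gas_density \<gamma> k0 q ((norm (grad \<phi>s x))\<^sup>2)))
     + surface_integral \<Gamma> (\<lambda>s. \<gamma> powr (\<gamma> / (\<gamma> - 1)) * ka powr (1 / (\<gamma> - 1)) * m s * w s)"

text \<open>The perturbation of \<open>\<phi>\<close> by \<open>\<delta>\<phi> = t \<eta>\<close>. To perturb across the free boundary, \<open>\<phi>\<close> is first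
  extended smoothly, from the set where it exceeds \<open>\<phi>s\<close>, to a function \<open>\<Phi>\<close> that lies below \<open>\<phi>s\<close>
  beyond the free boundary, so that \<open>t = 0\<close> gives \<open>\<phi>\<close> itself. The free boundary of the perturbed
  function is the zero set of \<open>\<Phi> + t \<eta> - \<phi>s\<close> and hence moves with \<open>t\<close>: to first order it is
  displaced along the normal \<open>n\<close> by
  \<open>\<alpha> = t \<eta> / (\<partial>\<phi>s/\<partial>n - \<partial>\<phi>/\<partial>n)\<close>.\<close>

definition perturbed ::
    "('a::euclidean_space \<Rightarrow> real) \<Rightarrow> ('a \<Rightarrow> real) \<Rightarrow> ('a \<Rightarrow> real) \<Rightarrow> real \<Rightarrow> 'a \<Rightarrow> real" where
  "perturbed \<phi>s \<Phi> \<eta> t = (\<lambda>x. max (\<phi>s x) (\<Phi> x + t * \<eta> x))"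

text \<open>The variation \<open>\<eta>\<close> is admissible if the perturbations stay in the admissible set for small
  \<open>t\<close> of either sign. This holds for every \<open>\<eta>\<close> supported near a point at which \<open>|\<nabla>\<phi>| < q\<close>.\<close>

definition critical_point ::
    "real \<Rightarrow> real \<Rightarrow> real \<Rightarrow> real \<Rightarrow> 'a::euclidean_space set \<Rightarrow> 'a set \<Rightarrow> ('a \<Rightarrow> real) \<Rightarrow> ('a \<Rightarrow> real) \<Rightarrow>
     ('a \<Rightarrow> real) \<Rightarrow> bool" where
  "critical_point \<gamma> k0 ka q A \<Gamma> \<phi>s m \<phi> \<longleftrightarrow> \<phi> \<in> admissible_set A \<phi>s q \<and>
     (\<forall>\<Phi> \<eta>. smooth_on UNIV \<Phi> \<and> smooth_on UNIV \<eta> \<and>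
        (\<forall>x\<in>noncoincidence A \<phi>s \<phi>. \<Phi> x = \<phi> x) \<and>
        (\<forall>x\<in>closure A - closure (noncoincidence A \<phi>s \<phi>). \<Phi> x < \<phi>s x) \<and>
        (\<exists>\<epsilon>>0. \<forall>t. \<bar>t\<bar> < \<epsilon> \<longrightarrow> perturbed \<phi>s \<Phi> \<eta> t \<in> admissible_set A \<phi>s q)
        \<longrightarrow> ((\<lambda>t. functional \<gamma> k0 ka q A \<Gamma> \<phi>s m (perturbed \<phi>s \<Phi> \<eta> t))
              has_real_derivative 0) (at 0))"

text \<open>Boundary values of \<open>\<nabla>\<phi>\<close>, taken from within the open set \<open>\<Omega>\<close>.\<close>

definition trace_grad :: "'a::euclidean_space set \<Rightarrow> ('a \<Rightarrow> real) \<Rightarrow> 'a \<Rightarrow> 'a" where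
  "trace_grad \<Omega> \<phi> x = Lim (at x within \<Omega>) (grad \<phi>)"

end

theory Submission
  imports Defs "HOL-Analysis.Analysis" "HOL-Computational_Algebra.Polynomial"
begin

text \<open>Extend \<open>\<phi>\<close> smoothly across the shock to a function \<open>\<Phi>\<close> lying below \<open>\<phi>s\<close> beyond it, and differentiate
\<open>I(max \<phi>s (\<Phi> + t \<eta>))\<close> at \<open>t = 0\<close>. Three choices of the support of \<open>\<eta>\<close> give the three conditions.

For \<open>\<eta>\<close> supported in \<open>\<Omega>\<close> the domain of integration does not move. Since \<open>d(c\<^sup>2)^(\<gamma>/(\<gamma>-1))\<close> is a
constant multiple of \<open>- \<rho> \<nabla>\<Phi> \<bullet> \<nabla>\<eta>\<close>, the variation vanishes exactly when \<open>\<rho> \<nabla>\<Phi>\<close> is divergence free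
(\<open>equation_of_motion\<close>). For \<open>\<eta> \<ge> 0\<close> supported near a point of \<open>\<Gamma>\<close>, the divergence theorem turns the same
integral into a surface integral over \<open>\<Gamma>\<close>, and the term with \<open>m\<close> in the functional gives
\<open>\<rho> \<partial>\<Phi>/\<partial>n = - m\<close> (\<open>inner_boundary_condition\<close>). For \<open>\<eta>\<close> supported near a point of the shock,
the domain \<open>{\<Phi> + t \<eta> > \<phi>s}\<close> moves as well, and its motion is weighted by the jump \<open>p - p\<^sup>s\<close> of the
integrand. The normal displacement is \<open>\<eta> / (\<partial>\<phi>s/\<partial>n - \<partial>\<Phi>/\<partial>n)\<close>, so the stationarity of the functional reads
\<open>\<rho> \<partial>\<Phi>/\<partial>n (\<partial>\<Phi>/\<partial>n - \<partial>\<phi>s/\<partial>n) + p - p\<^sup>s = 0\<close> (\<open>shock_condition\<close>).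

The motion of the domain is computed without parametrising the moving surface. If \<open>\<partial>u/\<partial>b\<close> does not
vanish, integration by parts for the Lipschitz function \<open>max 0 (u + t \<eta>)\<close> rewrites the difference of
the two indicator functions as an expression that can be differentiated under the integral
(\<open>moving_domain_variation\<close>). The result is again the integral of a divergence over \<open>\<Omega>\<close>.

The two flux identities are the divergence theorem on \<open>\<Omega>\<close> for \<open>\<rho> \<nabla>\<Phi>\<close> and on the region between the
shock and the outer sphere for \<open>\<rho>\<^sup>s \<nabla>\<phi>s\<close>. The first of these needs the equation of motion in all of
\<open>\<Omega>\<close>, whereas the variational argument only gives it where \<open>|\<nabla>\<Phi>| < q0\<close>. A maximum argument along the
direction of the flow shows that \<open>|\<nabla>\<Phi>| = q0\<close> cannot occur inside \<open>\<Omega>\<close> when it does not occur on the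
boundary (\<open>no_vacuum\<close>).

The divergence theorem itself is proved for sets that lie locally on one side of a smooth
hypersurface. Near a boundary point the hypersurface is a graph in some coordinate direction \<open>b\<close>;
a field splits into a part tangential to the level sets of the defining function, which has no
flux, and a multiple of \<open>b\<close>, which is integrated along lines by Fubini's theorem
(\<open>chart_graph_flux\<close>). The same computation shows that the surface measures of two overlapping graphs
agree, since both are determined by the volume integral of a divergence. Hence the surface measure
exists (\<open>surface_measure_exists\<close>).\<close>

section \<open>Calculus of continuously differentiable functions\<close>

abbreviation pd :: "'a \<Rightarrow> ('a::euclidean_space \<Rightarrow> real) \<Rightarrow> 'a \<Rightarrow> real" where
  "pd b f \<equiv> (\<lambda>x. frechet_derivative f (at x) b)"

lemma has_derivative_frechet:
  "f differentiable at x ==> (f has_derivative frechet_derivative f (at x)) (at x)"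
  by (simp only: frechet_derivative_works)

lemma pd_eqI: "(f has_derivative f') (at x) ==> pd b f x = f' b"
  by (simp add: frechet_derivative_at[symmetric])

lemma has_derivative_eq_open:
  assumes "(f has_derivative f') (at x)" "open U" "x \<in> U" "\<And>y. y \<in> U ==> f y = g y"
  shows "(g has_derivative f') (at x)"
  by (rule has_derivative_transform_within_open[OF assms(1-3)]) (rule assms(4))

lemma has_derivative_cong_open:
  fixes f g :: "'a::euclidean_space \<Rightarrow> 'b::euclidean_space"
  assumes "open U" "x \<in> U" "\<And>y. y \<in> U ==> f y = g y"
  shows "(f has_derivative f') (at x) \<longleftrightarrow> (g has_derivative f') (at x)"
proof
  show "(g has_derivative f') (at x)" if "(f has_derivative f') (at x)"
    by (rule has_derivative_eq_open[OF that assms(1,2)]) (rule assms(3))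
  show "(f has_derivative f') (at x)" if "(g has_derivative f') (at x)"
    by (rule has_derivative_eq_open[OF that assms(1,2)]) (rule assms(3)[symmetric])
qed

lemma frechet_derivative_cong_open:
  fixes f g :: "'a::euclidean_space \<Rightarrow> 'b::euclidean_space"
  assumes "open U" "x \<in> U" "\<And>y. y \<in> U ==> f y = g y"
  shows "frechet_derivative f (at x) = frechet_derivative g (at x)"
  unfolding frechet_derivative_def using has_derivative_cong_open[OF assms] by simp

lemma differentiable_cong_open:
  fixes f g :: "'a::euclidean_space \<Rightarrow> 'b::euclidean_space"
  assumes "open U" "x \<in> U" "\<And>y. y \<in> U ==> f y = g y"
  shows "f differentiable at x \<longleftrightarrow> g differentiable at x"
  unfolding differentiable_def using has_derivative_cong_open[OF assms] by simp

lemma Ck_on_cong: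
  assumes "open U" "\<And>x. x \<in> U ==> f x = g x"
  shows "Ck_on k U f \<longleftrightarrow> Ck_on k U g"
  using assms(2)
proof (induction k arbitrary: f g)
  case 0 then show ?case by (simp cong: continuous_on_cong)
next
  case (Suc k)
  have "Ck_on k U (pd b f) = Ck_on k U (pd b g)" for b
    by (rule Suc.IH, rule fun_cong[OF frechet_derivative_cong_open[OF assms(1)]]) (auto simp: Suc.prems)
  moreover have "(\<forall>x\<in>U. f differentiable at x) = (\<forall>x\<in>U. g differentiable at x)"
    using differentiable_cong_open[OF assms(1), of _ f g] Suc.prems by auto
  ultimately show ?case by simp
qed

lemma Ck_on_subset: "Ck_on k U f ==> V \<subseteq> U ==> Ck_on k V f"
  by (induction k arbitrary: f) (auto intro: continuous_on_subset)

lemma Ck_on_imp_continuous: "Ck_on k U f ==> continuous_on U f"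
  by (cases k) (auto simp: continuous_at_imp_continuous_on differentiable_imp_continuous_within)

lemma Ck_on_pred: "Ck_on (Suc k) U f ==> Ck_on k U f"
proof (induction k arbitrary: f)
  case 0 then show ?case using Ck_on_imp_continuous by fastforce
next
  case (Suc k)
  have "Ck_on k U (pd b f)" if "b \<in> Basis" for b
    using Suc.prems that Suc.IH by (metis Ck_on.simps(2))
  then show ?case using Suc.prems by simp
qed

lemma Ck_on_le: "Ck_on k U f ==> j \<le> k ==> Ck_on j U f"
  by (induction k) (auto simp: le_Suc_eq simp del: Ck_on.simps(2) dest: Ck_on_pred)

lemma Ck_on_union:
  assumes "open U" "open V" "Ck_on k U f" "Ck_on k V f"
  shows "Ck_on k (U \<union> V) f"
  using assms(3,4)
  by (induction k arbitrary: f) (auto intro: continuous_on_open_Un assms(1,2))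

text \<open>The directional derivatives of a sum, product or composition are computed from a derivative
  found by other means; this rule feeds them back into the recursive definition.\<close>

lemma Ck_on_SucI:
  assumes "open U" "\<And>x. x \<in> U ==> (f has_derivative f' x) (at x)"
    "\<And>b. b \<in> Basis ==> Ck_on k U (\<lambda>x. f' x b)"
  shows "Ck_on (Suc k) U f"
proof -
  have "Ck_on k U (pd b f)" if "b \<in> Basis" for b
  proof -
    have "Ck_on k U (pd b f) \<longleftrightarrow> Ck_on k U (\<lambda>x. f' x b)"
      by (rule Ck_on_cong[OF assms(1)]) (rule pd_eqI[OF assms(2)])
    then show ?thesis using assms(3) that by simp
  qed
  then show ?thesis using assms(2) by (auto simp: differentiable_def)
qed

lemma Ck_on_const [simp]: "Ck_on k U (\<lambda>x. c)"
  by (induction k arbitrary: c) auto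

lemma Ck_on_add:
  assumes "open U" "Ck_on k U f" "Ck_on k U g"
  shows "Ck_on k U (\<lambda>x. f x + g x)"
  using assms(2,3)
proof (induction k arbitrary: f g)
  case 0 then show ?case by (simp add: continuous_on_add)
next
  case (Suc k)
  show ?case
  proof (rule Ck_on_SucI[OF assms(1)])
    fix x assume "x \<in> U"
    then show "((\<lambda>x. f x + g x) has_derivative
        (\<lambda>h. pd h f x + pd h g x)) (at x)"
      using Suc.prems by (auto intro!: derivative_intros has_derivative_frechet)
  qed (use Suc in auto)
qed

lemma Ck_on_mult:
  assumes "open U" "Ck_on k U f" "Ck_on k U g"
  shows "Ck_on k U (\<lambda>x. f x * g x)"
  using assms(2,3)
proof (induction k arbitrary: f g)
  case 0 then show ?case by (simp add: continuous_on_mult)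
next
  case (Suc k)
  show ?case
  proof (rule Ck_on_SucI[OF assms(1)])
    fix x assume "x \<in> U"
    then show "((\<lambda>x. f x * g x) has_derivative
        (\<lambda>h. f x * pd h g x + pd h f x * g x)) (at x)"
      using Suc.prems by (auto intro!: derivative_intros has_derivative_frechet)
  next
    fix b :: 'a assume "b \<in> Basis"
    then show "Ck_on k U (\<lambda>x. f x * pd b g x
        + pd b f x * g x)"
      using Suc.prems by (intro Ck_on_add[OF assms(1)] Suc.IH) (auto dest: Ck_on_pred simp del: Ck_on.simps, auto)
  qed
qed

lemma Ck_on_cmult: "open U ==> Ck_on k U f ==> Ck_on k U (\<lambda>x. c * f x)"
  by (rule Ck_on_mult) auto

lemma Ck_on_minus: "open U ==> Ck_on k U f ==> Ck_on k U (\<lambda>x. - f x)"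
  using Ck_on_cmult[of U k f "-1"] by simp

lemma Ck_on_diff: "open U ==> Ck_on k U f ==> Ck_on k U g ==> Ck_on k U (\<lambda>x. f x - g x)"
  using Ck_on_add[of U k f "\<lambda>x. - g x"] Ck_on_minus[of U k g] by simp

lemma Ck_on_sum:
  assumes "open U" "\<And>i. i \<in> I ==> Ck_on k U (f i)"
  shows "Ck_on k U (\<lambda>x. \<Sum>i\<in>I. f i x)"
  using assms(2)
  by (induction I rule: infinite_finite_induct) (auto intro!: Ck_on_add assms(1) simp del: Ck_on.simps)

lemma Ck_on_prod:
  assumes "open U" "\<And>i. i \<in> I ==> Ck_on k U (f i)"
  shows "Ck_on k U (\<lambda>x. \<Prod>i\<in>I. f i x)"
  using assms(2)
  by (induction I rule: infinite_finite_induct) (auto intro!: Ck_on_mult assms(1) simp del: Ck_on.simps)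

lemma Ck_on_bounded_linear:
  assumes "bounded_linear (f :: 'a::euclidean_space \<Rightarrow> real)" "open U"
  shows "Ck_on k U f"
proof (cases k)
  case 0 then show ?thesis using assms by (simp add: linear_continuous_on)
next
  case (Suc j)
  have "Ck_on (Suc j) U f"
    by (rule Ck_on_SucI[where f' = "\<lambda>_. f"])
      (use assms in \<open>auto intro: bounded_linear_imp_has_derivative\<close>)
  then show ?thesis using Suc by simp
qed

lemma Ck_on_inner_const: "open U ==> Ck_on k U (\<lambda>x. x \<bullet> c)"
  by (rule Ck_on_bounded_linear) (rule bounded_linear_inner_left)

lemma Ck_on_compose:
  fixes h :: "'a::euclidean_space \<Rightarrow> 'b::euclidean_space"
  assumes "open U" "\<And>c. c \<in> Basis ==> Ck_on k U (\<lambda>x. h x \<bullet> c)" "Ck_on k V f" "h ` U \<subseteq> V"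
  shows "Ck_on k U (\<lambda>x. f (h x))"
  using assms(2,3)
proof (induction k arbitrary: f)
  case 0
  then have "continuous_on U h" by (subst continuous_on_componentwise) auto
  with 0 show ?case using continuous_on_compose2 assms(4) by (metis Ck_on.simps(1))
next
  case (Suc k)
  have hd: "(h has_derivative (\<lambda>d. \<Sum>c\<in>Basis. pd d (\<lambda>x. h x \<bullet> c) x *\<^sub>R c)) (at x)"
    if "x \<in> U" for x
  proof (subst has_derivative_componentwise_within, intro ballI)
    fix i :: 'b assume i: "i \<in> Basis"
    have "((\<lambda>x. h x \<bullet> i) has_derivative frechet_derivative (\<lambda>x. h x \<bullet> i) (at x)) (at x)"
      using Suc.prems(1)[OF i] that by (intro has_derivative_frechet) auto
    then show "((\<lambda>x. h x \<bullet> i) has_derivative (\<lambda>d. (\<Sum>c\<in>Basis. pd d (\<lambda>x. h x \<bullet> c) x *\<^sub>R c) \<bullet> i)) (at x)"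
      using i by (simp add: inner_sum_left inner_Basis if_distrib cong: if_cong)
  qed
  show ?case
  proof (rule Ck_on_SucI[OF assms(1)])
    fix x assume x: "x \<in> U"
    then have df: "(f has_derivative frechet_derivative f (at (h x))) (at (h x))"
      using Suc.prems(2) assms(4) by (intro has_derivative_frechet) auto
    have lin: "linear (frechet_derivative f (at (h x)))"
      using df has_derivative_linear by blast
    have "((\<lambda>x. f (h x)) has_derivative (\<lambda>d. frechet_derivative f (at (h x))
        (\<Sum>c\<in>Basis. pd d (\<lambda>x. h x \<bullet> c) x *\<^sub>R c))) (at x)"
      using has_derivative_compose[OF hd[OF x] df] by (simp add: o_def)
    then show "((\<lambda>x. f (h x)) has_derivative (\<lambda>d. \<Sum>c\<in>Basis. pd d (\<lambda>x. h x \<bullet> c) x *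
        frechet_derivative f (at (h x)) c)) (at x)"
      by (simp add: linear_sum[OF lin] linear_cmul[OF lin])
  next
    fix b :: 'a assume b: "b \<in> Basis"
    show "Ck_on k U (\<lambda>x. \<Sum>c\<in>Basis. pd b (\<lambda>x. h x \<bullet> c) x *
        frechet_derivative f (at (h x)) c)"
    proof (intro Ck_on_sum Ck_on_mult assms(1))
      fix c :: 'b assume c: "c \<in> Basis"
      show "Ck_on k U (\<lambda>x. pd b (\<lambda>x. h x \<bullet> c) x)"
        using Suc.prems(1)[OF c] b by simp
      show "Ck_on k U (\<lambda>x. frechet_derivative f (at (h x)) c)"
        by (rule Suc.IH[of "pd c f"]) (use Suc.prems c Ck_on_pred in \<open>auto simp del: Ck_on.simps intro: Ck_on_pred\<close>, auto)
    qed
  qed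
qed

lemma Ck_on_compose_real:
  fixes h :: "'a::euclidean_space \<Rightarrow> real" and f :: "real \<Rightarrow> real"
  assumes "open U" "Ck_on k U h" "Ck_on k V f" "h ` U \<subseteq> V"
  shows "Ck_on k U (\<lambda>x. f (h x))"
  by (rule Ck_on_compose[OF assms(1) _ assms(3,4)]) (use assms(2) in auto)

lemma Ck_on_realI:
  fixes f :: "real \<Rightarrow> real"
  assumes "open U" "\<And>x. x \<in> U ==> (f has_real_derivative f' x) (at x)" "Ck_on k U f'"
  shows "Ck_on (Suc k) U f"
  by (rule Ck_on_SucI[where f' = "\<lambda>x. (*) (f' x)"])
    (use assms in \<open>auto simp: has_field_derivative_def\<close>)

lemma Ck_on_powr: "Ck_on k {0<..} (\<lambda>x::real. x powr a)"
proof (induction k arbitrary: a)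
  case 0 show ?case by (auto intro!: continuous_intros)
next
  case (Suc k)
  show ?case
    by (rule Ck_on_realI[where f' = "\<lambda>x. a * x powr (a - 1)"])
      (auto intro!: derivative_eq_intros Ck_on_cmult Suc)
qed

lemma Ck_on_inverse_real: "Ck_on k (- {0}) (inverse :: real \<Rightarrow> real)"
proof (induction k)
  case 0 show ?case by (auto intro!: continuous_intros)
next
  case (Suc k)
  show ?case
    by (rule Ck_on_realI[where f' = "\<lambda>x. - (inverse x * inverse x)"])
      (auto intro!: derivative_eq_intros Ck_on_minus Ck_on_mult Suc simp: power2_eq_square
        simp del: mult_minus_left mult_minus_right)
qed

lemma Ck_on_divide:
  assumes "open U" "Ck_on k U f" "Ck_on k U g" "\<And>x. x \<in> U ==> g x \<noteq> 0"
  shows "Ck_on k U (\<lambda>x. f x / g x)"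
  unfolding divide_inverse
  by (intro Ck_on_mult Ck_on_compose_real[OF _ _ Ck_on_inverse_real] assms) (use assms(4) in auto)

lemma smooth_onD: "smooth_on U f ==> Ck_on k U f"
  by (simp add: smooth_on_def)

section \<open>Gradients\<close>

lemma grad_eqI: "GDERIV f x :> D ==> grad f x = D"
proof -
  assume a: "GDERIV f x :> D"
  have "D' = D" if "GDERIV f x :> D'" for D'
  proof -
    have "(\<lambda>h. h \<bullet> D') = (\<lambda>h. h \<bullet> D)"
      using a that unfolding gderiv_def by (rule has_derivative_unique[symmetric])
    then have "\<forall>h. h \<bullet> D' = h \<bullet> D" by metis
    then show ?thesis using vector_eq_ldot[of D' D] by simp
  qed
  then show ?thesis unfolding grad_def using a by (metis the_equality)
qed

lemma has_derivative_grad: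
  fixes f :: "'a::euclidean_space \<Rightarrow> real"
  assumes "f differentiable at x"
  shows "(f has_derivative (\<lambda>h. grad f x \<bullet> h)) (at x)"
proof -
  let ?D = "\<Sum>b\<in>Basis. pd b f x *\<^sub>R b"
  have d: "(f has_derivative frechet_derivative f (at x)) (at x)"
    using assms by (rule has_derivative_frechet)
  have lin: "linear (frechet_derivative f (at x))" using d has_derivative_linear by blast
  have "pd h f x = h \<bullet> ?D" for h
  proof -
    have "pd h f x = frechet_derivative f (at x) (\<Sum>b\<in>Basis. (h \<bullet> b) *\<^sub>R b)"
      by (simp add: euclidean_representation)
    also have "\<dots> = h \<bullet> ?D"
      by (simp add: linear_sum[OF lin] linear_cmul[OF lin] inner_sum_right mult.commute)
    finally show ?thesis .
  qed
  then have "frechet_derivative f (at x) = (\<lambda>h. h \<bullet> ?D)" by (rule ext)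
  then have "GDERIV f x :> ?D"
    using d unfolding gderiv_def by (simp only:)
  moreover from this have "grad f x = ?D" by (rule grad_eqI)
  ultimately show ?thesis unfolding gderiv_def by (simp add: inner_commute)
qed

lemma grad_inner: "f differentiable at x ==> grad f x \<bullet> h = pd h f x"
  using pd_eqI[OF has_derivative_grad] by metis

lemma grad_eq_of_has_derivative:
  "(f has_derivative (\<lambda>h. D \<bullet> h)) (at x) ==> grad f x = D"
  by (rule grad_eqI) (simp add: gderiv_def inner_commute)

lemma grad_cong_open:
  assumes "open U" "x \<in> U" "\<And>y. y \<in> U ==> f y = g y"
  shows "grad f x = grad g x"
proof -
  have "GDERIV f x :> D \<longleftrightarrow> GDERIV g x :> D" for D
    unfolding gderiv_def by (rule has_derivative_cong_open[OF assms])
  then have "gderiv f x = gderiv g x" by (rule ext)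
  then show ?thesis unfolding grad_def by simp
qed

lemma Ck_on_grad_inner:
  assumes "open U" "Ck_on (Suc k) U f"
  shows "Ck_on k U (\<lambda>x. grad f x \<bullet> c)"
proof -
  have "Ck_on k U (\<lambda>x. \<Sum>b\<in>Basis. pd b f x * (b \<bullet> c))"
    using assms by (intro Ck_on_sum Ck_on_mult) auto
  moreover have "grad f x \<bullet> c = (\<Sum>b\<in>Basis. pd b f x * (b \<bullet> c))" if "x \<in> U" for x
  proof -
    have "(\<Sum>b\<in>Basis. pd b f x * (b \<bullet> c)) = (\<Sum>b\<in>Basis. (grad f x \<bullet> b) * (c \<bullet> b))"
      using assms that by (intro sum.cong refl) (simp add: grad_inner inner_commute[of _ c])
    also have "\<dots> = grad f x \<bullet> c" by (simp add: euclidean_inner[of "grad f x" c])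
    finally show ?thesis by simp
  qed
  ultimately show ?thesis
    using Ck_on_cong[OF assms(1), of "\<lambda>x. grad f x \<bullet> c" "\<lambda>x. \<Sum>b\<in>Basis. pd b f x * (b \<bullet> c)" k] by blast
qed

lemma continuous_on_grad:
  assumes "open U" "Ck_on 1 U f"
  shows "continuous_on U (grad f)"
  using Ck_on_grad_inner[OF assms(1), of 0 f] assms(2)
  by (subst continuous_on_componentwise) simp

lemma Ck_on_norm_grad_sq:
  assumes "open U" "Ck_on (Suc k) U f"
  shows "Ck_on k U (\<lambda>x. (norm (grad f x))\<^sup>2)"
proof -
  have "Ck_on k U (\<lambda>x. \<Sum>b\<in>Basis. (grad f x \<bullet> b) * (grad f x \<bullet> b))"
    using assms by (intro Ck_on_sum Ck_on_mult Ck_on_grad_inner)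
  then show ?thesis by (simp add: power2_norm_eq_inner euclidean_inner[of "grad f _" "grad f _"])
qed

section \<open>Smooth cutoff functions\<close>

text \<open>With an arbitrary polynomial in \<open>1 / t\<close> as a factor the family is closed under differentiation,
  so smoothness follows by induction on the order.\<close>

definition expdecay :: "real poly \<Rightarrow> real \<Rightarrow> real" where
  "expdecay p t = (if t > 0 then poly p (1 / t) * exp (- (1 / t)) else 0)"

lemma poly_exp_decay: "((\<lambda>s. poly p s * exp (- s)) \<longlongrightarrow> 0) (at_top :: real filter)"
proof -
  have "((\<lambda>s. \<Sum>i\<le>degree p. coeff p i * (s ^ i / exp s)) \<longlongrightarrow> (\<Sum>i\<le>degree p. coeff p i * 0)) at_top"
    by (intro tendsto_intros tendsto_power_div_exp_0)
  moreover have "(\<lambda>s. \<Sum>i\<le>degree p. coeff p i * (s ^ i / exp s)) = (\<lambda>s. poly p s * exp (- s))"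
    by (simp add: poly_altdef sum_distrib_right exp_minus divide_inverse fun_eq_iff mult.assoc)
  ultimately show ?thesis by simp
qed

lemma expdecay_deriv:
  "(expdecay p has_real_derivative expdecay ([:0, 0, 1:] * (p - pderiv p)) t) (at t)"
proof -
  consider "t > 0" | "t < 0" | "t = 0" by linarith
  then show ?thesis
  proof cases
    case 1
    have "((\<lambda>t. poly p (1 / t) * exp (- (1 / t))) has_real_derivative
        expdecay ([:0, 0, 1:] * (p - pderiv p)) t) (at t)"
      using 1 by (auto intro!: derivative_eq_intros DERIV_chain2[where f = "poly p"] poly_DERIV
          simp: expdecay_def field_simps power2_eq_square)
    then show ?thesis
      by (rule has_field_derivative_transform_within_open[where S = "{0<..}"])
        (use 1 in \<open>auto simp: expdecay_def\<close>)
  next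
    case 2
    have "((\<lambda>t. 0) has_real_derivative expdecay ([:0, 0, 1:] * (p - pderiv p)) t) (at t)"
      using 2 by (auto simp: expdecay_def)
    then show ?thesis
      by (rule has_field_derivative_transform_within_open[where S = "{..<0}"])
        (use 2 in \<open>auto simp: expdecay_def\<close>)
  next
    case 3
    have "((\<lambda>h. poly ([:0, 1:] * p) (1 / h) * exp (- (1 / h))) \<longlongrightarrow> 0) (at_right 0)"
      using filterlim_compose[OF poly_exp_decay filterlim_inverse_at_top_right, of "[:0, 1:] * p"]
      by (simp add: divide_inverse)
    then have "((\<lambda>h. expdecay p h / h) \<longlongrightarrow> 0) (at_right 0)"
      by (rule Lim_transform_eventually)
        (auto simp: expdecay_def eventually_at_filter)
    moreover have "((\<lambda>h. expdecay p h / h) \<longlongrightarrow> 0) (at_left 0)"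
      by (rule Lim_transform_eventually[of "\<lambda>_. 0"])
        (auto simp: expdecay_def eventually_at_filter)
    ultimately have "((\<lambda>h. expdecay p h / h) \<longlongrightarrow> 0) (at 0)"
      by (simp add: filterlim_split_at)
    then show ?thesis using 3 by (simp add: has_field_derivative_iff expdecay_def)
  qed
qed

lemma Ck_on_expdecay: "Ck_on k UNIV (expdecay p)"
proof (induction k arbitrary: p)
  case 0
  have "continuous_on UNIV (expdecay p)"
    using expdecay_deriv DERIV_isCont by (metis continuous_at_imp_continuous_on)
  then show ?case by simp
next
  case (Suc k)
  show ?case by (rule Ck_on_realI[OF open_UNIV expdecay_deriv Suc])
qed

text \<open>The function is 1 on the ball of radius \<open>r\<close> about \<open>a\<close> and 0 outside the ball of radius \<open>2 * r\<close>. It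
  is built from the squared distance, which is smooth at the centre.\<close>

definition plateau :: "'a::euclidean_space \<Rightarrow> real \<Rightarrow> 'a \<Rightarrow> real" where
  "plateau a r x = (let u = expdecay 1 (4 * r\<^sup>2 - (x - a) \<bullet> (x - a));
     v = expdecay 1 ((x - a) \<bullet> (x - a) - r\<^sup>2) in u / (u + v))"

lemma expdecay_1_pos: "t > 0 ==> expdecay 1 t > 0"
  and expdecay_1_zero: "t \<le> 0 ==> expdecay 1 t = 0"
  and expdecay_1_nonneg: "expdecay 1 t \<ge> 0"
  by (auto simp: expdecay_def)

lemma plateau_denom:
  assumes "r > 0"
  shows "expdecay 1 (4 * r\<^sup>2 - s) + expdecay 1 (s - r\<^sup>2) > 0"
proof (cases "s < 4 * r\<^sup>2")
  case True then show ?thesis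
    using expdecay_1_pos[of "4 * r\<^sup>2 - s"] expdecay_1_nonneg[of "s - r\<^sup>2"] by simp
next
  case False
  have "r\<^sup>2 > 0" using assms by simp
  then have "s - r\<^sup>2 > 0" using False by linarith
  then show ?thesis using expdecay_1_pos[of "s - r\<^sup>2"] expdecay_1_nonneg[of "4 * r\<^sup>2 - s"] by simp
qed

lemma Ck_on_dist_sq: "Ck_on k UNIV (\<lambda>x::'a::euclidean_space. (x - a) \<bullet> (x - a))"
proof -
  have "Ck_on k UNIV (\<lambda>x::'a. \<Sum>b\<in>Basis. (x \<bullet> b - a \<bullet> b) * (x \<bullet> b - a \<bullet> b))"
    by (intro Ck_on_sum Ck_on_mult Ck_on_diff Ck_on_inner_const) auto
  moreover have "(x - a) \<bullet> (x - a) = (\<Sum>b\<in>Basis. (x \<bullet> b - a \<bullet> b) * (x \<bullet> b - a \<bullet> b))" for x :: 'a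
    by (subst euclidean_inner) (simp add: inner_diff_left)
  ultimately show ?thesis by simp
qed

lemma plateau_smooth:
  assumes "r > 0" shows "smooth_on UNIV (plateau a r)"
proof -
  have "Ck_on k UNIV (plateau a r)" for k
    unfolding plateau_def Let_def using plateau_denom[OF assms]
    by (intro Ck_on_divide Ck_on_add Ck_on_compose_real[OF _ _ Ck_on_expdecay] Ck_on_diff Ck_on_dist_sq)
      (auto simp: less_le)
  then show ?thesis by (simp add: smooth_on_def)
qed

lemma plateau_props:
  assumes "r > 0"
  shows "0 \<le> plateau a r x" "plateau a r x \<le> 1"
    "dist a x \<le> r ==> plateau a r x = 1" "dist a x \<ge> 2 * r ==> plateau a r x = 0"
    "dist a x < 2 * r ==> plateau a r x > 0"
proof -
  have d: "(x - a) \<bullet> (x - a) = (dist a x)\<^sup>2"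
    by (simp add: dist_norm norm_minus_commute[of a] flip: power2_norm_eq_inner)
  note pos = plateau_denom[OF assms, of "(dist a x)\<^sup>2"]
  note nn = expdecay_1_nonneg[of "(dist a x)\<^sup>2 - r\<^sup>2"] expdecay_1_nonneg[of "4 * r\<^sup>2 - (dist a x)\<^sup>2"]
  show "0 \<le> plateau a r x" "plateau a r x \<le> 1"
    using nn pos by (simp_all add: plateau_def Let_def d)
  { assume "dist a x \<le> r"
    then have "(dist a x)\<^sup>2 \<le> r\<^sup>2" by (simp add: power_mono)
    then show "plateau a r x = 1"
      using pos by (simp add: plateau_def Let_def d expdecay_1_zero) }
  { assume "dist a x \<ge> 2 * r"
    then have "(2 * r)\<^sup>2 \<le> (dist a x)\<^sup>2" using assms by (intro power_mono) auto
    then show "plateau a r x = 0"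
      by (simp add: plateau_def Let_def d expdecay_1_zero power_mult_distrib) }
  { assume "dist a x < 2 * r"
    then have "(dist a x)\<^sup>2 < (2 * r)\<^sup>2" using assms by (intro power_strict_mono) auto
    then show "plateau a r x > 0"
      using pos expdecay_1_pos[of "4 * r\<^sup>2 - (dist a x)\<^sup>2"]
      by (simp add: plateau_def Let_def d power_mult_distrib) }
qed

text \<open>Finitely many plateau balls cover \<open>K\<close>; the function is \<open>1 - \<Prod>(1 - plateau)\<close>.\<close>

lemma smooth_cutoff:
  fixes K U :: "'a::euclidean_space set"
  assumes "compact K" "open U" "K \<subseteq> U"
  obtains \<theta> K' V where "smooth_on UNIV \<theta>" "\<And>x. 0 \<le> \<theta> x" "\<And>x. \<theta> x \<le> (1::real)"
    "compact K'" "K' \<subseteq> U" "\<And>x. x \<notin> K' ==> \<theta> x = 0"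
    "open V" "K \<subseteq> V" "\<And>x. x \<in> V ==> \<theta> x = 1"
proof -
  have "\<forall>x\<in>K. \<exists>r>0. cball x (2 * r) \<subseteq> U"
  proof
    fix x assume "x \<in> K"
    then obtain e where "e > 0" "cball x e \<subseteq> U"
      using assms open_contains_cball by blast
    then show "\<exists>r>0. cball x (2 * r) \<subseteq> U" by (intro exI[of _ "e/2"]) auto
  qed
  then obtain r where r: "\<And>x. x \<in> K ==> r x > 0 \<and> cball x (2 * r x) \<subseteq> U" by metis
  obtain F where F: "F \<subseteq> K" "finite F" "K \<subseteq> (\<Union>x\<in>F. ball x (r x))"
  proof -
    have "K \<subseteq> (\<Union>x\<in>K. ball x (r x))" using r by force
    then show ?thesis using compactE_image[OF assms(1), of K "\<lambda>x. ball x (r x)"] that by blast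
  qed
  define \<theta> where "\<theta> = (\<lambda>x. 1 - (\<Prod>a\<in>F. 1 - plateau a (r a) x))"
  have p: "0 \<le> plateau a (r a) x" "plateau a (r a) x \<le> 1"
    "dist a x \<le> r a ==> plateau a (r a) x = 1" "dist a x \<ge> 2 * r a ==> plateau a (r a) x = 0"
    if "a \<in> F" for a x
    by (use plateau_props[of "r a" a x] r F(1) that in blast)+
  show ?thesis
  proof (rule that)
    show "smooth_on UNIV \<theta>"
      unfolding smooth_on_def \<theta>_def
      by (intro allI Ck_on_diff Ck_on_prod Ck_on_const open_UNIV smooth_onD plateau_smooth)
        (use r F(1) in auto)
    show "0 \<le> \<theta> x" for x
      unfolding \<theta>_def using p by (simp add: prod_le_1)
    show "\<theta> x \<le> 1" for x
      unfolding \<theta>_def using p by (simp add: prod_nonneg)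
    show "compact (\<Union>a\<in>F. cball a (2 * r a))" using F(2) by (intro compact_UN) auto
    show "(\<Union>a\<in>F. cball a (2 * r a)) \<subseteq> U" using r F(1) by blast
    show "\<theta> x = 0" if "x \<notin> (\<Union>a\<in>F. cball a (2 * r a))" for x
    proof -
      have "\<forall>a\<in>F. 1 - plateau a (r a) x = 1" using that p(4) by force
      then show ?thesis unfolding \<theta>_def by (simp add: prod.neutral)
    qed
    show "open (\<Union>x\<in>F. ball x (r x))" by auto
    show "K \<subseteq> (\<Union>x\<in>F. ball x (r x))" by (rule F(3))
    show "\<theta> x = 1" if "x \<in> (\<Union>x\<in>F. ball x (r x))" for x
    proof -
      from that have "\<exists>a\<in>F. dist a x < r a" by auto
      then obtain a where "a \<in> F" "dist a x \<le> r a" using less_imp_le by blast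
      then have "\<exists>a\<in>F. 1 - plateau a (r a) x = 0" using p(3) by force
      then show ?thesis unfolding \<theta>_def using F(2) by simp
    qed
  qed
qed

lemma Ck_on_glue:
  assumes "open U" "Ck_on k U f" "Ck_on k UNIV \<theta>" "compact K" "K \<subseteq> U" "\<And>x. x \<notin> K ==> \<theta> x = 0"
  shows "Ck_on k UNIV (\<lambda>x. \<theta> x * f x)"
proof -
  have op: "open (- K)" using assms(4) compact_imp_closed by auto
  have "Ck_on k U (\<lambda>x. \<theta> x * f x)"
    using assms Ck_on_subset by (intro Ck_on_mult) blast+
  moreover have "Ck_on k (- K) (\<lambda>x. \<theta> x * f x)"
    using Ck_on_cong[OF op, of "\<lambda>x. \<theta> x * f x" "\<lambda>x. 0"] assms(6) by simp
  ultimately have "Ck_on k (U \<union> - K) (\<lambda>x. \<theta> x * f x)"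
    using op assms(1) by (intro Ck_on_union)
  moreover have "U \<union> - K = UNIV" using assms(5) by auto
  ultimately show ?thesis by simp
qed

text \<open>The open sets \<open>U\<close> and \<open>- K\<close> cover the space, and \<open>f\<close> is zero on the second.\<close>

lemma Ck_on_extend_zero:
  assumes "open U" "Ck_on k U f" "compact K" "K \<subseteq> U" "\<And>x. x \<notin> K ==> f x = 0"
  shows "Ck_on k UNIV f"
proof -
  have op: "open (- K)" using assms(3) compact_imp_closed by auto
  have "Ck_on k (- K) f"
    using Ck_on_cong[OF op, of f "\<lambda>x. 0"] assms(5) by simp
  then have "Ck_on k (U \<union> - K) f"
    using op assms by (intro Ck_on_union)
  moreover have "U \<union> - K = UNIV" using assms(4) by auto
  ultimately show ?thesis by simp
qed

lemma pd_zero_outside: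
  fixes f :: "'a::euclidean_space \<Rightarrow> real"
  assumes "compact K" "\<And>x. x \<notin> K ==> f x = (0::real)" "x \<notin> K"
  shows "pd b f x = 0"
proof -
  have "open (- K)" using assms(1) compact_imp_closed by auto
  then have "frechet_derivative f (at x) = frechet_derivative (\<lambda>_. 0) (at x)"
    by (rule frechet_derivative_cong_open) (use assms in auto)
  then show ?thesis by simp
qed

section \<open>Functions with compact support\<close>

definition C1_compact :: "('a::euclidean_space \<Rightarrow> real) \<Rightarrow> bool" where
  "C1_compact f \<longleftrightarrow> Ck_on 1 UNIV f \<and> (\<exists>K. compact K \<and> (\<forall>x. x \<notin> K \<longrightarrow> f x = 0))"

lemma integrable_bounded_support:
  fixes f :: "'a::euclidean_space \<Rightarrow> real"
  assumes "f \<in> borel_measurable borel" "compact K" "\<And>x. x \<in> K ==> \<bar>f x\<bar> \<le> B" "\<And>x. x \<notin> K ==> f x = 0"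
  shows "integrable lborel f"
proof (rule Bochner_Integration.integrable_bound)
  show "integrable lborel (\<lambda>x. indicator K x * B)"
    using assms(2)
    by (intro integrable_real_indicator integrable_mult_left)
      (auto simp: compact_imp_closed emeasure_compact_finite[unfolded infinity_ennreal_def])
  show "f \<in> borel_measurable lborel" using assms(1) by simp
  show "AE x in lborel. norm (f x) \<le> norm (indicator K x * B)"
  proof (rule AE_I2)
    fix x
    show "norm (f x) \<le> norm (indicator K x * B)"
      using assms(3)[of x] assms(4)[of x] by (cases "x \<in> K") auto
  qed
qed

lemma integrable_continuous_support:
  fixes f :: "'a::euclidean_space \<Rightarrow> real"
  assumes "continuous_on UNIV f" "compact K" "\<And>x. x \<notin> K ==> f x = 0"
  shows "integrable lborel f"
proof -
  have "compact (f ` K)" using assms(1,2) compact_continuous_image continuous_on_subset by blast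
  then have "bounded (f ` K)" by (rule compact_imp_bounded)
  then obtain B where "\<forall>y\<in>f ` K. norm y \<le> B" unfolding bounded_iff by blast
  then have B: "\<bar>f x\<bar> \<le> B" if "x \<in> K" for x using that by auto
  show ?thesis
    by (rule integrable_bounded_support[OF _ assms(2) B assms(3)])
      (use assms(1) borel_measurable_continuous_onI in auto)
qed

lemma bounded_support:
  fixes f :: "'a::euclidean_space \<Rightarrow> real"
  assumes "continuous_on UNIV f" "compact K" "\<And>x. x \<notin> K ==> f x = 0"
  obtains B where "B \<ge> 0" "\<And>x. \<bar>f x\<bar> \<le> B"
proof -
  have "compact (f ` K)" using assms(1,2) compact_continuous_image continuous_on_subset by blast
  then have "bounded (f ` K)" by (rule compact_imp_bounded)
  then obtain B where "\<forall>y\<in>f ` K. norm y \<le> B" unfolding bounded_iff by blast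
  then have B: "\<bar>f x\<bar> \<le> B" if "x \<in> K" for x using that by auto
  have "\<bar>f x\<bar> \<le> max B 0" for x using B[of x] assms(3)[of x] by (cases "x \<in> K") auto
  then show ?thesis using that[of "max B 0"] by auto
qed

lemma C1_continuous_pd: "Ck_on 1 U f ==> b \<in> Basis ==> continuous_on U (pd b f)"
  by simp

lemma C1_compact_pd:
  assumes "C1_compact f" "b \<in> Basis"
  shows "integrable lborel (pd b f)" "continuous_on UNIV (pd b f)"
proof -
  obtain K where K: "compact K" "\<And>x. x \<notin> K ==> f x = 0"
    using assms unfolding C1_compact_def by blast
  show c: "continuous_on UNIV (pd b f)"
    using assms C1_continuous_pd unfolding C1_compact_def by blast
  show "integrable lborel (pd b f)"
    by (rule integrable_continuous_support[OF c K(1)]) (rule pd_zero_outside[OF K])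
qed

lemma C1_compact_lipschitz:
  fixes f :: "'a::euclidean_space \<Rightarrow> real"
  assumes "C1_compact f"
  obtains L where "L \<ge> 0" "\<And>x y. \<bar>f x - f y\<bar> \<le> L * norm (x - y)"
proof -
  obtain K where K: "compact K" "\<And>x. x \<notin> K ==> f x = 0"
    using assms unfolding C1_compact_def by blast
  have "\<exists>B\<ge>0. \<forall>x. \<bar>pd b f x\<bar> \<le> B" if "b \<in> Basis" for b
    using bounded_support[OF C1_compact_pd(2)[OF assms that] K(1) pd_zero_outside[OF K]] by metis
  then obtain B where B: "\<And>b x. b \<in> Basis ==> \<bar>pd b f x\<bar> \<le> B b" "\<And>b. b \<in> Basis ==> B b \<ge> 0"
    by metis
  define L where "L = (\<Sum>b\<in>Basis. B b)"
  have d: "(f has_derivative (\<lambda>h. grad f x \<bullet> h)) (at x)" for x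
    using assms by (intro has_derivative_grad) (auto simp: C1_compact_def)
  have n: "norm (grad f x) \<le> L" for x
  proof -
    have "norm (grad f x) \<le> (\<Sum>b\<in>Basis. \<bar>grad f x \<bullet> b\<bar>)" by (rule norm_le_l1)
    also have "\<dots> \<le> L" unfolding L_def
      using assms B(1) by (intro sum_mono) (auto simp: grad_inner C1_compact_def)
    finally show ?thesis .
  qed
  have "norm (f x - f y) \<le> L * norm (x - y)" for x y
  proof (rule differentiable_bound[OF convex_UNIV])
    show "(f has_derivative (\<lambda>h. grad f x \<bullet> h)) (at x within UNIV)" for x using d by simp
    show "onorm (\<lambda>h. grad f x \<bullet> h) \<le> L" for x
    proof (rule onorm_le)
      fix h
      have "norm (grad f x \<bullet> h) \<le> norm (grad f x) * norm h"
        using Cauchy_Schwarz_ineq2 by simp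
      also have "\<dots> \<le> L * norm h" by (rule mult_right_mono[OF n norm_ge_zero])
      finally show "norm (grad f x \<bullet> h) \<le> L * norm h" .
    qed
  qed auto
  moreover have "L \<ge> 0" unfolding L_def using B(2) by (simp add: sum_nonneg)
  ultimately show ?thesis using that by auto
qed

lemma integral_translate:
  fixes h :: "'a::euclidean_space \<Rightarrow> real"
  assumes [measurable]: "h \<in> borel_measurable borel"
  shows "integral\<^sup>L lborel (\<lambda>x. h (x + c)) = integral\<^sup>L lborel h"
proof -
  have "integral\<^sup>L lborel h = integral\<^sup>L (distr lborel borel ((+) c)) h"
    by (simp add: lborel_distr_plus)
  also have "\<dots> = integral\<^sup>L lborel (\<lambda>x. h (c + x))" by (subst integral_distr) auto
  finally show ?thesis by (simp add: add.commute)
qed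

text \<open>By translation invariance every difference quotient of \<open>h\<close> has integral zero. The Lipschitz
  bound dominates the quotients, so the integral of their limit is zero too. Only a one-sided
  limit along a sequence is used, which makes the lemma applicable to positive parts.\<close>

lemma integral_directional_derivative_zero:
  fixes h d :: "'a::euclidean_space \<Rightarrow> real"
  assumes L: "\<And>x y. \<bar>h x - h y\<bar> \<le> L * norm (x - y)" "L \<ge> 0"
    and K: "compact K" "\<And>x. x \<notin> K ==> h x = 0"
    and lim: "\<And>x. (\<lambda>n. (h (x + (1 / real (Suc n)) *\<^sub>R b) - h x) / (1 / real (Suc n))) \<longlonglongrightarrow> d x"
  shows "integrable lborel d" "integral\<^sup>L lborel d = 0"
proof -
  have "L-lipschitz_on UNIV h"
    using L by (intro lipschitz_onI) (auto simp: dist_norm)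
  then have ch: "continuous_on UNIV h" by (rule lipschitz_on_continuous_on)
  then have hm[measurable]: "h \<in> borel_measurable borel" by (rule borel_measurable_continuous_onI)
  have hi: "integrable lborel h" by (rule integrable_continuous_support[OF ch K])
  obtain C where C: "\<And>x. x \<in> K ==> norm x \<le> C"
    using compact_imp_bounded[OF K(1)] bounded_iff by metis
  define K' where "K' = cball (0::'a) (C + norm b)"
  let ?q = "\<lambda>n x. (h (x + (1 / real (Suc n)) *\<^sub>R b) - h x) / (1 / real (Suc n))"
  let ?w = "\<lambda>x. indicator K' x * (L * norm b)"
  have wi: "integrable lborel ?w"
    unfolding K'_def by (intro integrable_mult_left integrable_real_indicator)
      (auto simp: emeasure_compact_finite[unfolded infinity_ennreal_def])
  have bd: "\<bar>?q n x\<bar> \<le> ?w x" for n x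
  proof (cases "x \<in> K'")
    case True
    have "\<bar>h (x + (1 / real (Suc n)) *\<^sub>R b) - h x\<bar> \<le> L * norm ((1 / real (Suc n)) *\<^sub>R b)"
      using L(1)[of "x + (1 / real (Suc n)) *\<^sub>R b" x] by simp
    then have "\<bar>h (x + (1 / real (Suc n)) *\<^sub>R b) - h x\<bar> \<le> L * norm b / real (Suc n)"
      by (simp del: of_nat_Suc)
    then have "\<bar>?q n x\<bar> \<le> L * norm b"
      unfolding abs_divide by (simp add: pos_le_divide_eq del: of_nat_Suc)
    then show ?thesis using True by simp
  next
    case False
    have "norm ((1 / real (Suc n)) *\<^sub>R b) \<le> norm b"
      by (simp add: divide_le_eq mult_le_cancel_left1)
    moreover have "norm x \<le> norm (x + (1 / real (Suc n)) *\<^sub>R b) + norm ((1 / real (Suc n)) *\<^sub>R b)"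
      using norm_triangle_ineq4[of "x + (1 / real (Suc n)) *\<^sub>R b" "(1 / real (Suc n)) *\<^sub>R b"] by simp
    moreover have "C + norm b < norm x" using False unfolding K'_def by simp
    ultimately have "\<not> norm (x + (1 / real (Suc n)) *\<^sub>R b) \<le> C" "\<not> norm x \<le> C"
      using norm_ge_zero[of b] by linarith+
    then show ?thesis using C K(2) False by (metis abs_0 diff_zero div_0 indicator_simps(2) mult_zero_left order_refl)
  qed
  have z: "integral\<^sup>L lborel (?q n) = 0" for n
  proof -
    have "integrable lborel (\<lambda>x. h (x + (1 / real (Suc n)) *\<^sub>R b))"
    proof -
      have "integrable (distr lborel borel ((+) ((1 / real (Suc n)) *\<^sub>R b))) h"
        using hi by (simp add: lborel_distr_plus)
      then show ?thesis by (subst (asm) integrable_distr_eq) (auto simp: add.commute)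
    qed
    then show ?thesis using hi by (simp add: integral_translate)
  qed
  have dm[measurable]: "d \<in> borel_measurable borel"
    by (rule borel_measurable_LIMSEQ_real[OF lim]) measurable
  have qm: "?q n \<in> borel_measurable lborel" for n by measurable
  have bd': "AE x in lborel. norm (?q n x) \<le> ?w x" for n
    using bd by (intro AE_I2) (simp only: real_norm_def)
  have lim': "AE x in lborel. (\<lambda>n. ?q n x) \<longlonglongrightarrow> d x"
    using lim by (intro AE_I2)
  have dl: "d \<in> borel_measurable lborel" by simp
  have *: "integrable lborel d" "(\<lambda>n. integral\<^sup>L lborel (?q n)) \<longlonglongrightarrow> integral\<^sup>L lborel d"
    by (rule integrable_dominated_convergence[OF dl qm wi lim' bd']
        integral_dominated_convergence[OF dl qm wi lim' bd'])+
  show "integrable lborel d" by (rule *)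
  show "integral\<^sup>L lborel d = 0" using *(2) unfolding z by (simp add: LIMSEQ_const_iff)
qed

lemma inverse_Suc_tendsto_0: "(\<lambda>n. 1 / real (Suc n)) \<longlonglongrightarrow> 0"
  using LIMSEQ_inverse_real_of_nat by (simp only: inverse_eq_divide)

lemma difference_quotient_limit:
  fixes f :: "'a::euclidean_space \<Rightarrow> real"
  assumes "f differentiable at x"
  shows "(\<lambda>n. (f (x + (1 / real (Suc n)) *\<^sub>R b) - f x) / (1 / real (Suc n)))
    \<longlonglongrightarrow> pd b f x"
proof -
  have "((\<lambda>t. f (x + t *\<^sub>R b)) has_vector_derivative pd b f x) (at 0)"
  proof -
    have "((\<lambda>t. x + t *\<^sub>R b) has_derivative (\<lambda>t. t *\<^sub>R b)) (at 0)"
      by (auto intro!: derivative_eq_intros)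
    moreover have d: "(f has_derivative frechet_derivative f (at x)) (at (x + 0 *\<^sub>R b))"
      using has_derivative_frechet[OF assms] by simp
    ultimately have "((\<lambda>t. f (x + t *\<^sub>R b)) has_derivative (\<lambda>t. frechet_derivative f (at x) (t *\<^sub>R b))) (at 0)"
      by (rule has_derivative_compose)
    moreover have "frechet_derivative f (at x) (t *\<^sub>R b) = t *\<^sub>R pd b f x" for t
      using linear_cmul[OF has_derivative_linear[OF d]] .
    ultimately show ?thesis unfolding has_vector_derivative_def by (simp only:)
  qed
  then have "((\<lambda>t. (f (x + t *\<^sub>R b) - f x) / t) \<longlongrightarrow> pd b f x) (at 0)"
    by (simp add: has_real_derivative_iff_has_vector_derivative[symmetric] has_field_derivative_iff)
  moreover have "filterlim (\<lambda>n. 1 / real (Suc n)) (at 0) sequentially"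
    unfolding filterlim_at using inverse_Suc_tendsto_0 by auto
  ultimately show ?thesis by (rule filterlim_compose)
qed

lemma pd_minus_dir:
  assumes "f differentiable at x"
  shows "frechet_derivative f (at x) (- b) = - pd b f x"
  using has_derivative_linear[OF has_derivative_frechet[OF assms]] by (rule linear_neg)

text \<open>At a zero of \<open>w\<close> the positive part is in general not differentiable, but its difference quotients
  with positive step still converge.\<close>

definition pos_pd :: "'a::euclidean_space \<Rightarrow> ('a \<Rightarrow> real) \<Rightarrow> 'a \<Rightarrow> real" where
  "pos_pd b w x = (if w x > 0 then pd b w x
     else if w x = 0 then max 0 (pd b w x) else 0)"

lemma pos_part_quotient_limit:
  assumes "w differentiable at x"
  shows "(\<lambda>n. (max 0 (w (x + (1 / real (Suc n)) *\<^sub>R b)) - max 0 (w x)) / (1 / real (Suc n)))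
    \<longlonglongrightarrow> pos_pd b w x"
proof -
  let ?s = "\<lambda>n. 1 / real (Suc n)"
  let ?y = "\<lambda>n. x + ?s n *\<^sub>R b"
  note q = difference_quotient_limit[OF assms, of b]
  have "(\<lambda>n. w x + ?s n * ((w (?y n) - w x) / ?s n)) \<longlonglongrightarrow> w x + 0 * pd b w x"
    by (intro tendsto_intros q) (rule inverse_Suc_tendsto_0)
  then have c: "(\<lambda>n. w (?y n)) \<longlonglongrightarrow> w x" by simp
  consider "w x > 0" | "w x = 0" | "w x < 0" by linarith
  then show ?thesis
  proof cases
    case 1
    then have "\<forall>\<^sub>F n in sequentially. w (?y n) > 0" by (rule order_tendstoD(1)[OF c])
    then have "\<forall>\<^sub>F n in sequentially. (w (?y n) - w x) / ?s n = (max 0 (w (?y n)) - max 0 (w x)) / ?s n"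
      by eventually_elim (use 1 in simp)
    from Lim_transform_eventually[OF q this] show ?thesis using 1 by (simp add: pos_pd_def)
  next
    case 2
    have "(\<lambda>n. max 0 ((w (?y n) - w x) / ?s n)) \<longlonglongrightarrow> max 0 (pd b w x)"
      by (intro tendsto_intros q)
    moreover have "max 0 ((w (?y n) - w x) / ?s n) = (max 0 (w (?y n)) - max 0 (w x)) / ?s n" for n
      using 2 by (auto simp: max_def zero_le_mult_iff)
    ultimately show ?thesis using 2 by (simp add: pos_pd_def)
  next
    case 3
    then have "\<forall>\<^sub>F n in sequentially. w (?y n) < 0" by (rule order_tendstoD(2)[OF c])
    then have "\<forall>\<^sub>F n in sequentially. 0 = (max 0 (w (?y n)) - max 0 (w x)) / ?s n"
      by eventually_elim (use 3 in simp)
    from Lim_transform_eventually[OF tendsto_const this] show ?thesis using 3 by (simp add: pos_pd_def)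
  qed
qed

text \<open>The integrand is the one-sided derivative in direction \<open>b\<close> of the Lipschitz function
  \<open>max 0 w * g\<close>.\<close>

lemma pos_part_integral:
  assumes w: "C1_compact w" and g: "C1_compact g"
  shows "integrable lborel (\<lambda>x. pos_pd b w x * g x + max 0 (w x) * pd b g x)"
    "(LBINT x. pos_pd b w x * g x + max 0 (w x) * pd b g x) = 0"
proof -
  obtain K where K: "compact K" "\<And>x. x \<notin> K ==> g x = 0"
    using g unfolding C1_compact_def by blast
  obtain Kw where Kw: "compact Kw" "\<And>x. x \<notin> Kw ==> w x = 0"
    using w unfolding C1_compact_def by blast
  have cw: "continuous_on UNIV w" and cg: "continuous_on UNIV g"
    using w g Ck_on_imp_continuous unfolding C1_compact_def by blast+
  obtain Bw where Bw: "Bw \<ge> 0" "\<And>x. \<bar>w x\<bar> \<le> Bw" using bounded_support[OF cw Kw] by blast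
  obtain Bg where Bg: "Bg \<ge> 0" "\<And>x. \<bar>g x\<bar> \<le> Bg" using bounded_support[OF cg K] by blast
  obtain Lw where Lw: "Lw \<ge> 0" "\<And>x y. \<bar>w x - w y\<bar> \<le> Lw * norm (x - y)"
    using C1_compact_lipschitz[OF w] by blast
  obtain Lg where Lg: "Lg \<ge> 0" "\<And>x y. \<bar>g x - g y\<bar> \<le> Lg * norm (x - y)"
    using C1_compact_lipschitz[OF g] by blast
  define h where "h = (\<lambda>x. max 0 (w x) * g x)"
  have dw: "w differentiable at x" and dg: "g differentiable at x" for x
    using w g unfolding C1_compact_def by auto
  have L: "\<bar>h x - h y\<bar> \<le> (Lw * Bg + Bw * Lg) * norm (x - y)" for x y
  proof -
    have "h x - h y = (max 0 (w x) - max 0 (w y)) * g x + max 0 (w y) * (g x - g y)"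
      unfolding h_def by (simp add: algebra_simps)
    also have "\<bar>\<dots>\<bar> \<le> \<bar>max 0 (w x) - max 0 (w y)\<bar> * \<bar>g x\<bar> + \<bar>max 0 (w y)\<bar> * \<bar>g x - g y\<bar>"
      using abs_triangle_ineq by (metis abs_mult)
    also have "\<dots> \<le> (Lw * norm (x - y)) * Bg + Bw * (Lg * norm (x - y))"
    proof (intro add_mono mult_mono)
      show "\<bar>max 0 (w x) - max 0 (w y)\<bar> \<le> Lw * norm (x - y)" using Lw(2)[of x y] by linarith
      show "\<bar>max 0 (w y)\<bar> \<le> Bw" using Bw(2)[of y] by linarith
    qed (use Lw Lg Bw Bg in auto)
    finally show ?thesis by (simp add: algebra_simps)
  qed
  have lim: "(\<lambda>n. (h (x + (1 / real (Suc n)) *\<^sub>R b) - h x) / (1 / real (Suc n)))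
    \<longlonglongrightarrow> pos_pd b w x * g x + max 0 (w x) * pd b g x" for x
  proof -
    let ?s = "\<lambda>n. 1 / real (Suc n)"
    let ?y = "\<lambda>n. x + ?s n *\<^sub>R b"
    have "(\<lambda>n. x + ?s n *\<^sub>R b) \<longlonglongrightarrow> x + 0 *\<^sub>R b"
      by (intro tendsto_intros) (rule inverse_Suc_tendsto_0)
    then have "(\<lambda>n. g (?y n)) \<longlonglongrightarrow> g x"
      using cg by (intro continuous_on_tendsto_compose[OF cg]) auto
    then have "(\<lambda>n. (max 0 (w (?y n)) - max 0 (w x)) / ?s n * g (?y n)
        + max 0 (w x) * ((g (?y n) - g x) / ?s n))
      \<longlonglongrightarrow> pos_pd b w x * g x + max 0 (w x) * pd b g x"
      by (intro tendsto_intros pos_part_quotient_limit difference_quotient_limit dw dg)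
    moreover have "(max 0 (w (?y n)) - max 0 (w x)) / ?s n * g (?y n)
        + max 0 (w x) * ((g (?y n) - g x) / ?s n) = (h (?y n) - h x) / ?s n" for n
      unfolding h_def by (simp add: field_simps)
    ultimately show ?thesis by simp
  qed
  have hK: "h x = 0" if "x \<notin> K" for x using K(2)[OF that] unfolding h_def by simp
  have nn: "Lw * Bg + Bw * Lg \<ge> 0" using Lw Lg Bw Bg by simp
  show "integrable lborel (\<lambda>x. pos_pd b w x * g x + max 0 (w x) * pd b g x)"
    "(LBINT x. pos_pd b w x * g x + max 0 (w x) * pd b g x) = 0"
    using integral_directional_derivative_zero[OF L nn K(1) hK lim] by auto
qed

text \<open>The identities of \<open>pos_part_integral\<close> for \<open>b\<close> and \<open>- b\<close> add up to the integral of
  \<open>\<bar>\<partial>w/\<partial>b\<bar> * g\<close> over the zero set of \<open>w\<close>, where \<open>g \<ge> 0\<close> is a cutoff that is positive on the support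
  of \<open>w\<close>. A nonnegative integrand with integral zero vanishes almost everywhere.\<close>

lemma zero_set_null_compact:
  assumes w: "C1_compact w" and b: "b \<in> Basis"
  shows "AE x in lborel. w x = 0 \<longrightarrow> pd b w x = 0"
proof -
  obtain Kw where Kw: "compact Kw" "\<And>x. x \<notin> Kw ==> w x = 0"
    using w unfolding C1_compact_def by blast
  obtain g K' V where g: "smooth_on UNIV g" "\<And>x. 0 \<le> g x" "compact K'"
    "\<And>x. x \<notin> K' ==> g x = (0::real)" "Kw \<subseteq> V" "\<And>x. x \<in> V ==> g x = 1"
    using smooth_cutoff[OF Kw(1) open_UNIV subset_UNIV] by metis
  have gc: "C1_compact g" unfolding C1_compact_def using g smooth_onD by blast
  have dw: "w differentiable at x" and dg: "g differentiable at x" for x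
    using w gc unfolding C1_compact_def by auto
  let ?f = "\<lambda>b x. pos_pd b w x * g x + max 0 (w x) * pd b g x"
  note I = pos_part_integral[OF w gc]
  have eq: "?f b x + ?f (- b) x = indicator {x. w x = 0} x * \<bar>frechet_derivative w (at x) b\<bar> * g x" for x
    using pd_minus_dir[OF dw, of x b] pd_minus_dir[OF dg, of x b]
    by (auto simp: pos_pd_def indicator_def max_def)
  have i: "integrable lborel (\<lambda>x. ?f b x + ?f (- b) x)"
    by (intro Bochner_Integration.integrable_add I)
  have "(LBINT x. ?f b x + ?f (- b) x) = 0"
    by (subst Bochner_Integration.integral_add[OF I(1) I(1)]) (simp only: I(2) add_0)
  then have "AE x in lborel. ?f b x + ?f (- b) x = 0"
    by (subst (asm) integral_nonneg_eq_0_iff_AE[OF i]) (unfold eq, use g(2) in auto)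
  then show ?thesis
  proof eventually_elim
    case (elim x)
    show ?case
    proof
      assume "w x = 0"
      then have "pd b w x = 0 \<or> g x = 0"
        using elim unfolding eq by (simp add: indicator_def)
      moreover have "g x \<noteq> 0" if "x \<in> Kw" using g that by force
      moreover have "pd b w x = 0" if "x \<notin> Kw"
        using pd_zero_outside[OF Kw that] .
      ultimately show "pd b w x = 0" by blast
    qed
  qed
qed

lemma C1_localize:
  assumes "open U" "Ck_on k U w" "compact K" "K \<subseteq> U"
  obtains w' V K' where "Ck_on k UNIV w'" "open V" "K \<subseteq> V" "V \<subseteq> U" "\<And>x. x \<in> V ==> w' x = (w x :: real)"
    "compact K'" "K' \<subseteq> U" "\<And>x. x \<notin> K' ==> w' x = 0"
proof -
  obtain \<theta> K' V where t: "smooth_on UNIV \<theta>" "compact K'" "K' \<subseteq> U" "\<And>x. x \<notin> K' ==> \<theta> x = (0::real)"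
    "open V" "K \<subseteq> V" "\<And>x. x \<in> V ==> \<theta> x = 1"
    using smooth_cutoff[OF assms(3,1,4)] by metis
  show ?thesis
  proof (rule that)
    show "Ck_on k UNIV (\<lambda>x. \<theta> x * w x)"
      by (rule Ck_on_glue[OF assms(1,2) smooth_onD[OF t(1)] t(2,3,4)])
    show "open (V \<inter> U)" using t(5) assms(1) by auto
  qed (use t assms in auto)
qed

lemma zero_set_null:
  assumes U: "open U" and w: "Ck_on 1 U w" and b: "b \<in> Basis"
  shows "AE x in lborel. x \<in> U \<longrightarrow> w x = 0 \<longrightarrow> pd b w x = 0"
proof -
  obtain C :: "nat \<Rightarrow> 'a set" where C: "\<And>n. compact (C n)" "\<And>n. C n \<subseteq> U" "(\<Union>n. C n) = U"
    using open_Union_compact_subsets[OF U] by metis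
  have "AE x in lborel. x \<in> C n \<longrightarrow> w x = 0 \<longrightarrow> pd b w x = 0" for n
  proof -
    obtain w' V K' where w': "Ck_on 1 UNIV w'" "open V" "C n \<subseteq> V" "V \<subseteq> U"
      "\<And>x. x \<in> V ==> w' x = w x" "compact K'" "\<And>x. x \<notin> K' ==> w' x = 0"
      using C1_localize[OF U w C(1,2)[of n]] by metis
    have "C1_compact w'" using w' unfolding C1_compact_def by blast
    from zero_set_null_compact[OF this b] show ?thesis
    proof eventually_elim
      case (elim x)
      then show ?case
        using w'(3,5) frechet_derivative_cong_open[OF w'(2), of x w' w] by auto
    qed
  qed
  then have "AE x in lborel. \<forall>n. x \<in> C n \<longrightarrow> w x = 0 \<longrightarrow> pd b w x = 0"
    by (subst AE_all_countable) blast
  then show ?thesis by eventually_elim (use C(3) in blast)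
qed

lemma integral_pd_zero:
  assumes "C1_compact f" shows "integral\<^sup>L lborel (pd b f) = 0"
proof -
  obtain K where K: "compact K" "\<And>x. x \<notin> K ==> f x = 0"
    using assms unfolding C1_compact_def by blast
  obtain L where L: "L \<ge> 0" "\<And>x y. \<bar>f x - f y\<bar> \<le> L * norm (x - y)"
    using C1_compact_lipschitz[OF assms] by blast
  show ?thesis
    by (rule integral_directional_derivative_zero[OF L(2,1) K difference_quotient_limit])
      (use assms in \<open>auto simp: C1_compact_def\<close>)
qed

text \<open>By \<open>zero_set_null\<close> the one-sided derivative of \<open>max 0 w\<close> is almost everywhere the derivative of
  \<open>w\<close> times the indicator of \<open>w > 0\<close>.\<close>

lemma pos_part_by_parts:
  assumes U: "open U" and w: "Ck_on 1 U w" and g: "Ck_on 1 U g"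
    and K: "compact K" "K \<subseteq> U" "\<And>x. x \<notin> K ==> g x = 0" and b: "b \<in> Basis"
  shows "integrable lborel (\<lambda>x. indicator {x. 0 < w x} x * pd b w x * g x)"
    "integrable lborel (\<lambda>x. max 0 (w x) * pd b g x)"
    "(LBINT x. indicator {x. 0 < w x} x * pd b w x * g x)
      = - (LBINT x. max 0 (w x) * pd b g x)"
proof -
  obtain w' V K' where w': "Ck_on 1 UNIV w'" "open V" "K \<subseteq> V" "V \<subseteq> U"
    "\<And>x. x \<in> V ==> w' x = w x" "compact K'" "\<And>x. x \<notin> K' ==> w' x = 0"
    using C1_localize[OF U w K(1,2)] by metis
  have wc: "C1_compact w'" using w' unfolding C1_compact_def by blast
  have gc: "C1_compact g"
    using Ck_on_extend_zero[OF U g K] K unfolding C1_compact_def by blast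
  have cw: "continuous_on UNIV w'" and cg: "continuous_on UNIV g"
    using wc gc Ck_on_imp_continuous unfolding C1_compact_def by blast+
  note cgb = C1_compact_pd(2)[OF gc b] and cwb = C1_compact_pd(2)[OF wc b]
  have e1: "indicator {x. 0 < w x} x * pd b w x * g x
      = indicator {x. 0 < w' x} x * (pd b w' x * g x)" for x
  proof (cases "x \<in> K")
    case True then show ?thesis
      using w'(3,5) frechet_derivative_cong_open[OF w'(2), of x w' w] by (auto simp: indicator_def)
  qed (simp add: K(3))
  have e2: "max 0 (w x) * pd b g x = max 0 (w' x) * pd b g x" for x
  proof (cases "x \<in> K")
    case True then show ?thesis using w'(3,5) by auto
  qed (simp add: pd_zero_outside[OF K(1,3)])
  have i2: "integrable lborel (\<lambda>x. max 0 (w' x) * pd b g x)"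
    by (rule integrable_continuous_support[OF _ K(1)])
      (auto intro!: continuous_intros cw cgb simp: pd_zero_outside[OF K(1,3)])
  have [measurable]: "w' \<in> borel_measurable borel" using cw by (rule borel_measurable_continuous_onI)
  have "integrable lborel (\<lambda>x. pd b w' x * g x)"
    by (rule integrable_continuous_support[OF _ K(1)])
      (auto intro!: continuous_intros cwb cg simp: K(3))
  then have i1: "integrable lborel (\<lambda>x. indicator {x. 0 < w' x} x * (pd b w' x * g x))"
    by (intro integrable_mult_indicator[where 'b = real, simplified]) measurable
  show "integrable lborel (\<lambda>x. indicator {x. 0 < w x} x * pd b w x * g x)"
    "integrable lborel (\<lambda>x. max 0 (w x) * pd b g x)"
    unfolding e1 e2 by (rule i1 i2)+
  have "AE x in lborel. pos_pd b w' x * g x + max 0 (w' x) * pd b g x =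
     indicator {x. 0 < w' x} x * (pd b w' x * g x)
      + max 0 (w' x) * pd b g x"
    using zero_set_null_compact[OF wc b]
    by eventually_elim (auto simp: pos_pd_def indicator_def)
  then have "(LBINT x. pos_pd b w' x * g x + max 0 (w' x) * pd b g x)
    = (LBINT x. indicator {x. 0 < w' x} x * (pd b w' x * g x)
      + max 0 (w' x) * pd b g x)"
    using pos_part_integral(1)[OF wc gc, of b] i1 i2
    by (intro integral_cong_AE) (auto intro: borel_measurable_integrable)
  then have "(LBINT x. indicator {x. 0 < w' x} x * (pd b w' x * g x))
      + (LBINT x. max 0 (w' x) * pd b g x) = 0"
    using pos_part_integral(2)[OF wc gc, of b] i1 i2 by simp
  then show "(LBINT x. indicator {x. 0 < w x} x * pd b w x * g x)
      = - (LBINT x. max 0 (w x) * pd b g x)"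
    unfolding e1 e2 by linarith
qed

lemma integral_by_parts:
  assumes U: "open U" and w: "Ck_on 1 U w" and g: "Ck_on 1 U g"
    and K: "compact K" "K \<subseteq> U" "\<And>x. x \<notin> K ==> g x = 0" and b: "b \<in> Basis"
  shows "integrable lborel (\<lambda>x. pd b w x * g x)"
    "integrable lborel (\<lambda>x. w x * pd b g x)"
    "(LBINT x. pd b w x * g x) = - (LBINT x. w x * pd b g x)"
proof -
  obtain w' V K' where w': "Ck_on 1 UNIV w'" "open V" "K \<subseteq> V" "V \<subseteq> U"
    "\<And>x. x \<in> V ==> w' x = w x" "compact K'" "\<And>x. x \<notin> K' ==> w' x = 0"
    using C1_localize[OF U w K(1,2)] by metis
  have wc: "C1_compact w'" using w' unfolding C1_compact_def by blast
  have gc: "C1_compact g"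
    using Ck_on_extend_zero[OF U g K] K unfolding C1_compact_def by blast
  have cw: "continuous_on UNIV w'" and cg: "continuous_on UNIV g"
    using wc gc Ck_on_imp_continuous unfolding C1_compact_def by blast+
  note cgb = C1_compact_pd(2)[OF gc b] and cwb = C1_compact_pd(2)[OF wc b]
  have e1: "pd b w x * g x = pd b w' x * g x" for x
  proof (cases "x \<in> K")
    case True then show ?thesis
      using w'(3,5) frechet_derivative_cong_open[OF w'(2), of x w' w] by auto
  qed (simp add: K(3))
  have e2: "w x * pd b g x = w' x * pd b g x" for x
  proof (cases "x \<in> K")
    case True then show ?thesis using w'(3,5) by auto
  qed (simp add: pd_zero_outside[OF K(1,3)])
  have i2: "integrable lborel (\<lambda>x. w' x * pd b g x)"
    by (rule integrable_continuous_support[OF _ K(1)])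
      (auto intro!: continuous_intros cw cgb simp: pd_zero_outside[OF K(1,3)])
  have i1: "integrable lborel (\<lambda>x. pd b w' x * g x)"
    by (rule integrable_continuous_support[OF _ K(1)])
      (auto intro!: continuous_intros cwb cg simp: K(3))
  show "integrable lborel (\<lambda>x. pd b w x * g x)"
    "integrable lborel (\<lambda>x. w x * pd b g x)"
    unfolding e1 e2 by (rule i1 i2)+
  have dw: "w' differentiable at x" and dg: "g differentiable at x" for x
    using wc gc unfolding C1_compact_def by auto
  have pdm: "pd b (\<lambda>x. w' x * g x) x
      = w' x * pd b g x + pd b w' x * g x" for x
    by (rule pd_eqI[OF has_derivative_mult[OF has_derivative_frechet[OF dw] has_derivative_frechet[OF dg]]])
  have "C1_compact (\<lambda>x. w' x * g x)"
    using Ck_on_mult[OF open_UNIV w'(1), of g] gc K(1,3) unfolding C1_compact_def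
    by (intro conjI exI[of _ K]) auto
  from integral_pd_zero[OF this, of b] have "(LBINT x. pd b w' x * g x)
      + (LBINT x. w' x * pd b g x) = 0"
    unfolding pdm using i1 i2 by simp
  then show "(LBINT x. pd b w x * g x) = - (LBINT x. w x * pd b g x)"
    unfolding e1 e2 by linarith
qed

section \<open>Vector fields\<close>

abbreviation Ck_field :: "nat \<Rightarrow> 'a::euclidean_space set \<Rightarrow> ('a \<Rightarrow> 'a) \<Rightarrow> bool" where
  "Ck_field k U X \<equiv> \<forall>b\<in>Basis. Ck_on k U (\<lambda>x. X x \<bullet> b)"

lemma Ck_field_differentiable:
  assumes "Ck_field (Suc k) U X" "x \<in> U"
  shows "X differentiable at x"
proof -
  have "(X has_derivative (\<lambda>h. \<Sum>b\<in>Basis. pd h (\<lambda>x. X x \<bullet> b) x *\<^sub>R b)) (at x)"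
  proof (subst has_derivative_componentwise_within, intro ballI)
    fix i :: 'a assume i: "i \<in> Basis"
    have "((\<lambda>x. X x \<bullet> i) has_derivative frechet_derivative (\<lambda>x. X x \<bullet> i) (at x)) (at x)"
      using assms i by (intro has_derivative_frechet) auto
    then show "((\<lambda>x. X x \<bullet> i) has_derivative (\<lambda>h. (\<Sum>b\<in>Basis. pd h (\<lambda>x. X x \<bullet> b) x *\<^sub>R b) \<bullet> i)) (at x)"
      using i by (simp add: inner_sum_left inner_Basis if_distrib cong: if_cong)
  qed
  then show ?thesis unfolding differentiable_def by blast
qed

lemma divergence_eq_sum_pd:
  assumes "X differentiable at x"
  shows "divergence X x = (\<Sum>b\<in>Basis. pd b (\<lambda>y. X y \<bullet> b) x)"
  unfolding divergence_def
proof (rule sum.cong[OF refl])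
  fix b :: 'a
  have "(X has_derivative frechet_derivative X (at x)) (at x)"
    using assms by (simp only: frechet_derivative_works)
  then have "((\<lambda>y. X y \<bullet> b) has_derivative (\<lambda>h. frechet_derivative X (at x) h \<bullet> b)) (at x)"
    by (rule has_derivative_inner_left)
  then show "frechet_derivative X (at x) b \<bullet> b = pd b (\<lambda>y. X y \<bullet> b) x"
    by (rule pd_eqI[symmetric])
qed

lemma divergence_cong_open:
  assumes "open U" "x \<in> U" "\<And>y. y \<in> U ==> X y = Y y"
  shows "divergence X x = divergence Y x"
  unfolding divergence_def using frechet_derivative_cong_open[OF assms] by simp

lemma divergence_zero_outside:
  fixes X :: "'a::euclidean_space \<Rightarrow> 'a"
  assumes "compact K" "\<And>x. x \<notin> K ==> X x = 0" "x \<notin> K"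
  shows "divergence X x = 0"
proof -
  have "open (- K)" using assms(1) compact_imp_closed by auto
  then have "divergence X x = divergence (\<lambda>_. 0) x"
    by (rule divergence_cong_open) (use assms in auto)
  then show ?thesis by (simp add: divergence_def)
qed

lemma divergence_scaleR:
  assumes "f differentiable at x" "X differentiable at x"
  shows "divergence (\<lambda>y. f y *\<^sub>R X y) x = f x * divergence X x + grad f x \<bullet> X x"
proof -
  have df: "(f has_derivative (\<lambda>h. grad f x \<bullet> h)) (at x)" by (rule has_derivative_grad[OF assms(1)])
  have dX: "(X has_derivative frechet_derivative X (at x)) (at x)"
    using assms(2) by (simp only: frechet_derivative_works)
  have "frechet_derivative (\<lambda>y. f y *\<^sub>R X y) (at x)
      = (\<lambda>h. f x *\<^sub>R frechet_derivative X (at x) h + (grad f x \<bullet> h) *\<^sub>R X x)"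
    using has_derivative_scaleR[OF df dX] by (rule frechet_derivative_at[symmetric])
  then have "divergence (\<lambda>y. f y *\<^sub>R X y) x
     = (\<Sum>b\<in>Basis. f x * (frechet_derivative X (at x) b \<bullet> b) + (grad f x \<bullet> b) * (X x \<bullet> b))"
    unfolding divergence_def by (simp add: inner_add_left)
  also have "\<dots> = f x * divergence X x + grad f x \<bullet> X x"
    unfolding divergence_def by (simp add: sum.distrib sum_distrib_left euclidean_inner[of "grad f x" "X x"])
  finally show ?thesis .
qed

lemma divergence_add:
  assumes "X differentiable at x" "Y differentiable at x"
  shows "divergence (\<lambda>y. X y + Y y) x = divergence X x + divergence Y x"
proof -
  have "(X has_derivative frechet_derivative X (at x)) (at x)" "(Y has_derivative frechet_derivative Y (at x)) (at x)"
    using assms by (simp_all only: frechet_derivative_works)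
  from has_derivative_add[OF this]
  have "frechet_derivative (\<lambda>y. X y + Y y) (at x) = (\<lambda>h. frechet_derivative X (at x) h + frechet_derivative Y (at x) h)"
    by (rule frechet_derivative_at[symmetric])
  then show ?thesis unfolding divergence_def by (simp add: inner_add_left sum.distrib)
qed

lemma Ck_field_continuous:
  assumes "Ck_field k U X" shows "continuous_on U X"
  using assms Ck_on_imp_continuous by (subst continuous_on_componentwise) blast

lemma Ck_field_scaleR:
  assumes "open U" "Ck_on k U f" "Ck_field k U X"
  shows "Ck_field k U (\<lambda>x. f x *\<^sub>R X x)"
  using assms by (auto intro!: Ck_on_mult simp del: Ck_on.simps)

lemma continuous_divergence:
  assumes "open U" "Ck_field 1 U X" shows "continuous_on U (divergence X)"
proof -
  have "continuous_on U (\<lambda>x. \<Sum>b\<in>Basis. pd b (\<lambda>y. X y \<bullet> b) x)"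
    using assms(2) by (intro continuous_on_sum) simp
  moreover have "divergence X x = (\<Sum>b\<in>Basis. pd b (\<lambda>y. X y \<bullet> b) x)" if "x \<in> U" for x
    using Ck_field_differentiable[of 0 U X x] assms(2) that by (intro divergence_eq_sum_pd) simp
  ultimately show ?thesis by (simp cong: continuous_on_cong)
qed

lemma Ck_field_extend_zero:
  assumes "open U" "Ck_field k U X" "compact K" "K \<subseteq> U" "\<And>x. x \<notin> K ==> X x = 0"
  shows "Ck_field k UNIV X"
  using assms by (intro ballI Ck_on_extend_zero[OF assms(1) _ assms(3,4)]) auto

lemma integrable_divergence:
  fixes X :: "'a::euclidean_space \<Rightarrow> 'a"
  assumes "open U" "Ck_field 1 U X" "compact K" "K \<subseteq> U" "\<And>x. x \<notin> K ==> X x = 0"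
  shows "integrable lborel (divergence X)"
proof (rule integrable_continuous_support[OF _ assms(3)])
  show "continuous_on UNIV (divergence X)"
    by (rule continuous_divergence[OF open_UNIV Ck_field_extend_zero[OF assms]])
qed (rule divergence_zero_outside[OF assms(3,5)])

text \<open>Integration by parts against \<open>max 0 (w - e)\<close> moves the derivatives of \<open>X\<close> onto \<open>w\<close>, where they
  combine to \<open>X \<bullet> \<nabla>w = 0\<close>. Differences for nearby \<open>e\<close>, divided by the increment, tend to the indicator
  of \<open>w > 0\<close>. No surface measure is involved.\<close>

lemma tangential_divergence_zero:
  fixes X :: "'a::euclidean_space \<Rightarrow> 'a"
  assumes U: "open U" and w: "Ck_on 1 U w" and X: "Ck_field 1 U X"
    and K: "compact K" "K \<subseteq> U" "\<And>x. x \<notin> K ==> X x = 0"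
    and tang: "\<And>x. x \<in> U ==> X x \<bullet> grad w x = 0"
  shows "(LBINT x. indicator {x. 0 < w x} x * divergence X x) = 0"
proof -
  have Xd: "X differentiable at x" for x
    using Ck_field_differentiable[of 0 UNIV X x] Ck_field_extend_zero[OF U X K] by simp
  have pdz: "pd b (\<lambda>y. X y \<bullet> b) x = 0" if "x \<notin> K" for x b
    by (rule pd_zero_outside[OF K(1) _ that]) (simp add: K(3))
  note di = integrable_divergence[OF U X K]
  have shift: "integrable lborel (\<lambda>x. max 0 (w x - e) * divergence X x) \<and>
     (LBINT x. max 0 (w x - e) * divergence X x) = 0" for e
  proof -
    let ?w = "\<lambda>x. w x - e"
    have we: "Ck_on 1 U ?w" by (rule Ck_on_diff[OF U w Ck_on_const])
    have Kb: "X x \<bullet> b = 0" if "x \<notin> K" for x b using K(3)[OF that] by simp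
    note P = pos_part_by_parts[OF U we _ K(1,2) Kb]
    have Xb: "Ck_on 1 U (\<lambda>x. X x \<bullet> b)" if "b \<in> Basis" for b using X that by blast
    have eq: "max 0 (w x - e) * divergence X x = (\<Sum>b\<in>Basis. max 0 (?w x) * pd b (\<lambda>y. X y \<bullet> b) x)" for x
      by (simp add: divergence_eq_sum_pd[OF Xd] sum_distrib_left)
    have "(\<Sum>b\<in>Basis. indicator {x. 0 < ?w x} x * frechet_derivative ?w (at x) b * (X x \<bullet> b)) = 0" for x
    proof (cases "x \<in> U")
      case True
      then have wd: "w differentiable at x" using w by simp
      have "((\<lambda>x. w x - e) has_derivative frechet_derivative w (at x)) (at x)"
        using has_derivative_diff[OF has_derivative_frechet[OF wd] has_derivative_const] by simp
      then have "frechet_derivative ?w (at x) b = grad w x \<bullet> b" for b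
        using pd_eqI grad_inner[OF wd] by metis
      then have "(\<Sum>b\<in>Basis. indicator {x. 0 < ?w x} x * frechet_derivative ?w (at x) b * (X x \<bullet> b))
        = indicator {x. 0 < ?w x} x * (X x \<bullet> grad w x)"
        by (simp add: sum_distrib_left mult.assoc euclidean_inner[of "X x" "grad w x"] mult.commute[of "X x \<bullet> _"])
      then show ?thesis using tang[OF True] by simp
    next
      case False
      then have "X x = 0" using K by blast
      then show ?thesis by simp
    qed
    then have "0 = (LBINT x. (\<Sum>b\<in>Basis. indicator {x. 0 < ?w x} x * frechet_derivative ?w (at x) b * (X x \<bullet> b)))"
      by simp
    also have "\<dots> = (\<Sum>b\<in>Basis. LBINT x. indicator {x. 0 < ?w x} x * frechet_derivative ?w (at x) b * (X x \<bullet> b))"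
      by (rule Bochner_Integration.integral_sum) (rule P(1)[OF Xb])
    also have "\<dots> = - (\<Sum>b\<in>Basis. LBINT x. max 0 (?w x) * pd b (\<lambda>y. X y \<bullet> b) x)"
      unfolding sum_negf[symmetric] by (rule sum.cong[OF refl]) (rule P(3)[OF Xb])
    also have "\<dots> = - (LBINT x. (\<Sum>b\<in>Basis. max 0 (?w x) * pd b (\<lambda>y. X y \<bullet> b) x))"
      by (subst Bochner_Integration.integral_sum) (auto intro: P(2)[OF Xb])
    finally show ?thesis unfolding eq
      using P(2)[OF Xb] by (auto intro!: Bochner_Integration.integrable_sum)
  qed
  let ?e = "\<lambda>n. 1 / real (Suc n)"
  let ?s = "\<lambda>n x. (max 0 (w x - 0) * divergence X x - max 0 (w x - ?e n) * divergence X x) / ?e n"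
  have "(\<lambda>n. integral\<^sup>L lborel (?s n)) \<longlonglongrightarrow> (LBINT x. indicator {x. 0 < w x} x * divergence X x)"
  proof (rule integral_dominated_convergence)
    show "integrable lborel (\<lambda>x. \<bar>divergence X x\<bar>)" using di by simp
    show sm: "?s n \<in> borel_measurable lborel" for n
      using shift[of 0] shift[of "?e n"] borel_measurable_integrable
      by (intro borel_measurable_divide borel_measurable_diff borel_measurable_const) blast+
    have lim: "(\<lambda>n. ?s n x) \<longlonglongrightarrow> indicator {x. 0 < w x} x * divergence X x" for x
    proof (cases "w x > 0")
      case True
      have "\<forall>\<^sub>F n in sequentially. ?e n < w x"
        by (rule order_tendstoD(2)[OF inverse_Suc_tendsto_0 True])
      then have "\<forall>\<^sub>F n in sequentially. divergence X x = ?s n x"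
        by eventually_elim (use True in \<open>simp add: field_simps del: of_nat_Suc\<close>)
      from Lim_transform_eventually[OF tendsto_const this] show ?thesis using True by simp
    next
      case False
      have "max 0 (w x - ?e n) = 0" for n
      proof -
        have "?e n > 0" by simp
        then show ?thesis using False by linarith
      qed
      moreover have "max 0 (w x - 0) = 0" using False by simp
      ultimately have "?s n x = 0" for n by (simp only:) simp
      then have eq: "(\<lambda>n. ?s n x) = (\<lambda>_. 0)" by (rule ext)
      show ?thesis unfolding eq using False by simp
    qed
    then show "AE x in lborel. (\<lambda>n. ?s n x) \<longlonglongrightarrow> indicator {x. 0 < w x} x * divergence X x" by auto
    show "(\<lambda>x. indicator {x. 0 < w x} x * divergence X x) \<in> borel_measurable lborel"
      by (rule borel_measurable_LIMSEQ_real[OF lim sm])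
    show "AE x in lborel. norm (?s n x) \<le> \<bar>divergence X x\<bar>" for n
    proof (rule AE_I2)
      fix x
      have e: "?e n > 0" by simp
      have "\<bar>max 0 (w x - 0) - max 0 (w x - ?e n)\<bar> \<le> ?e n" using e by linarith
      then have "\<bar>max 0 (w x - 0) - max 0 (w x - ?e n)\<bar> / ?e n \<le> 1" by (simp only: pos_divide_le_eq[OF e] mult_1)
      then have "\<bar>divergence X x\<bar> * (\<bar>max 0 (w x - 0) - max 0 (w x - ?e n)\<bar> / ?e n) \<le> \<bar>divergence X x\<bar>"
        by (rule mult_left_le) simp
      moreover have "?s n x = divergence X x * ((max 0 (w x - 0) - max 0 (w x - ?e n)) / ?e n)"
        by (simp add: field_simps del: of_nat_Suc)
      moreover have "\<bar>?e n\<bar> = ?e n" using e by simp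
      ultimately show "norm (?s n x) \<le> \<bar>divergence X x\<bar>" by (simp only: real_norm_def abs_mult abs_divide)
    qed
  qed
  moreover have "integral\<^sup>L lborel (?s n) = 0" for n
    using shift[of 0] shift[of "?e n"] by (simp del: of_nat_Suc)
  ultimately show ?thesis by (simp add: LIMSEQ_const_iff)
qed

section \<open>Test functions determine measures and weak gradients\<close>

text \<open>An open set is the increasing union of compact sets; smooth cutoffs between consecutive
  members increase to its indicator.\<close>

lemma emeasure_le_of_test_functions:
  fixes M N :: "'a::euclidean_space measure"
  assumes s: "sets M = sets borel" "sets N = sets borel" and G: "open G"
    and le: "\<And>\<zeta>. test_function G \<zeta> ==> (\<forall>x. 0 \<le> \<zeta> x \<and> \<zeta> x \<le> 1) ==>
      (\<integral>\<^sup>+x. ennreal (\<zeta> x) \<partial>M) \<le> (\<integral>\<^sup>+x. ennreal (\<zeta> x) \<partial>N)"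
  shows "emeasure M G \<le> emeasure N G"
proof -
  obtain C :: "nat \<Rightarrow> 'a set" where C: "\<And>n. compact (C n)" "\<And>n. C n \<subseteq> G" "\<And>n. C n \<subseteq> interior (C (Suc n))" "(\<Union>n. C n) = G"
    using open_Union_compact_subsets[OF G] by metis
  have Cb: "C n \<in> sets M" for n using C(1)[of n] s by (simp add: borel_compact)
  have inc: "incseq C" using C(3) interior_subset by (intro incseq_SucI) blast
  have "emeasure M (C n) \<le> emeasure N G" for n
  proof -
    obtain \<theta> K' V where t: "smooth_on UNIV \<theta>" "\<And>x. 0 \<le> \<theta> x" "\<And>x. \<theta> x \<le> (1::real)"
      "compact K'" "K' \<subseteq> G" "\<And>x. x \<notin> K' ==> \<theta> x = 0" "C n \<subseteq> V" "\<And>x. x \<in> V ==> \<theta> x = 1"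
      using smooth_cutoff[OF C(1) G C(2), of n] by metis
    have tf: "test_function G \<theta>" unfolding test_function_def using t by blast
    have "emeasure M (C n) = (\<integral>\<^sup>+x. indicator (C n) x \<partial>M)" using Cb by simp
    also have "\<dots> \<le> (\<integral>\<^sup>+x. ennreal (\<theta> x) \<partial>M)"
      using t by (intro nn_integral_mono) (auto simp: indicator_def)
    also have "\<dots> \<le> (\<integral>\<^sup>+x. ennreal (\<theta> x) \<partial>N)" using le[OF tf] t by blast
    also have "\<dots> \<le> (\<integral>\<^sup>+x. indicator G x \<partial>N)"
    proof (rule nn_integral_mono)
      fix x
      have "\<theta> x = 0" if "x \<notin> G" using t(5,6) that by blast
      then show "ennreal (\<theta> x) \<le> indicator G x"
        using t(3)[of x] by (cases "x \<in> G") (auto simp: indicator_def ennreal_le_1)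
    qed
    also have "\<dots> = emeasure N G" using s G by simp
    finally show ?thesis .
  qed
  moreover have "(SUP n. emeasure M (C n)) = emeasure M G"
    using SUP_emeasure_incseq[of C M] Cb inc C(4) by auto
  ultimately show ?thesis by (metis SUP_least)
qed

text \<open>Open sets form an intersection-stable generator of the Borel sets.\<close>

lemma measures_eq_of_test_functions:
  fixes M N :: "'a::euclidean_space measure"
  assumes s: "sets M = sets borel" "sets N = sets borel" and A: "open A"
    and fin: "emeasure M A < \<infinity>"
    and eq: "\<And>\<zeta>. test_function A \<zeta> ==> (\<forall>x. 0 \<le> \<zeta> x \<and> \<zeta> x \<le> 1) ==>
      (\<integral>\<^sup>+x. ennreal (\<zeta> x) \<partial>M) = (\<integral>\<^sup>+x. ennreal (\<zeta> x) \<partial>N)"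
    and B: "B \<in> sets borel" "B \<subseteq> A"
  shows "emeasure M B = emeasure N B"
proof -
  have open_eq: "emeasure M G = emeasure N G" if "open G" "G \<subseteq> A" for G
  proof -
    have tf: "test_function A \<zeta>" if "test_function G \<zeta>" for \<zeta>
      using that \<open>G \<subseteq> A\<close> unfolding test_function_def by blast
    show ?thesis
      by (intro antisym emeasure_le_of_test_functions that s) (simp_all add: eq tf)
  qed
  let ?M = "density M (indicator A)" and ?N = "density N (indicator A)"
  have Ab: "A \<in> sets borel" using A by simp
  have Am: "indicator A \<in> borel_measurable M" "indicator A \<in> borel_measurable N"
    using Ab s by (auto intro!: borel_measurable_indicator)
  have em: "emeasure ?M C = emeasure M (A \<inter> C)" "emeasure ?N C = emeasure N (A \<inter> C)"
    if "C \<in> sets borel" for C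
    using that Am s Ab
    by (auto simp: emeasure_density indicator_inter_arith[symmetric] cong: nn_integral_cong)
  have "?M = ?N"
  proof (rule measure_eqI_generator_eq[where E = "{S. open S}" and \<Omega> = UNIV and A = "\<lambda>_. UNIV"])
    show "Int_stable {S::'a set. open S}" by (auto simp: Int_stable_def)
    show "emeasure ?M X = emeasure ?N X" if "X \<in> {S. open S}" for X
      using that A em[of X] open_eq[of "A \<inter> X"] by auto
    show "sets ?M = sigma_sets UNIV {S. open S}" "sets ?N = sigma_sets UNIV {S. open S}"
      using s by (simp_all add: borel_def)
    show "emeasure ?M UNIV \<noteq> \<infinity>" using em(1)[of UNIV] fin by simp
  qed auto
  then have "emeasure ?M B = emeasure ?N B" by (simp only:)
  moreover have "A \<inter> B = B" using B(2) by auto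
  ultimately show ?thesis using em[OF B(1)] by (simp only:)
qed

lemma bounded_set_integrable:
  fixes f :: "'a::euclidean_space \<Rightarrow> real"
  assumes "bounded A" "\<And>x. x \<in> A ==> \<bar>f x\<bar> \<le> B" "\<And>x. x \<notin> A ==> f x = 0" "f \<in> borel_measurable borel"
  shows "integrable lborel f"
proof -
  obtain C where C: "A \<subseteq> cball 0 C" using assms(1) unfolding bounded_iff by (auto simp: subset_iff)
  show ?thesis
  proof (rule integrable_bounded_support[OF assms(4), of "cball 0 C" "max B 0"])
    show "\<bar>f x\<bar> \<le> max B 0" for x using assms(2)[of x] assms(3)[of x] by (cases "x \<in> A") auto
    show "f x = 0" if "x \<notin> cball 0 C" for x using assms(3)[of x] C that by blast
  qed simp
qed

lemma enn2real_inj: "y \<noteq> \<infinity> ==> z \<noteq> \<infinity> ==> enn2real y = enn2real z ==> y = z"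
  by (metis ennreal_enn2real infinity_ennreal_def less_top)

text \<open>The positive and the negative part of \<open>g\<close> are the densities of two finite measures that agree on
  test functions.\<close>

lemma fundamental_lemma_borel:
  fixes g :: "'a::euclidean_space \<Rightarrow> real"
  assumes A: "open A" "bounded A" and gm[measurable]: "g \<in> borel_measurable borel"
    and bd: "\<And>x. \<bar>g x\<bar> \<le> B"
    and z: "\<And>\<zeta>. test_function A \<zeta> ==> (LBINT x. indicator A x * (g x * \<zeta> x)) = 0"
  shows "AE x in lborel. x \<in> A \<longrightarrow> g x = 0"
proof -
  have Am[measurable]: "A \<in> sets borel" using A by simp
  let ?M = "density lborel (\<lambda>x. indicator A x * ennreal (g x))"
  let ?N = "density lborel (\<lambda>x. indicator A x * ennreal (- g x))"
  have B0: "B \<ge> 0" using bd[of 0] by linarith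
  have fin: "emeasure ?M A < \<infinity>"
  proof -
    have "emeasure ?M A = (\<integral>\<^sup>+x. indicator A x * ennreal (g x) \<partial>lborel)"
      by (subst emeasure_density) (auto intro!: nn_integral_cong simp: indicator_def)
    also have "\<dots> \<le> (\<integral>\<^sup>+x. ennreal B * indicator A x \<partial>lborel)"
      using bd by (intro nn_integral_mono) (auto simp: indicator_def abs_le_iff ennreal_leI)
    also have "\<dots> = ennreal B * emeasure lborel A" by (simp add: nn_integral_cmult_indicator)
    also have "\<dots> < \<infinity>" using emeasure_bounded_finite[OF A(2)] by (simp add: ennreal_mult_less_top)
    finally show ?thesis .
  qed
  have eq: "(\<integral>\<^sup>+x. ennreal (\<zeta> x) \<partial>?M) = (\<integral>\<^sup>+x. ennreal (\<zeta> x) \<partial>?N)"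
    if t: "test_function A \<zeta>" "\<forall>x. 0 \<le> \<zeta> x \<and> \<zeta> x \<le> 1" for \<zeta>
  proof -
    have "continuous_on UNIV \<zeta>"
      using t(1) Ck_on_imp_continuous smooth_onD unfolding test_function_def by blast
    then have [measurable]: "\<zeta> \<in> borel_measurable borel" by (rule borel_measurable_continuous_onI)
    let ?f = "\<lambda>x. indicator A x * (g x * \<zeta> x)"
    have bdf: "\<bar>?f x\<bar> \<le> B" if "x \<in> A" for x
      using bd[of x] t(2) that B0 mult_mono[of "\<bar>g x\<bar>" B "\<bar>\<zeta> x\<bar>" 1] by (simp add: abs_mult)
    have fi: "integrable lborel ?f"
      by (rule bounded_set_integrable[OF A(2) bdf]) auto
    have e1: "(\<integral>\<^sup>+x. ennreal (\<zeta> x) \<partial>?M) = (\<integral>\<^sup>+x. ennreal (?f x) \<partial>lborel)"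
      using t(2) by (subst nn_integral_density) (auto intro!: nn_integral_cong simp: indicator_def ennreal_mult'')
    have e2: "(\<integral>\<^sup>+x. ennreal (\<zeta> x) \<partial>?N) = (\<integral>\<^sup>+x. ennreal (- ?f x) \<partial>lborel)"
      using t(2) by (subst nn_integral_density) (auto intro!: nn_integral_cong simp: indicator_def ennreal_mult''[symmetric])
    have fin: "(\<integral>\<^sup>+x. ennreal (?f x) \<partial>lborel) \<noteq> \<infinity>" "(\<integral>\<^sup>+x. ennreal (- ?f x) \<partial>lborel) \<noteq> \<infinity>"
      using fi by (auto simp: real_integrable_def)
    have "enn2real (\<integral>\<^sup>+x. ennreal (?f x) \<partial>lborel) = enn2real (\<integral>\<^sup>+x. ennreal (- ?f x) \<partial>lborel)"
      using real_lebesgue_integral_def[OF fi] z[OF t(1)] by simp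
    then show ?thesis unfolding e1 e2 by (rule enn2real_inj[OF fin])
  qed
  have MN: "emeasure ?M C = emeasure ?N C" if "C \<in> sets borel" "C \<subseteq> A" for C
    by (rule measures_eq_of_test_functions[OF _ _ A(1) fin eq that]) auto
  let ?P = "{x. x \<in> A \<and> g x > 0}" and ?Q = "{x. x \<in> A \<and> g x < 0}"
  have Pm: "?P \<in> sets borel" "?Q \<in> sets borel" by measurable
  have eM: "emeasure ?M C = (\<integral>\<^sup>+x. indicator A x * ennreal (g x) * indicator C x \<partial>lborel)"
    "emeasure ?N C = (\<integral>\<^sup>+x. indicator A x * ennreal (- g x) * indicator C x \<partial>lborel)" if "C \<in> sets borel" for C
    using that by (simp_all add: emeasure_density)
  have "emeasure ?N ?P = 0"
    unfolding eM(2)[OF Pm(1)] by (subst nn_integral_cong[where v = "\<lambda>_. 0"]) (auto simp: indicator_def ennreal_neg)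
  then have "(\<integral>\<^sup>+x. indicator A x * ennreal (g x) * indicator ?P x \<partial>lborel) = 0"
    using MN[OF Pm(1)] eM(1)[OF Pm(1)] by auto
  then have a1: "AE x in lborel. indicator A x * ennreal (g x) * indicator ?P x = 0"
    by (subst (asm) nn_integral_0_iff_AE) (use Pm in measurable)
  have "emeasure ?M ?Q = 0"
    unfolding eM(1)[OF Pm(2)] by (subst nn_integral_cong[where v = "\<lambda>_. 0"]) (auto simp: indicator_def ennreal_neg)
  then have "(\<integral>\<^sup>+x. indicator A x * ennreal (- g x) * indicator ?Q x \<partial>lborel) = 0"
    using MN[OF Pm(2)] eM(2)[OF Pm(2)] by auto
  then have a2: "AE x in lborel. indicator A x * ennreal (- g x) * indicator ?Q x = 0"
    by (subst (asm) nn_integral_0_iff_AE) (use Pm in measurable)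
  from a1 a2 show ?thesis
  proof eventually_elim
    case (elim x)
    then show ?case by (cases "g x > 0"; cases "g x < 0") (auto simp: indicator_def split: if_splits)
  qed
qed


lemma test_function_continuous: "test_function A \<zeta> ==> continuous_on UNIV \<zeta>"
  using Ck_on_imp_continuous smooth_onD unfolding test_function_def by blast

lemma test_function_bounded:
  assumes "test_function A \<zeta>" obtains B where "B \<ge> 0" "\<And>x. \<bar>\<zeta> x\<bar> \<le> B"
proof -
  obtain K where K: "compact K" "K \<subseteq> A" "\<And>x. x \<notin> K ==> \<zeta> x = 0"
    using assms unfolding test_function_def by blast
  show ?thesis using bounded_support[OF test_function_continuous[OF assms] K(1,3)] that by blast
qed

lemma L_inf_imp_borel:
  fixes g :: "'a::euclidean_space \<Rightarrow> real"
  assumes g: "L_inf A g"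
  obtains g' B where "g' \<in> borel_measurable borel" "\<And>x. \<bar>g' x\<bar> \<le> B"
    "AE x in lebesgue. indicator A x * g x = g' x"
proof -
  obtain B where B: "AE x in lebesgue. x \<in> A \<longrightarrow> norm (g x) \<le> B"
    and m: "(\<lambda>x. indicator A x * g x) \<in> borel_measurable lebesgue"
    using g unfolding L_inf_def set_borel_measurable_def by auto
  obtain g1 where g1: "g1 \<in> borel_measurable lborel" "AE x in lborel. indicator A x * g x = g1 x"
    using completion_ex_borel_measurable_real[OF m] by blast
  define g' where "g' = (\<lambda>x. max (- max B 0) (min (max B 0) (g1 x)))"
  have e: "AE x in lebesgue. indicator A x * g x = g1 x" using g1(2) by (rule AE_completion)
  show ?thesis
  proof (rule that)
    show "g' \<in> borel_measurable borel" using g1(1) unfolding g'_def by simp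
    show "\<bar>g' x\<bar> \<le> max B 0" for x unfolding g'_def by linarith
    show "AE x in lebesgue. indicator A x * g x = g' x"
      using e B
    proof eventually_elim
      case (elim x)
      then have "\<bar>g1 x\<bar> \<le> max B 0" by (cases "x \<in> A") (auto simp: indicator_def)
      then show ?case using elim(1) unfolding g'_def by (simp add: abs_le_iff)
    qed
  qed
qed

lemma L_inf_inner:
  fixes g :: "'a::euclidean_space \<Rightarrow> 'a"
  assumes "L_inf A g" "b \<in> Basis" shows "L_inf A (\<lambda>x. g x \<bullet> b)"
proof -
  obtain B where B: "AE x in lebesgue. x \<in> A \<longrightarrow> norm (g x) \<le> B"
    and m: "(\<lambda>x. indicator A x *\<^sub>R g x) \<in> borel_measurable lebesgue"
    using assms unfolding L_inf_def set_borel_measurable_def by auto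
  have "(\<lambda>x. (indicator A x *\<^sub>R g x) \<bullet> b) \<in> borel_measurable lebesgue"
    using m by (intro borel_measurable_inner borel_measurable_const)
  moreover have "AE x in lebesgue. x \<in> A \<longrightarrow> norm (g x \<bullet> b) \<le> B"
    using B by eventually_elim (use assms(2) Basis_le_norm order_trans in \<open>fastforce\<close>)
  ultimately show ?thesis unfolding L_inf_def set_borel_measurable_def by auto
qed

lemma fundamental_lemma:
  fixes g h :: "'a::euclidean_space \<Rightarrow> real"
  assumes A: "open A" "bounded A" and g: "L_inf A g" and h: "L_inf A h"
    and eq: "\<And>\<zeta>. test_function A \<zeta> ==> (LINT x:A|lebesgue. g x * \<zeta> x) = (LINT x:A|lebesgue. h x * \<zeta> x)"
  shows "AE x in lebesgue. x \<in> A \<longrightarrow> g x = h x"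
proof -
  obtain g' Bg where g': "g' \<in> borel_measurable borel" "\<And>x. \<bar>g' x\<bar> \<le> Bg"
    "AE x in lebesgue. indicator A x * g x = g' x" using L_inf_imp_borel[OF g] by blast
  obtain h' Bh where h': "h' \<in> borel_measurable borel" "\<And>x. \<bar>h' x\<bar> \<le> Bh"
    "AE x in lebesgue. indicator A x * h x = h' x" using L_inf_imp_borel[OF h] by blast
  have Am[measurable]: "A \<in> sets borel" using A by simp
  note [measurable] = g'(1) h'(1)
  have key: "integrable lborel (\<lambda>x. indicator A x * (f' x * \<zeta> x)) \<and>
      (LINT x:A|lebesgue. f x * \<zeta> x) = (LBINT x. indicator A x * (f' x * \<zeta> x))"
    if f': "f' \<in> borel_measurable borel" "\<And>x. \<bar>f' x\<bar> \<le> B" "AE x in lebesgue. indicator A x * f x = f' x"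
      and f: "L_inf A f" and t: "test_function A \<zeta>" for f f' :: "'a \<Rightarrow> real" and B \<zeta>
  proof -
    obtain C where C: "C \<ge> 0" "\<And>x. \<bar>\<zeta> x\<bar> \<le> C" using test_function_bounded[OF t] by blast
    note [measurable] = f'(1)
    have zm[measurable]: "\<zeta> \<in> borel_measurable borel"
      using test_function_continuous[OF t] by (rule borel_measurable_continuous_onI)
    have "integrable lborel (\<lambda>x. indicator A x * (f' x * \<zeta> x))"
    proof (rule bounded_set_integrable[OF A(2), where B = "B * C"])
      show "\<bar>indicator A x * (f' x * \<zeta> x)\<bar> \<le> B * C" if "x \<in> A" for x
        using that mult_mono[OF f'(2)[of x] C(2)[of x]] f'(2)[of x] by (simp add: abs_mult)
    qed auto
    moreover have "(LINT x:A|lebesgue. f x * \<zeta> x) = (\<integral>x. indicator A x * (f' x * \<zeta> x) \<partial>lebesgue)"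
      unfolding set_lebesgue_integral_def
    proof (rule integral_cong_AE)
      have "(\<lambda>x. indicator A x * f x) \<in> borel_measurable lebesgue"
        using f unfolding L_inf_def set_borel_measurable_def by auto
      moreover have "\<zeta> \<in> borel_measurable lebesgue" using zm by (intro measurable_completion) simp
      ultimately have "(\<lambda>x. (indicator A x * f x) * \<zeta> x) \<in> borel_measurable lebesgue"
        by (rule borel_measurable_times)
      then show "(\<lambda>x. indicat_real A x *\<^sub>R (f x * \<zeta> x)) \<in> borel_measurable lebesgue"
        by (simp add: mult.assoc)
      show "(\<lambda>x. indicat_real A x * (f' x * \<zeta> x)) \<in> borel_measurable lebesgue"
        by (intro measurable_completion) simp
      show "AE x in lebesgue. indicat_real A x *\<^sub>R (f x * \<zeta> x) = indicat_real A x * (f' x * \<zeta> x)"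
        using f'(3) by eventually_elim (auto simp: indicator_def)
    qed
    moreover have "(\<integral>x. indicator A x * (f' x * \<zeta> x) \<partial>lebesgue) = (LBINT x. indicator A x * (f' x * \<zeta> x))"
      by (rule integral_completion) simp
    ultimately show ?thesis by simp
  qed
  have "AE x in lborel. x \<in> A \<longrightarrow> g' x - h' x = 0"
  proof (rule fundamental_lemma_borel[OF A, where B = "Bg + Bh"])
    show "\<bar>g' x - h' x\<bar> \<le> Bg + Bh" for x using g'(2)[of x] h'(2)[of x] by linarith
    show "(LBINT x. indicator A x * ((g' x - h' x) * \<zeta> x)) = 0" if "test_function A \<zeta>" for \<zeta>
    proof -
      have "(LBINT x. indicator A x * (g' x * \<zeta> x) - indicator A x * (h' x * \<zeta> x)) = 0"
        using key[OF g' g that] key[OF h' h that] eq[OF that] by simp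
      then show ?thesis by (simp add: algebra_simps)
    qed
  qed simp
  then have "AE x in lebesgue. x \<in> A \<longrightarrow> g' x - h' x = 0" by (rule AE_completion)
  with g'(3) h'(3) show ?thesis by eventually_elim (auto simp: indicator_def)
qed

text \<open>This identifies the weak gradient selected by the choice operator with a gradient that is
  known explicitly.\<close>

lemma weak_grad_eqI:
  assumes A: "open A" "bounded A" and w: "L_inf A w" and G: "L_inf A G" "weak_gradient A w G"
  shows "w \<in> W1_inf A" "AE x in lebesgue. x \<in> A \<longrightarrow> weak_grad A w x = G x" "L_inf A (weak_grad A w)"
proof -
  show "w \<in> W1_inf A" unfolding W1_inf_def using w G by blast
  have sg: "L_inf A (weak_grad A w) \<and> weak_gradient A w (weak_grad A w)"
    unfolding weak_grad_def by (rule someI[where x = G]) (use G in blast)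
  then show "L_inf A (weak_grad A w)" by blast
  have "AE x in lebesgue. x \<in> A \<longrightarrow> weak_grad A w x \<bullet> b = G x \<bullet> b" if b: "b \<in> Basis" for b
  proof (rule fundamental_lemma[OF A L_inf_inner[OF _ b] L_inf_inner[OF G(1) b]])
    fix \<zeta> assume t: "test_function A \<zeta>"
    have "(LINT x:A|lebesgue. w x * (grad \<zeta> x \<bullet> b)) = - (LINT x:A|lebesgue. (weak_grad A w x \<bullet> b) * \<zeta> x)"
      "(LINT x:A|lebesgue. w x * (grad \<zeta> x \<bullet> b)) = - (LINT x:A|lebesgue. (G x \<bullet> b) * \<zeta> x)"
      using sg G(2) t b unfolding weak_gradient_def by blast+
    then show "(LINT x:A|lebesgue. (weak_grad A w x \<bullet> b) * \<zeta> x) = (LINT x:A|lebesgue. (G x \<bullet> b) * \<zeta> x)"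
      by linarith
  qed (use sg in blast)
  then have "AE x in lebesgue. \<forall>b\<in>Basis. x \<in> A \<longrightarrow> weak_grad A w x \<bullet> b = G x \<bullet> b"
    by (intro AE_finite_allI finite_Basis)
  moreover have "weak_grad A w x = G x"
    if "\<forall>b\<in>Basis. x \<in> A \<longrightarrow> weak_grad A w x \<bullet> b = G x \<bullet> b" "x \<in> A" for x
    by (rule euclidean_eqI) (use that in blast)
  ultimately show "AE x in lebesgue. x \<in> A \<longrightarrow> weak_grad A w x = G x"
    by (auto elim: eventually_mono)
qed

text \<open>On the set where the two functions agree their gradients agree almost everywhere, so that the
  choice made there is immaterial.\<close>

definition max_grad :: "('a::euclidean_space \<Rightarrow> real) \<Rightarrow> ('a \<Rightarrow> real) \<Rightarrow> 'a \<Rightarrow> 'a" where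
  "max_grad u v x = (if u x < v x then grad v x else grad u x)"

lemma set_lebesgue_integral_eq_lborel:
  fixes f :: "'a::euclidean_space \<Rightarrow> real"
  assumes "f \<in> borel_measurable borel" "\<And>x. x \<in> A ==> f x = g x" "\<And>x. x \<notin> A ==> f x = 0"
  shows "(LINT x:A|lebesgue. g x) = integral\<^sup>L lborel f"
proof -
  have "(LINT x:A|lebesgue. g x) = integral\<^sup>L lebesgue f"
    unfolding set_lebesgue_integral_def
    by (rule Bochner_Integration.integral_cong) (use assms(2,3) in \<open>auto simp: indicator_def\<close>)
  also have "\<dots> = integral\<^sup>L lborel f" using assms(1) by (intro integral_completion) simp
  finally show ?thesis .
qed

text \<open>Since \<open>max u v = u + max 0 (v - u)\<close>, this is integration by parts for a positive part.\<close>

lemma max_weak_gradient: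
  fixes A :: "'a::euclidean_space set"
  assumes W: "open W" "A \<subseteq> W" "open A" and u: "Ck_on 1 W u" and v: "Ck_on 1 W v"
  shows "weak_gradient A (\<lambda>x. max (u x) (v x)) (max_grad u v)"
  unfolding weak_gradient_def
proof (intro allI impI ballI)
  fix \<zeta> :: "'a \<Rightarrow> real" and b :: 'a assume t: "test_function A \<zeta>" and b: "b \<in> Basis"
  obtain K where K: "compact K" "K \<subseteq> A" "\<And>x. x \<notin> K ==> \<zeta> x = 0"
    using t unfolding test_function_def by blast
  have zC: "Ck_on 1 A \<zeta>" "Ck_on 1 UNIV \<zeta>"
    using t smooth_onD Ck_on_subset unfolding test_function_def by blast+
  have zd: "grad \<zeta> x \<bullet> b = pd b \<zeta> x" for x
    using zC(2) by (intro grad_inner) simp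
  have uA: "Ck_on 1 A u" and vA: "Ck_on 1 A v" using u v W(2) Ck_on_subset by blast+
  have wA: "Ck_on 1 A (\<lambda>x. v x - u x)" by (rule Ck_on_diff[OF W(3) vA uA])
  note P = pos_part_by_parts[OF W(3) wA zC(1) K b]
  note Q = integral_by_parts[OF W(3) uA zC(1) K b]
  let ?f1 = "\<lambda>x. u x * pd b \<zeta> x + max 0 (v x - u x) * pd b \<zeta> x"
  let ?f2 = "\<lambda>x. pd b u x * \<zeta> x
    + indicator {x. 0 < v x - u x} x * pd b (\<lambda>x. v x - u x) x * \<zeta> x"
  have "integrable lborel ?f1" "integrable lborel ?f2" using P Q by auto
  then have m: "?f1 \<in> borel_measurable borel" "?f2 \<in> borel_measurable borel"
    using borel_measurable_integrable by fastforce+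
  have KA: "x \<notin> K" if "x \<notin> A" for x using K(2) that by blast
  have "(LINT x:A|lebesgue. max (u x) (v x) * (grad \<zeta> x \<bullet> b)) = integral\<^sup>L lborel ?f1"
    by (rule set_lebesgue_integral_eq_lborel[OF m(1)])
      (auto simp: zd max_def algebra_simps pd_zero_outside[OF K(1,3) KA])
  also have "\<dots> = - integral\<^sup>L lborel ?f2" using P Q by simp
  also have "integral\<^sup>L lborel ?f2 = (LINT x:A|lebesgue. (max_grad u v x \<bullet> b) * \<zeta> x)"
  proof (rule set_lebesgue_integral_eq_lborel[OF m(2), symmetric])
    fix x assume x: "x \<in> A"
    have d: "u differentiable at x" "v differentiable at x" using uA vA x by auto
    have dd: "pd b (\<lambda>x. v x - u x) x = pd b v x - pd b u x"
      by (rule pd_eqI[OF has_derivative_diff[OF has_derivative_frechet[OF d(2)] has_derivative_frechet[OF d(1)]]])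
    show "?f2 x = (max_grad u v x \<bullet> b) * \<zeta> x"
      unfolding dd by (simp add: max_grad_def indicator_def grad_inner[OF d(1)] grad_inner[OF d(2)] left_diff_distrib)
  qed (use K(3) KA in auto)
  finally show "(LINT x:A|lebesgue. max (u x) (v x) * (grad \<zeta> x \<bullet> b))
      = - (LINT x:A|lebesgue. (max_grad u v x \<bullet> b) * \<zeta> x)" .
qed

lemma L_inf_continuous:
  fixes f :: "'a::euclidean_space \<Rightarrow> 'b::euclidean_space"
  assumes "bounded A" "open A" "continuous_on (closure A) f"
  shows "L_inf A f"
proof -
  have "compact (closure A)" using assms(1) by simp
  then have "compact (f ` closure A)" using assms(3) compact_continuous_image by blast
  then have "bounded (f ` closure A)" by (rule compact_imp_bounded)
  then obtain B where "\<forall>y\<in>f ` closure A. norm y \<le> B" unfolding bounded_iff by blast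
  then have "\<forall>x\<in>A. norm (f x) \<le> B" using closure_subset by blast
  moreover have "(\<lambda>x. indicator A x *\<^sub>R f x) \<in> borel_measurable lebesgue"
  proof (rule measurable_completion)
    have "(\<lambda>x. indicator A x *\<^sub>R f x) \<in> borel_measurable borel"
      using assms(2) continuous_on_subset[OF assms(3) closure_subset]
      by (intro borel_measurable_continuous_on_indicator) auto
    then show "(\<lambda>x. indicator A x *\<^sub>R f x) \<in> borel_measurable lborel" by simp
  qed
  ultimately show ?thesis unfolding L_inf_def set_borel_measurable_def by auto
qed

lemma open_less_set:
  fixes u v :: "'a::topological_space \<Rightarrow> real"
  assumes "open A" "continuous_on A u" "continuous_on A v"
  shows "open {x \<in> A. u x < v x}"
proof -
  have "open (A \<inter> (\<lambda>x. v x - u x) -` {0<..})"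
    by (rule continuous_open_preimage) (use assms in \<open>auto intro!: continuous_intros\<close>)
  moreover have "A \<inter> (\<lambda>x. v x - u x) -` {0<..} = {x \<in> A. u x < v x}" by auto
  ultimately show ?thesis by simp
qed

lemma L_inf_max_grad:
  fixes A :: "'a::euclidean_space set"
  assumes A: "bounded A" "open A" and W: "open W" "closure A \<subseteq> W" and u: "Ck_on 1 W u" and v: "Ck_on 1 W v"
  shows "L_inf A (max_grad u v)"
proof -
  have "continuous_on (closure A) (grad u)" "continuous_on (closure A) (grad v)"
    using continuous_on_grad[OF W(1) u] continuous_on_grad[OF W(1) v] W(2) continuous_on_subset by blast+
  then have g: "L_inf A (grad u)" "L_inf A (grad v)" using L_inf_continuous[OF A] by blast+
  have cu: "continuous_on A u" "continuous_on A v"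
    using continuous_on_subset[OF Ck_on_imp_continuous[OF u]] continuous_on_subset[OF Ck_on_imp_continuous[OF v]]
      order_trans[OF closure_subset W(2)] by blast+
  let ?P = "{x \<in> A. u x < v x}"
  have "open ?P" by (rule open_less_set[OF A(2) cu])
  then have P: "?P \<in> sets lebesgue" by simp
  obtain B1 B2 where B: "AE x in lebesgue. x \<in> A \<longrightarrow> norm (grad u x) \<le> B1" "AE x in lebesgue. x \<in> A \<longrightarrow> norm (grad v x) \<le> B2"
    and m: "(\<lambda>x. indicator A x *\<^sub>R grad u x) \<in> borel_measurable lebesgue"
      "(\<lambda>x. indicator A x *\<^sub>R grad v x) \<in> borel_measurable lebesgue"
    using g unfolding L_inf_def set_borel_measurable_def by blast
  have "AE x in lebesgue. x \<in> A \<longrightarrow> norm (max_grad u v x) \<le> max B1 B2"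
    using B by eventually_elim (auto simp: max_grad_def)
  moreover have "(\<lambda>x. if x \<in> ?P then indicator A x *\<^sub>R grad v x else indicator A x *\<^sub>R grad u x) \<in> borel_measurable lebesgue"
    using P m by (intro measurable_If_set) auto
  moreover have "(\<lambda>x. if x \<in> ?P then indicator A x *\<^sub>R grad v x else indicator A x *\<^sub>R grad u x)
      = (\<lambda>x. indicator A x *\<^sub>R max_grad u v x)"
    by (auto simp: max_grad_def indicator_def fun_eq_iff)
  ultimately show ?thesis unfolding L_inf_def set_borel_measurable_def by auto
qed

section \<open>Boundary charts and normals\<close>

lemma decrease_along:
  fixes f :: "'a::euclidean_space \<Rightarrow> real"
  assumes "f differentiable at x" "grad f x \<bullet> d < 0"
  shows "\<exists>e>0. \<forall>t. 0 < t \<and> t < e \<longrightarrow> f (x + t *\<^sub>R d) < f x"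
proof -
  have "((\<lambda>t. x + t *\<^sub>R d) has_derivative (\<lambda>t. t *\<^sub>R d)) (at 0)"
    by (auto intro!: derivative_eq_intros)
  moreover have "(f has_derivative (\<lambda>h. grad f x \<bullet> h)) (at (x + 0 *\<^sub>R d))"
    using has_derivative_grad[OF assms(1)] by simp
  ultimately have "((\<lambda>t. f (x + t *\<^sub>R d)) has_derivative (\<lambda>t. grad f x \<bullet> (t *\<^sub>R d))) (at 0)"
    by (rule has_derivative_compose)
  then have "((\<lambda>t. f (x + t *\<^sub>R d)) has_real_derivative (grad f x \<bullet> d)) (at 0)"
    by (simp add: has_field_derivative_def mult_commute_abs)
  from DERIV_neg_dec_right[OF this assms(2)] show ?thesis by auto
qed

lemma grad_uminus:
  fixes f :: "'a::euclidean_space \<Rightarrow> real"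
  assumes "f differentiable at x" shows "grad (\<lambda>y. - f y) x = - grad f x"
  by (rule grad_eq_of_has_derivative) (use has_derivative_minus[OF has_derivative_grad[OF assms]] in \<open>simp\<close>)

lemma boundary_chartD:
  assumes "boundary_chart E x U \<psi>"
  shows "open U" "x \<in> U" "smooth_on U \<psi>" "\<And>y. y \<in> U ==> grad \<psi> y \<noteq> 0" "\<psi> x = 0"
    "E \<inter> U = {y \<in> U. \<psi> y < 0}" "\<And>y. y \<in> U ==> \<psi> differentiable at y" "continuous_on U \<psi>"
  using assms smooth_onD[of U \<psi> 1] Ck_on_imp_continuous[OF smooth_onD] unfolding boundary_chart_def by auto

lemma chart_side_near:
  fixes \<psi> :: "'a::euclidean_space \<Rightarrow> real"
  assumes "open U" "x \<in> U" "\<psi> differentiable at x" "grad \<psi> x \<bullet> d < 0" "\<psi> x = 0"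
  shows "\<exists>e>0. \<forall>t. 0 < t \<and> t < e \<longrightarrow> x + t *\<^sub>R d \<in> U \<and> \<psi> (x + t *\<^sub>R d) < 0"
proof -
  obtain e where e: "e > 0" "\<And>t. 0 < t \<and> t < e ==> \<psi> (x + t *\<^sub>R d) < \<psi> x"
    using decrease_along[OF assms(3,4)] by blast
  have "continuous (at 0) (\<lambda>t. x + t *\<^sub>R d)" by (intro continuous_intros)
  then have "\<forall>\<^sub>F t in at 0. x + t *\<^sub>R d \<in> U"
    using topological_tendstoD[of "\<lambda>t. x + t *\<^sub>R d" x "at 0" U] assms(1,2) by (simp add: isCont_def)
  then obtain e' where e': "e' > 0" "\<And>t. t \<noteq> 0 ==> dist t 0 < e' ==> x + t *\<^sub>R d \<in> U"
    unfolding eventually_at by auto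
  show ?thesis
    by (rule exI[of _ "min e e'"]) (use e e' assms(5) in auto)
qed

text \<open>If the normals \<open>n1\<close> and \<open>n2\<close> differed, the direction \<open>n2 - n1\<close> would lead into the set according to
  the first chart and out of it according to the second.\<close>

lemma chart_normal_unique:
  assumes c1: "boundary_chart E x U1 \<psi>1" and c2: "boundary_chart E x U2 \<psi>2"
  shows "sgn (grad \<psi>1 x) = sgn (grad \<psi>2 x)"
proof (rule ccontr)
  assume ne: "sgn (grad \<psi>1 x) \<noteq> sgn (grad \<psi>2 x)"
  note c1 = boundary_chartD[OF c1] and c2 = boundary_chartD[OF c2]
  let ?n1 = "sgn (grad \<psi>1 x)" and ?n2 = "sgn (grad \<psi>2 x)"
  let ?d = "?n2 - ?n1"
  have n: "norm ?n1 = 1" "norm ?n2 = 1" using c1(2,4) c2(2,4) by (auto simp: norm_sgn)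
  then have nn: "?n1 \<bullet> ?n1 = 1" "?n2 \<bullet> ?n2 = 1" by (simp_all add: dot_square_norm)
  have "0 < (norm ?d)\<^sup>2" using ne by simp
  also have "(norm ?d)\<^sup>2 = 2 - 2 * (?n1 \<bullet> ?n2)"
    using nn by (simp add: power2_norm_eq_inner inner_diff_left inner_diff_right inner_commute)
  finally have lt: "?n1 \<bullet> ?n2 < 1" by simp
  have g1: "grad \<psi>1 x = norm (grad \<psi>1 x) *\<^sub>R ?n1" and g2: "grad \<psi>2 x = norm (grad \<psi>2 x) *\<^sub>R ?n2"
    by (simp_all add: sgn_div_norm c1(2,4) c2(2,4))
  have p: "norm (grad \<psi>1 x) > 0" "norm (grad \<psi>2 x) > 0" using c1(2,4) c2(2,4) by auto
  have "grad \<psi>1 x \<bullet> ?d = norm (grad \<psi>1 x) * (?n1 \<bullet> ?d)" by (subst g1) simp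
  also have "\<dots> < 0" using p lt nn by (intro mult_pos_neg) (auto simp: inner_diff_right)
  finally have 1: "grad \<psi>1 x \<bullet> ?d < 0" .
  have "grad \<psi>2 x \<bullet> ?d = norm (grad \<psi>2 x) * (?n2 \<bullet> ?d)" by (subst g2) simp
  also have "\<dots> > 0" using p lt nn by (intro mult_pos_pos) (auto simp: inner_diff_right inner_commute)
  finally have 2: "grad (\<lambda>y. - \<psi>2 y) x \<bullet> ?d < 0" using c2(2,7) by (simp add: grad_uminus)
  obtain e1 where e1: "e1 > 0" "\<And>t. 0 < t \<and> t < e1 ==> x + t *\<^sub>R ?d \<in> U1 \<and> \<psi>1 (x + t *\<^sub>R ?d) < 0"
    using chart_side_near[OF c1(1,2) c1(7)[OF c1(2)] 1 c1(5)] by blast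
  have dm: "(\<lambda>y. - \<psi>2 y) differentiable at x" using c2(7)[OF c2(2)] by (rule differentiable_minus)
  obtain e2 where e2: "e2 > 0" "\<And>t. 0 < t \<and> t < e2 ==> x + t *\<^sub>R ?d \<in> U2 \<and> - \<psi>2 (x + t *\<^sub>R ?d) < 0"
    using chart_side_near[OF c2(1,2) dm 2] c2(5) by auto
  define t where "t = min e1 e2 / 2"
  have t: "0 < t \<and> t < e1" "0 < t \<and> t < e2" using e1(1) e2(1) unfolding t_def by auto
  have "x + t *\<^sub>R ?d \<in> E" using e1(2)[OF t(1)] c1(6) by blast
  moreover have "x + t *\<^sub>R ?d \<notin> E"
  proof
    assume "x + t *\<^sub>R ?d \<in> E"
    then have "x + t *\<^sub>R ?d \<in> {y \<in> U2. \<psi>2 y < 0}" using e2(2)[OF t(2)] c2(6) by blast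
    then show False using e2(2)[OF t(2)] by simp
  qed
  ultimately show False by blast
qed

lemma outer_normal_eq:
  assumes "boundary_chart E x U \<psi>" shows "outer_normal E x = sgn (grad \<psi> x)"
  unfolding outer_normal_def
  by (rule the_equality) (use assms chart_normal_unique in blast)+

lemma chart_in_closure:
  fixes \<psi> :: "'a::euclidean_space \<Rightarrow> real"
  assumes "open U" "x \<in> U" "\<psi> differentiable at x" "grad \<psi> x \<noteq> 0" "\<psi> x = 0"
  shows "x \<in> closure {y \<in> U. \<psi> y < 0}"
proof -
  have "grad \<psi> x \<bullet> (- grad \<psi> x) < 0" using assms(4) by simp
  from chart_side_near[OF assms(1,2,3) this assms(5)]
  obtain e where e: "e > 0" "\<And>t. 0 < t \<and> t < e ==> x + t *\<^sub>R (- grad \<psi> x) \<in> {y \<in> U. \<psi> y < 0}"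
    by blast
  show ?thesis unfolding closure_approachable
  proof (intro allI impI)
    fix d :: real assume d: "d > 0"
    let ?n = "norm (grad \<psi> x)"
    have n: "?n > 0" using assms(4) by simp
    define t where "t = min (e / 2) (d / (2 * ?n))"
    have t: "0 < t \<and> t < e" using e(1) d n unfolding t_def by (auto simp: min_less_iff_disj)
    have "t * ?n \<le> d / (2 * ?n) * ?n" unfolding t_def using n by (intro mult_right_mono) auto
    then have "t * ?n < d" using d n by simp
    then have "dist (x + t *\<^sub>R (- grad \<psi> x)) x < d" using t by (simp add: dist_norm)
    then show "\<exists>y\<in>{y \<in> U. \<psi> y < 0}. dist y x < d" using e(2)[OF t] by blast
  qed
qed

lemma chart_frontier:
  assumes "boundary_chart E x U \<psi>" shows "frontier E \<inter> U = {y \<in> U. \<psi> y = 0}"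
    and "closure E \<inter> U = {y \<in> U. \<psi> y \<le> 0}"
proof -
  note c = boundary_chartD[OF assms]
  have op1: "open {y \<in> U. \<psi> y < 0}" by (rule open_less_set[OF c(1,8)]) auto
  have op2: "open {y \<in> U. 0 < \<psi> y}" by (rule open_less_set[OF c(1) _ c(8)]) auto
  have int: "y \<in> interior E" if "y \<in> U" "\<psi> y < 0" for y
  proof (rule interiorI[OF op1])
    show "{y \<in> U. \<psi> y < 0} \<subseteq> E" using c(6) by blast
  qed (use that in auto)
  have ext: "y \<notin> closure E" if "y \<in> U" "0 < \<psi> y" for y
  proof -
    have "{y \<in> U. 0 < \<psi> y} \<inter> E = {}" using c(6) by force
    then have "{y \<in> U. 0 < \<psi> y} \<inter> closure E = {}" using open_Int_closure_eq_empty[OF op2] by blast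
    then show ?thesis using that by blast
  qed
  have bd: "y \<in> closure E" "y \<notin> E" if "y \<in> U" "\<psi> y = 0" for y
  proof -
    have "y \<in> closure {y \<in> U. \<psi> y < 0}" by (rule chart_in_closure) (use c that in auto)
    then show "y \<in> closure E" using c(6) closure_mono[of "E \<inter> U" E] by auto
    show "y \<notin> E" using c(6) that by force
  qed
  show "frontier E \<inter> U = {y \<in> U. \<psi> y = 0}"
    unfolding frontier_def using int ext bd interior_subset[of E]
    by (auto, metis linorder_less_linear)
  show "closure E \<inter> U = {y \<in> U. \<psi> y \<le> 0}"
    using int ext bd interior_subset[of E] closure_subset[of E]
    by (auto simp: not_less[symmetric], metis linorder_neqE_linordered_idom subsetD)
qed

lemma chart_restrict:
  assumes "boundary_chart E x U \<psi>" "open U'" "x \<in> U'" "E' \<inter> U \<inter> U' = E \<inter> U \<inter> U'"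
  shows "boundary_chart E' x (U \<inter> U') \<psi>"
proof -
  note c = boundary_chartD[OF assms(1)]
  have "smooth_on (U \<inter> U') \<psi>" using c(3) Ck_on_subset unfolding smooth_on_def by blast
  moreover have "E' \<inter> (U \<inter> U') = {y \<in> U \<inter> U'. \<psi> y < 0}" using assms(4) c(6) by blast
  ultimately show ?thesis unfolding boundary_chart_def using c assms by auto
qed

lemma chart_complement:
  assumes "boundary_chart E x U \<psi>"
  shows "boundary_chart (- closure E) x U (\<lambda>y. - \<psi> y)"
proof -
  note c = boundary_chartD[OF assms]
  have "smooth_on U (\<lambda>y. - \<psi> y)" unfolding smooth_on_def using Ck_on_minus[OF c(1) smooth_onD[OF c(3)]] by blast
  moreover have "- closure E \<inter> U = {y \<in> U. - \<psi> y < 0}"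
    using chart_frontier(2)[OF assms] by force
  ultimately show ?thesis unfolding boundary_chart_def using c grad_uminus[OF c(7)] by auto
qed

text \<open>A boundary chart describes \<open>E\<close> but says nothing about \<open>S\<close>. Here \<open>S\<close> is required to be the zero set of
  the chart, so that it is a union of components of the boundary of \<open>E\<close>.\<close>

definition bounds :: "'a::euclidean_space set \<Rightarrow> 'a set \<Rightarrow> bool" where
  "bounds E S \<longleftrightarrow> compact S \<and> (\<forall>x\<in>S. \<exists>U \<psi>. boundary_chart E x U \<psi> \<and> S \<inter> U = {y \<in> U. \<psi> y = 0})"

text \<open>Away from \<open>T\<close> the set \<open>S\<close> is the frontier of \<open>E\<close>, and a chart has the frontier as its zero set.\<close>

lemma boundsI:
  assumes "compact S" "smooth_boundary_on E S" "closed T" "S \<inter> T = {}" "frontier E \<subseteq> S \<union> T"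
    "S \<subseteq> frontier E"
  shows "bounds E S"
  unfolding bounds_def
proof (intro conjI ballI assms(1))
  fix x assume x: "x \<in> S"
  obtain U \<psi> where c: "boundary_chart E x U \<psi>" using assms(2) x unfolding smooth_boundary_on_def by blast
  have "boundary_chart E x (U \<inter> - T) \<psi>"
    by (rule chart_restrict[OF c]) (use assms(3,4) x in auto)
  moreover from chart_frontier(1)[OF this] have "S \<inter> (U \<inter> - T) = {y \<in> U \<inter> - T. \<psi> y = 0}"
    using assms(5,6) by blast
  ultimately show "\<exists>U \<psi>. boundary_chart E x U \<psi> \<and> S \<inter> U = {y \<in> U. \<psi> y = 0}" by blast
qed

lemma boundsE:
  assumes "bounds E S" "x \<in> S"
  obtains U \<psi> where "boundary_chart E x U \<psi>" "S \<inter> U = {y \<in> U. \<psi> y = 0}"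
  using assms unfolding bounds_def by blast

lemma bounds_compact: "bounds E S ==> compact S"
  by (simp add: bounds_def)

lemma bounds_subset_closure:
  assumes "bounds E S" shows "S \<subseteq> closure E"
proof
  fix x assume "x \<in> S"
  then obtain U \<psi> where c: "boundary_chart E x U \<psi>" using boundsE[OF assms] by metis
  then show "x \<in> closure E" using chart_frontier(2)[OF c] boundary_chartD[OF c] by auto
qed

lemma outer_normal_local:
  assumes "boundary_chart E x U \<psi>" "S \<inter> U = {y \<in> U. \<psi> y = 0}" "y \<in> S \<inter> U"
  shows "outer_normal E y = sgn (grad \<psi> y)"
proof (rule outer_normal_eq)
  show "boundary_chart E y U \<psi>"
    using assms unfolding boundary_chart_def by auto
qed

lemma continuous_on_sgn_grad:
  assumes "boundary_chart E x U \<psi>"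
  shows "continuous_on U (\<lambda>y. sgn (grad \<psi> y))"
proof -
  note c = boundary_chartD[OF assms]
  have "continuous_on U (grad \<psi>)" by (rule continuous_on_grad[OF c(1) smooth_onD[OF c(3)]])
  then show ?thesis using c(4) unfolding sgn_div_norm by (intro continuous_intros) auto
qed

lemma continuous_on_outer_normal:
  assumes "bounds E S" shows "continuous_on S (outer_normal E)"
  unfolding continuous_on_eq_continuous_within
proof
  fix x assume x: "x \<in> S"
  obtain U \<psi> where c: "boundary_chart E x U \<psi>" "S \<inter> U = {y \<in> U. \<psi> y = 0}" using boundsE[OF assms x] .
  note cD = boundary_chartD[OF c(1)]
  have "continuous (at x within S) (\<lambda>y. sgn (grad \<psi> y))"
    using continuous_on_sgn_grad[OF c(1)] cD(1,2)
    by (meson continuous_at_imp_continuous_at_within continuous_on_eq_continuous_at)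
  then show "continuous (at x within S) (outer_normal E)"
  proof (rule continuous_transform_within_openin[where T = S and S = "S \<inter> U"])
    show "openin (top_of_set S) (S \<inter> U)" using cD(1) by (simp add: openin_open_Int)
    show "x \<in> S \<inter> U" using x cD(2) by auto
    show "sgn (grad \<psi> y) = outer_normal E y" if "y \<in> S \<inter> U" for y
      using outer_normal_local[OF c that] by simp
  qed
qed

lemma norm_outer_normal:
  assumes "bounds E S" "x \<in> S" shows "norm (outer_normal E x) = 1"
proof -
  obtain U \<psi> where c: "boundary_chart E x U \<psi>" "S \<inter> U = {y \<in> U. \<psi> y = 0}" using boundsE[OF assms] .
  note cD = boundary_chartD[OF c(1)]
  show ?thesis using outer_normal_eq[OF c(1)] cD(2,4) by (simp add: norm_sgn)
qed

section \<open>Regular level sets are graphs\<close>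

definition graph_patch :: "'a::euclidean_space set \<Rightarrow> 'a \<Rightarrow> 'a set \<Rightarrow> ('a \<Rightarrow> real) \<Rightarrow> bool" where
  "graph_patch S b U g \<longleftrightarrow> b \<in> Basis \<and> open U \<and> smooth_on U g \<and> (\<forall>x t. g (x + t *\<^sub>R b) = g x) \<and>
     S \<inter> U = {x \<in> U. x \<bullet> b = g x}"

text \<open>The inverse function theorem is applied to the map that replaces the coordinate \<open>x \<bullet> b\<close> by
  \<open>\<psi> x\<close>. Its inverse gives the graph function on the slice \<open>\<psi> = 0\<close>; differentiating the equation
  \<open>\<psi> (y + g y b) = 0\<close> shows by induction that \<open>g\<close> has derivatives of every order.\<close>

lemma chart_graph_patch:
  fixes \<psi> :: "'a::euclidean_space \<Rightarrow> real"
  assumes U: "open U" "x0 \<in> U" and sm: "smooth_on U \<psi>" and z: "\<psi> x0 = 0" and g0: "grad \<psi> x0 \<noteq> 0"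
    and S: "S \<inter> U = {y \<in> U. \<psi> y = 0}"
  obtains b V g where "graph_patch S b V g" "x0 \<in> V"
proof -
  obtain b where b: "b \<in> Basis" "grad \<psi> x0 \<bullet> b \<noteq> 0" using g0 euclidean_all_zero_iff by blast
  have bb[simp]: "b \<bullet> b = 1" using b(1) by simp
  have dif: "\<psi> differentiable at x" if "x \<in> U" for x using smooth_onD[OF sm, of 1] that by simp
  have C1: "Ck_on 1 U \<psi>" by (rule smooth_onD[OF sm])
  define U1 where "U1 = {x \<in> U. grad \<psi> x \<bullet> b \<noteq> 0}"
  have cg: "continuous_on U (grad \<psi>)" by (rule continuous_on_grad[OF U(1) C1])
  have U1: "open U1"
  proof -
    have "open (U \<inter> (\<lambda>x. grad \<psi> x \<bullet> b) -` (- {0}))"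
      by (rule continuous_open_preimage) (use U cg in \<open>auto intro!: continuous_intros\<close>)
    moreover have "U \<inter> (\<lambda>x. grad \<psi> x \<bullet> b) -` (- {0}) = U1" unfolding U1_def by auto
    ultimately show ?thesis by simp
  qed
  have U1U: "U1 \<subseteq> U" and x0U1: "x0 \<in> U1" unfolding U1_def using b U by auto
  define \<Theta> where "\<Theta> = (\<lambda>x. x + (\<psi> x - x \<bullet> b) *\<^sub>R b)"
  define \<Theta>' where "\<Theta>' = (\<lambda>x. id_blinfun + (blinfun_scaleR_left b o\<^sub>L blinfun_inner_right (grad \<psi> x - b)))"
  have app: "blinfun_apply (\<Theta>' x) h = h + ((grad \<psi> x - b) \<bullet> h) *\<^sub>R b" for x h
    unfolding \<Theta>'_def by (simp add: blinfun.add_left)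
  have der: "(\<Theta> has_derivative blinfun_apply (\<Theta>' x)) (at x)" if "x \<in> U1" for x
  proof -
    have "(\<Theta> has_derivative (\<lambda>h. h + (grad \<psi> x \<bullet> h - h \<bullet> b) *\<^sub>R b)) (at x)"
      unfolding \<Theta>_def using that U1U
      by (auto intro!: derivative_eq_intros has_derivative_grad dif)
    moreover have "(\<lambda>h. h + (grad \<psi> x \<bullet> h - h \<bullet> b) *\<^sub>R b) = blinfun_apply (\<Theta>' x)"
      by (rule ext) (simp add: app inner_diff_left inner_commute[of b])
    ultimately show ?thesis by simp
  qed
  have cont: "continuous_on U1 \<Theta>'"
  proof -
    have "continuous_on U1 (\<lambda>x. grad \<psi> x - b)"
      using continuous_on_subset[OF cg U1U] by (intro continuous_intros)
    then show ?thesis unfolding \<Theta>'_def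
      by (intro continuous_intros bounded_linear.continuous_on[OF bounded_linear_blinfun_inner_right]
          bounded_bilinear.continuous_on[OF bounded_bilinear_blinfun_compose])
        (rule continuous_on_subset[OF cg U1U])
  qed
  define d where "d = grad \<psi> x0 \<bullet> b"
  have d: "d \<noteq> 0" unfolding d_def using b by simp
  define invf where "invf = id_blinfun - ((1 / d) *\<^sub>R (blinfun_scaleR_left b o\<^sub>L blinfun_inner_right (grad \<psi> x0 - b)))"
  have inv: "invf o\<^sub>L \<Theta>' x0 = id_blinfun"
  proof (rule blinfun_eqI)
    fix h
    let ?s = "(grad \<psi> x0 - b) \<bullet> h"
    have ia: "blinfun_apply invf k = k - (((grad \<psi> x0 - b) \<bullet> k) / d) *\<^sub>R b" for k
      unfolding invf_def by (simp add: blinfun.diff_left blinfun.scaleR_left)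
    have "(grad \<psi> x0 - b) \<bullet> (h + ?s *\<^sub>R b) = ?s * d"
      by (simp add: inner_add_right inner_diff_left d_def algebra_simps)
    then show "blinfun_apply (invf o\<^sub>L \<Theta>' x0) h = blinfun_apply id_blinfun h"
      using d by (simp add: ia app)
  qed
  obtain U' V0 k k' where IFT: "open U'" "U' \<subseteq> U1" "x0 \<in> U'" "open V0" "\<Theta> x0 \<in> V0" "homeomorphism U' V0 \<Theta> k"
    "\<And>y. y \<in> V0 ==> (k has_derivative (k' y)) (at y)"
    using inverse_function_theorem[OF U1 der cont x0U1 inv] by metis
  define P where "P = (\<lambda>x. x - (x \<bullet> b) *\<^sub>R b)"
  have Pinv: "P (x + t *\<^sub>R b) = P x" for x t unfolding P_def by (simp add: inner_add_left algebra_simps)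
  have Pb: "P x \<bullet> b = 0" for x unfolding P_def by (simp add: inner_diff_left)
  define g where "g = (\<lambda>x. k (P x) \<bullet> b)"
  have ginv: "g (x + t *\<^sub>R b) = g x" for x t unfolding g_def Pinv ..
  have Pbl: "bounded_linear P" unfolding P_def
    by (intro bounded_linear_sub bounded_linear_ident bounded_linear_scaleR_const bounded_linear_inner_left)
  have cP: "continuous_on UNIV P" using Pbl by (simp add: linear_continuous_on)
  define Q where "Q = P -` V0"
  have Q: "open Q" unfolding Q_def using open_vimage[OF IFT(4) cP] .
  have hk: "\<And>z. z \<in> V0 ==> k z \<in> U' \<and> \<Theta> (k z) = z" "\<And>x. x \<in> U' ==> \<Theta> x \<in> V0 \<and> k (\<Theta> x) = x"
    using IFT(6) unfolding homeomorphism_def by auto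
  have Y: "k (P x) = P x + g x *\<^sub>R b" "k (P x) \<in> U'" "\<psi> (k (P x)) = 0" if "x \<in> Q" for x
  proof -
    have e: "\<Theta> (k (P x)) = P x" and u: "k (P x) \<in> U'" using hk(1)[of "P x"] that unfolding Q_def by auto
    have "\<Theta> (k (P x)) \<bullet> b = 0" using e Pb by simp
    then show z: "\<psi> (k (P x)) = 0" unfolding \<Theta>_def by (simp add: inner_add_left)
    show "k (P x) = P x + g x *\<^sub>R b" using e z unfolding \<Theta>_def g_def by (simp add: algebra_simps)
    show "k (P x) \<in> U'" by (rule u)
  qed
  have Tx0: "\<Theta> x0 = P x0" unfolding \<Theta>_def P_def z by simp
  define V where "V = Q \<inter> U'"
  have V: "open V" "x0 \<in> V" unfolding V_def Q_def using Q IFT(3,5) Tx0 by (auto simp: Q_def IFT(1))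
  have SV: "S \<inter> V = {x \<in> V. x \<bullet> b = g x}"
  proof -
    have "\<psi> x = 0 \<longleftrightarrow> x \<bullet> b = g x" if "x \<in> V" for x
    proof
      assume "\<psi> x = 0"
      then have "\<Theta> x = P x" unfolding \<Theta>_def P_def by simp
      then have "k (P x) = x" using hk(2)[of x] that unfolding V_def by auto
      then show "x \<bullet> b = g x" unfolding g_def by simp
    next
      assume "x \<bullet> b = g x"
      then have "k (P x) = x" using Y(1)[of x] that unfolding V_def P_def by simp
      then show "\<psi> x = 0" using Y(3)[of x] that unfolding V_def by simp
    qed
    moreover have "V \<subseteq> U" unfolding V_def using IFT(2) U1U by blast
    ultimately show ?thesis using S by blast
  qed
  have gd: "g differentiable at x" if "x \<in> Q" for x
  proof -
    have "(k has_derivative (k' (P x))) (at (P x))" using IFT(7) that unfolding Q_def by auto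
    from has_derivative_compose[OF bounded_linear_imp_has_derivative[OF Pbl] this]
    have "((\<lambda>x. k (P x)) has_derivative (\<lambda>h. k' (P x) (P h))) (at x)" .
    then have "(g has_derivative (\<lambda>h. k' (P x) (P h) \<bullet> b)) (at x)"
      unfolding g_def by (rule has_derivative_inner_left)
    then show ?thesis unfolding differentiable_def by blast
  qed
  have gder: "pd h g x = - (grad \<psi> (k (P x)) \<bullet> P h) / (grad \<psi> (k (P x)) \<bullet> b)" if x: "x \<in> Q" for x h
  proof -
    have xU: "k (P x) \<in> U1" using Y(2)[OF x] IFT(2) by blast
    have df: "(\<psi> has_derivative (\<lambda>h. grad \<psi> (k (P x)) \<bullet> h)) (at (P x + g x *\<^sub>R b))"
      using has_derivative_grad[OF dif] xU U1U Y(1)[OF x] by auto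
    have "((\<lambda>x. P x + g x *\<^sub>R b) has_derivative (\<lambda>h. P h + pd h g x *\<^sub>R b)) (at x)"
      by (intro has_derivative_add bounded_linear_imp_has_derivative[OF Pbl] has_derivative_scaleR_left
          has_derivative_frechet gd x)
    from has_derivative_compose[OF this df]
    have 1: "((\<lambda>x. \<psi> (P x + g x *\<^sub>R b)) has_derivative (\<lambda>h. grad \<psi> (k (P x)) \<bullet> (P h + pd h g x *\<^sub>R b))) (at x)" .
    have "((\<lambda>x. 0) has_derivative (\<lambda>h. grad \<psi> (k (P x)) \<bullet> (P h + pd h g x *\<^sub>R b))) (at x)"
      by (rule has_derivative_eq_open[OF 1 Q x]) (use Y(1,3) in auto)
    then have "(\<lambda>h. grad \<psi> (k (P x)) \<bullet> (P h + pd h g x *\<^sub>R b)) = (\<lambda>h. 0)"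
      using has_derivative_unique[OF _ has_derivative_const] by blast
    from fun_cong[OF this, of h] show ?thesis
      using xU unfolding U1_def by (simp add: inner_add_right field_simps)
  qed
  have kPU: "k (P x) \<in> U" if "x \<in> Q" for x using Y(2)[OF that] IFT(2) U1U by blast
  have "Ck_on j Q g" for j
  proof (induction j)
    case 0
    have "continuous_on Q g"
      by (intro continuous_at_imp_continuous_on ballI differentiable_imp_continuous_within gd)
    then show ?case by simp
  next
    case (Suc j)
    have Yc: "Ck_on j Q (\<lambda>x. (P x + g x *\<^sub>R b) \<bullet> c)" for c
    proof -
      have "Ck_on j Q (\<lambda>x. (x \<bullet> c - (x \<bullet> b) * (b \<bullet> c)) + g x * (b \<bullet> c))"
        by (intro Ck_on_add Ck_on_diff Ck_on_mult Ck_on_inner_const Ck_on_const Suc Q)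
      then show ?thesis unfolding P_def by (simp add: inner_add_left inner_diff_left)
    qed
    have comp: "Ck_on j Q (\<lambda>x. grad \<psi> (P x + g x *\<^sub>R b) \<bullet> c)" for c
    proof (rule Ck_on_compose[OF Q Yc])
      show "Ck_on j U (\<lambda>y. grad \<psi> y \<bullet> c)" by (rule Ck_on_grad_inner[OF U(1) smooth_onD[OF sm]])
      show "(\<lambda>x. P x + g x *\<^sub>R b) ` Q \<subseteq> U" 
      proof (rule image_subsetI)
        fix x assume "x \<in> Q"
        from kPU[OF this] show "P x + g x *\<^sub>R b \<in> U" by (simp only: Y(1)[OF \<open>x \<in> Q\<close>])
      qed
    qed
    have nz: "grad \<psi> (P x + g x *\<^sub>R b) \<bullet> b \<noteq> 0" if "x \<in> Q" for x
      using Y(1,2)[OF that] IFT(2) unfolding U1_def by auto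
    show ?case
    proof (rule Ck_on_SucI[OF Q has_derivative_frechet[OF gd]])
      fix c :: 'a
      have "Ck_on j Q (\<lambda>x. - (grad \<psi> (P x + g x *\<^sub>R b) \<bullet> P c) / (grad \<psi> (P x + g x *\<^sub>R b) \<bullet> b))"
        by (intro Ck_on_divide Ck_on_minus comp nz Q)
      moreover have "pd c g x = - (grad \<psi> (P x + g x *\<^sub>R b) \<bullet> P c) / (grad \<psi> (P x + g x *\<^sub>R b) \<bullet> b)" if "x \<in> Q" for x
        using gder[OF that] Y(1)[OF that] by simp
      ultimately show "Ck_on j Q (\<lambda>x. pd c g x)"
        using Ck_on_cong[OF Q, of "\<lambda>x. pd c g x" "\<lambda>x. - (grad \<psi> (P x + g x *\<^sub>R b) \<bullet> P c) / (grad \<psi> (P x + g x *\<^sub>R b) \<bullet> b)" j]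
        by blast
    qed
  qed
  then have "smooth_on V g" unfolding smooth_on_def V_def using Ck_on_subset by blast
  then have "graph_patch S b V g" unfolding graph_patch_def using b(1) V(1) ginv SV by blast
  then show ?thesis using that V(2) by blast
qed

lemma bounds_graph_patch:
  assumes "bounds E S" "x \<in> S" obtains b V g where "graph_patch S b V g" "x \<in> V"
proof -
  obtain U \<psi> where c: "boundary_chart E x U \<psi>" "S \<inter> U = {y \<in> U. \<psi> y = 0}" using boundsE[OF assms] .
  note cD = boundary_chartD[OF c(1)]
  show ?thesis using chart_graph_patch[OF cD(1-3,5) cD(4)[OF cD(2)] c(2)] that by blast
qed

section \<open>Slicing along a coordinate direction\<close>

lemma hyperplane_sets [simp, measurable_cong]: "sets (hyperplane_measure b) = sets borel"
  unfolding hyperplane_measure_def by simp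

lemma hyperplane_space [simp]: "space (hyperplane_measure b) = UNIV"
  unfolding hyperplane_measure_def by simp

lemma lborel_slice_space:
  fixes I :: "'a::euclidean_space set"
  shows "(\<lambda>f. \<Sum>i\<in>I. f i *\<^sub>R i) \<in> borel_measurable (\<Pi>\<^sub>M i\<in>I. (lborel :: real measure))"
proof (intro borel_measurable_sum borel_measurable_scaleR borel_measurable_const)
  fix i assume "i \<in> I"
  then have "(\<lambda>f. f i) \<in> measurable (\<Pi>\<^sub>M i\<in>I. (lborel :: real measure)) lborel"
    by (rule measurable_component_singleton)
  then show "(\<lambda>f. f i) \<in> borel_measurable (\<Pi>\<^sub>M i\<in>I. (lborel :: real measure))" by simp
qed

lemma lborel_as_PiM:
  "(lborel :: 'a::euclidean_space measure) = distr (\<Pi>\<^sub>M b\<in>Basis. lborel) borel (\<lambda>f. \<Sum>b\<in>Basis. f b *\<^sub>R b)"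
  unfolding lborel_def[where 'a = 'a] lborel_eq_real ..

lemma sum_fun_upd_slice:
  fixes b :: "'a::euclidean_space"
  assumes "b \<in> Basis"
  shows "(\<Sum>i\<in>Basis. (x(b := t)) i *\<^sub>R i) = (\<Sum>i\<in>Basis - {b}. x i *\<^sub>R i) + t *\<^sub>R b"
  using assms by (subst sum.remove[of _ b]) (auto simp: add.commute intro!: sum.cong)

lemma slice_measurable:
  fixes f :: "'a::euclidean_space \<Rightarrow> 'b::topological_space"
  assumes [measurable]: "f \<in> borel_measurable borel" and that: "sets M = sets borel"
  shows "(\<lambda>(y, t). f (y + t *\<^sub>R b)) \<in> borel_measurable (M \<Otimes>\<^sub>M lborel)"
proof -
  have "(\<lambda>z::'a \<times> real. f (fst z + snd z *\<^sub>R b)) \<in> borel_measurable (borel \<Otimes>\<^sub>M borel)"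
    by measurable
  moreover have "sets (M \<Otimes>\<^sub>M (lborel :: real measure)) = sets (borel \<Otimes>\<^sub>M borel)"
    using that by (intro sets_pair_measure_cong) auto
  ultimately show ?thesis
    by (subst measurable_cong_sets[where M' = "borel \<Otimes>\<^sub>M borel"]) (auto simp: case_prod_beta')
qed

text \<open>Lebesgue measure is the image of a product measure over the basis; splitting off the factor \<open>b\<close>
  is Fubini's theorem.\<close>

lemma nn_integral_slice:
  fixes f :: "'a::euclidean_space \<Rightarrow> ennreal"
  assumes b: "b \<in> Basis" and f[measurable]: "f \<in> borel_measurable borel"
  shows "integral\<^sup>N lborel f = (\<integral>\<^sup>+y. (\<integral>\<^sup>+t. f (y + t *\<^sub>R b) \<partial>lborel) \<partial>hyperplane_measure b)"
proof -
  interpret product_sigma_finite "\<lambda>_::'a. lborel :: real measure" by standard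
  have B: "insert b (Basis - {b}) = (Basis :: 'a set)" using b by auto
  have fm: "(\<lambda>z. f (\<Sum>i\<in>Basis. z i *\<^sub>R i)) \<in> borel_measurable (Pi\<^sub>M Basis (\<lambda>_. lborel))"
    by (rule measurable_compose[OF lborel_slice_space f])
  have "integral\<^sup>N lborel f = (\<integral>\<^sup>+z. f (\<Sum>i\<in>Basis. z i *\<^sub>R i) \<partial>Pi\<^sub>M Basis (\<lambda>_. lborel))"
    using f by (subst lborel_as_PiM) (simp add: nn_integral_distr[OF lborel_slice_space])
  also have "\<dots> = (\<integral>\<^sup>+x. (\<integral>\<^sup>+t. f (\<Sum>i\<in>Basis. (x(b := t)) i *\<^sub>R i) \<partial>lborel) \<partial>Pi\<^sub>M (Basis - {b}) (\<lambda>_. lborel))"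
    using product_nn_integral_insert[of "Basis - {b}" b "\<lambda>z. f (\<Sum>i\<in>Basis. z i *\<^sub>R i)"] fm
    unfolding B by simp
  also have "\<dots> = (\<integral>\<^sup>+x. (\<integral>\<^sup>+t. f ((\<Sum>i\<in>Basis - {b}. x i *\<^sub>R i) + t *\<^sub>R b) \<partial>lborel) \<partial>Pi\<^sub>M (Basis - {b}) (\<lambda>_. lborel))"
    by (simp only: sum_fun_upd_slice[OF b])
  also have "\<dots> = (\<integral>\<^sup>+y. (\<integral>\<^sup>+t. f (y + t *\<^sub>R b) \<partial>lborel) \<partial>hyperplane_measure b)"
    unfolding hyperplane_measure_def
    using lborel.borel_measurable_nn_integral[OF slice_measurable[OF f refl, of b]]
    by (subst nn_integral_distr[OF lborel_slice_space]) auto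
  finally show ?thesis .
qed

lemma integral_slice:
  fixes f :: "'a::euclidean_space \<Rightarrow> real"
  assumes b: "b \<in> Basis" and fi: "integrable lborel f"
  shows "integral\<^sup>L lborel f = (\<integral>y. (LBINT t. f (y + t *\<^sub>R b)) \<partial>hyperplane_measure b)"
proof -
  interpret product_sigma_finite "\<lambda>_::'a. lborel :: real measure" by standard
  have f[measurable]: "f \<in> borel_measurable borel" using borel_measurable_integrable[OF fi] by simp
  have B: "insert b (Basis - {b}) = (Basis :: 'a set)" using b by auto
  have fm: "integrable (Pi\<^sub>M Basis (\<lambda>_. lborel)) (\<lambda>z. f (\<Sum>i\<in>Basis. z i *\<^sub>R i))"
    using fi by (subst (asm) lborel_as_PiM) (subst (asm) integrable_distr_eq[OF lborel_slice_space f])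
  have "integral\<^sup>L lborel f = (\<integral>z. f (\<Sum>i\<in>Basis. z i *\<^sub>R i) \<partial>Pi\<^sub>M Basis (\<lambda>_. lborel))"
    by (subst lborel_as_PiM) (subst integral_distr[OF lborel_slice_space f], rule refl)
  also have "\<dots> = (\<integral>x. (LBINT t. f (\<Sum>i\<in>Basis. (x(b := t)) i *\<^sub>R i)) \<partial>Pi\<^sub>M (Basis - {b}) (\<lambda>_. lborel))"
    using product_integral_insert[of "Basis - {b}" b "\<lambda>z. f (\<Sum>i\<in>Basis. z i *\<^sub>R i)"] fm
    unfolding B by simp
  also have "\<dots> = (\<integral>x. (LBINT t. f ((\<Sum>i\<in>Basis - {b}. x i *\<^sub>R i) + t *\<^sub>R b)) \<partial>Pi\<^sub>M (Basis - {b}) (\<lambda>_. lborel))"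
    by (simp only: sum_fun_upd_slice[OF b])
  also have "\<dots> = (\<integral>y. (LBINT t. f (y + t *\<^sub>R b)) \<partial>hyperplane_measure b)"
    unfolding hyperplane_measure_def
    using lborel.borel_measurable_lebesgue_integral[OF slice_measurable[OF f refl, of b]]
    by (subst integral_distr[OF lborel_slice_space]) auto
  finally show ?thesis .
qed

lemma slice_integral_measurable:
  fixes f :: "'a::euclidean_space \<Rightarrow> real"
  assumes f: "f \<in> borel_measurable borel"
  shows "(\<lambda>y. LBINT t. f (y + t *\<^sub>R b)) \<in> borel_measurable borel"
  using lborel.borel_measurable_lebesgue_integral[OF slice_measurable[OF f refl, of b]] by auto

lemma AE_hyperplane:
  assumes that: "b \<in> Basis"
  shows "AE y in hyperplane_measure b. y \<bullet> b = 0"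
proof -
  have "(\<Sum>i\<in>Basis - {b}. x i *\<^sub>R i) \<bullet> b = 0" for x :: "'a \<Rightarrow> real"
    using that by (simp add: inner_sum_left inner_Basis)
  then show ?thesis
    unfolding hyperplane_measure_def
    by (subst AE_distr_iff[OF lborel_slice_space]) auto
qed

lemma hyperplane_bounded_finite:
  assumes b: "b \<in> Basis" and B: "bounded B" "B \<in> sets borel"
  shows "emeasure (hyperplane_measure b) B < \<infinity>"
proof -
  obtain C where C: "\<And>x. x \<in> B ==> norm x \<le> C" using B(1) bounded_iff by metis
  let ?f = "indicator (cball (0::'a) (C + 1)) :: 'a \<Rightarrow> ennreal"
  have "emeasure (hyperplane_measure b) B = (\<integral>\<^sup>+y. indicator B y \<partial>hyperplane_measure b)"
    using B(2) by simp
  also have "\<dots> \<le> (\<integral>\<^sup>+y. (\<integral>\<^sup>+t. ?f (y + t *\<^sub>R b) \<partial>lborel) \<partial>hyperplane_measure b)"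
  proof (rule nn_integral_mono)
    fix y :: 'a
    show "indicator B y \<le> (\<integral>\<^sup>+t. ?f (y + t *\<^sub>R b) \<partial>lborel)"
    proof (cases "y \<in> B")
      case True
      have "(1::ennreal) = (\<integral>\<^sup>+t. indicator {0..1::real} t \<partial>lborel)" by simp
      also have "\<dots> \<le> (\<integral>\<^sup>+t. ?f (y + t *\<^sub>R b) \<partial>lborel)"
      proof (rule nn_integral_mono)
        fix t :: real
        have "norm (y + t *\<^sub>R b) \<le> C + 1" if "t \<in> {0..1}"
          using norm_triangle_ineq[of y "t *\<^sub>R b"] C[OF True] that b by simp
        then show "indicator {0..1} t \<le> ?f (y + t *\<^sub>R b)" by (auto simp: indicator_def)
      qed
      finally show ?thesis using True by simp
    qed simp
  qed
  also have "\<dots> = emeasure lborel (cball (0::'a) (C + 1))"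
    by (subst nn_integral_slice[OF b, symmetric]) (rule borel_measurable_indicator, simp_all)
  also have "\<dots> < \<infinity>" by (rule emeasure_compact_finite) simp
  finally show ?thesis .
qed

section \<open>Graphs and their surface measure\<close>

lemma graph_patchD:
  assumes "graph_patch S b U g"
  shows "b \<in> Basis" "open U" "smooth_on U g" "\<And>x t. g (x + t *\<^sub>R b) = g x" "S \<inter> U = {x \<in> U. x \<bullet> b = g x}"
    "b \<bullet> b = 1" "norm b = 1"
  using assms unfolding graph_patch_def by auto

lemma isCont_eventually_open:
  fixes f :: "'a::t2_space \<Rightarrow> 'b::topological_space"
  assumes "isCont f y" "open U" "f y \<in> U" shows "\<forall>\<^sub>F z in nhds y. f z \<in> U"
proof -
  have "(f \<longlongrightarrow> f y) (nhds y)"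
    using assms(1) tendsto_at_iff_tendsto_nhds[of f y] by (simp add: isCont_def)
  then show ?thesis using assms(2,3) by (rule topological_tendstoD)
qed

lemma graph_map_continuous:
  fixes g :: "'a::euclidean_space \<Rightarrow> real"
  assumes p: "graph_patch S b U g" and y: "y + g y *\<^sub>R b \<in> U"
  shows "isCont g y" "isCont (\<lambda>y. y + g y *\<^sub>R b) y"
proof -
  note D = graph_patchD[OF p]
  have "continuous_on U g" using Ck_on_imp_continuous smooth_onD D(3) by blast
  then have "isCont g (y + g y *\<^sub>R b)" using D(2) y continuous_on_eq_continuous_at by blast
  then have "isCont (\<lambda>z. g (z + g y *\<^sub>R b)) y"
    using isCont_o2[of y "\<lambda>z. z + g y *\<^sub>R b" g] by simp
  then show "isCont g y" using D(4) by simp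
  then show "isCont (\<lambda>y. y + g y *\<^sub>R b) y" by (intro continuous_intros)
qed

text \<open>Base points are arbitrary points of the space: \<open>g\<close> does not depend on the coordinate \<open>b\<close>, and the
  hyperplane measure is carried by the points with \<open>b\<close>-coordinate zero.\<close>

definition graph_dom :: "'a::euclidean_space \<Rightarrow> 'a set \<Rightarrow> ('a \<Rightarrow> real) \<Rightarrow> 'a set" where
  "graph_dom b U g = {y. y + g y *\<^sub>R b \<in> U}"

lemma graph_dom_open:
  assumes p: "graph_patch S b U g" shows "open (graph_dom b U g)"
  unfolding open_dist graph_dom_def
proof safe
  fix y assume y: "y + g y *\<^sub>R b \<in> U"
  have "\<forall>\<^sub>F z in nhds y. z + g z *\<^sub>R b \<in> U"
    by (rule isCont_eventually_open[OF graph_map_continuous(2)[OF p y] graph_patchD(2)[OF p] y])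
  then show "\<exists>e>0. \<forall>z. dist z y < e \<longrightarrow> z \<in> {y. y + g y *\<^sub>R b \<in> U}"
    unfolding eventually_nhds_metric by simp
qed

lemma graph_map_measurable:
  fixes f :: "'a::euclidean_space \<Rightarrow> 'b::real_normed_vector"
  assumes p: "graph_patch S b U g" and f: "continuous_on U f"
  shows "(\<lambda>y. indicator (graph_dom b U g) y *\<^sub>R f (y + g y *\<^sub>R b)) \<in> borel_measurable borel"
proof (rule borel_measurable_continuous_on_indicator)
  show "graph_dom b U g \<in> sets borel" using graph_dom_open[OF p] by simp
  show "continuous_on (graph_dom b U g) (\<lambda>y. f (y + g y *\<^sub>R b))"
  proof (rule continuous_on_compose2[OF f])
    show "continuous_on (graph_dom b U g) (\<lambda>y. y + g y *\<^sub>R b)"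
      using graph_map_continuous(2)[OF p]
      by (intro continuous_at_imp_continuous_on) (auto simp: graph_dom_def)
  qed (auto simp: graph_dom_def)
qed

definition graph_map :: "'a::euclidean_space \<Rightarrow> 'a set \<Rightarrow> ('a \<Rightarrow> real) \<Rightarrow> 'a \<Rightarrow> 'a" where
  "graph_map b U g y = indicator (graph_dom b U g) y *\<^sub>R (y + g y *\<^sub>R b)"

definition graph_weight :: "('a::euclidean_space \<Rightarrow> real) \<Rightarrow> 'a \<Rightarrow> real" where
  "graph_weight g y = sqrt (1 + (norm (grad g y))\<^sup>2)"

text \<open>The push-forward of the weighted hyperplane measure turns the condition of
  \<open>is_surface_measure_def\<close> on a patch into an equality of two measures.\<close>

definition graph_measure :: "'a::euclidean_space \<Rightarrow> 'a set \<Rightarrow> ('a \<Rightarrow> real) \<Rightarrow> 'a measure" where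
  "graph_measure b U g = distr (density (hyperplane_measure b)
     (\<lambda>y. ennreal (indicator (graph_dom b U g) y * graph_weight g y))) borel (graph_map b U g)"

lemma graph_measure_sets [simp, measurable_cong]: "sets (graph_measure b U g) = sets borel"
  unfolding graph_measure_def by simp

lemma graph_grad_invariant:
  assumes p: "graph_patch S b U g"
  shows "grad g (y + t *\<^sub>R b) = grad g y"
proof -
  have "GDERIV g (y + t *\<^sub>R b) :> D \<longleftrightarrow> GDERIV g y :> D" for D
  proof -
    have "((\<lambda>z. g (z + t *\<^sub>R b)) has_derivative (\<lambda>h. h \<bullet> D)) (at y) \<longleftrightarrow> (g has_derivative (\<lambda>h. h \<bullet> D)) (at (y + t *\<^sub>R b))"
    proof
      assume a: "(g has_derivative (\<lambda>h. h \<bullet> D)) (at (y + t *\<^sub>R b))"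
      have "((\<lambda>z. z + t *\<^sub>R b) has_derivative (\<lambda>h. h)) (at y)" by (auto intro!: derivative_eq_intros)
      from has_derivative_compose[OF this a]
      show "((\<lambda>z. g (z + t *\<^sub>R b)) has_derivative (\<lambda>h. h \<bullet> D)) (at y)" .
    next
      assume a: "((\<lambda>z. g (z + t *\<^sub>R b)) has_derivative (\<lambda>h. h \<bullet> D)) (at y)"
      have 1: "((\<lambda>z. z - t *\<^sub>R b) has_derivative (\<lambda>h. h)) (at (y + t *\<^sub>R b))" by (auto intro!: derivative_eq_intros)
      have "((\<lambda>z. g (z + t *\<^sub>R b)) has_derivative (\<lambda>h. h \<bullet> D)) (at (y + t *\<^sub>R b - t *\<^sub>R b))" using a by simp
      from has_derivative_compose[OF 1 this]
      have "((\<lambda>z. g (z - t *\<^sub>R b + t *\<^sub>R b)) has_derivative (\<lambda>h. h \<bullet> D)) (at (y + t *\<^sub>R b))" .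
      then show "(g has_derivative (\<lambda>h. h \<bullet> D)) (at (y + t *\<^sub>R b))" by simp
    qed
    then show ?thesis unfolding gderiv_def using graph_patchD(4)[OF p] by simp
  qed
  then have "gderiv g (y + t *\<^sub>R b) = gderiv g y" by (rule ext)
  then show ?thesis unfolding grad_def by simp
qed

lemma graph_weight_invariant:
  assumes p: "graph_patch S b U g" shows "graph_weight g (y + t *\<^sub>R b) = graph_weight g y"
  unfolding graph_weight_def graph_grad_invariant[OF p] ..

lemma graph_weight_continuous:
  assumes p: "graph_patch S b U g" shows "continuous_on U (graph_weight g)"
proof -
  note D = graph_patchD[OF p]
  have "continuous_on U (grad g)" by (rule continuous_on_grad[OF D(2) smooth_onD[OF D(3)]])
  then show ?thesis unfolding graph_weight_def by (intro continuous_intros) 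
qed

lemma graph_weight_measurable:
  assumes p: "graph_patch S b U g"
  shows "(\<lambda>y. indicator (graph_dom b U g) y * graph_weight g y) \<in> borel_measurable borel"
  using graph_map_measurable[OF p graph_weight_continuous[OF p]] by (simp add: graph_weight_invariant[OF p])

lemma graph_map_borel:
  assumes p: "graph_patch S b U g" shows "graph_map b U g \<in> borel_measurable borel"
  using graph_map_measurable[OF p continuous_on_id] unfolding graph_map_def[abs_def] .

lemma graph_weight_pos: "graph_weight g y \<ge> 1"
  unfolding graph_weight_def by simp

lemma nn_integral_graph_measure:
  fixes f :: "'a::euclidean_space \<Rightarrow> ennreal"
  assumes p: "graph_patch S b U g" and f: "f \<in> borel_measurable borel" "\<And>x. x \<notin> U ==> f x = 0"
  shows "integral\<^sup>N (graph_measure b U g) f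
    = (\<integral>\<^sup>+y. f (y + g y *\<^sub>R b) * ennreal (graph_weight g y) \<partial>hyperplane_measure b)"
proof -
  note [measurable] = graph_map_borel[OF p] graph_weight_measurable[OF p] f(1)
  have "integral\<^sup>N (graph_measure b U g) f
    = (\<integral>\<^sup>+y. ennreal (indicator (graph_dom b U g) y * graph_weight g y) * f (graph_map b U g y) \<partial>hyperplane_measure b)"
    unfolding graph_measure_def
    by (subst nn_integral_distr, measurable, subst nn_integral_density) (auto intro: measurable_compose)
  also have "\<dots> = (\<integral>\<^sup>+y. f (y + g y *\<^sub>R b) * ennreal (graph_weight g y) \<partial>hyperplane_measure b)"
    by (rule nn_integral_cong) (auto simp: graph_map_def graph_dom_def indicator_def f(2) mult.commute)
  finally show ?thesis .
qed

lemma integral_graph_measure: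
  fixes f :: "'a::euclidean_space \<Rightarrow> real"
  assumes p: "graph_patch S b U g" and f: "f \<in> borel_measurable borel" "\<And>x. x \<notin> U ==> f x = 0"
  shows "integral\<^sup>L (graph_measure b U g) f
    = (\<integral>y. f (y + g y *\<^sub>R b) * graph_weight g y \<partial>hyperplane_measure b)"
proof -
  note [measurable] = graph_map_borel[OF p] graph_weight_measurable[OF p] f(1)
  have nn: "0 \<le> indicat_real (graph_dom b U g) y * graph_weight g y" for y
    using graph_weight_pos[of g y] by simp
  have "integral\<^sup>L (graph_measure b U g) f
    = (\<integral>y. (indicator (graph_dom b U g) y * graph_weight g y) *\<^sub>R f (graph_map b U g y) \<partial>hyperplane_measure b)"
    unfolding graph_measure_def
    by (subst integral_distr, measurable, subst integral_density) (auto intro: measurable_compose nn)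
  also have "\<dots> = (\<integral>y. f (y + g y *\<^sub>R b) * graph_weight g y \<partial>hyperplane_measure b)"
    by (rule Bochner_Integration.integral_cong) (auto simp: graph_map_def graph_dom_def indicator_def f(2))
  finally show ?thesis .
qed

lemma emeasure_graph_measure:
  assumes p: "graph_patch S b U g" and E: "E \<in> sets borel" "E \<subseteq> U"
  shows "emeasure (graph_measure b U g) E
    = (\<integral>\<^sup>+y. indicator E (y + g y *\<^sub>R b) * ennreal (sqrt (1 + (norm (grad g y))\<^sup>2)) \<partial>hyperplane_measure b)"
proof -
  have "emeasure (graph_measure b U g) E = (\<integral>\<^sup>+x. indicator E x \<partial>graph_measure b U g)" using E by simp
  also have "\<dots> = (\<integral>\<^sup>+y. indicator E (y + g y *\<^sub>R b) * ennreal (graph_weight g y) \<partial>hyperplane_measure b)"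
    by (rule nn_integral_graph_measure[OF p]) (use E in \<open>auto simp: indicator_def\<close>)
  finally show ?thesis unfolding graph_weight_def .
qed

lemma is_surface_measure_iff:
  "is_surface_measure S \<sigma> \<longleftrightarrow> sets \<sigma> = sets borel \<and> emeasure \<sigma> (- S) = 0 \<and>
    (\<forall>b U g. graph_patch S b U g \<longrightarrow>
      (\<forall>E\<in>sets borel. E \<subseteq> S \<inter> U \<longrightarrow> emeasure \<sigma> E = emeasure (graph_measure b U g) E))"
proof -
  have "(\<forall>b\<in>Basis. \<forall>U g. open U \<and> smooth_on U g \<and> (\<forall>x t. g (x + t *\<^sub>R b) = g x) \<and>
        S \<inter> U = {x \<in> U. x \<bullet> b = g x} \<longrightarrow>
        (\<forall>E\<in>sets borel. E \<subseteq> S \<inter> U \<longrightarrow>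
           emeasure \<sigma> E =
             (\<integral>\<^sup>+ y. indicator E (y + g y *\<^sub>R b) * ennreal (sqrt (1 + (norm (grad g y))\<^sup>2))
                \<partial>hyperplane_measure b)))
    \<longleftrightarrow> (\<forall>b U g. graph_patch S b U g \<longrightarrow>
      (\<forall>E\<in>sets borel. E \<subseteq> S \<inter> U \<longrightarrow> emeasure \<sigma> E = emeasure (graph_measure b U g) E))" (is "?L \<longleftrightarrow> ?R")
  proof
    assume L: ?L
    show ?R
    proof (intro allI impI ballI)
      fix b U g and E :: "'a set" assume p: "graph_patch S b U g" and E: "E \<in> sets borel" "E \<subseteq> S \<inter> U"
      then have "E \<subseteq> U" by blast
      then show "emeasure \<sigma> E = emeasure (graph_measure b U g) E"
        unfolding emeasure_graph_measure[OF p E(1) \<open>E \<subseteq> U\<close>] using L p E unfolding graph_patch_def by blast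
    qed
  next
    assume R: ?R
    show ?L
    proof (intro allI impI ballI)
      fix b :: 'a and U g and E :: "'a set"
      assume b: "b \<in> Basis" and a: "open U \<and> smooth_on U g \<and> (\<forall>x t. g (x + t *\<^sub>R b) = g x) \<and>
        S \<inter> U = {x \<in> U. x \<bullet> b = g x}" and E: "E \<in> sets borel" "E \<subseteq> S \<inter> U"
      have p: "graph_patch S b U g" unfolding graph_patch_def using b a by blast
      have "E \<subseteq> U" using E by blast
      then show "emeasure \<sigma> E = (\<integral>\<^sup>+ y. indicator E (y + g y *\<^sub>R b) * ennreal (sqrt (1 + (norm (grad g y))\<^sup>2))
                \<partial>hyperplane_measure b)"
        unfolding emeasure_graph_measure[OF p E(1) \<open>E \<subseteq> U\<close>, symmetric] using R p E by blast
    qed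
  qed
  then show ?thesis unfolding is_surface_measure_def by simp
qed

text \<open>The base points \<open>y\<close> that matter have \<open>y \<bullet> b = 0\<close> and are mapped to \<open>y + g y b\<close>, a point of the graph.\<close>

lemma graph_measure_carrier:
  assumes p: "graph_patch S b U g" and E: "E \<in> sets borel" "E \<subseteq> U" "E \<inter> S = {}"
  shows "emeasure (graph_measure b U g) E = 0"
proof -
  note D = graph_patchD[OF p]
  have "AE y in hyperplane_measure b. indicator E (y + g y *\<^sub>R b) * ennreal (sqrt (1 + (norm (grad g y))\<^sup>2)) = 0"
    using AE_hyperplane[OF D(1)]
  proof eventually_elim
    case (elim y)
    have "y + g y *\<^sub>R b \<notin> E"
    proof
      assume e: "y + g y *\<^sub>R b \<in> E"
      then have "y + g y *\<^sub>R b \<in> S \<inter> U" using elim E(2) D(4-6) by (auto simp: inner_add_left)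
      then show False using e E(3) by blast
    qed
    then show ?case by simp
  qed
  then show ?thesis
    unfolding emeasure_graph_measure[OF p E(1,2)]
    by (subst nn_integral_cong_AE[where v = "\<lambda>_. 0"]) auto
qed

lemma graph_measure_compact_finite:
  assumes p: "graph_patch S b U g" and K: "compact K" "K \<subseteq> U"
  shows "emeasure (graph_measure b U g) K < \<infinity>"
proof -
  note D = graph_patchD[OF p]
  have Kb: "K \<in> sets borel" using K(1) by (simp add: borel_compact)
  have "compact (graph_weight g ` K)"
    using K graph_weight_continuous[OF p] compact_continuous_image continuous_on_subset by blast
  then have "bounded (graph_weight g ` K)" by (rule compact_imp_bounded)
  then obtain W where "\<forall>z\<in>graph_weight g ` K. norm z \<le> W" unfolding bounded_iff by blast
  then have W: "graph_weight g x \<le> W" if "x \<in> K" for x using that by force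
  have "bounded K" using K(1) by (rule compact_imp_bounded)
  then obtain C where C: "\<And>x. x \<in> K ==> norm x \<le> C" unfolding bounded_iff by blast
  have "emeasure (graph_measure b U g) K
    = (\<integral>\<^sup>+y. indicator K (y + g y *\<^sub>R b) * ennreal (graph_weight g y) \<partial>hyperplane_measure b)"
    unfolding emeasure_graph_measure[OF p Kb K(2)] graph_weight_def ..
  also have "\<dots> \<le> (\<integral>\<^sup>+y. ennreal W * indicator (cball 0 (C + C)) y \<partial>hyperplane_measure b)"
  proof (rule nn_integral_mono_AE)
    show "AE y in hyperplane_measure b. indicator K (y + g y *\<^sub>R b) * ennreal (graph_weight g y)
      \<le> ennreal W * indicator (cball 0 (C + C)) y"
      using AE_hyperplane[OF D(1)]
    proof eventually_elim
      case (elim y)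
      show ?case
      proof (cases "y + g y *\<^sub>R b \<in> K")
        case True
        have "(y + g y *\<^sub>R b) \<bullet> b = g y" using elim D(6) by (simp add: inner_add_left)
        then have "\<bar>g y\<bar> \<le> C" using Basis_le_norm[OF D(1), of "y + g y *\<^sub>R b"] C[OF True] by simp
        then have "norm y \<le> C + C"
          using norm_triangle_ineq4[of "y + g y *\<^sub>R b" "g y *\<^sub>R b"] C[OF True] D(7) by simp
        then show ?thesis using W[OF True] True by (simp add: graph_weight_invariant[OF p] ennreal_leI)
      qed simp
    qed
  qed
  also have "\<dots> = ennreal W * emeasure (hyperplane_measure b) (cball 0 (C + C))"
    by (subst nn_integral_cmult_indicator) auto
  also have "\<dots> < \<infinity>"
    using hyperplane_bounded_finite[OF D(1), of "cball 0 (C + C)"] by (simp add: ennreal_mult_less_top)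
  finally show ?thesis .
qed

lemma norm_project_le:
  fixes v b :: "'a::euclidean_space"
  assumes "b \<bullet> b = 1" shows "norm (v - (v \<bullet> b) *\<^sub>R b) \<le> norm v"
proof -
  define s where "s = v \<bullet> b"
  have "b \<bullet> v = s" unfolding s_def by (rule inner_commute)
  then have "(v - s *\<^sub>R b) \<bullet> (v - s *\<^sub>R b) = v \<bullet> v - s\<^sup>2"
    using assms s_def[symmetric] by (simp add: inner_diff_left inner_diff_right power2_eq_square)
  then have "(norm (v - s *\<^sub>R b))\<^sup>2 \<le> (norm v)\<^sup>2" by (simp add: power2_norm_eq_inner)
  then show ?thesis unfolding s_def by (rule power2_le_imp_le) simp
qed

text \<open>Near a point of the graph the base points fill a ball of the hyperplane, and by Fubini such a ball
  cannot have measure zero, as a ball of the whole space would then be null.\<close>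

lemma graph_measure_open_pos:
  assumes p: "graph_patch S b U g" and x: "x \<in> S \<inter> U" and G: "open G" "x \<in> G"
  shows "emeasure (graph_measure b U g) (G \<inter> U) > 0"
proof (rule ccontr)
  assume "\<not> ?thesis"
  then have z: "emeasure (graph_measure b U g) (G \<inter> U) = 0" by simp
  note D = graph_patchD[OF p]
  let ?G = "G \<inter> U"
  have Gb: "?G \<in> sets borel" using G(1) D(2) by auto
  have Go: "open ?G" using G(1) D(2) by auto
  define y0 where "y0 = x - (x \<bullet> b) *\<^sub>R b"
  have xg: "x \<bullet> b = g x" using x D(5) by blast
  have gy: "g y0 = g x" using D(4)[of x "- (x \<bullet> b)"] unfolding y0_def by simp
  have "g y0 = x \<bullet> b" using gy xg by simp
  then have xy: "y0 + g y0 *\<^sub>R b = x" by (simp only:) (simp add: y0_def)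
  have "isCont (\<lambda>y. y + g y *\<^sub>R b) y0" by (rule graph_map_continuous(2)[OF p]) (use xy x in auto)
  then have "\<forall>\<^sub>F z in nhds y0. z + g z *\<^sub>R b \<in> ?G"
    by (rule isCont_eventually_open[OF _ Go]) (use xy x G(2) in auto)
  then obtain e where e: "e > 0" "\<And>z. dist z y0 < e ==> z + g z *\<^sub>R b \<in> ?G"
    unfolding eventually_nhds_metric by blast
  let ?f = "indicator (ball y0 e) :: 'a \<Rightarrow> ennreal"
  have y0b: "y0 \<bullet> b = 0" unfolding y0_def using D(6) by (simp add: inner_diff_left)
  have Pm: "(\<lambda>y. indicator (graph_dom b U g) y *\<^sub>R (y + g y *\<^sub>R b)) \<in> borel_measurable borel"
    using graph_map_measurable[OF p continuous_on_id] .
  have N: "AE y in hyperplane_measure b. indicator ?G (y + g y *\<^sub>R b) * ennreal (graph_weight g y) = 0"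
  proof -
    have m: "(\<lambda>y. indicator ?G (y + g y *\<^sub>R b) * ennreal (graph_weight g y)) \<in> borel_measurable (hyperplane_measure b)"
    proof -
      note [measurable] = graph_map_borel[OF p] graph_weight_measurable[OF p] Gb
      have dm[measurable]: "graph_dom b U g \<in> sets borel" using graph_dom_open[OF p] by simp
      have "(\<lambda>y. indicator (graph_dom b U g) y * (indicator ?G (graph_map b U g y) * ennreal (indicator (graph_dom b U g) y * graph_weight g y))) \<in> borel_measurable borel"
        by measurable
      moreover have "(\<lambda>y. indicator (graph_dom b U g) y * (indicator ?G (graph_map b U g y) * ennreal (indicator (graph_dom b U g) y * graph_weight g y)))
        = (\<lambda>y. indicator ?G (y + g y *\<^sub>R b) * ennreal (graph_weight g y))"
        by (rule ext) (auto simp: graph_map_def graph_dom_def indicator_def)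
      ultimately show ?thesis by simp
    qed
    have "(\<integral>\<^sup>+y. indicator ?G (y + g y *\<^sub>R b) * ennreal (graph_weight g y) \<partial>hyperplane_measure b) = 0"
      using z emeasure_graph_measure[OF p Gb] unfolding graph_weight_def by simp
    then show ?thesis using nn_integral_0_iff_AE[OF m] by simp
  qed
  have "integral\<^sup>N lborel ?f = (\<integral>\<^sup>+y. (\<integral>\<^sup>+t. ?f (y + t *\<^sub>R b) \<partial>lborel) \<partial>hyperplane_measure b)"
    by (rule nn_integral_slice[OF D(1)]) (rule borel_measurable_indicator, simp)
  also have "\<dots> = (\<integral>\<^sup>+y. 0 \<partial>hyperplane_measure b)"
  proof (rule nn_integral_cong_AE)
    show "AE y in hyperplane_measure b. (\<integral>\<^sup>+t. ?f (y + t *\<^sub>R b) \<partial>lborel) = 0"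
      using N AE_hyperplane[OF D(1)]
    proof eventually_elim
      case (elim y)
      have "y + t *\<^sub>R b \<notin> ball y0 e" for t
      proof
        assume "y + t *\<^sub>R b \<in> ball y0 e"
        then have l: "norm (y + t *\<^sub>R b - y0) < e" by (simp add: dist_norm norm_minus_commute)
        have "(y + t *\<^sub>R b - y0) \<bullet> b = t" using elim(2) y0b D(6) by (simp add: inner_add_left inner_diff_left)
        then have eq: "y - y0 = (y + t *\<^sub>R b - y0) - ((y + t *\<^sub>R b - y0) \<bullet> b) *\<^sub>R b" by simp
        have "norm (y - y0) \<le> norm (y + t *\<^sub>R b - y0)"
          by (subst eq) (rule norm_project_le[OF D(6)])
        then have "norm (y - y0) < e" using l by linarith
        then have "y + g y *\<^sub>R b \<in> ?G" using e(2)[of y] by (simp add: dist_norm)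
        moreover have "ennreal (graph_weight g y) \<noteq> 0" using graph_weight_pos[of g y] by (simp add: ennreal_eq_0_iff)
        ultimately show False using elim(1) by simp
      qed
      then show ?case by (simp add: indicator_def)
    qed
  qed
  finally have "emeasure lborel (ball y0 e) = 0" by simp
  moreover have "emeasure lborel (ball y0 e) \<noteq> 0"
    using e(1) open_ball[of y0 e] negligible_iff_null_sets[of "ball y0 e"] open_not_negligible[of "ball y0 e"]
    by (auto simp: null_sets_completion_iff null_setsI)
  ultimately show False by simp
qed

text \<open>The sign \<open>\<epsilon>\<close> tells whether the half-line lies below or above \<open>a\<close>.\<close>

lemma integral_half_line_derivative:
  fixes h h' :: "real \<Rightarrow> real"
  assumes d: "\<And>t. (h has_real_derivative h' t) (at t)" and c: "continuous_on UNIV h'"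
    and s: "\<And>t. \<bar>t\<bar> > M ==> h t = 0" "\<And>t. \<bar>t\<bar> > M ==> h' t = 0" and e: "\<epsilon> = 1 \<or> \<epsilon> = - 1"
  shows "(LBINT t. indicator {t. \<epsilon> * (t - a) < 0} t * h' t) = \<epsilon> * h a"
proof -
  define B where "B = \<bar>M\<bar> + \<bar>a\<bar> + 1"
  have B: "- B < a" "a < B" "h (- B) = 0" "h B = 0" unfolding B_def using s(1) by auto
  have FTC: "(LBINT t. h' t * indicator {u..v} t) = h v - h u" if "u \<le> v" for u v
    using integral_FTC_Icc_real[OF that, of h h'] d continuous_on_eq_continuous_at[OF open_UNIV] c
    by (auto simp: mult.commute)
  have nn: "AE t in lborel. t \<noteq> a" by (rule AE_lborel_singleton)
  have hm: "h' \<in> borel_measurable borel" using c by (rule borel_measurable_continuous_onI)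
  from e show ?thesis
  proof
    assume e: "\<epsilon> = 1"
    have "(LBINT t. indicator {t. \<epsilon> * (t - a) < 0} t * h' t) = (LBINT t. h' t * indicator {- B..a} t)"
    proof (rule integral_cong_AE)
      show "AE t in lborel. indicator {t. \<epsilon> * (t - a) < 0} t * h' t = h' t * indicator {- B..a} t"
        using nn by eventually_elim (use e s(2) in \<open>auto simp: indicator_def B_def\<close>)
    qed (use hm e in \<open>auto intro!: borel_measurable_times borel_measurable_indicator\<close>)
    then show ?thesis using FTC[of "- B" a] B e by simp
  next
    assume e: "\<epsilon> = - 1"
    have "(LBINT t. indicator {t. \<epsilon> * (t - a) < 0} t * h' t) = (LBINT t. h' t * indicator {a..B} t)"
    proof (rule integral_cong_AE)
      show "AE t in lborel. indicator {t. \<epsilon> * (t - a) < 0} t * h' t = h' t * indicator {a..B} t"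
        using nn by eventually_elim (use e s(2) in \<open>auto simp: indicator_def B_def\<close>)
    qed (use hm e in \<open>auto intro!: borel_measurable_times borel_measurable_indicator\<close>)
    then show ?thesis using FTC[of a B] B e by simp
  qed
qed

text \<open>On each line in direction \<open>b\<close> the set \<open>E\<close> is a half-line ending on the graph, so that the
  fundamental theorem of calculus leaves the value of \<open>h\<close> on the graph.\<close>

lemma graph_integral_derivative:
  fixes h :: "'a::euclidean_space \<Rightarrow> real"
  assumes p: "graph_patch S b U g" and h: "Ck_on 1 UNIV h" and K: "compact K" "K \<subseteq> V" "V \<subseteq> U" "\<And>x. x \<notin> K ==> h x = 0"
    and E: "E \<in> sets borel" "E \<inter> V = {x \<in> V. \<epsilon> * (x \<bullet> b - g x) < 0}" and e: "\<epsilon> = 1 \<or> \<epsilon> = - 1"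
  shows "(LBINT x. indicator E x * pd b h x)
    = \<epsilon> * (\<integral>y. h (y + g y *\<^sub>R b) \<partial>hyperplane_measure b)"
proof -
  note D = graph_patchD[OF p]
  have hc: "C1_compact h" unfolding C1_compact_def using h K by blast
  note hp = C1_compact_pd[OF hc D(1)]
  have "bounded K" using K(1) by (rule compact_imp_bounded)
  then obtain C where C: "\<And>x. x \<in> K ==> norm x \<le> C" unfolding bounded_iff by blast
  have fi: "integrable lborel (\<lambda>x. indicator E x * pd b h x)"
    using integrable_mult_indicator[OF _ hp(1), of E] E(1) by simp
  have line: "(LBINT t. indicator E (y + t *\<^sub>R b) * frechet_derivative h (at (y + t *\<^sub>R b)) b) = \<epsilon> * h (y + g y *\<^sub>R b)"
    if y: "y \<bullet> b = 0" for y
  proof -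
    have pz: "pd b h x = 0" if "x \<notin> K" for x by (rule pd_zero_outside[OF K(1,4) that])
    have "(LBINT t. indicator E (y + t *\<^sub>R b) * frechet_derivative h (at (y + t *\<^sub>R b)) b)
      = (LBINT t. indicator {t. \<epsilon> * (t - g y) < 0} t * frechet_derivative h (at (y + t *\<^sub>R b)) b)"
    proof (rule Bochner_Integration.integral_cong[OF refl])
      fix t
      show "indicator E (y + t *\<^sub>R b) * frechet_derivative h (at (y + t *\<^sub>R b)) b
        = indicator {t. \<epsilon> * (t - g y) < 0} t * frechet_derivative h (at (y + t *\<^sub>R b)) b"
      proof (cases "y + t *\<^sub>R b \<in> K")
        case True
        then have "y + t *\<^sub>R b \<in> V" using K(2) by blast
        then have "y + t *\<^sub>R b \<in> E \<longleftrightarrow> \<epsilon> * ((y + t *\<^sub>R b) \<bullet> b - g (y + t *\<^sub>R b)) < 0" using E(2) by blast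
        then have "y + t *\<^sub>R b \<in> E \<longleftrightarrow> \<epsilon> * (t - g y) < 0" using y D(4,6) by (simp add: inner_add_left)
        then show ?thesis by (simp add: indicator_def)
      qed (simp add: pz)
    qed
    also have "\<dots> = \<epsilon> * h (y + g y *\<^sub>R b)"
    proof (rule integral_half_line_derivative[where h = "\<lambda>t. h (y + t *\<^sub>R b)" and M = "C + norm y", OF _ _ _ _ e])
      fix t
      have hd: "(h has_derivative frechet_derivative h (at (y + t *\<^sub>R b))) (at (y + t *\<^sub>R b))"
        using h by (intro has_derivative_frechet) simp
      have "((\<lambda>t. y + t *\<^sub>R b) has_derivative (\<lambda>s. s *\<^sub>R b)) (at t)" by (auto intro!: derivative_eq_intros)
      from has_derivative_compose[OF this hd]
      show "((\<lambda>t. h (y + t *\<^sub>R b)) has_real_derivative frechet_derivative h (at (y + t *\<^sub>R b)) b) (at t)"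
        using linear_cmul[OF has_derivative_linear[OF hd]] by (simp add: has_field_derivative_def mult_commute_abs)
      have "y + t *\<^sub>R b \<notin> K" if "\<bar>t\<bar> > C + norm y"
        using C[of "y + t *\<^sub>R b"] norm_triangle_ineq4[of "y + t *\<^sub>R b" y] that D(7) by auto
      then show "\<bar>t\<bar> > C + norm y ==> h (y + t *\<^sub>R b) = 0"
        "\<bar>t\<bar> > C + norm y ==> frechet_derivative h (at (y + t *\<^sub>R b)) b = 0" using K(4) pz by auto
    next
      show "continuous_on UNIV (\<lambda>t. frechet_derivative h (at (y + t *\<^sub>R b)) b)"
        by (rule continuous_on_compose2[OF hp(2)]) (auto intro!: continuous_intros)
    qed
    finally show ?thesis .
  qed
  have ch: "continuous_on UNIV h" by (rule Ck_on_imp_continuous[OF h])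
  have hgm: "(\<lambda>y. h (y + g y *\<^sub>R b)) \<in> borel_measurable borel"
  proof -
    have "(\<lambda>y. indicator (graph_dom b U g) y *\<^sub>R h (y + g y *\<^sub>R b)) \<in> borel_measurable borel"
      by (rule graph_map_measurable[OF p continuous_on_subset[OF ch subset_UNIV]])
    moreover have "(\<lambda>y. indicator (graph_dom b U g) y *\<^sub>R h (y + g y *\<^sub>R b)) = (\<lambda>y. h (y + g y *\<^sub>R b))"
      by (rule ext) (use K in \<open>auto simp: graph_dom_def indicator_def\<close>)
    ultimately show ?thesis by (simp only:)
  qed
  have "(LBINT x. indicator E x * pd b h x)
    = (\<integral>y. (LBINT t. indicator E (y + t *\<^sub>R b) * frechet_derivative h (at (y + t *\<^sub>R b)) b) \<partial>hyperplane_measure b)"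
    by (rule integral_slice[OF D(1) fi])
  also have "\<dots> = (\<integral>y. \<epsilon> * h (y + g y *\<^sub>R b) \<partial>hyperplane_measure b)"
  proof (rule integral_cong_AE)
    show "AE y in hyperplane_measure b. (LBINT t. indicator E (y + t *\<^sub>R b) * frechet_derivative h (at (y + t *\<^sub>R b)) b) = \<epsilon> * h (y + g y *\<^sub>R b)"
      using AE_hyperplane[OF D(1)] by eventually_elim (rule line)
    have "(\<lambda>x. indicator E x * pd b h x) \<in> borel_measurable borel"
      using borel_measurable_integrable[OF fi] by simp
    from slice_integral_measurable[OF this]
    show "(\<lambda>y. LBINT t. indicator E (y + t *\<^sub>R b) * frechet_derivative h (at (y + t *\<^sub>R b)) b) \<in> borel_measurable (hyperplane_measure b)"
      by simp
  qed (use hgm in simp)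
  finally show ?thesis by simp
qed

section \<open>Flux through a piece of a hypersurface\<close>

lemma graph_grad_orthogonal:
  assumes p: "graph_patch S b U g" and x: "x \<in> U" shows "grad g x \<bullet> b = 0"
proof -
  note D = graph_patchD[OF p]
  have gd: "g differentiable at x" using smooth_onD[OF D(3), of 1] x by simp
  have "(\<lambda>n. (g (x + (1 / real (Suc n)) *\<^sub>R b) - g x) / (1 / real (Suc n))) \<longlonglongrightarrow> pd b g x"
    by (rule difference_quotient_limit[OF gd])
  then have "(\<lambda>n::nat. 0::real) \<longlonglongrightarrow> pd b g x" using D(4) by simp
  then have "pd b g x = 0" by (simp add: LIMSEQ_const_iff)
  then show ?thesis using grad_inner[OF gd] by simp
qed

lemma graph_projection_continuous:
  assumes p: "graph_patch S b U g" shows "continuous_on U (\<lambda>y. y - (y \<bullet> b - g y) *\<^sub>R b)"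
  using Ck_on_imp_continuous[OF smooth_onD[OF graph_patchD(3)[OF p]]] by (intro continuous_intros)

lemma graph_projection:
  assumes p: "graph_patch S b U g"
  shows "(y - (y \<bullet> b - g y) *\<^sub>R b) \<bullet> b = g y" "g (y - (y \<bullet> b - g y) *\<^sub>R b) = g y"
proof -
  show "(y - (y \<bullet> b - g y) *\<^sub>R b) \<bullet> b = g y" using graph_patchD(6)[OF p] by (simp add: inner_diff_left)
  show "g (y - (y \<bullet> b - g y) *\<^sub>R b) = g y"
    using graph_patchD(4)[OF p, of y "- (y \<bullet> b - g y)"] by (simp only: scaleR_minus_left add_uminus_conv_diff)
qed

text \<open>The composition of \<open>\<psi>\<close> with the projection along \<open>b\<close> onto the graph vanishes identically.
  Differentiating it expresses all partial derivatives of \<open>\<psi>\<close> by the one in direction \<open>b\<close>.\<close>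

lemma grad_on_graph:
  assumes p: "graph_patch S b U g" and V: "open V" "V \<subseteq> U" "x \<in> V" and xb: "x \<bullet> b = g x"
    and z: "\<And>y. y \<in> V ==> y \<bullet> b = g y ==> \<psi> y = 0" and d: "\<psi> differentiable at x"
  shows "grad \<psi> x = (grad \<psi> x \<bullet> b) *\<^sub>R (b - grad g x)"
proof -
  note D = graph_patchD[OF p]
  let ?R = "\<lambda>y. y - (y \<bullet> b - g y) *\<^sub>R b"
  have gd: "g differentiable at x" using smooth_onD[OF D(3), of 1] V by auto
  have Rx: "?R x = x" using xb by simp
  have 1: "(?R has_derivative (\<lambda>h. h - (h \<bullet> b - grad g x \<bullet> h) *\<^sub>R b)) (at x)"
    using has_derivative_grad[OF gd] by (auto intro!: derivative_eq_intros)
  have 2: "(\<psi> has_derivative (\<lambda>h. grad \<psi> x \<bullet> h)) (at (?R x))"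
    using has_derivative_grad[OF d] by (simp only: Rx)
  have 3: "((\<lambda>y. \<psi> (?R y)) has_derivative (\<lambda>h. grad \<psi> x \<bullet> (h - (h \<bullet> b - grad g x \<bullet> h) *\<^sub>R b))) (at x)"
    by (rule has_derivative_compose[OF 1 2])
  have op: "open (V \<inter> ?R -` V)"
    by (rule continuous_open_preimage[OF continuous_on_subset[OF graph_projection_continuous[OF p] V(2)] V(1) V(1)])
  have "((\<lambda>y. 0) has_derivative (\<lambda>h. grad \<psi> x \<bullet> (h - (h \<bullet> b - grad g x \<bullet> h) *\<^sub>R b))) (at x)"
  proof (rule has_derivative_eq_open[OF 3 op])
    have "?R x \<in> V" using V(3) by (simp only: Rx)
    then show "x \<in> V \<inter> ?R -` V" using V(3) by blast
    show "\<psi> (?R y) = 0" if "y \<in> V \<inter> ?R -` V" for y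
      by (rule z) (use that graph_projection[OF p, of y] in auto)
  qed
  then have "(\<lambda>h. grad \<psi> x \<bullet> (h - (h \<bullet> b - grad g x \<bullet> h) *\<^sub>R b)) = (\<lambda>h. 0)"
    using has_derivative_unique[OF _ has_derivative_const] by blast
  then have e: "grad \<psi> x \<bullet> (h - (h \<bullet> b - grad g x \<bullet> h) *\<^sub>R b) = 0" for h by metis
  have "grad \<psi> x \<bullet> h = ((grad \<psi> x \<bullet> b) *\<^sub>R (b - grad g x)) \<bullet> h" for h
  proof -
    have "grad \<psi> x \<bullet> h = (h \<bullet> b - grad g x \<bullet> h) * (grad \<psi> x \<bullet> b)"
      using e[of h] by (simp only: inner_diff_right inner_scaleR_right)
    also have "\<dots> = ((grad \<psi> x \<bullet> b) *\<^sub>R (b - grad g x)) \<bullet> h"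
      by (simp only: inner_scaleR_left inner_diff_left inner_commute[of h b] mult.commute)
    finally show ?thesis .
  qed
  then show ?thesis using vector_eq_rdot[of "grad \<psi> x" "(grad \<psi> x \<bullet> b) *\<^sub>R (b - grad g x)"] by blast
qed

text \<open>The mean value theorem on the segment from \<open>y\<close> to its projection onto the graph. The ball is
  chosen independently of \<open>f\<close>, with its projection contained in a larger ball, which is convex.\<close>

lemma graph_mvt:
  assumes p: "graph_patch S b U g" and x0: "x0 \<in> S" "x0 \<in> U1" and U1: "open U1" "U1 \<subseteq> U"
  obtains r where "r > 0" "ball x0 r \<subseteq> U1"
    "\<And>f y. (\<And>z. z \<in> U1 ==> f differentiable at z) ==> (\<And>z. z \<in> S \<inter> U1 ==> f z = 0) ==> y \<in> ball x0 r ==>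
      \<exists>\<xi>\<in>U1. f y = (y \<bullet> b - g y) * (grad f \<xi> \<bullet> b)"
proof -
  note D = graph_patchD[OF p]
  let ?R = "\<lambda>y. y - (y \<bullet> b - g y) *\<^sub>R b"
  have x0b: "x0 \<bullet> b = g x0" using x0 U1 D(5) by blast
  obtain r0 where r0: "r0 > 0" "ball x0 r0 \<subseteq> U1" using open_contains_ball U1(1) x0(2) by blast
  have "open (U \<inter> ?R -` ball x0 r0)"
    by (rule continuous_open_preimage[OF graph_projection_continuous[OF p] D(2)]) simp
  moreover have "x0 \<in> U \<inter> ?R -` ball x0 r0" using x0 U1 x0b r0(1) by auto
  ultimately obtain r1 where r1: "r1 > 0" "ball x0 r1 \<subseteq> U \<inter> ?R -` ball x0 r0"
    using open_contains_ball by blast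
  define r where "r = min r0 r1"
  have r: "r > 0" "ball x0 r \<subseteq> ball x0 r0" "ball x0 r \<subseteq> ball x0 r1" unfolding r_def using r0(1) r1(1) by auto
  show ?thesis
  proof (rule that[OF r(1)])
    show "ball x0 r \<subseteq> U1" using r(2) r0(2) by blast
    fix f :: "'a \<Rightarrow> real" and x
    assume fd: "\<And>z. z \<in> U1 ==> f differentiable at z" and fz: "\<And>z. z \<in> S \<inter> U1 ==> f z = 0" and x: "x \<in> ball x0 r"
    have xb: "x \<in> ball x0 r0" using x r(2) by blast
    have "x \<in> ball x0 r1" using x r(3) by blast
    then have Rb: "?R x \<in> ball x0 r0" using r1(2) by blast
    have "?R x \<in> S \<inter> U1"
    proof -
      have "?R x \<in> U" using Rb r0(2) U1(2) by blast
      then have "?R x \<in> {z \<in> U. z \<bullet> b = g z}"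
        using graph_projection[OF p, of x] by (simp only: mem_Collect_eq)
      then have "?R x \<in> S" using D(5) by blast
      then show ?thesis using Rb r0(2) by blast
    qed
    then have Rz: "f (?R x) = 0" by (rule fz)
    define s where "s = x \<bullet> b - g x"
    have on: "?R x + (t * s) *\<^sub>R b \<in> U1" if "0 \<le> t" "t \<le> 1" for t
    proof -
      have "(1 - t) *\<^sub>R ?R x + t *\<^sub>R x \<in> ball x0 r0"
        using convex_ball Rb xb that by (intro convexD_alt) auto
      moreover have "(1 - t) *\<^sub>R ?R x + t *\<^sub>R x = ?R x + (t * s) *\<^sub>R b"
        unfolding s_def by (simp add: algebra_simps)
      ultimately show ?thesis using r0(2) by auto
    qed
    have der: "((\<lambda>t. f (?R x + (t * s) *\<^sub>R b)) has_real_derivative (s * (grad f (?R x + (t * s) *\<^sub>R b) \<bullet> b))) (at t)"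
      if "0 \<le> t" "t \<le> 1" for t
    proof -
      have h: "(f has_derivative (\<lambda>h. grad f (?R x + (t * s) *\<^sub>R b) \<bullet> h)) (at (?R x + (t * s) *\<^sub>R b))"
        using fd[OF on[OF that]] by (rule has_derivative_grad)
      have "((\<lambda>t. ?R x + (t * s) *\<^sub>R b) has_derivative (\<lambda>u. (u * s) *\<^sub>R b)) (at t)"
        by (auto intro!: derivative_eq_intros)
      note hc = has_derivative_compose[OF this h]
      have "(\<lambda>u. grad f (?R x + (t * s) *\<^sub>R b) \<bullet> ((u * s) *\<^sub>R b)) = (*) (s * (grad f (?R x + (t * s) *\<^sub>R b) \<bullet> b))"
        by (rule ext) (simp only: inner_scaleR_right mult_ac)
      with hc show ?thesis by (simp only: has_field_derivative_def)
    qed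
    obtain \<xi> where xi: "0 < \<xi>" "\<xi> < 1" "f (?R x + (1 * s) *\<^sub>R b) - f (?R x + (0 * s) *\<^sub>R b)
        = (1 - 0) * (s * (grad f (?R x + (\<xi> * s) *\<^sub>R b) \<bullet> b))"
      using MVT2[of 0 1 "\<lambda>t. f (?R x + (t * s) *\<^sub>R b)", OF _ der] by auto
    define z where "z = ?R x + (\<xi> * s) *\<^sub>R b"
    have Rs: "?R x + (1 * s) *\<^sub>R b = x" "?R x + (0 * s) *\<^sub>R b = ?R x" unfolding s_def by simp_all
    have "f x = s * (grad f z \<bullet> b)" using xi(3) Rz unfolding Rs z_def by simp
    moreover have "z \<in> U1" unfolding z_def using on[of \<xi>] xi(1,2) by simp
    ultimately show "\<exists>\<xi>\<in>U1. f x = (x \<bullet> b - g x) * (grad f \<xi> \<bullet> b)"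
      unfolding s_def by blast
  qed
qed

text \<open>Compares the two descriptions of the same piece of hypersurface: the sign \<open>\<epsilon>\<close> records on which
  side of the graph the set \<open>E\<close> lies.\<close>

lemma chart_graph_local:
  assumes c: "boundary_chart E x0 U0 \<psi>" and S: "S \<inter> U0 = {y \<in> U0. \<psi> y = 0}"
    and p: "graph_patch S b U g" and x0: "x0 \<in> U" "x0 \<in> S"
  obtains r \<epsilon> where "r > 0" "ball x0 r \<subseteq> U \<inter> U0" "\<epsilon> = 1 \<or> \<epsilon> = - 1"
    "\<And>x. x \<in> ball x0 r ==> \<epsilon> * (grad \<psi> x \<bullet> b) > 0"
    "E \<inter> ball x0 r = {x \<in> ball x0 r. \<epsilon> * (x \<bullet> b - g x) < 0}"
proof -
  note D = graph_patchD[OF p] and C = boundary_chartD[OF c]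
  have zero: "\<psi> y = 0" if "y \<in> U \<inter> U0" "y \<bullet> b = g y" for y using that D(5) S by blast
  have x0b: "x0 \<bullet> b = g x0" using x0 D(5) by blast
  have "grad \<psi> x0 = (grad \<psi> x0 \<bullet> b) *\<^sub>R (b - grad g x0)"
    by (rule grad_on_graph[OF p, of "U \<inter> U0"]) (use D(2) C(1,2,7) x0 x0b zero in auto)
  then have nz: "grad \<psi> x0 \<bullet> b \<noteq> 0" using C(2,4) by (metis scaleR_zero_left)
  define \<epsilon> where "\<epsilon> = sgn (grad \<psi> x0 \<bullet> b)"
  have e: "\<epsilon> = 1 \<or> \<epsilon> = - 1" using nz unfolding \<epsilon>_def by (auto simp: sgn_if)
  have e0: "\<epsilon> * (grad \<psi> x0 \<bullet> b) > 0" using nz unfolding \<epsilon>_def by (simp add: sgn_if)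
  have cg: "continuous_on (U \<inter> U0) (\<lambda>x. \<epsilon> * (grad \<psi> x \<bullet> b))"
    using continuous_on_subset[OF continuous_on_grad[OF C(1) smooth_onD[OF C(3)]]] by (intro continuous_intros) auto
  define U1 where "U1 = {x \<in> U \<inter> U0. 0 < \<epsilon> * (grad \<psi> x \<bullet> b)}"
  have U1: "x \<in> U1 \<longleftrightarrow> x \<in> U \<and> x \<in> U0 \<and> 0 < \<epsilon> * (grad \<psi> x \<bullet> b)" for x unfolding U1_def by blast
  have o1: "open U1" unfolding U1_def
    by (rule open_less_set[OF _ continuous_on_const cg]) (use D(2) C(1) in auto)
  have x1: "x0 \<in> U1" unfolding U1 using x0 C(2) e0 by blast
  have U1U: "U1 \<subseteq> U" using U1 by blast
  obtain r where r: "r > 0" "ball x0 r \<subseteq> U1"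
    and mv: "\<And>f y. (\<And>z. z \<in> U1 ==> f differentiable at z) ==> (\<And>z. z \<in> S \<inter> U1 ==> f z = 0) ==> y \<in> ball x0 r ==>
      \<exists>\<xi>\<in>U1. f y = (y \<bullet> b - g y) * (grad f \<xi> \<bullet> b)"
    by (rule graph_mvt[OF p x0(2) x1 o1 U1U]) blast
  have side: "\<psi> x < 0 \<longleftrightarrow> \<epsilon> * (x \<bullet> b - g x) < 0" if x: "x \<in> ball x0 r" for x
  proof -
    have "\<exists>\<xi>\<in>U1. \<psi> x = (x \<bullet> b - g x) * (grad \<psi> \<xi> \<bullet> b)"
    proof (rule mv[OF _ _ x])
      show "\<psi> differentiable at z" if "z \<in> U1" for z by (rule C(7)) (use that U1 in blast)
      show "\<psi> z = 0" if "z \<in> S \<inter> U1" for z using that S U1 by blast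
    qed
    then obtain k where k: "\<psi> x = (x \<bullet> b - g x) * k" "\<epsilon> * k > 0" using U1 by blast
    define s where "s = x \<bullet> b - g x"
    show ?thesis using k e unfolding s_def[symmetric] by (auto simp: mult_less_0_iff zero_less_mult_iff)
  qed
  show ?thesis
  proof (rule that[OF r(1) _ e])
    show "ball x0 r \<subseteq> U \<inter> U0" using r(2) U1 by blast
    show "\<epsilon> * (grad \<psi> x \<bullet> b) > 0" if "x \<in> ball x0 r" for x using that r(2) U1 by blast
    show "E \<inter> ball x0 r = {x \<in> ball x0 r. \<epsilon> * (x \<bullet> b - g x) < 0}"
      using side C(6) r(2) U1 by blast
  qed
qed

lemma graph_patch_restrict:
  assumes "graph_patch S b U g" "open V" "V \<subseteq> U" shows "graph_patch S b V g"
  using assms Ck_on_subset unfolding graph_patch_def smooth_on_def by blast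

lemma integrable_indicator_mult:
  fixes f :: "'a::euclidean_space \<Rightarrow> real"
  assumes "integrable lborel f" "E \<in> sets borel"
  shows "integrable lborel (\<lambda>x. indicator E x * f x)"
  using integrable_mult_indicator[of E lborel f] assms by simp

text \<open>Near \<open>x0\<close> the field is \<open>X = Y + f b\<close> with \<open>f = (X \<bullet> \<nabla>\<psi>) / (\<partial>\<psi>/\<partial>b)\<close>. Then \<open>Y\<close> is tangential to the level
  sets of \<open>\<psi>\<close> and contributes nothing, and \<open>f b\<close> is integrated along lines. On the graph
  \<open>\<nabla>\<psi> = \<partial>\<psi>/\<partial>b (b - \<nabla>g)\<close>, whose length contains exactly the weight of the surface measure, so that the
  boundary term is \<open>X \<bullet> \<nabla>\<psi> / |\<nabla>\<psi>|\<close>.\<close>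

lemma chart_graph_flux:
  assumes c: "boundary_chart E x0 U0 \<psi>" and S: "S \<inter> U0 = {y \<in> U0. \<psi> y = 0}"
    and p: "graph_patch S b U g" and x0: "x0 \<in> U" "x0 \<in> S" and E: "E \<in> sets borel"
  obtains r where "r > 0" "ball x0 r \<subseteq> U \<inter> U0"
    "\<And>X K. Ck_field 1 UNIV X ==> compact K ==> K \<subseteq> ball x0 r ==> (\<And>x. x \<notin> K ==> X x = 0) ==>
      (LBINT x. indicator E x * divergence X x) = (\<integral>x. X x \<bullet> sgn (grad \<psi> x) \<partial>graph_measure b U g)"
proof -
  note D = graph_patchD[OF p] and C = boundary_chartD[OF c]
  obtain r \<epsilon> where r: "r > 0" "ball x0 r \<subseteq> U \<inter> U0" and e: "\<epsilon> = 1 \<or> \<epsilon> = - 1"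
    and pos: "\<And>x. x \<in> ball x0 r ==> \<epsilon> * (grad \<psi> x \<bullet> b) > 0"
    and side: "E \<inter> ball x0 r = {x \<in> ball x0 r. \<epsilon> * (x \<bullet> b - g x) < 0}"
    using chart_graph_local[OF c S p x0] by blast
  let ?B = "ball x0 r"
  have oB: "open ?B" by simp
  have p': "graph_patch S b ?B g" by (rule graph_patch_restrict[OF p oB]) (use r(2) in auto)
  have smB: "Ck_on k ?B \<psi>" for k using smooth_onD[OF C(3)] Ck_on_subset r(2) by blast
  show ?thesis
  proof (rule that[OF r])
    fix X :: "'a \<Rightarrow> 'a" and K
    assume X: "Ck_field 1 UNIV X" and K: "compact K" "K \<subseteq> ?B" "\<And>x. x \<notin> K ==> X x = 0"
    define f where "f = (\<lambda>x. (X x \<bullet> grad \<psi> x) / (grad \<psi> x \<bullet> b))"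
    have fK: "f x = 0" if "x \<notin> K" for x unfolding f_def using K(3)[OF that] by simp
    have XB: "Ck_on 1 ?B (\<lambda>x. X x \<bullet> i)" if "i \<in> Basis" for i using X that Ck_on_subset by blast
    have gB: "Ck_on 1 ?B (\<lambda>x. grad \<psi> x \<bullet> i)" for i by (rule Ck_on_grad_inner[OF oB smB])
    have "Ck_on 1 ?B (\<lambda>x. (\<Sum>i\<in>Basis. (X x \<bullet> i) * (grad \<psi> x \<bullet> i)) / (grad \<psi> x \<bullet> b))"
      using pos by (intro Ck_on_divide Ck_on_sum Ck_on_mult XB gB oB) force+
    then have fB: "Ck_on 1 ?B f" unfolding f_def by (simp only: euclidean_inner[of "X _" "grad \<psi> _"])
    have fU: "Ck_on 1 UNIV f" by (rule Ck_on_extend_zero[OF oB fB K(1,2) fK])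
    define Y where "Y = (\<lambda>x. X x - f x *\<^sub>R b)"
    have YU: "Ck_field 1 UNIV Y"
      unfolding Y_def using X fU
      by (auto simp: inner_diff_left simp del: Ck_on.simps One_nat_def intro!: Ck_on_diff Ck_on_mult)
    have YK: "Y x = 0" if "x \<notin> K" for x unfolding Y_def using K(3) fK that by simp
    have Xd: "X differentiable at x" and Yd: "Y differentiable at x" for x
      using Ck_field_differentiable[of 0 UNIV X x] Ck_field_differentiable[of 0 UNIV Y x] X YU by simp_all
    have fd: "f differentiable at x" for x using fU by simp
    have "(LBINT x. indicator {x. 0 < - \<psi> x} x * divergence Y x) = 0"
    proof (rule tangential_divergence_zero[OF oB _ _ K(1,2) YK])
      show "Ck_on 1 ?B (\<lambda>x. - \<psi> x)" by (rule Ck_on_minus[OF oB smB])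
      show "Ck_field 1 ?B Y" using YU Ck_on_subset by blast
      fix x assume x: "x \<in> ?B"
      have "grad \<psi> x \<bullet> b \<noteq> 0" using pos[OF x] by auto
      then have "Y x \<bullet> grad \<psi> x = 0"
        unfolding Y_def f_def by (simp add: inner_diff_left inner_commute[of b])
      moreover have "\<psi> differentiable at x" using C(7) x r(2) by blast
      ultimately show "Y x \<bullet> grad (\<lambda>x. - \<psi> x) x = 0" by (simp add: grad_uminus)
    qed
    moreover have "indicator {x. 0 < - \<psi> x} x * divergence Y x = indicator E x * divergence Y x" for x
    proof (cases "x \<in> K")
      case True
      then have "x \<in> U0" using K(2) r(2) by blast
      then have "x \<in> E \<longleftrightarrow> \<psi> x < 0" using C(6) by blast
      then show ?thesis by (simp add: indicator_def)
    qed (simp add: divergence_zero_outside[OF K(1) YK])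
    ultimately have I1: "(LBINT x. indicator E x * divergence Y x) = 0" by (simp only:)
    have I2: "(LBINT x. indicator E x * pd b f x) = \<epsilon> * (\<integral>y. f (y + g y *\<^sub>R b) \<partial>hyperplane_measure b)"
      by (rule graph_integral_derivative[OF p fU K(1,2) _ fK E side e]) (use r(2) in auto)
    have dec: "divergence X x = divergence Y x + pd b f x" for x
    proof -
      have fb: "(\<lambda>y. f y *\<^sub>R b) differentiable at x" using fd[of x] by (intro differentiable_scaleR) auto
      have "divergence X x = divergence (\<lambda>y. Y y + f y *\<^sub>R b) x" unfolding Y_def by simp
      also have "\<dots> = divergence Y x + divergence (\<lambda>y. f y *\<^sub>R b) x" by (rule divergence_add[OF Yd fb])
      also have "divergence (\<lambda>y. f y *\<^sub>R b) x = pd b f x"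
        using divergence_scaleR[OF fd[of x], where X = "\<lambda>_. b"] grad_inner[OF fd] by (simp add: divergence_def)
      finally show ?thesis .
    qed
    have fc: "C1_compact f" unfolding C1_compact_def using fU K(1) fK by blast
    have i1: "integrable lborel (\<lambda>x. indicator E x * divergence Y x)"
      by (rule integrable_indicator_mult[OF integrable_divergence[OF open_UNIV YU K(1) subset_UNIV YK] E])
    have i2: "integrable lborel (\<lambda>x. indicator E x * pd b f x)"
      by (rule integrable_indicator_mult[OF C1_compact_pd(1)[OF fc D(1)] E])
    have L: "(LBINT x. indicator E x * divergence X x) = \<epsilon> * (\<integral>y. f (y + g y *\<^sub>R b) \<partial>hyperplane_measure b)"
      unfolding dec distrib_left using Bochner_Integration.integral_add[OF i1 i2] I1 I2 by simp
    let ?F = "\<lambda>x. X x \<bullet> sgn (grad \<psi> x)"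
    have FB: "continuous_on ?B ?F"
      using continuous_on_subset[OF continuous_on_sgn_grad[OF c], of ?B] r(2)
        continuous_on_subset[OF Ck_field_continuous[OF X], of ?B] by (intro continuous_on_inner) auto
    have F0: "?F x = 0" if "x \<notin> ?B" for x
    proof -
      have "X x = 0" using K(2,3) that by blast
      then show ?thesis by simp
    qed
    have fB0: "f x = 0" if "x \<notin> ?B" for x
      by (rule fK) (use K(2) that in blast)
    have Feq: "(\<lambda>x. indicator ?B x *\<^sub>R ?F x) = ?F" by (rule ext) (use F0 in \<open>auto simp: indicator_def\<close>)
    have Fm: "?F \<in> borel_measurable borel"
      using borel_measurable_continuous_on_indicator[OF _ FB] unfolding Feq by simp
    have "(\<integral>x. ?F x \<partial>graph_measure b U g) = (\<integral>y. ?F (y + g y *\<^sub>R b) * graph_weight g y \<partial>hyperplane_measure b)"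
      by (rule integral_graph_measure[OF p Fm F0]) (use r(2) in auto)
    also have "\<dots> = (\<integral>y. \<epsilon> * f (y + g y *\<^sub>R b) \<partial>hyperplane_measure b)"
    proof (rule integral_cong_AE)
      have ind: "(\<lambda>y. indicator (graph_dom b ?B g) y *\<^sub>R h (y + g y *\<^sub>R b)) = (\<lambda>y. h (y + g y *\<^sub>R b))"
        if "\<And>x. x \<notin> ?B ==> h x = 0" for h :: "'a \<Rightarrow> real"
        by (rule ext) (use that in \<open>auto simp: graph_dom_def indicator_def\<close>)
      have "continuous_on ?B (\<lambda>x. ?F x * graph_weight g x)"
        by (intro continuous_on_mult FB graph_weight_continuous[OF p'])
      from graph_map_measurable[OF p' this]
      show "(\<lambda>y. ?F (y + g y *\<^sub>R b) * graph_weight g y) \<in> borel_measurable (hyperplane_measure b)"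
        by (subst (asm) ind) (use F0 in \<open>auto simp: graph_weight_invariant[OF p]\<close>)
      have "continuous_on ?B (\<lambda>x. \<epsilon> * f x)" by (intro continuous_intros Ck_on_imp_continuous[OF fB])
      from graph_map_measurable[OF p' this]
      show "(\<lambda>y. \<epsilon> * f (y + g y *\<^sub>R b)) \<in> borel_measurable (hyperplane_measure b)"
        by (subst (asm) ind) (simp_all add: fB0)
      show "AE y in hyperplane_measure b. ?F (y + g y *\<^sub>R b) * graph_weight g y = \<epsilon> * f (y + g y *\<^sub>R b)"
        using AE_hyperplane[OF D(1)]
      proof eventually_elim
        case (elim y)
        let ?x = "y + g y *\<^sub>R b"
        show ?case
        proof (cases "?x \<in> ?B")
          case True
          have xb: "?x \<bullet> b = g ?x" using elim D(4,6) by (simp add: inner_add_left)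
          have xU: "?x \<in> U" using True r(2) by blast
          define k where "k = grad \<psi> ?x \<bullet> b"
          have g1: "grad \<psi> ?x = k *\<^sub>R (b - grad g ?x)" unfolding k_def
          proof (rule grad_on_graph[OF p oB _ True xb])
            show "?B \<subseteq> U" using r(2) by blast
            show "\<psi> differentiable at ?x" using C(7) True r(2) by blast
            show "\<psi> z = 0" if "z \<in> ?B" "z \<bullet> b = g z" for z using that D(5) S r(2) by blast
          qed
          have "(norm (b - grad g ?x))\<^sup>2 = 1 + (norm (grad g ?x))\<^sup>2"
            using norm_add_Pythagorean[of b "- grad g ?x"] graph_grad_orthogonal[OF p xU] D(7)
            by (simp add: orthogonal_def inner_commute[of b])
          then have "norm (b - grad g ?x) = graph_weight g ?x"
            unfolding graph_weight_def by (metis norm_ge_zero real_sqrt_unique)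
          then have ng: "norm (grad \<psi> ?x) = \<bar>k\<bar> * graph_weight g y"
            by (subst g1) (simp add: graph_weight_invariant[OF p])
          have kp: "\<epsilon> * k > 0" unfolding k_def by (rule pos[OF True])
          then have ka: "\<bar>k\<bar> = \<epsilon> * k" "k \<noteq> 0" using e by (auto simp: abs_if)
          have w: "graph_weight g y \<noteq> 0" using graph_weight_pos[of g y] by simp
          have "?F ?x * graph_weight g y = (X ?x \<bullet> grad \<psi> ?x) / (\<epsilon> * k)"
            unfolding sgn_div_norm ng ka(1) using w kp by (simp add: field_simps)
          also have "\<dots> = \<epsilon> * f ?x" unfolding f_def k_def[symmetric] using e ka(2) by auto
          finally show ?thesis .
        next
          case False
          then have "?F ?x = 0" "f ?x = 0" using F0 fK K(2) by blast+
          then show ?thesis by (simp only: mult_zero_left mult_zero_right)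
        qed
      qed
    qed
    finally show "(LBINT x. indicator E x * divergence X x) = (\<integral>x. ?F x \<partial>graph_measure b U g)"
      unfolding L by simp
  qed
qed

section \<open>Existence of the surface measure\<close>

text \<open>Countably many of the neighbourhoods cover the set, and they can be made disjoint.\<close>

lemma measures_agree_locally:
  fixes M N :: "'a::euclidean_space measure"
  assumes s: "sets M = sets borel" "sets N = sets borel"
    and loc: "\<And>x. x \<in> A ==> \<exists>G. open G \<and> x \<in> G \<and> (\<forall>B\<in>sets borel. B \<subseteq> A \<inter> G \<longrightarrow> emeasure M B = emeasure N B)"
    and C: "C \<in> sets borel" "C \<subseteq> A"
  shows "emeasure M C = emeasure N C"
proof -
  obtain G where G: "\<And>x. x \<in> A ==> open (G x) \<and> x \<in> G x \<and> (\<forall>B\<in>sets borel. B \<subseteq> A \<inter> G x \<longrightarrow> emeasure M B = emeasure N B)"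
    using loc by metis
  obtain F' where F': "F' \<subseteq> G ` A" "countable F'" "\<Union>F' = \<Union>(G ` A)"
    using Lindelof[of "G ` A"] G by blast
  show ?thesis
  proof (cases "C = {}")
    case False
    then have ne: "F' \<noteq> {}" using C(2) F'(3) G by force
    define H where "H = from_nat_into F'"
    have H: "range H = F'" unfolding H_def by (rule range_from_nat_into[OF ne F'(2)])
    have Hb: "H n \<in> sets borel" for n
    proof -
      have "H n \<in> G ` A" using H F'(1) by blast
      then show ?thesis using G by (auto intro: borel_open)
    qed
    let ?D = "\<lambda>n. C \<inter> disjointed H n"
    have Db: "?D n \<in> sets borel" for n
      using sets.range_disjointed_sets[of H borel] Hb C(1) by (intro sets.Int) auto
    have dj: "disjoint_family ?D"
      using disjoint_family_disjointed[of H] unfolding disjoint_family_on_def by blast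
    have un: "(\<Union>n. ?D n) = C"
    proof -
      have "(\<Union>n. disjointed H n) = \<Union>F'" using UN_disjointed_eq[of H] H by auto
      moreover have "C \<subseteq> \<Union>F'"
      proof
        fix x assume "x \<in> C"
        then have "x \<in> A" using C(2) by blast
        then show "x \<in> \<Union>F'" unfolding F'(3) using G[of x] by blast
      qed
      ultimately show ?thesis by auto
    qed
    have e: "emeasure M (?D n) = emeasure N (?D n)" for n
    proof -
      have "H n \<in> G ` A" using H F'(1) by blast
      then obtain x where x: "x \<in> A" "H n = G x" by blast
      have "?D n \<subseteq> A \<inter> G x" using C(2) disjointed_subset[of H n] x(2) by blast
      then show ?thesis using G[OF x(1)] Db by blast
    qed
    have rg: "range ?D \<subseteq> sets M" "range ?D \<subseteq> sets N" unfolding s using Db by blast+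
    have "emeasure M C = (\<Sum>n. emeasure M (?D n))"
      using suminf_emeasure[OF rg(1) dj] unfolding un by simp
    also have "\<dots> = (\<Sum>n. emeasure N (?D n))" by (simp only: e)
    also have "\<dots> = emeasure N C" using suminf_emeasure[OF rg(2) dj] unfolding un by simp
    finally show ?thesis .
  qed simp
qed

lemma Ck_on_sgn_grad:
  assumes c: "boundary_chart E x U \<psi>" shows "Ck_on k U (\<lambda>y. sgn (grad \<psi> y) \<bullet> i)"
proof -
  note C = boundary_chartD[OF c]
  have "Ck_on k U (\<lambda>y. (grad \<psi> y \<bullet> i) / ((norm (grad \<psi> y))\<^sup>2 powr (1 / 2)))"
    by (intro Ck_on_divide Ck_on_grad_inner Ck_on_compose_real[OF C(1) Ck_on_norm_grad_sq Ck_on_powr] C(1) smooth_onD[OF C(3)])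
      (use C(4) in auto)
  moreover have "(grad \<psi> y \<bullet> i) / ((norm (grad \<psi> y))\<^sup>2 powr (1 / 2)) = sgn (grad \<psi> y) \<bullet> i" for y
  proof -
    have "(norm (grad \<psi> y))\<^sup>2 powr (1 / 2) = norm (grad \<psi> y)" by (simp add: powr_half_sqrt)
    then show ?thesis by (simp only: sgn_div_norm inner_scaleR_left divide_inverse_commute)
  qed
  ultimately show ?thesis by simp
qed

lemma integrable_finite_support:
  fixes f :: "'a::euclidean_space \<Rightarrow> real"
  assumes "sets M = sets borel" "f \<in> borel_measurable borel" "K \<in> sets borel" "emeasure M K < \<infinity>"
    "\<And>x. x \<in> K ==> \<bar>f x\<bar> \<le> B" "\<And>x. x \<notin> K ==> f x = 0"
  shows "integrable M f"
proof (rule Bochner_Integration.integrable_bound)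
  show "integrable M (\<lambda>x. indicator K x * B)"
    using assms(1,3,4) by (intro integrable_mult_left integrable_real_indicator) auto
  show "f \<in> borel_measurable M" using assms(1,2) measurable_cong_sets by blast
  show "AE x in M. norm (f x) \<le> norm (indicator K x * B)"
  proof (rule AE_I2)
    fix x show "norm (f x) \<le> norm (indicator K x * B)"
      using assms(5)[of x] assms(6)[of x] by (cases "x \<in> K") auto
  qed
qed

text \<open>For a test function \<open>\<zeta>\<close>, the flux of \<open>\<zeta>\<close> times the unit normal computes \<open>\<integral>\<zeta>\<close> with respect to either
  graph measure, and the flux is a volume integral that does not refer to a graph. No change of
  variables between the two coordinate hyperplanes is needed.\<close>

lemma graph_measures_agree:
  assumes bd: "bounds E S" and E: "E \<in> sets borel"
    and p1: "graph_patch S b1 U1 g1" and p2: "graph_patch S b2 U2 g2"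
    and C: "C \<in> sets borel" "C \<subseteq> S \<inter> U1 \<inter> U2"
  shows "emeasure (graph_measure b1 U1 g1) C = emeasure (graph_measure b2 U2 g2) C"
proof (rule measures_agree_locally[OF _ _ _ C])
  fix x assume x: "x \<in> S \<inter> U1 \<inter> U2"
  obtain U \<psi> where c: "boundary_chart E x U \<psi>" "S \<inter> U = {y \<in> U. \<psi> y = 0}"
    using boundsE[OF bd] x by blast
  have xx: "x \<in> U1" "x \<in> U2" "x \<in> S" using x by auto
  obtain r1 where r1: "r1 > 0" "ball x r1 \<subseteq> U1 \<inter> U" and f1:
    "\<And>X K. Ck_field 1 UNIV X ==> compact K ==> K \<subseteq> ball x r1 ==> (\<And>x. x \<notin> K ==> X x = 0) ==>
      (LBINT x. indicator E x * divergence X x) = (\<integral>x. X x \<bullet> sgn (grad \<psi> x) \<partial>graph_measure b1 U1 g1)"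
    using chart_graph_flux[OF c p1 xx(1,3) E] by blast
  obtain r2 where r2: "r2 > 0" "ball x r2 \<subseteq> U2 \<inter> U" and f2:
    "\<And>X K. Ck_field 1 UNIV X ==> compact K ==> K \<subseteq> ball x r2 ==> (\<And>x. x \<notin> K ==> X x = 0) ==>
      (LBINT x. indicator E x * divergence X x) = (\<integral>x. X x \<bullet> sgn (grad \<psi> x) \<partial>graph_measure b2 U2 g2)"
    using chart_graph_flux[OF c p2 xx(2,3) E] by blast
  define r where "r = min r1 r2 / 2"
  let ?A = "ball x r"
  have r: "r > 0" "cball x r \<subseteq> ball x r1" "cball x r \<subseteq> ball x r2"
    unfolding r_def using r1(1) r2(1) by (auto simp: subset_iff)
  have A: "?A \<subseteq> cball x r" by auto
  have cU: "cball x r \<subseteq> U1" "cball x r \<subseteq> U2" "?A \<subseteq> U" using r(2,3) r1(2) r2(2) A by blast+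
  have fin: "emeasure (graph_measure b1 U1 g1) (cball x r) < \<infinity>" "emeasure (graph_measure b2 U2 g2) (cball x r) < \<infinity>"
    using graph_measure_compact_finite[OF p1 compact_cball cU(1)] graph_measure_compact_finite[OF p2 compact_cball cU(2)] by auto
  have eq: "(\<integral>\<^sup>+x. ennreal (\<zeta> x) \<partial>graph_measure b1 U1 g1) = (\<integral>\<^sup>+x. ennreal (\<zeta> x) \<partial>graph_measure b2 U2 g2)"
    if t: "test_function ?A \<zeta>" "\<forall>x. 0 \<le> \<zeta> x \<and> \<zeta> x \<le> 1" for \<zeta>
  proof -
    obtain K where K: "compact K" "K \<subseteq> ?A" "\<And>x. x \<notin> K ==> \<zeta> x = 0"
      using t unfolding test_function_def by blast
    have zm: "\<zeta> \<in> borel_measurable borel"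
      using test_function_continuous[OF t(1)] by (rule borel_measurable_continuous_onI)
    let ?X = "\<lambda>x. \<zeta> x *\<^sub>R sgn (grad \<psi> x)"
    note Cc = boundary_chartD[OF c(1)]
    have X: "Ck_field 1 UNIV ?X"
    proof
      fix i :: 'a assume "i \<in> Basis"
      have "Ck_on 1 UNIV (\<lambda>x. \<zeta> x * (sgn (grad \<psi> x) \<bullet> i))"
        by (rule Ck_on_glue[OF Cc(1) Ck_on_sgn_grad[OF c(1)] _ K(1) _ K(3)])
          (use t(1) K(2) cU(3) smooth_onD in \<open>auto simp: test_function_def simp del: Ck_on.simps One_nat_def\<close>)
      then show "Ck_on 1 UNIV (\<lambda>x. ?X x \<bullet> i)" by (simp only: inner_scaleR_left)
    qed
    have Xs: "?X x \<bullet> sgn (grad \<psi> x) = \<zeta> x" for x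
    proof (cases "x \<in> K")
      case True
      then have "norm (sgn (grad \<psi> x)) = 1" using K(2) cU(3) Cc(4) by (auto simp: norm_sgn)
      then show ?thesis by (simp add: dot_square_norm)
    qed (simp add: K(3))
    have X0: "?X x = 0" if "x \<notin> K" for x using K(3)[OF that] by simp
    have Kr: "K \<subseteq> ball x r1" "K \<subseteq> ball x r2" using K(2) A r(2,3) by blast+
    have "(\<integral>x. \<zeta> x \<partial>graph_measure b1 U1 g1) = (\<integral>x. \<zeta> x \<partial>graph_measure b2 U2 g2)"
      using f1[OF X K(1) Kr(1) X0] f2[OF X K(1) Kr(2) X0] unfolding Xs by linarith
    moreover have "integrable (graph_measure b1 U1 g1) \<zeta>" "integrable (graph_measure b2 U2 g2) \<zeta>"
      using t(2) K(2,3) A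
      by (intro integrable_finite_support[OF _ zm _ fin(1), where B = 1]
          integrable_finite_support[OF _ zm _ fin(2), where B = 1]; force)+
    ultimately show ?thesis using t(2) by (simp add: nn_integral_eq_integral)
  qed
  have "emeasure (graph_measure b1 U1 g1) B = emeasure (graph_measure b2 U2 g2) B" if "B \<in> sets borel" "B \<subseteq> S \<inter> U1 \<inter> U2 \<inter> ?A" for B
  proof (rule measures_eq_of_test_functions[OF _ _ _ _ eq that(1)])
    show "emeasure (graph_measure b1 U1 g1) ?A < \<infinity>"
      using fin(1) emeasure_mono[OF A, of "graph_measure b1 U1 g1"] by (simp add: order_le_less_trans)
  qed (use that in auto)
  then show "\<exists>G. open G \<and> x \<in> G \<and> (\<forall>B\<in>sets borel. B \<subseteq> S \<inter> U1 \<inter> U2 \<inter> G \<longrightarrow>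
      emeasure (graph_measure b1 U1 g1) B = emeasure (graph_measure b2 U2 g2) B)"
    using r(1) by (intro exI[of _ ?A]) auto
qed auto

lemma finite_sum_measure:
  fixes M :: "nat \<Rightarrow> 'a::euclidean_space measure"
  assumes s: "\<And>i. sets (M i) = sets borel" and Q: "\<And>i. Q i \<in> sets borel"
  obtains \<sigma> where "sets \<sigma> = sets borel" "\<And>E. E \<in> sets borel ==> emeasure \<sigma> E = (\<Sum>i<(n::nat). emeasure (M i) (E \<inter> Q i))"
proof -
  let ?\<mu> = "\<lambda>E. \<Sum>i<n. emeasure (M i) (E \<inter> Q i)"
  define \<sigma> where "\<sigma> = measure_of UNIV (sets borel) ?\<mu>"
  have sa: "sigma_algebra UNIV (sets (borel :: 'a measure))"
    using sets.sigma_algebra_axioms[of "borel :: 'a measure"] by simp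
  have ss: "sets \<sigma> = sets borel" unfolding \<sigma>_def
    using sets.sigma_sets_eq[of "borel :: 'a measure"] by (subst sets_measure_of) auto
  have ca: "countably_additive (sets borel) ?\<mu>"
    unfolding countably_additive_def
  proof (intro allI impI)
    fix A :: "nat \<Rightarrow> 'a set" assume A: "range A \<subseteq> sets borel" "disjoint_family A"
    have "(\<Sum>k. ?\<mu> (A k)) = (\<Sum>i<n. \<Sum>k. emeasure (M i) (A k \<inter> Q i))"
      by (rule suminf_sum) auto
    also have "\<dots> = (\<Sum>i<n. emeasure (M i) ((\<Union>k. A k) \<inter> Q i))"
    proof (rule sum.cong[OF refl])
      fix i
      have "(\<Sum>k. emeasure (M i) (A k \<inter> Q i)) = emeasure (M i) (\<Union>k. A k \<inter> Q i)"
      proof (rule suminf_emeasure)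
        show "range (\<lambda>k. A k \<inter> Q i) \<subseteq> sets (M i)" using A(1) Q s by auto
        show "disjoint_family (\<lambda>k. A k \<inter> Q i)" using A(2) unfolding disjoint_family_on_def by blast
      qed
      then show "(\<Sum>k. emeasure (M i) (A k \<inter> Q i)) = emeasure (M i) ((\<Union>k. A k) \<inter> Q i)" by simp
    qed
    finally show "(\<Sum>k. ?\<mu> (A k)) = ?\<mu> (\<Union>k. A k)" .
  qed
  have "emeasure \<sigma> E = ?\<mu> E" if "E \<in> sets borel" for E
    unfolding \<sigma>_def
    by (rule emeasure_measure_of_sigma[OF sa _ ca that]) (simp add: positive_def)
  then show ?thesis using that ss by blast
qed

text \<open>Finitely many graphs cover the compact hypersurface. It is cut into disjoint Borel pieces, each
  inside one graph, and the measures of the pieces are added; \<open>graph_measures_agree\<close> shows that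
  the result restricts to the graph measure on every patch.\<close>

lemma surface_measure_exists:
  assumes bd: "bounds E S" and E: "E \<in> sets borel" shows "\<exists>\<sigma>. is_surface_measure S \<sigma>"
proof -
  have Sb: "S \<in> sets borel" using bounds_compact[OF bd] by (simp add: borel_compact)
  have "\<exists>b U g. graph_patch S b U g \<and> x \<in> U" if "x \<in> S" for x
    using bounds_graph_patch[OF bd that] by metis
  then obtain b U g where pt: "\<And>x. x \<in> S ==> graph_patch S (b x) (U x) (g x) \<and> x \<in> U x" by metis
  have "S \<subseteq> (\<Union>x\<in>S. U x)" "\<And>x. x \<in> S ==> open (U x)" using pt graph_patchD(2) by blast+
  from compactE_image[OF bounds_compact[OF bd] this(2,1)]
  obtain F where F: "F \<subseteq> S" "finite F" "S \<subseteq> (\<Union>x\<in>F. U x)" by blast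
  obtain n :: nat and h where h: "F = h ` {i. i < n}" using finite_imp_nat_seg_image_inj_on[OF F(2)] by blast
  define Q where "Q = (\<lambda>i. (if i < n then S \<inter> U (h i) - (\<Union>j<i. U (h j)) else {}))"
  have hS: "h i \<in> S" if "i < n" for i using h F(1) that by blast
  have Ub: "U (h i) \<in> sets borel" if "i < n" for i using pt[OF hS[OF that]] graph_patchD(2) by (metis borel_open)
  have Qb: "Q i \<in> sets borel" for i unfolding Q_def using Sb Ub by auto
  define M where "M = (\<lambda>i. graph_measure (b (h i)) (U (h i)) (g (h i)))"
  have Ms: "sets (M i) = sets borel" for i unfolding M_def by simp
  obtain \<sigma> where sg: "sets \<sigma> = sets borel"
    "\<And>E. E \<in> sets borel ==> emeasure \<sigma> E = (\<Sum>i<n. emeasure (M i) (E \<inter> Q i))"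
    by (rule finite_sum_measure[of M Q n, OF Ms Qb]) blast
  have QS: "Q i \<subseteq> S" for i unfolding Q_def by auto
  have cov: "(\<Union>i<n. Q i) = S"
  proof
    show "S \<subseteq> (\<Union>i<n. Q i)"
    proof
      fix x assume x: "x \<in> S"
      then obtain i where i: "i < n" "x \<in> U (h i)" using F(3) h by auto
      define k where "k = (LEAST i. x \<in> U (h i))"
      have k: "x \<in> U (h k)" "k \<le> i" unfolding k_def using i(2) by (auto intro: LeastI Least_le)
      have "x \<notin> U (h j)" if "j < k" for j using not_less_Least that unfolding k_def by blast
      then have "x \<in> Q k" unfolding Q_def using x k i(1) by auto
      then show "x \<in> (\<Union>i<n. Q i)" using k(2) i(1) by auto
    qed
  qed (use QS in blast)
  have dis: "Q i \<inter> Q j = {}" if "i < j" for i j using that unfolding Q_def by auto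
  have disj: "disjoint_family_on Q {..<n}"
    unfolding disjoint_family_on_def using dis by (metis Int_commute linorder_neqE_nat)
  have "is_surface_measure S \<sigma>"
    unfolding is_surface_measure_iff
  proof (intro conjI allI impI ballI sg(1))
    have "emeasure \<sigma> (- S) = (\<Sum>i<n. emeasure (M i) (- S \<inter> Q i))"
      by (rule sg(2)) (use Sb in auto)
    also have "\<dots> = 0"
    proof (rule sum.neutral, rule ballI)
      fix i
      have "- S \<inter> Q i = {}" using QS by blast
      then show "emeasure (M i) (- S \<inter> Q i) = 0" by simp
    qed
    finally show "emeasure \<sigma> (- S) = 0" .
    fix b' U' g' and C :: "'a set" assume p: "graph_patch S b' U' g'" and C: "C \<in> sets borel" "C \<subseteq> S \<inter> U'"
    have "emeasure \<sigma> C = (\<Sum>i<n. emeasure (M i) (C \<inter> Q i))"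
      by (rule sg(2)[OF C(1)])
    also have "\<dots> = (\<Sum>i<n. emeasure (graph_measure b' U' g') (C \<inter> Q i))"
    proof (rule sum.cong[OF refl])
      fix i assume "i \<in> {..<n}"
      then have i: "i < n" by simp
      show "emeasure (M i) (C \<inter> Q i) = emeasure (graph_measure b' U' g') (C \<inter> Q i)"
        unfolding M_def
      proof (rule graph_measures_agree[OF bd E _ p])
        show "graph_patch S (b (h i)) (U (h i)) (g (h i))" using pt[OF hS[OF i]] by blast
        show "C \<inter> Q i \<in> sets borel" using C(1) Qb by auto
        have "Q i \<subseteq> U (h i)" unfolding Q_def by auto
        then show "C \<inter> Q i \<subseteq> S \<inter> U (h i) \<inter> U'" using C(2) by blast
      qed
    qed
    also have "\<dots> = emeasure (graph_measure b' U' g') (\<Union>i<n. C \<inter> Q i)"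
      by (rule sum_emeasure) (use C Qb disj in \<open>auto simp: disjoint_family_on_def\<close>)
    also have "(\<Union>i<n. C \<inter> Q i) = C" using cov C(2) by blast
    finally show "emeasure \<sigma> C = emeasure (graph_measure b' U' g') C" .
  qed
  then show ?thesis by blast
qed

lemma surface_measure_props:
  assumes bd: "bounds E S" and E: "E \<in> sets borel"
  shows "sets (surface_measure S) = sets borel" "emeasure (surface_measure S) (- S) = 0"
    "\<And>b U g C. graph_patch S b U g ==> C \<in> sets borel ==> C \<subseteq> S \<inter> U ==>
      emeasure (surface_measure S) C = emeasure (graph_measure b U g) C"
proof -
  have "is_surface_measure S (surface_measure S)"
    unfolding surface_measure_def by (rule someI_ex[OF surface_measure_exists[OF assms]])
  then show "sets (surface_measure S) = sets borel" "emeasure (surface_measure S) (- S) = 0"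
    "\<And>b U g C. graph_patch S b U g ==> C \<in> sets borel ==> C \<subseteq> S \<inter> U ==>
      emeasure (surface_measure S) C = emeasure (graph_measure b U g) C"
    unfolding is_surface_measure_iff by blast+
qed

lemma bounds_borel: "bounds E S ==> S \<in> sets borel"
  by (rule borel_compact) (rule bounds_compact)

lemma surface_measure_finite:
  assumes bd: "bounds E S" and E: "E \<in> sets borel"
  shows "emeasure (surface_measure S) S < \<infinity>"
proof -
  note sm = surface_measure_props[OF assms]
  have Sb: "S \<in> sets borel" by (rule bounds_borel[OF bd])
  have "\<exists>e>0. emeasure (surface_measure S) (S \<inter> ball x e) < \<infinity>" if x: "x \<in> S" for x
  proof -
    obtain b U g where p: "graph_patch S b U g" "x \<in> U" using bounds_graph_patch[OF bd x] .
    obtain e where e: "e > 0" "cball x e \<subseteq> U" using graph_patchD(2)[OF p(1)] p(2) open_contains_cball by blast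
    have "emeasure (surface_measure S) (S \<inter> ball x e) = emeasure (graph_measure b U g) (S \<inter> ball x e)"
      by (rule sm(3)[OF p(1)]) (use Sb e in auto)
    also have "\<dots> \<le> emeasure (graph_measure b U g) (cball x e)" by (rule emeasure_mono) auto
    also have "\<dots> < \<infinity>" by (rule graph_measure_compact_finite[OF p(1) compact_cball e(2)])
    finally show ?thesis using e(1) by blast
  qed
  then obtain e where e: "\<And>x. x \<in> S ==> e x > 0 \<and> emeasure (surface_measure S) (S \<inter> ball x (e x)) < \<infinity>" by metis
  have c: "S \<subseteq> (\<Union>x\<in>S. ball x (e x))" using e by force
  obtain F where F: "F \<subseteq> S" "finite F" "S \<subseteq> (\<Union>x\<in>F. ball x (e x))"
    by (rule compactE_image[OF bounds_compact[OF bd] _ c]) auto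
  have "emeasure (surface_measure S) S \<le> emeasure (surface_measure S) (\<Union>x\<in>F. S \<inter> ball x (e x))"
  proof (rule emeasure_mono)
    show "S \<subseteq> (\<Union>x\<in>F. S \<inter> ball x (e x))" using F(3) by blast
    show "(\<Union>x\<in>F. S \<inter> ball x (e x)) \<in> sets (surface_measure S)"
      unfolding sm(1) by (intro sets.finite_UN F(2) sets.Int Sb) simp
  qed
  also have "\<dots> \<le> (\<Sum>x\<in>F. emeasure (surface_measure S) (S \<inter> ball x (e x)))"
  proof (rule emeasure_subadditive_finite[OF F(2)])
    show "(\<lambda>x. S \<inter> ball x (e x)) ` F \<subseteq> sets (surface_measure S)"
      unfolding sm(1) using Sb by (intro image_subsetI sets.Int) simp_all
  qed
  also have "\<dots> < \<infinity>"
  proof -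
    have "\<forall>x\<in>F. emeasure (surface_measure S) (S \<inter> ball x (e x)) < \<infinity>" using e F(1) by blast
    then show ?thesis using F(2) by simp
  qed
  finally show ?thesis .
qed

lemma surface_indicator_measurable:
  assumes bd: "bounds E S" and f: "continuous_on S f"
  shows "(\<lambda>x. indicator S x * f x :: real) \<in> borel_measurable borel"
  using borel_measurable_continuous_on_indicator[OF bounds_borel[OF bd] f] by simp

lemma surface_integrable:
  fixes f :: "'a::euclidean_space \<Rightarrow> real"
  assumes bd: "bounds E S" and E: "E \<in> sets borel" and f: "continuous_on S f"
  shows "set_integrable (surface_measure S) S f"
proof -
  have "compact (f ` S)" using bounds_compact[OF bd] f compact_continuous_image by blast
  then have "bounded (f ` S)" by (rule compact_imp_bounded)
  then obtain B where "\<forall>y\<in>f ` S. norm y \<le> B" unfolding bounded_iff by blast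
  then have B: "\<bar>f x\<bar> \<le> B" if "x \<in> S" for x using that by auto
  have "integrable (surface_measure S) (\<lambda>x. indicator S x * f x)"
    by (rule integrable_finite_support[OF surface_measure_props(1)[OF bd E] surface_indicator_measurable[OF bd f]
          bounds_borel[OF bd] surface_measure_finite[OF bd E], where B = B]) (use B in auto)
  then show ?thesis unfolding set_integrable_def by simp
qed

lemma surface_integral_add:
  assumes bd: "bounds E S" and E: "E \<in> sets borel" and f: "continuous_on S f" "continuous_on S g"
  shows "surface_integral S (\<lambda>x. f x + g x) = surface_integral S f + surface_integral S g"
  unfolding surface_integral_def
  using set_integral_add(2)[OF surface_integrable[OF bd E f(1)] surface_integrable[OF bd E f(2)]] .

lemma surface_integral_cmult: "surface_integral S (\<lambda>x. c * f x) = c * surface_integral S f"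
  unfolding surface_integral_def by simp

lemma surface_integral_cong: "(\<And>x. x \<in> S ==> f x = g x) ==> surface_integral S f = surface_integral S g"
  unfolding surface_integral_def set_lebesgue_integral_def
  by (rule Bochner_Integration.integral_cong) (auto simp: indicator_def)

text \<open>Reduces an integral with respect to the chosen surface measure to an explicit one when the
  integrand is supported in a single graph.\<close>

lemma surface_integral_patch:
  fixes f :: "'a::euclidean_space \<Rightarrow> real"
  assumes bd: "bounds E S" and E: "E \<in> sets borel" and p: "graph_patch S b U g"
    and f: "f \<in> borel_measurable borel" "\<And>x. x \<notin> U ==> f x = 0"
  shows "surface_integral S f = integral\<^sup>L (graph_measure b U g) f"
proof -
  note sm = surface_measure_props[OF bd E]
  let ?gm = "graph_measure b U g"
  have Sb: "S \<in> sets borel" by (rule bounds_borel[OF bd])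
  have Ub: "U \<in> sets borel" using graph_patchD(2)[OF p] by simp
  let ?A = "S \<inter> U"
  have Ab: "?A \<in> sets borel" using Sb Ub by auto
  let ?N1 = "density (surface_measure S) (\<lambda>x. ennreal (indicator ?A x))"
  let ?N2 = "density ?gm (\<lambda>x. ennreal (indicator ?A x))"
  have em: "emeasure (density M (\<lambda>x. ennreal (indicator ?A x))) C = emeasure M (?A \<inter> C)"
    if "sets M = sets borel" "C \<in> sets borel" for M C
  proof -
    have "emeasure (density M (\<lambda>x. ennreal (indicator ?A x))) C = (\<integral>\<^sup>+x. ennreal (indicator ?A x) * indicator C x \<partial>M)"
      by (rule emeasure_density) (use that Ab in \<open>auto intro!: measurable_compose[OF borel_measurable_indicator measurable_ennreal]\<close>)
    also have "\<dots> = (\<integral>\<^sup>+x. indicator (?A \<inter> C) x \<partial>M)" by (rule nn_integral_cong) (auto simp: indicator_def)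
    also have "\<dots> = emeasure M (?A \<inter> C)" using that Ab by simp
    finally show ?thesis .
  qed
  have N: "?N1 = ?N2"
  proof (rule measure_eqI)
    show "sets ?N1 = sets ?N2" using sm(1) by simp
    fix C assume "C \<in> sets ?N1"
    then have C: "C \<in> sets borel" using sm(1) by simp
    show "emeasure ?N1 C = emeasure ?N2 C"
      unfolding em[OF sm(1) C] em[OF graph_measure_sets C] by (rule sm(3)[OF p]) (use Ab C in auto)
  qed
  have fm: "f \<in> borel_measurable (surface_measure S)" "f \<in> borel_measurable ?gm"
    using f(1) sm(1) measurable_cong_sets by (blast, simp)
  have im: "indicat_real ?A \<in> borel_measurable (surface_measure S)" "indicat_real ?A \<in> borel_measurable ?gm"
    using Ab sm(1) by (auto intro!: borel_measurable_indicator)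
  have "surface_integral S f = (\<integral>x. indicator ?A x *\<^sub>R f x \<partial>surface_measure S)"
    unfolding surface_integral_def set_lebesgue_integral_def
    by (rule Bochner_Integration.integral_cong) (use f(2) in \<open>auto simp: indicator_def\<close>)
  also have "\<dots> = integral\<^sup>L ?N1 f" by (rule integral_density[symmetric]) (use fm im in auto)
  also have "\<dots> = integral\<^sup>L ?N2 f" unfolding N ..
  also have "\<dots> = (\<integral>x. indicator ?A x *\<^sub>R f x \<partial>?gm)" by (rule integral_density) (use fm im in auto)
  also have "\<dots> = integral\<^sup>L ?gm f"
  proof (rule integral_cong_AE)
    have "U - S \<in> null_sets ?gm"
      using graph_measure_carrier[OF p, of "U - S"] Ub Sb by (auto intro!: null_setsI)
    then have "AE x in ?gm. x \<notin> U - S" by (rule AE_not_in)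
    then show "AE x in ?gm. indicator ?A x *\<^sub>R f x = f x"
      by eventually_elim (use f(2) in \<open>auto simp: indicator_def\<close>)
  qed (use fm im in auto)
  finally show ?thesis .
qed

text \<open>If \<open>f x0\<close> were not zero, \<open>f\<close> would have a fixed sign near \<open>x0\<close>, and a bump function times \<open>f\<close> would have
  a nonzero integral because small pieces of a hypersurface have positive measure. Bumps that are
  nonnegative suffice, which matters for one-sided variations.\<close>

lemma surface_density_zero:
  fixes f :: "'a::euclidean_space \<Rightarrow> real"
  assumes bd: "bounds E S" and E: "E \<in> sets borel" and x0: "x0 \<in> S" and f: "continuous_on S f" and r: "r > 0"
    and z: "\<And>\<zeta> K. smooth_on UNIV \<zeta> ==> (\<And>x. 0 \<le> \<zeta> x) ==> compact K ==> K \<subseteq> ball x0 r ==> (\<And>x. x \<notin> K ==> \<zeta> x = 0) ==>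
      surface_integral S (\<lambda>x. \<zeta> x * f x) = 0"
  shows "f x0 = 0"
proof (rule ccontr)
  assume nz: "f x0 \<noteq> 0"
  note sm = surface_measure_props[OF bd E]
  have Sb: "S \<in> sets borel" by (rule bounds_borel[OF bd])
  define s where "s = sgn (f x0)"
  have s: "s * f x0 > 0" "s \<noteq> 0" using nz unfolding s_def by (auto simp: sgn_if)
  obtain d where d: "d > 0" "\<And>x. x \<in> S ==> dist x x0 < d ==> dist (f x) (f x0) < \<bar>f x0\<bar>"
    using f x0 nz unfolding continuous_on_iff by (metis zero_less_abs_iff)
  have pos: "s * f x > 0" if "x \<in> S" "dist x x0 < d" for x
    using d(2)[OF that] s unfolding s_def dist_real_def by (auto simp: sgn_if abs_if split: if_splits)
  define e where "e = min r d / 4"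
  have e: "e > 0" "2 * e < r" "2 * e < d" using r d(1) unfolding e_def by auto
  let ?z = "plateau x0 e"
  note P = plateau_props[OF e(1), of x0]
  have zs: "smooth_on UNIV ?z" by (rule plateau_smooth[OF e(1)])
  have "surface_integral S (\<lambda>x. ?z x * f x) = 0"
    by (rule z[OF zs P(1) compact_cball[of x0 "2 * e"]]) (use e P(4) in auto)
  then have "surface_integral S (\<lambda>x. s * (?z x * f x)) = 0" by (simp only: surface_integral_cmult mult_zero_right)
  then have I0: "(\<integral>x. indicator S x * (s * (?z x * f x)) \<partial>surface_measure S) = 0"
    unfolding surface_integral_def set_lebesgue_integral_def by simp
  have zc: "continuous_on S ?z" using Ck_on_imp_continuous[OF smooth_onD[OF zs]] continuous_on_subset by blast
  have "continuous_on S (\<lambda>x. s * (?z x * f x))" by (intro continuous_intros zc f)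
  from surface_integrable[OF bd E this]
  have i: "integrable (surface_measure S) (\<lambda>x. indicator S x * (s * (?z x * f x)))"
    unfolding set_integrable_def by simp
  have nn: "0 \<le> indicator S x * (s * (?z x * f x))" for x
  proof (cases "x \<in> S \<and> dist x0 x < 2 * e")
    case True
    then have "s * f x > 0" using pos e(3) by (auto simp: dist_commute)
    then have "0 \<le> ?z x * (s * f x)" using P(1)[of x] by simp
    then show ?thesis by (auto simp: indicator_def mult.left_commute)
  next
    case False then show ?thesis using P(4)[of x] by (auto simp: indicator_def)
  qed
  have "AE x in surface_measure S. indicator S x * (s * (?z x * f x)) = 0"
    using integral_nonneg_eq_0_iff_AE[OF i] nn I0 by simp
  then have "AE x in surface_measure S. x \<notin> S \<inter> ball x0 e"
  proof eventually_elim
    case (elim x)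
    show ?case
    proof
      assume x: "x \<in> S \<inter> ball x0 e"
      then have "?z x = 1" using P(3)[of x] by simp
      moreover have "s * f x > 0" using pos[of x] x e by (auto simp: dist_commute)
      ultimately show False using elim x s(2) by auto
    qed
  qed
  then have n0: "emeasure (surface_measure S) (S \<inter> ball x0 e) = 0"
    using AE_iff_null_sets[of "S \<inter> ball x0 e" "surface_measure S"] Sb sm(1) by auto
  obtain b U g where p: "graph_patch S b U g" "x0 \<in> U" using bounds_graph_patch[OF bd x0] .
  have Ub: "U \<in> sets borel" using graph_patchD(2)[OF p(1)] by simp
  have "0 < emeasure (graph_measure b U g) (ball x0 e \<inter> U)"
    by (rule graph_measure_open_pos[OF p(1), of x0]) (use x0 p(2) e in auto)
  also have "\<dots> \<le> emeasure (graph_measure b U g) (S \<inter> ball x0 e \<inter> U) + emeasure (graph_measure b U g) ((ball x0 e \<inter> U) - S)"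
  proof -
    have "ball x0 e \<inter> U = (S \<inter> ball x0 e \<inter> U) \<union> ((ball x0 e \<inter> U) - S)" by blast
    then show ?thesis using emeasure_subadditive[of "S \<inter> ball x0 e \<inter> U" "graph_measure b U g" "(ball x0 e \<inter> U) - S"] Sb Ub by auto
  qed
  also have "emeasure (graph_measure b U g) ((ball x0 e \<inter> U) - S) = 0"
    by (rule graph_measure_carrier[OF p(1)]) (use Sb Ub in auto)
  also have "emeasure (graph_measure b U g) (S \<inter> ball x0 e \<inter> U) = emeasure (surface_measure S) (S \<inter> ball x0 e \<inter> U)"
    by (rule sm(3)[OF p(1), symmetric]) (use Sb Ub in auto)
  also have "\<dots> \<le> emeasure (surface_measure S) (S \<inter> ball x0 e)"
    by (rule emeasure_mono) (use Sb sm(1) in auto)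
  finally show False using n0 by simp
qed

section \<open>The divergence theorem\<close>

lemma local_divergence_theorem:
  assumes bd: "bounds E S" and E: "E \<in> sets borel" and x0: "x0 \<in> S"
  obtains r where "r > 0" "\<And>X K. Ck_field 1 UNIV X ==> compact K ==> K \<subseteq> ball x0 r ==> (\<And>x. x \<notin> K ==> X x = 0) ==>
      (LBINT x. indicator E x * divergence X x) = surface_integral S (\<lambda>x. X x \<bullet> outer_normal E x)"
proof -
  obtain U0 \<psi> where c: "boundary_chart E x0 U0 \<psi>" "S \<inter> U0 = {y \<in> U0. \<psi> y = 0}" using boundsE[OF bd x0] .
  obtain b U g where p: "graph_patch S b U g" "x0 \<in> U" using bounds_graph_patch[OF bd x0] .
  obtain r where r: "r > 0" "ball x0 r \<subseteq> U \<inter> U0" and fl: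
    "\<And>X K. Ck_field 1 UNIV X ==> compact K ==> K \<subseteq> ball x0 r ==> (\<And>x. x \<notin> K ==> X x = 0) ==>
      (LBINT x. indicator E x * divergence X x) = (\<integral>x. X x \<bullet> sgn (grad \<psi> x) \<partial>graph_measure b U g)"
    using chart_graph_flux[OF c p x0 E] by blast
  show ?thesis
  proof (rule that[OF r(1)])
    fix X :: "'a \<Rightarrow> 'a" and K assume X: "Ck_field 1 UNIV X" and K: "compact K" "K \<subseteq> ball x0 r" "\<And>x. x \<notin> K ==> X x = 0"
    let ?F = "\<lambda>x. X x \<bullet> sgn (grad \<psi> x)"
    have X0: "X x = 0" if "x \<notin> ball x0 r" for x by (rule K(3)) (use K(2) that in blast)
    have F0: "?F x = 0" if "x \<notin> U" for x using X0[of x] that r(2) by (metis IntD1 inner_zero_left subsetD)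
    have FB: "continuous_on (ball x0 r) ?F"
      using continuous_on_subset[OF continuous_on_sgn_grad[OF c(1)], of "ball x0 r"] r(2)
        continuous_on_subset[OF Ck_field_continuous[OF X], of "ball x0 r"] by (intro continuous_on_inner) auto
    have Feq: "(\<lambda>x. indicator (ball x0 r) x *\<^sub>R ?F x) = ?F"
      by (rule ext) (use X0 in \<open>auto simp: indicator_def\<close>)
    have Fm: "?F \<in> borel_measurable borel"
      using borel_measurable_continuous_on_indicator[OF _ FB] unfolding Feq by simp
    have "surface_integral S (\<lambda>x. X x \<bullet> outer_normal E x) = surface_integral S ?F"
    proof (rule surface_integral_cong)
      fix x assume x: "x \<in> S"
      show "X x \<bullet> outer_normal E x = ?F x"
      proof (cases "x \<in> ball x0 r")
        case True
        then have "outer_normal E x = sgn (grad \<psi> x)" using outer_normal_local[OF c, of x] x r(2) by blast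
        then show ?thesis by simp
      next
        case False
        then have "X x = 0" by (rule X0)
        then show ?thesis by simp
      qed
    qed
    also have "\<dots> = integral\<^sup>L (graph_measure b U g) ?F" by (rule surface_integral_patch[OF bd E p(1) Fm F0])
    also have "\<dots> = (LBINT x. indicator E x * divergence X x)" by (rule fl[OF X K, symmetric])
    finally show "(LBINT x. indicator E x * divergence X x) = surface_integral S (\<lambda>x. X x \<bullet> outer_normal E x)" by simp
  qed
qed

lemma bounds_disjoint:
  assumes "bounds E S" shows "S \<inter> E = {}"
proof (rule ccontr)
  assume "S \<inter> E \<noteq> {}"
  then obtain x where x: "x \<in> S" "x \<in> E" by blast
  obtain U \<psi> where c: "boundary_chart E x U \<psi>" "S \<inter> U = {y \<in> U. \<psi> y = 0}" using boundsE[OF assms x(1)] .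
  then show False using boundary_chartD(2,5,6)[OF c(1)] x by force
qed

lemma integrable_on_closure:
  fixes f :: "'a::euclidean_space \<Rightarrow> real"
  assumes E: "open E" "bounded E" and f: "continuous_on (closure E) f"
  shows "integrable lborel (\<lambda>x. indicator E x * f x)"
proof -
  have "compact (closure E)" using E(2) by simp
  then have "compact (f ` closure E)" using f compact_continuous_image by blast
  then have "bounded (f ` closure E)" by (rule compact_imp_bounded)
  then obtain B where "\<forall>y\<in>f ` closure E. norm y \<le> B" unfolding bounded_iff by blast
  then have B: "\<bar>f x\<bar> \<le> B" if "x \<in> E" for x using that closure_subset by auto
  have "(\<lambda>x. indicator E x *\<^sub>R f x) \<in> borel_measurable borel"
    by (rule borel_measurable_continuous_on_indicator[OF _ continuous_on_subset[OF f closure_subset]]) (use E in simp)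
  then show ?thesis by (intro bounded_set_integrable[OF E(2), of _ B]) (use B in auto)
qed

text \<open>The defect of the asserted identity is additive in the field and vanishes for fields supported
  in a small ball: inside \<open>E\<close> because the integral of the divergence of a compactly supported field
  is zero, and at boundary points by the local theorem. The finitely many plateau functions \<open>p a\<close> of
  a cover of the closure are subtracted one at a time, replacing the field \<open>Y\<close> by \<open>(1 - p a) Y\<close>; what
  remains vanishes on the closure. Two hypersurfaces are allowed because the region between the
  inner boundary and the shock has two boundary components.\<close>

theorem divergence_theorem:
  fixes X :: "'a::euclidean_space \<Rightarrow> 'a"
  assumes E: "open E" "bounded E" and S: "bounds E S" and T: "bounds E T" and disj: "S \<inter> T = {}"
    and fr: "frontier E \<subseteq> S \<union> T" and N: "open N" "closure E \<subseteq> N" and X: "Ck_field 1 N X"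
  shows "(LBINT x. indicator E x * divergence X x)
    = surface_integral S (\<lambda>x. X x \<bullet> outer_normal E x) + surface_integral T (\<lambda>x. X x \<bullet> outer_normal E x)"
proof -
  have Eb: "E \<in> sets borel" using E by simp
  have cl: "S \<subseteq> closure E" "T \<subseteq> closure E" using bounds_subset_closure S T by blast+
  define defect where "defect = (\<lambda>X. (LBINT x. indicator E x * divergence X x)
    - (surface_integral S (\<lambda>x. X x \<bullet> outer_normal E x) + surface_integral T (\<lambda>x. X x \<bullet> outer_normal E x)))"
  have cd: "continuous_on (closure E) (divergence X)" if "Ck_field 1 N X" for X
    using continuous_divergence[OF N(1) that] N(2) continuous_on_subset by blast
  have cn: "continuous_on S' (\<lambda>x. X x \<bullet> outer_normal E x)" if "Ck_field 1 N X" "bounds E S'" for X S'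
    using continuous_on_subset[OF Ck_field_continuous[OF that(1)], of S'] bounds_subset_closure[OF that(2)] N(2)
      continuous_on_outer_normal[OF that(2)] by (intro continuous_on_inner) auto
  have add: "defect (\<lambda>x. X x + Y x) = defect X + defect Y" if XY: "Ck_field 1 N X" "Ck_field 1 N Y" for X Y
  proof -
    have "(LBINT x. indicator E x * divergence (\<lambda>x. X x + Y x) x)
      = (LBINT x. indicator E x * divergence X x + indicator E x * divergence Y x)"
    proof (rule Bochner_Integration.integral_cong[OF refl])
      fix x
      show "indicator E x * divergence (\<lambda>x. X x + Y x) x = indicator E x * divergence X x + indicator E x * divergence Y x"
      proof (cases "x \<in> E")
        case True
        then have "x \<in> N" using N(2) closure_subset by blast
        then have "X differentiable at x" "Y differentiable at x"
          using Ck_field_differentiable[of 0 N] XY by simp_all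
        then show ?thesis by (simp add: divergence_add distrib_left)
      qed simp
    qed
    also have "\<dots> = (LBINT x. indicator E x * divergence X x) + (LBINT x. indicator E x * divergence Y x)"
      by (rule Bochner_Integration.integral_add; rule integrable_on_closure[OF E cd]; rule XY)
    finally show ?thesis
      unfolding defect_def inner_add_left
      using surface_integral_add[OF S Eb cn[OF XY(1) S] cn[OF XY(2) S]]
        surface_integral_add[OF T Eb cn[OF XY(1) T] cn[OF XY(2) T]] by linarith
  qed
  have zero: "surface_integral S' (\<lambda>x. X x \<bullet> outer_normal E x) = 0" if "\<And>x. x \<in> S' ==> X x = 0" for X S'
  proof -
    have "surface_integral S' (\<lambda>x. X x \<bullet> outer_normal E x) = surface_integral S' (\<lambda>x. 0)"
      by (rule surface_integral_cong) (simp add: that)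
    then show ?thesis by (simp add: surface_integral_def)
  qed
  have loc: "\<exists>r>0. ball x r \<subseteq> N \<and> (\<forall>X K. Ck_field 1 UNIV X \<and> compact K \<and> K \<subseteq> ball x r \<and> (\<forall>x. x \<notin> K \<longrightarrow> X x = 0) \<longrightarrow> defect X = 0)"
    if x: "x \<in> closure E" for x
  proof -
    obtain r0 where r0: "r0 > 0" "ball x r0 \<subseteq> N" using N x open_contains_ball by blast
    have side: "\<exists>r>0. ball x r \<subseteq> N \<and> (\<forall>X K. Ck_field 1 UNIV X \<and> compact K \<and> K \<subseteq> ball x r \<and> (\<forall>x. x \<notin> K \<longrightarrow> X x = 0) \<longrightarrow> defect X = 0)"
      if xA: "x \<in> A" and A: "bounds E A" and B: "bounds E B" and AB: "A \<inter> B = {}" and AS: "A = S \<and> B = T \<or> A = T \<and> B = S" for A B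
    proof -
      obtain r1 where r1: "r1 > 0" and f1: "\<And>X K. Ck_field 1 UNIV X ==> compact K ==> K \<subseteq> ball x r1 ==> (\<And>x. x \<notin> K ==> X x = 0) ==>
        (LBINT x. indicator E x * divergence X x) = surface_integral A (\<lambda>x. X x \<bullet> outer_normal E x)"
        using local_divergence_theorem[OF A Eb xA] by blast
      have "open (- B)" using bounds_compact[OF B] compact_imp_closed by auto
      moreover have "x \<in> - B" using xA AB by blast
      ultimately obtain r2 where r2: "r2 > 0" "ball x r2 \<subseteq> - B" using open_contains_ball by blast
      define r where "r = min r0 (min r1 r2)"
      have r: "r > 0" "ball x r \<subseteq> ball x r0" "ball x r \<subseteq> ball x r1" "ball x r \<subseteq> ball x r2"
        unfolding r_def using r0 r1 r2 by auto
      show ?thesis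
      proof (intro exI[of _ r] conjI allI impI)
        show "0 < r" "ball x r \<subseteq> N" using r r0(2) by auto
        fix X K assume a: "Ck_field 1 UNIV X \<and> compact K \<and> K \<subseteq> ball x r \<and> (\<forall>x. x \<notin> K \<longrightarrow> X x = 0)"
        have "(LBINT x. indicator E x * divergence X x) = surface_integral A (\<lambda>x. X x \<bullet> outer_normal E x)"
          by (rule f1[of X K]) (use a r(3) in blast)+
        moreover have "surface_integral B (\<lambda>x. X x \<bullet> outer_normal E x) = 0"
        proof (rule zero)
          fix y assume "y \<in> B"
          then have "y \<notin> K" using a r(4) r2(2) by blast
          then show "X y = 0" using a by blast
        qed
        ultimately show "defect X = 0" unfolding defect_def using AS by auto
      qed
    qed
    have xc: "x \<in> E \<or> x \<in> S \<or> x \<in> T" using x fr E(1) unfolding frontier_def by (auto simp: interior_open)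
    show ?thesis
    proof (cases "x \<in> E")
      case True
      obtain r1 where r1: "r1 > 0" "ball x r1 \<subseteq> E" using E(1) True open_contains_ball by blast
      show ?thesis
      proof (intro exI[of _ r1] conjI allI impI)
        show "0 < r1" "ball x r1 \<subseteq> N" using r1 N(2) closure_subset by blast+
        fix X K assume a: "Ck_field 1 UNIV X \<and> compact K \<and> K \<subseteq> ball x r1 \<and> (\<forall>x. x \<notin> K \<longrightarrow> X x = 0)"
        have K: "compact K" "K \<subseteq> E" "\<And>x. x \<notin> K ==> X x = 0" and X: "Ck_field 1 UNIV X" using a r1(2) by blast+
        have "surface_integral S (\<lambda>x. X x \<bullet> outer_normal E x) = 0" "surface_integral T (\<lambda>x. X x \<bullet> outer_normal E x) = 0"
          by (rule zero, use K(2,3) bounds_disjoint[OF S] bounds_disjoint[OF T] in blast)+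
        moreover have "(LBINT x. indicator E x * divergence X x) = 0"
        proof -
          have Xd: "X differentiable at x" for x using Ck_field_differentiable[of 0 UNIV X x] X by simp
          have cc: "C1_compact (\<lambda>x. X x \<bullet> b)" if "b \<in> Basis" for b
            unfolding C1_compact_def using X that K(1,3) by (metis inner_zero_left)
          have "indicator E x * divergence X x = (\<Sum>b\<in>Basis. pd b (\<lambda>y. X y \<bullet> b) x)" for x
          proof (cases "x \<in> K")
            case False
            have "divergence X x = 0" by (rule divergence_zero_outside[OF K(1) _ False]) (rule K(3))
            then show ?thesis using divergence_eq_sum_pd[OF Xd, of x] by simp
          qed (use K(2) divergence_eq_sum_pd[OF Xd] in auto)
          then have "(LBINT x. indicator E x * divergence X x) = (LBINT x. (\<Sum>b\<in>Basis. pd b (\<lambda>y. X y \<bullet> b) x))"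
            by simp
          also have "\<dots> = (\<Sum>b\<in>Basis. LBINT x. pd b (\<lambda>y. X y \<bullet> b) x)"
            by (rule Bochner_Integration.integral_sum) (rule C1_compact_pd(1)[OF cc])
          also have "\<dots> = 0" by (rule sum.neutral) (use integral_pd_zero[OF cc] in blast)
          finally show ?thesis .
        qed
        ultimately show "defect X = 0" unfolding defect_def by linarith
      qed
    next
      case False
      then show ?thesis using xc side[OF _ S T disj] side[OF _ T S] disj by blast
    qed
  qed
  then obtain \<rho> where \<rho>: "\<And>x. x \<in> closure E ==> \<rho> x > 0 \<and> ball x (\<rho> x) \<subseteq> N \<and>
    (\<forall>X K. Ck_field 1 UNIV X \<and> compact K \<and> K \<subseteq> ball x (\<rho> x) \<and> (\<forall>x. x \<notin> K \<longrightarrow> X x = 0) \<longrightarrow> defect X = 0)"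
    by metis
  let ?p = "\<lambda>a. plateau a (\<rho> a / 3)"
  have cov: "closure E \<subseteq> (\<Union>x\<in>closure E. ball x (\<rho> x / 3))" using \<rho> by force
  have cE: "compact (closure E)" using E(2) by simp
  obtain F where F: "F \<subseteq> closure E" "finite F" "closure E \<subseteq> (\<Union>x\<in>F. ball x (\<rho> x / 3))"
    by (rule compactE_image[OF cE _ cov]) auto
  have sm: "smooth_on UNIV (?p a)" if "a \<in> closure E" for a
    by (rule plateau_smooth) (use \<rho>[OF that] in simp)
  have step: "defect Y = defect (\<lambda>x. (\<Prod>a\<in>F'. 1 - ?p a x) *\<^sub>R Y x)" if "finite F'" "F' \<subseteq> closure E" "Ck_field 1 N Y" for F' Y
    using that
  proof (induction F' arbitrary: Y rule: finite_induct)
    case (insert a F')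
    have a: "a \<in> closure E" using insert by blast
    have aN: "ball a (\<rho> a) \<subseteq> N" using \<rho>[OF a] by blast
    have sN: "Ck_on 1 N (?p a)" using smooth_onD[OF sm[OF a]] Ck_on_subset by blast
    have f1: "Ck_field 1 N (\<lambda>x. ?p a x *\<^sub>R Y x)" by (rule Ck_field_scaleR[OF N(1) sN insert.prems(2)])
    have f2: "Ck_field 1 N (\<lambda>x. (1 - ?p a x) *\<^sub>R Y x)"
      by (rule Ck_field_scaleR[OF N(1) Ck_on_diff[OF N(1) Ck_on_const sN] insert.prems(2)])
    let ?K = "cball a (2 * (\<rho> a / 3))"
    have K: "compact ?K" "?K \<subseteq> ball a (\<rho> a)" using \<rho>[OF a] by auto
    have K0: "?p a x *\<^sub>R Y x = 0" if "x \<notin> ?K" for x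
      using plateau_props(4)[of "\<rho> a / 3" a x] \<rho>[OF a] that by auto
    have KN: "?K \<subseteq> N" using K(2) aN by blast
    have f0: "Ck_field 1 UNIV (\<lambda>x. ?p a x *\<^sub>R Y x)" by (rule Ck_field_extend_zero[OF N(1) f1 K(1) KN K0])
    have "\<forall>X K. Ck_field 1 UNIV X \<and> compact K \<and> K \<subseteq> ball a (\<rho> a) \<and> (\<forall>x. x \<notin> K \<longrightarrow> X x = 0) \<longrightarrow> defect X = 0"
      using \<rho>[OF a] by (elim conjE)
    from this[rule_format, of "\<lambda>x. ?p a x *\<^sub>R Y x" ?K]
    have d0: "defect (\<lambda>x. ?p a x *\<^sub>R Y x) = 0" using f0 K K0 by blast
    have "defect Y = defect (\<lambda>x. ?p a x *\<^sub>R Y x + (1 - ?p a x) *\<^sub>R Y x)" by (simp add: scaleR_diff_left)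
    also have "\<dots> = defect (\<lambda>x. (1 - ?p a x) *\<^sub>R Y x)" by (simp only: add[OF f1 f2] d0 add_0)
    also have "\<dots> = defect (\<lambda>x. (\<Prod>a\<in>F'. 1 - ?p a x) *\<^sub>R ((1 - ?p a x) *\<^sub>R Y x))"
      by (rule insert.IH[OF _ f2]) (use insert.prems in blast)
    also have "(\<lambda>x. (\<Prod>a\<in>F'. 1 - ?p a x) *\<^sub>R ((1 - ?p a x) *\<^sub>R Y x)) = (\<lambda>x. (\<Prod>a\<in>insert a F'. 1 - ?p a x) *\<^sub>R Y x)"
      using insert.hyps by (simp add: mult.commute)
    finally show ?case .
  qed simp
  let ?Z = "\<lambda>x. (\<Prod>a\<in>F. 1 - ?p a x) *\<^sub>R X x"
  let ?G = "\<Union>x\<in>F. ball x (\<rho> x / 3)"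
  have Z0: "?Z x = 0" if "x \<in> ?G" for x
  proof -
    from that obtain a where a: "a \<in> F" "dist a x < \<rho> a / 3" by auto
    then have "1 - ?p a x = 0" using plateau_props(3)[of "\<rho> a / 3" a x] \<rho>[of a] F(1) by auto
    then have "(\<Prod>a\<in>F. 1 - ?p a x) = 0" using a(1) F(2) by (intro prod_zero) auto
    then show ?thesis by simp
  qed
  have GS: "closure E \<subseteq> ?G" by (rule F(3))
  have "defect ?Z = 0"
  proof -
    have "divergence ?Z x = 0" if "x \<in> E" for x
    proof -
      have "divergence ?Z x = divergence (\<lambda>_. 0) x"
        by (rule divergence_cong_open[of ?G]) (use Z0 that GS closure_subset in blast)+
      then show ?thesis by (simp add: divergence_def)
    qed
    then have h: "indicator E x * divergence ?Z x = 0" for x by (auto simp: indicator_def)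
    have "(LBINT x. indicator E x * divergence ?Z x) = 0" unfolding h by simp
    moreover have "surface_integral S (\<lambda>x. ?Z x \<bullet> outer_normal E x) = 0" "surface_integral T (\<lambda>x. ?Z x \<bullet> outer_normal E x) = 0"
      by (rule zero, rule Z0, use GS cl in blast)+
    ultimately show ?thesis unfolding defect_def by linarith
  qed
  then have "defect X = 0" using step[OF F(2,1) X] by (simp only:)
  then show ?thesis unfolding defect_def by linarith
qed

section \<open>Gas laws\<close>

lemma gas_density_Ck:
  assumes U: "open U" and f: "Ck_on k U f" and lt: "\<And>x. x \<in> U ==> f x < q\<^sup>2" and c: "\<gamma> > 1" "ka > 0"
  shows "Ck_on k U (\<lambda>x. gas_density \<gamma> ka q (f x))"
  unfolding gas_density_def
  by (intro Ck_on_compose_real[OF U _ Ck_on_powr] Ck_on_mult Ck_on_diff U f Ck_on_const) (use lt c in auto)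

lemma gas_density_pos:
  assumes "v2 < q\<^sup>2" "\<gamma> > 1" "ka > 0" shows "gas_density \<gamma> ka q v2 > 0"
  unfolding gas_density_def using assms by simp

text \<open>The square of the speed of sound.\<close>

definition bernoulli :: "real \<Rightarrow> real \<Rightarrow> real \<Rightarrow> real" where
  "bernoulli \<gamma> q v2 = (\<gamma> - 1) / 2 * (q\<^sup>2 - v2)"

text \<open>The common constant factor of the functional. It converts the pressure \<open>k_a \<rho>^\<gamma>\<close> into
  \<open>(c\<^sup>2)^(\<gamma>/(\<gamma>-1))\<close>.\<close>

definition scale :: "real \<Rightarrow> real \<Rightarrow> real" where
  "scale \<gamma> ka = \<gamma> powr (\<gamma> / (\<gamma> - 1)) * ka powr (1 / (\<gamma> - 1))"

lemma scale_pos: "\<gamma> > 1 ==> ka > 0 ==> scale \<gamma> ka > 0"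
  unfolding scale_def by simp

lemma bernoulli_density:
  assumes c: "\<gamma> > 1" "ka > 0" and v: "v2 \<le> q\<^sup>2"
  shows "\<gamma> * bernoulli \<gamma> q v2 powr (1 / (\<gamma> - 1)) = scale \<gamma> ka * gas_density \<gamma> ka q v2"
    and "bernoulli \<gamma> q v2 powr (\<gamma> / (\<gamma> - 1)) = scale \<gamma> ka * pressure \<gamma> ka (gas_density \<gamma> ka q v2)"
proof -
  define y where "y = 1 / ka * ((\<gamma> - 1) / (2 * \<gamma>)) * (q\<^sup>2 - v2)"
  have y: "y \<ge> 0" unfolding y_def using c v by (intro mult_nonneg_nonneg) auto
  have b: "bernoulli \<gamma> q v2 = (\<gamma> * ka) * y" unfolding bernoulli_def y_def using c by (simp add: field_simps)
  have gd: "gas_density \<gamma> ka q v2 = y powr (1 / (\<gamma> - 1))" unfolding gas_density_def y_def ..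
  have ex: "1 + 1 / (\<gamma> - 1) = \<gamma> / (\<gamma> - 1)" using c by (simp add: field_simps)
  have g: "\<gamma> * \<gamma> powr (1 / (\<gamma> - 1)) = \<gamma> powr (\<gamma> / (\<gamma> - 1))"
    using powr_add[of \<gamma> 1 "1 / (\<gamma> - 1)"] c unfolding ex by simp
  have k: "ka * ka powr (1 / (\<gamma> - 1)) = ka powr (\<gamma> / (\<gamma> - 1))"
    using powr_add[of ka 1 "1 / (\<gamma> - 1)"] c unfolding ex by simp
  have "\<gamma> * bernoulli \<gamma> q v2 powr (1 / (\<gamma> - 1)) = (\<gamma> * \<gamma> powr (1 / (\<gamma> - 1))) * ka powr (1 / (\<gamma> - 1)) * y powr (1 / (\<gamma> - 1))"
    unfolding b using c y by (simp add: powr_mult)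
  then show "\<gamma> * bernoulli \<gamma> q v2 powr (1 / (\<gamma> - 1)) = scale \<gamma> ka * gas_density \<gamma> ka q v2"
    unfolding g scale_def gd by simp
  have "bernoulli \<gamma> q v2 powr (\<gamma> / (\<gamma> - 1)) = \<gamma> powr (\<gamma> / (\<gamma> - 1)) * (ka * ka powr (1 / (\<gamma> - 1))) * y powr (\<gamma> / (\<gamma> - 1))"
    unfolding b k using c y by (simp add: powr_mult)
  also have "y powr (\<gamma> / (\<gamma> - 1)) = (y powr (1 / (\<gamma> - 1))) powr \<gamma>" by (simp add: powr_powr)
  finally show "bernoulli \<gamma> q v2 powr (\<gamma> / (\<gamma> - 1)) = scale \<gamma> ka * pressure \<gamma> ka (gas_density \<gamma> ka q v2)"
    unfolding scale_def pressure_def gd by simp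
qed

lemma bernoulli_powr_derivative:
  fixes a d :: "'a::euclidean_space"
  assumes c: "\<gamma> > 1" and lt: "norm (a + t *\<^sub>R d) < q"
  shows "((\<lambda>t. bernoulli \<gamma> q ((norm (a + t *\<^sub>R d))\<^sup>2) powr (\<gamma> / (\<gamma> - 1))) has_real_derivative
    - (\<gamma> * bernoulli \<gamma> q ((norm (a + t *\<^sub>R d))\<^sup>2) powr (1 / (\<gamma> - 1)) * ((a + t *\<^sub>R d) \<bullet> d))) (at t)"
proof -
  have sq: "(norm (a + t *\<^sub>R d))\<^sup>2 < q\<^sup>2" using lt by (intro power_strict_mono) auto
  then have pos: "bernoulli \<gamma> q ((norm (a + t *\<^sub>R d))\<^sup>2) > 0" unfolding bernoulli_def using c by simp
  have n: "(norm (a + t *\<^sub>R d))\<^sup>2 = a \<bullet> a + 2 * t * (a \<bullet> d) + t\<^sup>2 * (d \<bullet> d)" for t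
    unfolding power2_norm_eq_inner by (simp add: inner_add_left inner_add_right inner_commute power2_eq_square)
  have 1: "((\<lambda>t. bernoulli \<gamma> q ((norm (a + t *\<^sub>R d))\<^sup>2)) has_real_derivative
    (\<gamma> - 1) / 2 * (- (2 * (a \<bullet> d) + 2 * t * (d \<bullet> d)))) (at t)"
    unfolding bernoulli_def n by (auto intro!: derivative_eq_intros)
  have ex: "\<gamma> / (\<gamma> - 1) - 1 = 1 / (\<gamma> - 1)" using c by (simp add: field_simps)
  have "((\<lambda>t. bernoulli \<gamma> q ((norm (a + t *\<^sub>R d))\<^sup>2) powr (\<gamma> / (\<gamma> - 1))) has_real_derivative
    (\<gamma> / (\<gamma> - 1)) * bernoulli \<gamma> q ((norm (a + t *\<^sub>R d))\<^sup>2) powr (\<gamma> / (\<gamma> - 1) - 1) * ((\<gamma> - 1) / 2 * (- (2 * (a \<bullet> d) + 2 * t * (d \<bullet> d))))) (at t)"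
    by (rule DERIV_fun_powr[OF 1 pos, of "\<gamma> / (\<gamma> - 1)", unfolded of_nat_1])
  moreover have "(\<gamma> / (\<gamma> - 1)) * z * ((\<gamma> - 1) / 2 * (- (2 * (a \<bullet> d) + 2 * t * (d \<bullet> d)))) = - (\<gamma> * z * ((a + t *\<^sub>R d) \<bullet> d))" for z
    using c by (simp add: inner_add_left field_simps)
  ultimately show ?thesis unfolding ex by (simp only:)
qed

text \<open>A bound on the difference quotient of the energy density that is uniform in the point; it
  dominates the integrands in the first variation.\<close>

lemma bernoulli_powr_lipschitz:
  fixes a d :: "'a::euclidean_space"
  assumes c: "\<gamma> > 1" and t: "t > 0" and lt: "\<And>s. 0 \<le> s ==> s \<le> t ==> norm (a + s *\<^sub>R d) < q" and d: "norm d \<le> H"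
  shows "\<bar>bernoulli \<gamma> q ((norm (a + t *\<^sub>R d))\<^sup>2) powr (\<gamma> / (\<gamma> - 1)) - bernoulli \<gamma> q ((norm a)\<^sup>2) powr (\<gamma> / (\<gamma> - 1))\<bar>
    \<le> t * (\<gamma> * ((\<gamma> - 1) / 2 * q\<^sup>2) powr (1 / (\<gamma> - 1)) * (q * H))"
proof -
  let ?F = "\<lambda>t. bernoulli \<gamma> q ((norm (a + t *\<^sub>R d))\<^sup>2) powr (\<gamma> / (\<gamma> - 1))"
  let ?D = "\<lambda>t. - (\<gamma> * bernoulli \<gamma> q ((norm (a + t *\<^sub>R d))\<^sup>2) powr (1 / (\<gamma> - 1)) * ((a + t *\<^sub>R d) \<bullet> d))"
  obtain s where s: "0 < s" "s < t" "?F t - ?F 0 = (t - 0) * ?D s"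
    using MVT2[OF t, of ?F ?D] bernoulli_powr_derivative[OF c lt] by blast
  have ns: "norm (a + s *\<^sub>R d) < q" using lt s by simp
  then have q: "q > 0" using norm_ge_zero[of "a + s *\<^sub>R d"] by linarith
  have sq: "(norm (a + s *\<^sub>R d))\<^sup>2 \<le> q\<^sup>2" using ns by (intro power_mono) auto
  have b: "0 \<le> bernoulli \<gamma> q ((norm (a + s *\<^sub>R d))\<^sup>2)" "bernoulli \<gamma> q ((norm (a + s *\<^sub>R d))\<^sup>2) \<le> (\<gamma> - 1) / 2 * q\<^sup>2"
    unfolding bernoulli_def using c sq by (auto intro!: mult_nonneg_nonneg mult_left_mono)
  have "\<bar>(a + s *\<^sub>R d) \<bullet> d\<bar> \<le> norm (a + s *\<^sub>R d) * norm d" by (rule Cauchy_Schwarz_ineq2)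
  also have "\<dots> \<le> q * H" using ns d q by (intro mult_mono) auto
  finally have i: "\<bar>(a + s *\<^sub>R d) \<bullet> d\<bar> \<le> q * H" .
  have "\<bar>?D s\<bar> = \<gamma> * bernoulli \<gamma> q ((norm (a + s *\<^sub>R d))\<^sup>2) powr (1 / (\<gamma> - 1)) * \<bar>(a + s *\<^sub>R d) \<bullet> d\<bar>"
    using c by (simp add: abs_mult)
  also have "\<dots> \<le> \<gamma> * ((\<gamma> - 1) / 2 * q\<^sup>2) powr (1 / (\<gamma> - 1)) * (q * H)"
    using c b i by (intro mult_mono mult_left_mono powr_mono2) auto
  finally have "\<bar>?F t - ?F 0\<bar> \<le> t * (\<gamma> * ((\<gamma> - 1) / 2 * q\<^sup>2) powr (1 / (\<gamma> - 1)) * (q * H))"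
    unfolding s(3) using t by (simp add: abs_mult mult_left_mono)
  then show ?thesis by simp
qed

section \<open>Variation of a moving domain\<close>

text \<open>The moving domain \<open>u + t \<eta> > 0\<close> converges pointwise off the zero set of \<open>u\<close>, which is a null set
  where \<open>u\<close> has a nonvanishing partial derivative.\<close>

lemma positive_set_limit:
  assumes "t \<longlonglongrightarrow> (0::real)" "u \<noteq> 0"
  shows "(\<lambda>n. indicat_real {x. 0 < x} (u + t n * e)) \<longlonglongrightarrow> indicat_real {x. 0 < x} u"
proof -
  have l: "(\<lambda>n. u + t n * e) \<longlonglongrightarrow> u + 0 * e" by (intro tendsto_intros assms(1))
  consider "u > 0" | "u < 0" using assms(2) by linarith
  then have "\<forall>\<^sub>F n in sequentially. indicat_real {x. 0 < x} u = indicat_real {x. 0 < x} (u + t n * e)"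
  proof cases
    case 1
    then have "\<forall>\<^sub>F n in sequentially. 0 < u + t n * e" using order_tendstoD(1)[OF l, of 0] by simp
    then show ?thesis by eventually_elim (use 1 in simp)
  next
    case 2
    then have "\<forall>\<^sub>F n in sequentially. u + t n * e < 0" using order_tendstoD(2)[OF l, of 0] by simp
    then show ?thesis by eventually_elim (use 2 in simp)
  qed
  from Lim_transform_eventually[OF tendsto_const this] show ?thesis .
qed

text \<open>With \<open>w = u + t \<eta>\<close> the integrand is the difference of \<open>g * \<partial>(max 0 w)/\<partial>b\<close> and
  \<open>g * \<partial>(max 0 u)/\<partial>b\<close>, minus \<open>t g * \<partial>\<eta>/\<partial>b\<close> on \<open>w > 0\<close>. Integration by parts moves the derivative onto \<open>g\<close>;
  the difference quotient of \<open>max 0 (u + t \<eta>)\<close> is bounded by \<open>\<bar>\<eta>\<bar>\<close> and tends to \<open>\<eta>\<close> where \<open>u > 0\<close>. The limit is an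
  integral over the unperturbed domain, from which the surface integral is recovered by the
  divergence theorem.\<close>

lemma moving_domain_variation:
  fixes u g \<eta> :: "'a::euclidean_space \<Rightarrow> real"
  assumes U: "open U" and u: "Ck_on 1 U u" and b: "b \<in> Basis" and nz: "\<And>x. x \<in> U ==> pd b u x \<noteq> 0"
    and e: "Ck_on 1 UNIV \<eta>" and g: "Ck_on 1 U g" and K: "compact K" "K \<subseteq> U" "\<And>x. x \<notin> K ==> g x = 0"
    and t: "t \<longlonglongrightarrow> 0" "\<And>n. t n > 0"
  shows "(\<lambda>n. (LBINT x. (indicator {x. 0 < x} (u x + t n * \<eta> x) - indicator {x. 0 < x} (u x)) * (g x * pd b u x)) / t n)
    \<longlonglongrightarrow> - (LBINT x. indicator {x. 0 < x} (u x) * pd b (\<lambda>x. \<eta> x * g x) x)"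
proof -
  let ?i = "indicat_real {x::real. 0 < x}"
  let ?w = "\<lambda>n x. u x + t n * \<eta> x"
  have eU: "Ck_on 1 U \<eta>" using e Ck_on_subset by blast
  have wU: "Ck_on 1 U (?w n)" for n by (intro Ck_on_add Ck_on_mult Ck_on_const U u eU)
  have gc: "C1_compact g" using Ck_on_extend_zero[OF U g K] K unfolding C1_compact_def by blast
  note gp = C1_compact_pd[OF gc b]
  have gd: "g differentiable at x" and ed: "\<eta> differentiable at x" for x
    using gc e unfolding C1_compact_def by auto
  have g0: "pd b g x = 0" if "x \<notin> K" for x by (rule pd_zero_outside[OF K(1) _ that]) (rule K(3))
  have cg: "continuous_on UNIV g" using gc Ck_on_imp_continuous unfolding C1_compact_def by blast
  have ce: "continuous_on UNIV \<eta>" by (rule Ck_on_imp_continuous[OF e])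
  have ceb: "continuous_on UNIV (pd b \<eta>)" by (rule C1_continuous_pd[OF e b])
  have ind: "?i (w x) = indicator {x. 0 < w x} x" for w :: "'a \<Rightarrow> real" and x by (simp add: indicator_def)
  note P = pos_part_by_parts[OF U wU g K b, folded ind]
  note P0 = pos_part_by_parts[OF U u g K b, folded ind]
  have um: "(\<lambda>x. indicator K x * u x) \<in> borel_measurable borel"
    using borel_measurable_continuous_on_indicator[OF borel_compact[OF K(1)] continuous_on_subset[OF Ck_on_imp_continuous[OF u] K(2)]] by simp
  have [measurable]: "\<eta> \<in> borel_measurable borel" "K \<in> sets borel" "g \<in> borel_measurable borel" "pd b g \<in> borel_measurable borel" "pd b \<eta> \<in> borel_measurable borel"
    using ce cg ceb gp(2) borel_compact[OF K(1)] by (auto intro: borel_measurable_continuous_onI)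
  note [measurable] = um
  have im[measurable]: "(\<lambda>x. indicator K x * ?i (?w n x)) \<in> borel_measurable borel" for n
  proof -
    have "(\<lambda>x. indicator K x * ?i (indicator K x * u x + t n * \<eta> x)) \<in> borel_measurable borel" by measurable
    moreover have "(\<lambda>x. indicator K x * ?i (indicator K x * u x + t n * \<eta> x)) = (\<lambda>x. indicator K x * ?i (?w n x))"
      by (rule ext) (auto simp: indicator_def)
    ultimately show ?thesis by simp
  qed
  have e1: "integrable lborel (\<lambda>x. pd b \<eta> x * g x)"
    by (rule integrable_continuous_support[OF _ K(1)]) (auto intro!: continuous_intros ceb cg simp: K(3))
  have e2: "integrable lborel (\<lambda>x. \<eta> x * pd b g x)"
    by (rule integrable_continuous_support[OF _ K(1)]) (auto intro!: continuous_intros ce gp(2) simp: g0)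
  have bnd: "integrable lborel (\<lambda>x. h x * f x)"
    if f: "integrable lborel f" and h: "h \<in> borel_measurable borel" "\<And>x. \<bar>h x\<bar> \<le> 1" for f h :: "'a \<Rightarrow> real"
  proof (rule Bochner_Integration.integrable_bound[OF f])
    show "(\<lambda>x. h x * f x) \<in> borel_measurable lborel" using h(1) borel_measurable_integrable[OF f] by simp
    show "AE x in lborel. norm (h x * f x) \<le> norm (f x)"
      using h(2) by (intro AE_I2) (simp add: abs_mult mult_left_le_one_le)
  qed
  have i3: "integrable lborel (\<lambda>x. ?i (?w n x) * (pd b \<eta> x * g x))" for n
  proof -
    have "integrable lborel (\<lambda>x. (indicator K x * ?i (?w n x)) * (pd b \<eta> x * g x))"
      by (rule bnd[OF e1 im]) (auto simp: indicator_def)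
    moreover have "(\<lambda>x. (indicator K x * ?i (?w n x)) * (pd b \<eta> x * g x)) = (\<lambda>x. ?i (?w n x) * (pd b \<eta> x * g x))"
      by (rule ext) (use K(3) in \<open>auto simp: indicator_def\<close>)
    ultimately show ?thesis by simp
  qed
  have split: "(LBINT x. (?i (?w n x) - ?i (u x)) * (g x * pd b u x)) / t n
    = - (LBINT x. (max 0 (?w n x) - max 0 (u x)) / t n * pd b g x) - (LBINT x. ?i (?w n x) * (pd b \<eta> x * g x))" for n
  proof -
    have tn: "t n \<noteq> 0" using t(2)[of n] by simp
    have pw: "pd b (?w n) x = pd b u x + t n * pd b \<eta> x" if "x \<in> U" for x
    proof -
      have "u differentiable at x" using u that by simp
      from has_derivative_add[OF has_derivative_frechet[OF this] has_derivative_mult_right[OF has_derivative_frechet[OF ed]], of "t n"]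
      show ?thesis by (rule pd_eqI)
    qed
    have "(?i (?w n x) - ?i (u x)) * (g x * pd b u x)
      = (?i (?w n x) * pd b (?w n) x * g x - ?i (u x) * pd b u x * g x) - t n * (?i (?w n x) * (pd b \<eta> x * g x))" for x
    proof (cases "x \<in> K")
      case True
      then have "x \<in> U" using K(2) by blast
      show ?thesis unfolding pw[OF \<open>x \<in> U\<close>] by (simp add: algebra_simps)
    qed (simp add: K(3))
    then have "(LBINT x. (?i (?w n x) - ?i (u x)) * (g x * pd b u x))
      = (LBINT x. ?i (?w n x) * pd b (?w n) x * g x) - (LBINT x. ?i (u x) * pd b u x * g x)
        - t n * (LBINT x. ?i (?w n x) * (pd b \<eta> x * g x))"
      using P(1) P0(1) i3 by simp
    also have "\<dots> = - ((LBINT x. max 0 (?w n x) * pd b g x) - (LBINT x. max 0 (u x) * pd b g x))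
        - t n * (LBINT x. ?i (?w n x) * (pd b \<eta> x * g x))"
      using P(3) P0(3) by simp
    also have "(LBINT x. max 0 (?w n x) * pd b g x) - (LBINT x. max 0 (u x) * pd b g x)
      = t n * (LBINT x. (max 0 (?w n x) - max 0 (u x)) / t n * pd b g x)"
    proof -
      have "(LBINT x. max 0 (?w n x) * pd b g x) - (LBINT x. max 0 (u x) * pd b g x)
        = (LBINT x. max 0 (?w n x) * pd b g x - max 0 (u x) * pd b g x)"
        using P(2) P0(2) by simp
      also have "\<dots> = (LBINT x. t n * ((max 0 (?w n x) - max 0 (u x)) / t n * pd b g x))"
        by (rule Bochner_Integration.integral_cong[OF refl]) (use tn in \<open>simp add: left_diff_distrib\<close>)
      finally show ?thesis by simp
    qed
    finally have *: "(LBINT x. (?i (?w n x) - ?i (u x)) * (g x * pd b u x))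
      = t n * (- (LBINT x. (max 0 (?w n x) - max 0 (u x)) / t n * pd b g x) - (LBINT x. ?i (?w n x) * (pd b \<eta> x * g x)))"
      by (simp add: right_diff_distrib)
    show ?thesis unfolding * using tn by simp
  qed
  have null: "AE x in lborel. x \<in> K \<longrightarrow> u x \<noteq> 0"
    using zero_set_null[OF U u b] by eventually_elim (use K(2) nz in blast)
  have um0: "(\<lambda>x. indicator K x * ?i (u x)) \<in> borel_measurable borel"
  proof -
    have "(\<lambda>x. indicator K x * ?i (indicator K x * u x)) \<in> borel_measurable borel" by measurable
    moreover have "(\<lambda>x. indicator K x * ?i (indicator K x * u x)) = (\<lambda>x. indicator K x * ?i (u x))"
      by (rule ext) (auto simp: indicator_def)
    ultimately show ?thesis by simp
  qed
  have l2: "(\<lambda>n. LBINT x. ?i (?w n x) * (pd b \<eta> x * g x)) \<longlonglongrightarrow> (LBINT x. ?i (u x) * (pd b \<eta> x * g x))"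
  proof (rule integral_dominated_convergence)
    show "integrable lborel (\<lambda>x. \<bar>pd b \<eta> x * g x\<bar>)" using e1 by simp
    show "(\<lambda>x. ?i (?w n x) * (pd b \<eta> x * g x)) \<in> borel_measurable lborel" for n
      by (rule borel_measurable_integrable[OF i3])
    have "(\<lambda>x. (indicator K x * ?i (u x)) * (pd b \<eta> x * g x)) \<in> borel_measurable lborel" using um0 by simp
    moreover have "(\<lambda>x. (indicator K x * ?i (u x)) * (pd b \<eta> x * g x)) = (\<lambda>x. ?i (u x) * (pd b \<eta> x * g x))"
      by (rule ext) (use K(3) in \<open>auto simp: indicator_def\<close>)
    ultimately show "(\<lambda>x. ?i (u x) * (pd b \<eta> x * g x)) \<in> borel_measurable lborel" by simp
    show "AE x in lborel. (\<lambda>n. ?i (?w n x) * (pd b \<eta> x * g x)) \<longlonglongrightarrow> ?i (u x) * (pd b \<eta> x * g x)"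
      using null
    proof eventually_elim
      case (elim x)
      show ?case
      proof (cases "x \<in> K")
        case True
        then show ?thesis using elim by (intro tendsto_intros positive_set_limit[OF t(1)]) auto
      qed (simp add: K(3))
    qed
    show "AE x in lborel. norm (?i (?w n x) * (pd b \<eta> x * g x)) \<le> \<bar>pd b \<eta> x * g x\<bar>" for n
      by (intro AE_I2) (simp add: indicator_def abs_mult)
  qed
  have i4: "integrable lborel (\<lambda>x. (max 0 (?w n x) - max 0 (u x)) / t n * pd b g x)" for n
  proof -
    have "integrable lborel (\<lambda>x. (max 0 (?w n x) * pd b g x - max 0 (u x) * pd b g x) / t n)"
      using P(2)[of n] P0(2) by simp
    then show ?thesis by (simp add: left_diff_distrib)
  qed
  have l1: "(\<lambda>n. LBINT x. (max 0 (?w n x) - max 0 (u x)) / t n * pd b g x) \<longlonglongrightarrow> (LBINT x. ?i (u x) * (\<eta> x * pd b g x))"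
  proof (rule integral_dominated_convergence)
    show "integrable lborel (\<lambda>x. \<bar>\<eta> x * pd b g x\<bar>)" using e2 by simp
    show "(\<lambda>x. (max 0 (?w n x) - max 0 (u x)) / t n * pd b g x) \<in> borel_measurable lborel" for n
      by (rule borel_measurable_integrable[OF i4])
    have "(\<lambda>x. (indicator K x * ?i (u x)) * (\<eta> x * pd b g x)) \<in> borel_measurable lborel" using um0 by simp
    moreover have "(\<lambda>x. (indicator K x * ?i (u x)) * (\<eta> x * pd b g x)) = (\<lambda>x. ?i (u x) * (\<eta> x * pd b g x))"
      by (rule ext) (use g0 in \<open>auto simp: indicator_def\<close>)
    ultimately show "(\<lambda>x. ?i (u x) * (\<eta> x * pd b g x)) \<in> borel_measurable lborel" by simp
    show "AE x in lborel. (\<lambda>n. (max 0 (?w n x) - max 0 (u x)) / t n * pd b g x) \<longlonglongrightarrow> ?i (u x) * (\<eta> x * pd b g x)"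
      using null
    proof eventually_elim
      case (elim x)
      show ?case
      proof (cases "x \<in> K")
        case True
        then have nz: "u x \<noteq> 0" using elim by blast
        have l: "(\<lambda>n. ?w n x) \<longlonglongrightarrow> u x + 0 * \<eta> x" by (intro tendsto_intros t(1))
        have "(\<lambda>n. (max 0 (?w n x) - max 0 (u x)) / t n) \<longlonglongrightarrow> ?i (u x) * \<eta> x"
        proof (cases "u x > 0")
          case True
          then have "\<forall>\<^sub>F n in sequentially. 0 < ?w n x" using order_tendstoD(1)[OF l, of 0] by simp
          then have "\<forall>\<^sub>F n in sequentially. \<eta> x = (max 0 (?w n x) - max 0 (u x)) / t n"
            by eventually_elim (use True t(2) in \<open>simp add: less_imp_neq[symmetric]\<close>)
          from Lim_transform_eventually[OF tendsto_const this] show ?thesis using True by simp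
        next
          case False
          then have "u x < 0" using nz by simp
          then have "\<forall>\<^sub>F n in sequentially. ?w n x < 0" using order_tendstoD(2)[OF l, of 0] by simp
          then have "\<forall>\<^sub>F n in sequentially. 0 = (max 0 (?w n x) - max 0 (u x)) / t n"
            by eventually_elim (use False in simp)
          from Lim_transform_eventually[OF tendsto_const this] show ?thesis using False by simp
        qed
        then have "(\<lambda>n. (max 0 (?w n x) - max 0 (u x)) / t n * pd b g x) \<longlonglongrightarrow> (?i (u x) * \<eta> x) * pd b g x"
          by (intro tendsto_intros)
        then show ?thesis by (simp add: mult.assoc)
      qed (simp add: g0)
    qed
    show "AE x in lborel. norm ((max 0 (?w n x) - max 0 (u x)) / t n * pd b g x) \<le> \<bar>\<eta> x * pd b g x\<bar>" for n
    proof (rule AE_I2)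
      fix x
      have "\<bar>max 0 (?w n x) - max 0 (u x)\<bar> \<le> \<bar>t n * \<eta> x\<bar>" by linarith
      also have "\<dots> = t n * \<bar>\<eta> x\<bar>" using t(2)[of n] by (simp add: abs_mult)
      finally have "\<bar>max 0 (?w n x) - max 0 (u x)\<bar> / t n \<le> \<bar>\<eta> x\<bar>"
        using t(2)[of n] by (simp add: pos_divide_le_eq mult.commute)
      then have "\<bar>max 0 (?w n x) - max 0 (u x)\<bar> / t n * \<bar>pd b g x\<bar> \<le> \<bar>\<eta> x\<bar> * \<bar>pd b g x\<bar>" by (rule mult_right_mono) simp
      then show "norm ((max 0 (?w n x) - max 0 (u x)) / t n * pd b g x) \<le> \<bar>\<eta> x * pd b g x\<bar>"
        using t(2)[of n] by (simp add: abs_mult)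
    qed
  qed
  have ie1: "integrable lborel (\<lambda>x. ?i (u x) * (pd b \<eta> x * g x))"
  proof -
    have "integrable lborel (\<lambda>x. (indicator K x * ?i (u x)) * (pd b \<eta> x * g x))"
      by (rule bnd[OF e1 um0]) (auto simp: indicator_def)
    moreover have "(\<lambda>x. (indicator K x * ?i (u x)) * (pd b \<eta> x * g x)) = (\<lambda>x. ?i (u x) * (pd b \<eta> x * g x))"
      by (rule ext) (use K(3) in \<open>auto simp: indicator_def\<close>)
    ultimately show ?thesis by simp
  qed
  have ie2: "integrable lborel (\<lambda>x. ?i (u x) * (\<eta> x * pd b g x))"
  proof -
    have "integrable lborel (\<lambda>x. (indicator K x * ?i (u x)) * (\<eta> x * pd b g x))"
      by (rule bnd[OF e2 um0]) (auto simp: indicator_def)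
    moreover have "(\<lambda>x. (indicator K x * ?i (u x)) * (\<eta> x * pd b g x)) = (\<lambda>x. ?i (u x) * (\<eta> x * pd b g x))"
      by (rule ext) (use g0 in \<open>auto simp: indicator_def\<close>)
    ultimately show ?thesis by simp
  qed
  have prod: "pd b (\<lambda>x. \<eta> x * g x) x = \<eta> x * pd b g x + pd b \<eta> x * g x" for x
    by (rule pd_eqI[OF has_derivative_mult[OF has_derivative_frechet[OF ed] has_derivative_frechet[OF gd]]])
  have "(LBINT x. ?i (u x) * pd b (\<lambda>x. \<eta> x * g x) x)
     = (LBINT x. ?i (u x) * (\<eta> x * pd b g x)) + (LBINT x. ?i (u x) * (pd b \<eta> x * g x))"
    unfolding prod distrib_left using ie1 ie2 by (rule Bochner_Integration.integral_add[OF _ _, rotated])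
  then have lim: "- (LBINT x. ?i (u x) * pd b (\<lambda>x. \<eta> x * g x) x)
    = - (LBINT x. ?i (u x) * (\<eta> x * pd b g x)) - (LBINT x. ?i (u x) * (pd b \<eta> x * g x))" by simp
  show ?thesis unfolding split lim by (intro tendsto_intros l1 l2)
qed

section \<open>Geometry of the configuration\<close>

text \<open>One-sided gradients are taken from the smooth extension \<open>\<Phi>0\<close>, so that no limits occur in the
  assumptions.\<close>

locale transonic_shock =
  fixes \<gamma> k0 ka q0 R :: real
    and D A \<Gamma> \<Omega> S W :: "'a::euclidean_space set"
    and \<phi>s m \<phi> \<Phi>0 :: "'a \<Rightarrow> real"
  assumes gam: "\<gamma> > 1" and k0: "k0 > 0" and ka: "ka > 0" and q0: "q0 > 0"
    and D: "open D" "connected D" "D \<noteq> {}" "closure D \<subseteq> ball 0 R" "smooth_boundary_on D \<Gamma>"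
    and Gam: "\<Gamma> = frontier D" and A: "A = ball 0 R - closure D"
    and W: "open W" "closure A \<subseteq> W" "Ck_on 2 W \<phi>s" "\<And>x. x \<in> closure A ==> norm (grad \<phi>s x) < q0"
    and m: "continuous_on \<Gamma> m"
    and crit: "critical_point \<gamma> k0 ka q0 A \<Gamma> \<phi>s m \<phi>"
    and Om: "\<Omega> = noncoincidence A \<phi>s \<phi>" and S: "S = shock A \<phi>s \<phi>" "smooth_boundary_on \<Omega> S" "compact S"
      "\<Gamma> \<subseteq> inside S" and Om_inside: "\<Omega> = A \<inter> inside S"
    and Phi0: "smooth_on UNIV \<Phi>0" "\<And>x. x \<in> \<Omega> ==> \<Phi>0 x = \<phi> x"
    and disp: "\<And>x. x \<in> S ==> grad \<phi>s x \<bullet> outer_normal \<Omega> x \<noteq> grad \<Phi>0 x \<bullet> outer_normal \<Omega> x"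
    and novac: "\<And>x. x \<in> S \<union> \<Gamma> ==> norm (grad \<Phi>0 x) < q0"
begin

lemma open_A: "open A" and bounded_A: "bounded A"
proof -
  show "open A" unfolding A by (intro open_Diff) auto
  show "bounded A" unfolding A by (rule bounded_subset[OF bounded_ball[of 0 R]]) auto
qed

lemma S_subset_A: "S \<subseteq> A" unfolding S(1) shock_def by auto

lemma closed_S: "closed S" using S(3) by (rule compact_imp_closed)

lemma open_inside_S: "open (inside S)" by (rule open_inside[OF closed_S])

lemma open_Omega: "open \<Omega>" unfolding Om_inside using open_A open_inside_S by auto

lemma Omega_subset: "\<Omega> \<subseteq> A" "\<Omega> \<subseteq> inside S" unfolding Om_inside by auto

lemma bounded_Omega: "bounded \<Omega>" using bounded_subset[OF bounded_A Omega_subset(1)] .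

lemma inside_S_subset_ball: "inside S \<subseteq> ball 0 R"
proof -
  have "S \<subseteq> ball 0 R" using S_subset_A unfolding A by blast
  then have "- ball 0 R \<subseteq> outside S" by (intro outside_subset_convex) auto
  then show ?thesis using inside_Int_outside[of S] by blast
qed

lemma Gamma_nonempty: "\<Gamma> \<noteq> {}"
proof -
  have "D \<noteq> UNIV"
  proof
    assume "D = UNIV"
    then have "(UNIV :: 'a set) \<subseteq> ball 0 R" using D(4) by simp
    then have "bounded (UNIV :: 'a set)" by (rule bounded_subset[OF bounded_ball])
    then show False by simp
  qed
  then show ?thesis unfolding Gam using D(3) frontier_eq_empty by blast
qed

text \<open>The connected set \<open>closure D\<close> does not meet the shock and has a point of \<open>\<Gamma>\<close> inside it.\<close>

lemma closure_D_inside: "closure D \<subseteq> inside S"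
proof -
  obtain x where x: "x \<in> \<Gamma>" using Gamma_nonempty by blast
  have xD: "x \<in> closure D" using x unfolding Gam frontier_def by blast
  have con: "connected (closure D)" by (rule connected_imp_connected_closure[OF D(2)])
  have sub: "closure D \<subseteq> - S" using S_subset_A unfolding A by blast
  show ?thesis
  proof
    fix y assume y: "y \<in> closure D"
    have "connected_component (- S) x y" unfolding connected_component_def using con sub xD y by blast
    then show "y \<in> inside S" by (rule inside_same_component) (use x S(4) in blast)
  qed
qed

lemma Gamma_closure_D: "\<Gamma> \<subseteq> closure D" unfolding Gam frontier_def by blast

lemma compact_Gamma: "compact \<Gamma>"
proof -
  have "bounded D" using bounded_subset[OF bounded_ball[of 0 R]] D(4) closure_subset by blast
  then show ?thesis unfolding Gam using compact_frontier_bounded by blast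
qed

lemma Gamma_disjoint: "\<Gamma> \<inter> A = {}" "\<Gamma> \<inter> S = {}" "S \<inter> \<Gamma> = {}"
  using Gamma_closure_D S_subset_A unfolding A by blast+

lemma closure_A_D: "closure A \<inter> D = {}"
proof -
  have "A \<inter> D = {}" unfolding A using closure_subset by blast
  then show ?thesis using open_Int_closure_eq_empty[OF D(1), of A] by blast
qed

lemma closure_Omega: "closure \<Omega> \<subseteq> \<Omega> \<union> S \<union> \<Gamma>"
proof
  fix x assume x: "x \<in> closure \<Omega>"
  have "x \<in> closure (inside S)" using x closure_mono[OF Omega_subset(2)] by blast
  then have "x \<in> inside S \<or> x \<in> S"
    using frontier_inside_subset[OF closed_S] open_inside_S unfolding frontier_def by (auto simp: interior_open)
  then show "x \<in> \<Omega> \<union> S \<union> \<Gamma>"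
  proof
    assume i: "x \<in> inside S"
    have "x \<notin> D" using closure_mono[OF Omega_subset(1)] x closure_A_D by blast
    then show ?thesis using i inside_S_subset_ball unfolding Om_inside A Gam frontier_def
      using D(1) by (auto simp: interior_open)
  qed auto
qed

lemma frontier_Omega: "frontier \<Omega> \<subseteq> S \<union> \<Gamma>"
  using closure_Omega open_Omega unfolding frontier_def by (auto simp: interior_open)

lemma closure_Omega_A: "closure \<Omega> \<subseteq> closure A" by (rule closure_mono[OF Omega_subset(1)])

lemma bounds_Omega_S: "bounds \<Omega> S"
proof (rule boundsI[OF S(3) S(2) compact_imp_closed[OF compact_Gamma] Gamma_disjoint(3) frontier_Omega])
  show "S \<subseteq> frontier \<Omega>"
  proof
    fix x assume "x \<in> S"
    then obtain U \<psi> where c: "boundary_chart \<Omega> x U \<psi>" using S(2) unfolding smooth_boundary_on_def by blast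
    show "x \<in> frontier \<Omega>" using chart_frontier(1)[OF c] boundary_chartD(2,5)[OF c] by blast
  qed
qed

lemma Gamma_chart:
  assumes x: "x \<in> \<Gamma>"
  obtains U \<psi> where "boundary_chart \<Omega> x U \<psi>" "boundary_chart A x U \<psi>"
proof -
  obtain U \<psi> where c: "boundary_chart D x U \<psi>" using D(5) x unfolding smooth_boundary_on_def by blast
  let ?G = "inside S"
  have xG: "x \<in> ?G" using x S(4) by blast
  have "boundary_chart \<Omega> x (U \<inter> ?G) (\<lambda>y. - \<psi> y)"
    by (rule chart_restrict[OF chart_complement[OF c] open_inside_S xG])
      (use inside_S_subset_ball in \<open>unfold Om_inside A, blast\<close>)
  moreover have "boundary_chart A x (U \<inter> ?G) (\<lambda>y. - \<psi> y)"
    by (rule chart_restrict[OF chart_complement[OF c] open_inside_S xG])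
      (use inside_S_subset_ball in \<open>unfold A, blast\<close>)
  ultimately show ?thesis using that by blast
qed

lemma outer_normal_Gamma: "x \<in> \<Gamma> ==> outer_normal \<Omega> x = outer_normal A x"
  using Gamma_chart outer_normal_eq by metis

lemma Gamma_frontier: "\<Gamma> \<subseteq> frontier \<Omega>"
proof
  fix x assume "x \<in> \<Gamma>"
  then obtain U \<psi> where c: "boundary_chart \<Omega> x U \<psi>" using Gamma_chart by metis
  show "x \<in> frontier \<Omega>" using chart_frontier(1)[OF c] boundary_chartD(2,5)[OF c] by blast
qed

lemma bounds_Omega_Gamma: "bounds \<Omega> \<Gamma>"
proof (rule boundsI[OF compact_Gamma _ closed_S Gamma_disjoint(2) _ Gamma_frontier])
  show "smooth_boundary_on \<Omega> \<Gamma>" unfolding smooth_boundary_on_def using Gamma_chart by metis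
  show "frontier \<Omega> \<subseteq> \<Gamma> \<union> S" using frontier_Omega by blast
qed

lemma S_frontier: "S \<subseteq> closure \<Omega>" "S \<inter> \<Omega> = {}"
  using bounds_subset_closure[OF bounds_Omega_S] bounds_disjoint[OF bounds_Omega_S] by auto

lemma Gamma_closure: "\<Gamma> \<subseteq> closure \<Omega>" "\<Gamma> \<inter> \<Omega> = {}"
  using bounds_subset_closure[OF bounds_Omega_Gamma] bounds_disjoint[OF bounds_Omega_Gamma] by auto

section \<open>The potential near the shock and its extension\<close>

lemma W1: "Ck_on 1 W \<phi>s" using Ck_on_le[OF W(3), of 1] by simp

lemma cont_phis: "continuous_on W \<phi>s" by (rule Ck_on_imp_continuous[OF W(3)])

lemma phi_admissible: "\<phi> \<in> admissible_set A \<phi>s q0" using crit unfolding critical_point_def by blast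

lemma phi_continuous: "continuous_on (closure A) \<phi>" and phi_ge: "x \<in> A ==> \<phi>s x \<le> \<phi> x"
  using phi_admissible unfolding admissible_set_def by auto

lemma smooth_Phi_cont: "smooth_on UNIV f ==> continuous_on X f"
  using Ck_on_imp_continuous[OF smooth_onD] continuous_on_subset by blast

lemma Phi0_eq: "x \<in> closure \<Omega> ==> \<Phi>0 x = \<phi> x"
proof -
  assume x: "x \<in> closure \<Omega>"
  have c: "continuous_on (closure \<Omega>) (\<lambda>x. \<Phi>0 x - \<phi> x)"
    using continuous_on_subset[OF phi_continuous closure_Omega_A] smooth_Phi_cont[OF Phi0(1)]
    by (intro continuous_intros)
  have "(\<lambda>x. \<Phi>0 x - \<phi> x) x = 0"
    by (rule continuous_constant_on_closure[OF c _ x]) (simp add: Phi0(2))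
  then show ?thesis by simp
qed

lemma phi_outside: "x \<in> A ==> x \<notin> \<Omega> ==> \<phi> x = \<phi>s x"
  using phi_ge[of x] unfolding Om noncoincidence_def by auto

lemma phi_Omega: "x \<in> \<Omega> ==> \<phi>s x < \<phi> x" unfolding Om noncoincidence_def by auto

lemma Phi0_S: "x \<in> S ==> \<Phi>0 x = \<phi>s x"
proof -
  assume x: "x \<in> S"
  have "x \<in> A" "x \<notin> \<Omega>" "x \<in> closure \<Omega>" using x S_subset_A S_frontier by blast+
  then show ?thesis using Phi0_eq phi_outside by simp
qed

text \<open>On \<open>\<Gamma>\<close> the inequality is inherited from \<open>A\<close> by continuity; it can be an equality there, which is why
  variations near \<open>\<Gamma>\<close> are taken nonnegative.\<close>

lemma phi_ge_Gamma: "x \<in> \<Gamma> ==> \<phi>s x \<le> \<phi> x"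
proof -
  assume x: "x \<in> \<Gamma>"
  have xc: "x \<in> closure A" using x Gamma_closure closure_Omega_A by blast
  have c: "continuous_on (closure A) (\<lambda>x. \<phi> x - \<phi>s x)"
    using continuous_on_subset[OF cont_phis W(2)] phi_continuous by (intro continuous_intros)
  have "0 \<le> (\<lambda>x. \<phi> x - \<phi>s x) x"
    by (rule continuous_ge_on_closure[OF c xc]) (use phi_ge in auto)
  then show ?thesis by simp
qed

abbreviation n where "n \<equiv> outer_normal \<Omega>"

lemma u0_differentiable:
  assumes "x \<in> W" shows "(\<lambda>y. \<Phi>0 y - \<phi>s y) differentiable at x" "grad (\<lambda>y. \<Phi>0 y - \<phi>s y) x = grad \<Phi>0 x - grad \<phi>s x"
proof -
  have d: "\<Phi>0 differentiable at x" "\<phi>s differentiable at x"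
    using smooth_onD[OF Phi0(1), of 1] W1 assms by auto
  then show "(\<lambda>y. \<Phi>0 y - \<phi>s y) differentiable at x" by (rule differentiable_diff)
  show "grad (\<lambda>y. \<Phi>0 y - \<phi>s y) x = grad \<Phi>0 x - grad \<phi>s x"
    by (rule grad_eq_of_has_derivative)
      (use has_derivative_diff[OF has_derivative_grad[OF d(1)] has_derivative_grad[OF d(2)]] in \<open>simp add: inner_diff_left\<close>)
qed

lemma S_W: "S \<subseteq> W" using S_subset_A W(2) closure_subset by blast

text \<open>The jump potential \<open>\<Phi>0 - \<phi>s\<close> vanishes on the shock, so that its gradient is normal. It is positive on
  \<open>\<Omega>\<close>, so that the normal derivative is at most zero, and \<open>disp\<close> excludes zero.\<close>

lemma jump_gradient:
  assumes x: "x \<in> S"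
  shows "grad \<Phi>0 x - grad \<phi>s x = ((grad \<Phi>0 x - grad \<phi>s x) \<bullet> n x) *\<^sub>R n x" "(grad \<Phi>0 x - grad \<phi>s x) \<bullet> n x < 0"
proof -
  let ?u = "\<lambda>y. \<Phi>0 y - \<phi>s y"
  have xW: "x \<in> W" using x S_W by blast
  note u = u0_differentiable[OF xW]
  obtain U \<psi> where c: "boundary_chart \<Omega> x U \<psi>" "S \<inter> U = {y \<in> U. \<psi> y = 0}" using boundsE[OF bounds_Omega_S x] .
  note C = boundary_chartD[OF c(1)]
  obtain b V g where p: "graph_patch S b V g" "x \<in> V" using bounds_graph_patch[OF bounds_Omega_S x] .
  note G = graph_patchD[OF p(1)]
  have xb: "x \<bullet> b = g x" using G(5) x p(2) by blast
  have nx: "n x = sgn (grad \<psi> x)" by (rule outer_normal_eq[OF c(1)])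
  have gp: "grad \<psi> x = (grad \<psi> x \<bullet> b) *\<^sub>R (b - grad g x)"
    by (rule grad_on_graph[OF p(1), of "V \<inter> U"]) (use G(2,5) C p(2) c(2) xb in auto)
  have gu: "grad ?u x = (grad ?u x \<bullet> b) *\<^sub>R (b - grad g x)"
    by (rule grad_on_graph[OF p(1), of V]) (use G(2,5) p(2) xb u(1) Phi0_S in auto)
  have nz: "grad \<psi> x \<noteq> 0" using C(2,4) by blast
  then have k: "grad \<psi> x \<bullet> b \<noteq> 0" using gp by (metis scaleR_zero_left)
  define l where "l = (grad ?u x \<bullet> b) / (grad \<psi> x \<bullet> b) * norm (grad \<psi> x)"
  have "b - grad g x = (1 / (grad \<psi> x \<bullet> b)) *\<^sub>R grad \<psi> x" using k by (subst gp) simp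
  then have "grad ?u x = ((grad ?u x \<bullet> b) / (grad \<psi> x \<bullet> b)) *\<^sub>R grad \<psi> x" by (subst gu) simp
  also have "\<dots> = l *\<^sub>R n x" unfolding l_def nx sgn_div_norm using nz by simp
  finally have gl: "grad \<Phi>0 x - grad \<phi>s x = l *\<^sub>R n x" unfolding u(2) .
  have nn: "n x \<bullet> n x = 1" using norm_outer_normal[OF bounds_Omega_S x] by (simp add: dot_square_norm)
  have ll: "(grad \<Phi>0 x - grad \<phi>s x) \<bullet> n x = l" unfolding gl using nn by simp
  then show "grad \<Phi>0 x - grad \<phi>s x = ((grad \<Phi>0 x - grad \<phi>s x) \<bullet> n x) *\<^sub>R n x" using gl by simp
  have "l \<noteq> 0" using disp[OF x] ll by (auto simp: inner_diff_left)
  moreover have "\<not> l > 0"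
  proof
    assume l: "l > 0"
    have "grad ?u x \<bullet> (- n x) < 0" unfolding u(2) using ll l by simp
    then obtain e1 where e1: "e1 > 0" "\<And>t. 0 < t \<and> t < e1 ==> ?u (x + t *\<^sub>R (- n x)) < ?u x"
      using decrease_along[OF u(1)] by blast
    have "grad \<psi> x \<bullet> (- n x) < 0"
    proof -
      have "grad \<psi> x \<bullet> n x = norm (grad \<psi> x)"
        unfolding nx sgn_div_norm using nz by (simp add: dot_square_norm power2_eq_square)
      then show ?thesis using nz by simp
    qed
    then obtain e2 where e2: "e2 > 0" "\<And>t. 0 < t \<and> t < e2 ==> x + t *\<^sub>R (- n x) \<in> U \<and> \<psi> (x + t *\<^sub>R (- n x)) < 0"
      using chart_side_near[OF C(1,2) C(7)[OF C(2)] _ C(5)] by blast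
    define t where "t = min e1 e2 / 2"
    have t: "0 < t \<and> t < e1" "0 < t \<and> t < e2" unfolding t_def using e1(1) e2(1) by auto
    let ?y = "x + t *\<^sub>R (- n x)"
    have "?y \<in> \<Omega>" using e2(2)[OF t(2)] C(6) by blast
    then have "?u ?y > 0" using phi_Omega Phi0(2) by auto
    moreover have "?u ?y < ?u x" by (rule e1(2)[OF t(1)])
    ultimately show False using Phi0_S[OF x] by simp
  qed
  ultimately show "(grad \<Phi>0 x - grad \<phi>s x) \<bullet> n x < 0" unfolding ll by simp
qed

text \<open>By the mean value theorem the jump potential is a negative multiple of the signed distance to
  the graph, measured along \<open>b\<close>.\<close>

lemma below_beyond_shock:
  assumes x: "x \<in> S"
  obtains r where "r > 0" "\<And>y. y \<in> ball x r ==> y \<notin> closure \<Omega> ==> \<Phi>0 y < \<phi>s y"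
proof -
  let ?u = "\<lambda>y. \<Phi>0 y - \<phi>s y"
  have xW: "x \<in> W" using x S_W by blast
  obtain U \<psi> where c: "boundary_chart \<Omega> x U \<psi>" "S \<inter> U = {y \<in> U. \<psi> y = 0}" using boundsE[OF bounds_Omega_S x] .
  note C = boundary_chartD[OF c(1)]
  obtain b V g where p: "graph_patch S b V g" "x \<in> V" using bounds_graph_patch[OF bounds_Omega_S x] .
  note G = graph_patchD[OF p(1)]
  obtain r0 \<epsilon> where r0: "r0 > 0" "ball x r0 \<subseteq> V \<inter> U" and e: "\<epsilon> = 1 \<or> \<epsilon> = - 1"
    and pos: "\<And>y. y \<in> ball x r0 ==> \<epsilon> * (grad \<psi> y \<bullet> b) > 0"
    and side: "\<Omega> \<inter> ball x r0 = {y \<in> ball x r0. \<epsilon> * (y \<bullet> b - g y) < 0}"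
    using chart_graph_local[OF c p x] by blast
  have "\<epsilon> * (n x \<bullet> b) > 0"
  proof -
    have "\<epsilon> * (grad \<psi> x \<bullet> b) > 0" using pos r0(1) by simp
    moreover have "inverse (norm (grad \<psi> x)) > 0" using C(2,4) by simp
    ultimately have "0 < inverse (norm (grad \<psi> x)) * (\<epsilon> * (grad \<psi> x \<bullet> b))" by (rule mult_pos_pos[rotated])
    then show ?thesis unfolding outer_normal_eq[OF c(1)] sgn_div_norm by (simp only: inner_scaleR_left mult.left_commute[of \<epsilon>])
  qed
  then have neg: "\<epsilon> * ((grad \<Phi>0 x - grad \<phi>s x) \<bullet> b) < 0"
    using jump_gradient[OF x] by (metis inner_scaleR_left mult.left_commute mult_neg_pos)
  define U1 where "U1 = {y \<in> ball x r0 \<inter> W. \<epsilon> * ((grad \<Phi>0 y - grad \<phi>s y) \<bullet> b) < 0}"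
  have "continuous_on (ball x r0 \<inter> W) (\<lambda>y. \<epsilon> * ((grad \<Phi>0 y - grad \<phi>s y) \<bullet> b))"
    using continuous_on_subset[OF continuous_on_grad[OF W(1) W1]] continuous_on_subset[OF continuous_on_grad[OF open_UNIV smooth_onD[OF Phi0(1)]]]
    by (intro continuous_intros) auto
  then have oU1: "open U1" unfolding U1_def by (intro open_less_set) (use W(1) in auto)
  have xU1: "x \<in> U1" unfolding U1_def using r0(1) xW neg by simp
  have U1V: "U1 \<subseteq> V" unfolding U1_def using r0(2) by blast
  obtain r where r: "r > 0" "ball x r \<subseteq> U1" and mv: "\<And>f y. (\<And>z. z \<in> U1 ==> f differentiable at z) ==> (\<And>z. z \<in> S \<inter> U1 ==> f z = 0) ==> y \<in> ball x r ==>
      \<exists>\<xi>\<in>U1. f y = (y \<bullet> b - g y) * (grad f \<xi> \<bullet> b)"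
    using graph_mvt[OF p(1) x xU1 oU1 U1V] by blast
  show ?thesis
  proof (rule that[OF r(1)])
    fix y assume y: "y \<in> ball x r" "y \<notin> closure \<Omega>"
    have "\<exists>\<xi>\<in>U1. ?u y = (y \<bullet> b - g y) * (grad ?u \<xi> \<bullet> b)"
      by (rule mv[OF _ _ y(1)]) (use u0_differentiable Phi0_S in \<open>auto simp: U1_def\<close>)
    then obtain \<xi> where xi: "\<xi> \<in> U1" "?u y = (y \<bullet> b - g y) * (grad ?u \<xi> \<bullet> b)" by blast
    have k: "\<epsilon> * (grad ?u \<xi> \<bullet> b) < 0" using xi(1) u0_differentiable(2)[of \<xi>] unfolding U1_def by auto
    have yr0: "y \<in> ball x r0" using y(1) r(2) unfolding U1_def by blast
    have "y \<notin> \<Omega>" "y \<notin> S" using y(2) closure_subset S_frontier(1) by blast+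
    then have "\<not> \<epsilon> * (y \<bullet> b - g y) < 0" "y \<bullet> b \<noteq> g y"
      using side yr0 G(5) r0(2) by blast+
    then have "\<epsilon> * (y \<bullet> b - g y) > 0" using e by auto
    then have "?u y < 0" unfolding xi(2) using k e by (auto simp: mult_less_0_iff)
    then show "\<Phi>0 y < \<phi>s y" by simp
  qed
qed

text \<open>\<open>\<Phi>0\<close> is below \<open>\<phi>s\<close> just beyond the shock, so the points beyond it where this fails form a compact
  set at positive distance from \<open>\<Omega>\<close>. A large multiple of a cutoff function of this set is subtracted.\<close>

lemma extension_exists:
  obtains \<Phi> N where "smooth_on UNIV \<Phi>" "open N" "closure \<Omega> \<subseteq> N" "\<And>x. x \<in> N ==> \<Phi> x = \<Phi>0 x"
    "\<And>x. x \<in> closure A - closure \<Omega> ==> \<Phi> x < \<phi>s x"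
proof -
  define C where "C = {x \<in> closure A - closure \<Omega>. \<phi>s x \<le> \<Phi>0 x}"
  have cu: "continuous_on (closure A) (\<lambda>x. \<Phi>0 x - \<phi>s x)"
    using continuous_on_subset[OF cont_phis W(2)] smooth_Phi_cont[OF Phi0(1)] by (intro continuous_intros)
  have cA: "compact (closure A)" using bounded_A by simp
  have near: "\<exists>r>0. ball x r \<inter> C = {}" if x: "x \<in> closure \<Omega>" for x
  proof (cases "x \<in> S")
    case True
    obtain r where "r > 0" "\<And>y. y \<in> ball x r ==> y \<notin> closure \<Omega> ==> \<Phi>0 y < \<phi>s y"
      using below_beyond_shock[OF True] by blast
    then show ?thesis unfolding C_def by (intro exI[of _ r]) force
  next
    case False
    then have "x \<in> inside S" using x closure_Omega Omega_subset(2) S(4) by blast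
    then obtain r where r: "r > 0" "ball x r \<subseteq> inside S" using open_inside_S open_contains_ball by blast
    have "inside S \<inter> closure A \<subseteq> closure \<Omega>"
      using open_Int_closure_subset[OF open_inside_S, of A] unfolding Om_inside by (simp add: Int_commute)
    then show ?thesis using r unfolding C_def by (intro exI[of _ r]) blast
  qed
  have "closed C"
  proof -
    have "closure C \<subseteq> C"
    proof
      fix x assume x: "x \<in> closure C"
      have xA: "x \<in> closure A" using x closure_mono[of C "closure A"] unfolding C_def by auto
      have "0 \<le> (\<lambda>x. \<Phi>0 x - \<phi>s x) x"
        by (rule continuous_ge_on_closure[OF continuous_on_subset[OF cu] x])
          (use closure_mono[of C "closure A"] in \<open>auto simp: C_def\<close>)
      moreover have "x \<notin> closure \<Omega>"
      proof
        assume "x \<in> closure \<Omega>"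
        then obtain r where "r > 0" "ball x r \<inter> C = {}" using near by blast
        then show False using x unfolding closure_approachable by (auto simp: dist_commute disjoint_iff)
      qed
      ultimately show "x \<in> C" unfolding C_def using xA by auto
    qed
    then show ?thesis using closure_subset_eq by blast
  qed
  then have cC: "compact C"
    using cA compact_Int_closed[of "closure A" C] unfolding C_def by (simp add: Int_absorb1 subset_iff)
  have CO: "C \<subseteq> - closure \<Omega>" unfolding C_def by blast
  obtain \<theta> K' V where t: "smooth_on UNIV \<theta>" "\<And>x. 0 \<le> \<theta> x" "compact K'" "K' \<subseteq> - closure \<Omega>" "\<And>x. x \<notin> K' ==> \<theta> x = (0::real)"
    "C \<subseteq> V" "\<And>x. x \<in> V ==> \<theta> x = 1"
    using smooth_cutoff[OF cC _ CO] by (metis closed_closure open_Compl)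
  have "compact ((\<lambda>x. \<Phi>0 x - \<phi>s x) ` closure A)" using compact_continuous_image[OF cu cA] .
  then have "bounded ((\<lambda>x. \<Phi>0 x - \<phi>s x) ` closure A)" by (rule compact_imp_bounded)
  then obtain B where "\<forall>y\<in>(\<lambda>x. \<Phi>0 x - \<phi>s x) ` closure A. norm y \<le> B" unfolding bounded_iff by blast
  then have B: "\<bar>\<Phi>0 x - \<phi>s x\<bar> \<le> B" if "x \<in> closure A" for x using that by auto
  define M where "M = \<bar>B\<bar> + 1"
  show ?thesis
  proof (rule that)
    show "smooth_on UNIV (\<lambda>x. \<Phi>0 x - M * \<theta> x)"
      unfolding smooth_on_def
      by (intro allI Ck_on_diff Ck_on_mult Ck_on_const open_UNIV smooth_onD[OF Phi0(1)] smooth_onD[OF t(1)])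
    show "open (- K')" using t(3) compact_imp_closed by auto
    show "closure \<Omega> \<subseteq> - K'" using t(4) by blast
    show "\<Phi>0 x - M * \<theta> x = \<Phi>0 x" if "x \<in> - K'" for x using t(5) that by simp
    fix x assume x: "x \<in> closure A - closure \<Omega>"
    show "\<Phi>0 x - M * \<theta> x < \<phi>s x"
    proof (cases "x \<in> C")
      case True
      then have "\<theta> x = 1" using t(6,7) by blast
      moreover have "\<Phi>0 x - \<phi>s x < M" using B[of x] x unfolding M_def by auto
      ultimately show ?thesis by simp
    next
      case False
      then have "\<Phi>0 x < \<phi>s x" using x unfolding C_def by auto
      moreover have "0 \<le> M * \<theta> x" unfolding M_def using t(2) by simp
      ultimately show ?thesis by linarith
    qed
  qed
qed

end

section \<open>First variation\<close>

lemma weak_grad_cong: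
  assumes "\<And>x. x \<in> A ==> w x = w' x" shows "weak_grad A w = weak_grad A w'"
proof -
  have "weak_gradient A w g = weak_gradient A w' g" for g
  proof -
    have "(LINT x:A|lebesgue. w x * (grad \<zeta> x \<bullet> b)) = (LINT x:A|lebesgue. w' x * (grad \<zeta> x \<bullet> b))" for \<zeta> b
      unfolding set_lebesgue_integral_def
      by (rule Bochner_Integration.integral_cong) (auto simp: indicator_def assms)
    then show ?thesis unfolding weak_gradient_def by simp
  qed
  then show ?thesis unfolding weak_grad_def by simp
qed

text \<open>A derivative tested along one sequence of positive steps. This is all that the variational
  argument uses, and it fits the dominated convergence theorem.\<close>

lemma derivative_sequence:
  fixes f :: "real \<Rightarrow> real"
  assumes "(f has_real_derivative d) (at 0)" "t \<longlonglongrightarrow> 0" "\<And>n. t n > 0"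
  shows "(\<lambda>n. (f (t n) - f 0) / t n) \<longlonglongrightarrow> d"
proof -
  have "((\<lambda>h. (f (0 + h) - f 0) / h) \<longlongrightarrow> d) (at 0)" using assms(1) by (simp only: has_field_derivative_iff) (simp add: add_0)
  moreover have "filterlim t (at 0) sequentially"
    unfolding filterlim_at using assms(2,3) by (auto intro!: eventuallyI simp: less_imp_neq[symmetric])
  ultimately have "((\<lambda>n. (f (0 + t n) - f 0) / t n) \<longlonglongrightarrow> d)" by (rule filterlim_compose)
  then show ?thesis by simp
qed

lemma open_null_empty:
  fixes G :: "'a::euclidean_space set"
  assumes "open G" "AE x in lebesgue. x \<notin> G" shows "G = {}"
proof -
  have "G \<in> null_sets lebesgue" using assms AE_iff_null_sets[of G lebesgue] by simp
  then have "negligible G" by (simp add: negligible_iff_null_sets)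
  then show ?thesis using open_not_negligible[OF assms(1)] by blast
qed

lemma integral_divergence_zero:
  fixes X :: "'a::euclidean_space \<Rightarrow> 'a"
  assumes X: "Ck_field 1 UNIV X" and K: "compact K" "\<And>x. x \<notin> K ==> X x = 0"
  shows "integral\<^sup>L lborel (divergence X) = 0"
proof -
  have Xd: "X differentiable at x" for x using Ck_field_differentiable[of 0 UNIV X x] X by simp
  have cc: "C1_compact (\<lambda>x. X x \<bullet> b)" if "b \<in> Basis" for b
    unfolding C1_compact_def using X that K by (metis inner_zero_left)
  have "integral\<^sup>L lborel (divergence X) = (LBINT x. (\<Sum>b\<in>Basis. pd b (\<lambda>y. X y \<bullet> b) x))"
    by (rule Bochner_Integration.integral_cong) (simp_all add: divergence_eq_sum_pd[OF Xd])
  also have "\<dots> = (\<Sum>b\<in>Basis. LBINT x. pd b (\<lambda>y. X y \<bullet> b) x)"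
    by (rule Bochner_Integration.integral_sum) (rule C1_compact_pd(1)[OF cc])
  also have "\<dots> = 0" by (rule sum.neutral) (use integral_pd_zero[OF cc] in blast)
  finally show ?thesis .
qed

lemma grad_zero_outside:
  fixes f :: "'a::euclidean_space \<Rightarrow> real"
  assumes "compact K" "\<And>x. x \<notin> K ==> f x = 0" "x \<notin> K" shows "grad f x = 0"
proof -
  have "open (- K)" using assms(1) compact_imp_closed by auto
  then have "grad f x = grad (\<lambda>_. 0) x" by (rule grad_cong_open) (use assms in auto)
  also have "\<dots> = 0" by (rule grad_eq_of_has_derivative) simp
  finally show ?thesis .
qed

text \<open>\<open>\<Phi>\<close> is a competitor in the definition of a critical point; \<open>N\<close> is a neighbourhood on which it agrees
  with \<open>\<Phi>0\<close>, so that the gradients agree up to the boundary of \<open>\<Omega>\<close>.\<close>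

locale extended_potential = transonic_shock +
  fixes \<Phi> :: "'a \<Rightarrow> real" and N :: "'a set"
  assumes Phi: "smooth_on UNIV \<Phi>" and N: "open N" "closure \<Omega> \<subseteq> N" "\<And>x. x \<in> N ==> \<Phi> x = \<Phi>0 x"
    and below: "\<And>x. x \<in> closure A - closure \<Omega> ==> \<Phi> x < \<phi>s x"
begin

lemma grad_Phi: "x \<in> closure \<Omega> ==> grad \<Phi> x = grad \<Phi>0 x"
  using N by (intro grad_cong_open[OF N(1)]) auto

lemma Phi_phi: "x \<in> closure \<Omega> ==> \<Phi> x = \<phi> x" using N Phi0_eq by force

lemma Omega_iff: "x \<in> A ==> \<phi>s x < \<Phi> x \<longleftrightarrow> x \<in> \<Omega>"
proof -
  assume x: "x \<in> A"
  have c: "x \<in> closure A" using x closure_subset by blast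
  show ?thesis
  proof (cases "x \<in> closure \<Omega>")
    case True
    then show ?thesis using Phi_phi[OF True] phi_Omega phi_outside[OF x] by fastforce
  next
    case False
    moreover have "x \<notin> \<Omega>" using False closure_subset by blast
    ultimately show ?thesis using below[of x] c by auto
  qed
qed

lemma max_phi: "x \<in> A ==> max (\<phi>s x) (\<Phi> x) = \<phi> x"
proof -
  assume x: "x \<in> A"
  show ?thesis
  proof (cases "x \<in> \<Omega>")
    case True
    then show ?thesis using Phi_phi[of x] closure_subset[of \<Omega>] phi_Omega[OF True] by auto
  next
    case False
    then show ?thesis using Omega_iff[OF x] phi_outside[OF x False] by auto
  qed
qed

lemma Phi_C: "Ck_on k UNIV \<Phi>" by (rule smooth_onD[OF Phi])

lemma Phi_diff: "\<Phi> differentiable at x" using Phi_C[of 1] by simp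

lemma cont_grad_Phi: "continuous_on X (grad \<Phi>)"
  using continuous_on_subset[OF continuous_on_grad[OF open_UNIV Phi_C]] by blast

lemma grad_perturbed:
  assumes "smooth_on UNIV \<eta>" shows "grad (\<lambda>x. \<Phi> x + t * \<eta> x) x = grad \<Phi> x + t *\<^sub>R grad \<eta> x"
proof (rule grad_eq_of_has_derivative)
  have "\<eta> differentiable at x" using smooth_onD[OF assms, of 1] by simp
  from has_derivative_add[OF has_derivative_grad[OF Phi_diff] has_derivative_mult_right[OF has_derivative_grad[OF this], of t]]
  show "((\<lambda>x. \<Phi> x + t * \<eta> x) has_derivative (\<bullet>) (grad \<Phi> x + t *\<^sub>R grad \<eta> x)) (at x)"
    by (rule has_derivative_eq_rhs) (simp add: fun_eq_iff inner_add_left)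
qed

text \<open>The perturbation is the maximum of two continuously differentiable functions, so its weak
  gradient is known and the integrand of the functional can be written down.\<close>

lemma perturbed_weak_grad:
  assumes e: "smooth_on UNIV \<eta>"
  shows "perturbed \<phi>s \<Phi> \<eta> t \<in> W1_inf A" "L_inf A (weak_grad A (perturbed \<phi>s \<Phi> \<eta> t))"
    "AE x in lebesgue. x \<in> A \<longrightarrow> weak_grad A (perturbed \<phi>s \<Phi> \<eta> t) x = max_grad \<phi>s (\<lambda>x. \<Phi> x + t * \<eta> x) x"
    "continuous_on (closure A) (perturbed \<phi>s \<Phi> \<eta> t)"
proof -
  let ?v = "\<lambda>x. \<Phi> x + t * \<eta> x"
  have v: "Ck_on 1 UNIV ?v" by (intro Ck_on_add Ck_on_mult Ck_on_const open_UNIV Phi_C smooth_onD[OF e])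
  then have vW: "Ck_on 1 W ?v" using Ck_on_subset by blast
  have AW: "A \<subseteq> W" using W(2) closure_subset by blast
  show c: "continuous_on (closure A) (perturbed \<phi>s \<Phi> \<eta> t)"
    unfolding perturbed_def
    by (intro continuous_on_max continuous_on_subset[OF cont_phis W(2)] continuous_on_subset[OF Ck_on_imp_continuous[OF v]]) auto
  have g: "weak_gradient A (perturbed \<phi>s \<Phi> \<eta> t) (max_grad \<phi>s ?v)"
    unfolding perturbed_def by (rule max_weak_gradient[OF W(1) AW open_A W1 vW])
  note wg = weak_grad_eqI[OF open_A bounded_A L_inf_continuous[OF bounded_A open_A c]
      L_inf_max_grad[OF bounded_A open_A W(1,2) W1 vW] g]
  show "perturbed \<phi>s \<Phi> \<eta> t \<in> W1_inf A" "L_inf A (weak_grad A (perturbed \<phi>s \<Phi> \<eta> t))"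
    "AE x in lebesgue. x \<in> A \<longrightarrow> weak_grad A (perturbed \<phi>s \<Phi> \<eta> t) x = max_grad \<phi>s ?v x"
    using wg by auto
qed

text \<open>The constraint on the weak gradient holds almost everywhere; in the open set \<open>\<Omega>\<close> the gradient is
  continuous.\<close>

lemma grad_Phi_bound: "x \<in> \<Omega> ==> norm (grad \<Phi> x) \<le> q0"
proof -
  assume x: "x \<in> \<Omega>"
  have z: "smooth_on UNIV (\<lambda>x::'a. 0::real)" unfolding smooth_on_def by simp
  have e: "weak_grad A (perturbed \<phi>s \<Phi> (\<lambda>_. 0) 0) = weak_grad A \<phi>"
    by (rule weak_grad_cong) (simp add: perturbed_def max_phi)
  have "AE x in lebesgue. x \<in> A \<longrightarrow> norm (weak_grad A \<phi> x) \<le> q0"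
    using phi_admissible unfolding admissible_set_def by blast
  moreover have "AE x in lebesgue. x \<in> A \<longrightarrow> weak_grad A \<phi> x = max_grad \<phi>s (\<lambda>x. \<Phi> x + 0 * 0) x"
    using perturbed_weak_grad(3)[OF z, of 0] unfolding e .
  ultimately have "AE x in lebesgue. x \<notin> {x \<in> \<Omega>. q0 < norm (grad \<Phi> x)}"
  proof eventually_elim
    case (elim y)
    show ?case
    proof
      assume y: "y \<in> {x \<in> \<Omega>. q0 < norm (grad \<Phi> x)}"
      then have "y \<in> A" using Omega_subset by blast
      then have "weak_grad A \<phi> y = grad \<Phi> y" using elim(2) Omega_iff y unfolding max_grad_def by auto
      then show False using elim(1) y \<open>y \<in> A\<close> by auto
    qed
  qed
  moreover have "open {x \<in> \<Omega>. q0 < norm (grad \<Phi> x)}"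
    by (rule open_less_set[OF open_Omega]) (auto intro!: continuous_intros cont_grad_Phi)
  ultimately have "{x \<in> \<Omega>. q0 < norm (grad \<Phi> x)} = {}" using open_null_empty by blast
  then show ?thesis using x by auto
qed

text \<open>On the compact set \<open>K\<close> the speed stays below some \<open>q1 < q0\<close>, which leaves room for small \<open>t \<eta>\<close>. Off \<open>K\<close>
  nothing changes.\<close>

lemma admissible_variation:
  assumes e: "smooth_on UNIV \<eta>" and K: "compact K" "\<And>x. x \<notin> K ==> \<eta> x = 0" and lt: "\<And>x. x \<in> K ==> norm (grad \<Phi> x) < q0"
  obtains \<delta> where "\<delta> > 0" "\<And>t. \<bar>t\<bar> < \<delta> ==> perturbed \<phi>s \<Phi> \<eta> t \<in> admissible_set A \<phi>s q0"
    "\<And>t x. \<bar>t\<bar> < \<delta> ==> x \<in> K ==> norm (grad \<Phi> x + t *\<^sub>R grad \<eta> x) < q0"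
    "\<And>t x. \<bar>t\<bar> < \<delta> ==> x \<in> A ==> \<phi>s x < \<Phi> x + t * \<eta> x ==> norm (grad \<Phi> x + t *\<^sub>R grad \<eta> x) \<le> q0"
proof -
  obtain q1 where q1: "q1 < q0" "\<And>x. x \<in> K ==> norm (grad \<Phi> x) \<le> q1"
  proof (cases "K = {}")
    case True then show ?thesis using that[of "q0 - 1"] by auto
  next
    case False
    have "continuous_on K (\<lambda>x. norm (grad \<Phi> x))" by (intro continuous_intros cont_grad_Phi)
    then obtain x where "x \<in> K" "\<And>y. y \<in> K ==> norm (grad \<Phi> y) \<le> norm (grad \<Phi> x)"
      using continuous_attains_sup[OF K(1) False] by blast
    then show ?thesis using that[of "norm (grad \<Phi> x)"] lt by blast
  qed
  have ce: "continuous_on K (grad \<eta>)"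
    using continuous_on_subset[OF continuous_on_grad[OF open_UNIV smooth_onD[OF e]]] by blast
  have "bounded (grad \<eta> ` K)" using compact_imp_bounded[OF compact_continuous_image[OF ce K(1)]] .
  then obtain H0 where H0: "\<forall>y\<in>grad \<eta> ` K. norm y \<le> H0" unfolding bounded_iff by blast
  define H where "H = \<bar>H0\<bar> + 1"
  have H: "H > 0" "\<And>x. x \<in> K ==> norm (grad \<eta> x) \<le> H" unfolding H_def using H0 by force+
  define \<delta> where "\<delta> = (q0 - q1) / H"
  have d: "\<delta> > 0" unfolding \<delta>_def using q1 H by simp
  have in_K: "norm (grad \<Phi> x + t *\<^sub>R grad \<eta> x) < q0" if t: "\<bar>t\<bar> < \<delta>" and x: "x \<in> K" for t x
  proof -
    have "norm (grad \<Phi> x + t *\<^sub>R grad \<eta> x) \<le> norm (grad \<Phi> x) + \<bar>t\<bar> * norm (grad \<eta> x)"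
      using norm_triangle_ineq[of "grad \<Phi> x" "t *\<^sub>R grad \<eta> x"] by simp
    also have "\<dots> \<le> q1 + \<bar>t\<bar> * H" using q1(2)[OF x] H(2)[OF x] by (intro add_mono mult_left_mono) auto
    also have "\<dots> < q1 + \<delta> * H" using t H(1) by simp
    also have "\<dots> = q0" unfolding \<delta>_def using H(1) by simp
    finally show ?thesis .
  qed
  have in_A: "norm (grad \<Phi> x + t *\<^sub>R grad \<eta> x) \<le> q0" if t: "\<bar>t\<bar> < \<delta>" and x: "x \<in> A" "\<phi>s x < \<Phi> x + t * \<eta> x" for t x
  proof (cases "x \<in> K")
    case True then show ?thesis using in_K[OF t True] by simp
  next
    case False
    then have "x \<in> \<Omega>" using x Omega_iff[OF x(1)] K(2) by simp
    then show ?thesis using grad_Phi_bound grad_zero_outside[OF K False] by simp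
  qed
  show ?thesis
  proof (rule that[OF d _ in_K in_A])
    fix t :: real assume t: "\<bar>t\<bar> < \<delta>"
    note pw = perturbed_weak_grad[OF e, of t]
    have "AE x in lebesgue. x \<in> A \<longrightarrow> norm (weak_grad A (perturbed \<phi>s \<Phi> \<eta> t) x) \<le> q0"
      using pw(3)
    proof eventually_elim
      case (elim x)
      show ?case
      proof
        assume x: "x \<in> A"
        then have "x \<in> closure A" using closure_subset by blast
        then show "norm (weak_grad A (perturbed \<phi>s \<Phi> \<eta> t) x) \<le> q0"
          using elim x in_A[OF t x] W(4)[of x] unfolding max_grad_def by (auto simp: grad_perturbed[OF e])
      qed
    qed
    then show "perturbed \<phi>s \<Phi> \<eta> t \<in> admissible_set A \<phi>s q0"
      unfolding admissible_set_def using pw(1,4) by (auto simp: perturbed_def)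
  qed
qed

text \<open>A neighbourhood of the closure of \<open>A\<close> on which the supersonic density is differentiable.\<close>

definition Nsup where "Nsup = {x \<in> W. norm (grad \<phi>s x) < q0}"

lemma Nsup: "open Nsup" "closure A \<subseteq> Nsup"
  unfolding Nsup_def using W(2,4)
  by (auto intro!: open_less_set[OF W(1)] continuous_intros continuous_on_grad[OF W(1) W1])

definition rhos where "rhos x = gas_density \<gamma> k0 q0 ((norm (grad \<phi>s x))\<^sup>2)"

definition Psup where "Psup x = scale \<gamma> ka * pressure \<gamma> k0 (rhos x)"

lemma Nsup_sq: "x \<in> Nsup ==> (norm (grad \<phi>s x))\<^sup>2 < q0\<^sup>2"
  unfolding Nsup_def by (auto intro: power_strict_mono)

lemma W2: "Ck_on (Suc 1) W \<phi>s" using W(3) by (simp only: numeral_2_eq_2 One_nat_def)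

lemma rhos_C1: "Ck_on 1 Nsup rhos"
  unfolding rhos_def
  by (intro gas_density_Ck Ck_on_norm_grad_sq Nsup(1) Ck_on_subset[OF W2] Nsup_sq gam k0) (auto simp: Nsup_def)

lemma Psup_C1: "Ck_on 1 Nsup Psup"
  unfolding Psup_def pressure_def
  by (intro Ck_on_mult Ck_on_const Nsup(1) Ck_on_compose_real[OF Nsup(1) rhos_C1 Ck_on_powr])
    (use gas_density_pos[OF Nsup_sq gam k0] in \<open>auto simp: rhos_def\<close>)

lemma Psup_integrable: "integrable lborel (\<lambda>x. indicator A x * Psup x)"
  by (rule integrable_on_closure[OF open_A bounded_A continuous_on_subset[OF Ck_on_imp_continuous[OF Psup_C1] Nsup(2)]])

text \<open>The energy density of the perturbed flow; it is integrated over the perturbed domain \<open>Ovar\<close>.\<close>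

definition Fvar where "Fvar \<eta> t x = bernoulli \<gamma> q0 ((norm (grad \<Phi> x + t *\<^sub>R grad \<eta> x))\<^sup>2) powr (\<gamma> / (\<gamma> - 1))"

definition Ovar where "Ovar \<eta> t = {x \<in> A. \<phi>s x < \<Phi> x + t * \<eta> x}"

lemma Ovar_0: "Ovar \<eta> 0 = \<Omega>" unfolding Ovar_def using Omega_iff Omega_subset by auto

lemma Ovar_borel:
  assumes e: "smooth_on UNIV \<eta>" shows "Ovar \<eta> t \<in> sets borel"
proof -
  have "open (Ovar \<eta> t)" unfolding Ovar_def
    using closure_subset W(2) by (intro open_less_set[OF open_A] continuous_on_subset[OF cont_phis] continuous_intros
      smooth_Phi_cont[OF Phi] smooth_Phi_cont[OF e]) auto
  then show ?thesis by simp
qed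

lemma Fvar_borel:
  assumes e: "smooth_on UNIV \<eta>" shows "Fvar \<eta> t \<in> borel_measurable borel"
proof -
  have [measurable]: "grad \<Phi> \<in> borel_measurable borel" "grad \<eta> \<in> borel_measurable borel"
    using cont_grad_Phi continuous_on_grad[OF open_UNIV smooth_onD[OF e]] by (auto intro: borel_measurable_continuous_onI)
  show ?thesis unfolding Fvar_def[abs_def] bernoulli_def by measurable
qed

lemma Fvar_integrable:
  assumes e: "smooth_on UNIV \<eta>" and bd: "\<And>x. x \<in> Ovar \<eta> t ==> norm (grad \<Phi> x + t *\<^sub>R grad \<eta> x) \<le> q0"
  shows "integrable lborel (\<lambda>x. indicator (Ovar \<eta> t) x * Fvar \<eta> t x)"
proof -
  note [measurable] = Ovar_borel[OF e, of t] Fvar_borel[OF e, of t]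
  have b: "bounded (Ovar \<eta> t)" unfolding Ovar_def by (rule bounded_subset[OF bounded_A]) auto
  show ?thesis
  proof (rule bounded_set_integrable[OF b, of _ "((\<gamma> - 1) / 2 * q0\<^sup>2) powr (\<gamma> / (\<gamma> - 1))"])
    fix x assume x: "x \<in> Ovar \<eta> t"
    have "(norm (grad \<Phi> x + t *\<^sub>R grad \<eta> x))\<^sup>2 \<le> q0\<^sup>2" using bd[OF x] by (intro power_mono) auto
    then have "0 \<le> bernoulli \<gamma> q0 ((norm (grad \<Phi> x + t *\<^sub>R grad \<eta> x))\<^sup>2)"
      "bernoulli \<gamma> q0 ((norm (grad \<Phi> x + t *\<^sub>R grad \<eta> x))\<^sup>2) \<le> (\<gamma> - 1) / 2 * q0\<^sup>2"
      unfolding bernoulli_def using gam by (auto intro!: mult_nonneg_nonneg mult_left_mono)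
    then have "Fvar \<eta> t x \<le> ((\<gamma> - 1) / 2 * q0\<^sup>2) powr (\<gamma> / (\<gamma> - 1))"
      unfolding Fvar_def using gam by (intro powr_mono2) auto
    moreover have "0 \<le> Fvar \<eta> t x" unfolding Fvar_def by simp
    ultimately show "\<bar>indicator (Ovar \<eta> t) x * Fvar \<eta> t x\<bar> \<le> ((\<gamma> - 1) / 2 * q0\<^sup>2) powr (\<gamma> / (\<gamma> - 1))"
      using x by simp
  qed auto
qed

lemma Psup_Ovar_integrable:
  assumes e: "smooth_on UNIV \<eta>" shows "integrable lborel (\<lambda>x. indicator (Ovar \<eta> t) x * Psup x)"
proof -
  have "integrable lborel (\<lambda>x. indicator (Ovar \<eta> t) x * (indicator A x * Psup x))"
    by (rule integrable_indicator_mult[OF Psup_integrable Ovar_borel[OF e]])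
  moreover have "(\<lambda>x. indicator (Ovar \<eta> t) x * (indicator A x * Psup x)) = (\<lambda>x. indicator (Ovar \<eta> t) x * Psup x)"
    by (rule ext) (auto simp: indicator_def Ovar_def)
  ultimately show ?thesis by simp
qed

text \<open>The integral of \<open>Psup\<close> over the coincidence set is written as a constant minus an integral over
  the perturbed domain, so that only integrals over one moving domain remain.\<close>

lemma functional_eq:
  assumes e: "smooth_on UNIV \<eta>" and bd: "\<And>x. x \<in> Ovar \<eta> t ==> norm (grad \<Phi> x + t *\<^sub>R grad \<eta> x) \<le> q0"
  shows "functional \<gamma> k0 ka q0 A \<Gamma> \<phi>s m (perturbed \<phi>s \<Phi> \<eta> t)
    = - (LBINT x. indicator (Ovar \<eta> t) x * (Fvar \<eta> t x - Psup x)) - (LBINT x. indicator A x * Psup x)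
      + surface_integral \<Gamma> (\<lambda>s. scale \<gamma> ka * m s * perturbed \<phi>s \<Phi> \<eta> t s)"
proof -
  let ?w = "perturbed \<phi>s \<Phi> \<eta> t"
  let ?h = "\<lambda>z::'a. bernoulli \<gamma> q0 ((norm z)\<^sup>2) powr (\<gamma> / (\<gamma> - 1))"
  have O: "noncoincidence A \<phi>s ?w = Ovar \<eta> t"
    unfolding noncoincidence_def Ovar_def perturbed_def by (auto simp: less_max_iff_disj)
  note Ob = Ovar_borel[OF e, of t] and Fb = Fvar_borel[OF e, of t]
  note pw = perturbed_weak_grad[OF e, of t]
  have hb: "?h \<in> borel_measurable borel" unfolding bernoulli_def by measurable
  have F1: "(LINT x:Ovar \<eta> t|lebesgue. ((\<gamma> - 1) / 2 * (q0\<^sup>2 - (norm (weak_grad A ?w x))\<^sup>2)) powr (\<gamma> / (\<gamma> - 1)))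
    = (LBINT x. indicator (Ovar \<eta> t) x * Fvar \<eta> t x)"
  proof -
    have "(LINT x:Ovar \<eta> t|lebesgue. ((\<gamma> - 1) / 2 * (q0\<^sup>2 - (norm (weak_grad A ?w x))\<^sup>2)) powr (\<gamma> / (\<gamma> - 1)))
      = (\<integral>x. indicator (Ovar \<eta> t) x * Fvar \<eta> t x \<partial>lebesgue)"
      unfolding set_lebesgue_integral_def
    proof (rule integral_cong_AE)
      have "(\<lambda>x. indicator A x *\<^sub>R weak_grad A ?w x) \<in> borel_measurable lebesgue"
        using pw(2) unfolding L_inf_def set_borel_measurable_def by blast
      then have "(\<lambda>x. ?h (indicator A x *\<^sub>R weak_grad A ?w x)) \<in> borel_measurable lebesgue"
        using hb by (rule measurable_compose)
      then have "(\<lambda>x. indicator (Ovar \<eta> t) x *\<^sub>R ?h (indicator A x *\<^sub>R weak_grad A ?w x)) \<in> borel_measurable lebesgue"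
        using Ob by (intro borel_measurable_scaleR borel_measurable_indicator) auto
      moreover have "(\<lambda>x. indicator (Ovar \<eta> t) x *\<^sub>R ?h (indicator A x *\<^sub>R weak_grad A ?w x))
        = (\<lambda>x. indicator (Ovar \<eta> t) x *\<^sub>R (((\<gamma> - 1) / 2 * (q0\<^sup>2 - (norm (weak_grad A ?w x))\<^sup>2)) powr (\<gamma> / (\<gamma> - 1))))"
        by (rule ext) (auto simp: indicator_def Ovar_def bernoulli_def)
      ultimately show "(\<lambda>x. indicat_real (Ovar \<eta> t) x *\<^sub>R (((\<gamma> - 1) / 2 * (q0\<^sup>2 - (norm (weak_grad A ?w x))\<^sup>2)) powr (\<gamma> / (\<gamma> - 1)))) \<in> borel_measurable lebesgue"
        by simp
      show "(\<lambda>x. indicat_real (Ovar \<eta> t) x * Fvar \<eta> t x) \<in> borel_measurable lebesgue"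
        using Ob Fb by (intro measurable_completion) simp
      show "AE x in lebesgue. indicat_real (Ovar \<eta> t) x *\<^sub>R (((\<gamma> - 1) / 2 * (q0\<^sup>2 - (norm (weak_grad A ?w x))\<^sup>2)) powr (\<gamma> / (\<gamma> - 1)))
        = indicat_real (Ovar \<eta> t) x * Fvar \<eta> t x"
        using pw(3)
      proof eventually_elim
        case (elim x)
        show ?case
        proof (cases "x \<in> Ovar \<eta> t")
          case True
          then have "weak_grad A ?w x = grad \<Phi> x + t *\<^sub>R grad \<eta> x"
            using elim unfolding Ovar_def max_grad_def by (auto simp: grad_perturbed[OF e])
          then show ?thesis unfolding Fvar_def bernoulli_def by simp
        qed simp
      qed
    qed
    also have "\<dots> = (LBINT x. indicator (Ovar \<eta> t) x * Fvar \<eta> t x)"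
      using Ob Fb by (intro integral_completion) simp
    finally show ?thesis .
  qed
  have Pi: "integrable lborel (\<lambda>x. indicator (Ovar \<eta> t) x * Psup x)" by (rule Psup_Ovar_integrable[OF e])
  have F2: "(LINT x:A - Ovar \<eta> t|lebesgue. \<gamma> powr (\<gamma> / (\<gamma> - 1)) * ka powr (1 / (\<gamma> - 1)) *
          pressure \<gamma> k0 (gas_density \<gamma> k0 q0 ((norm (grad \<phi>s x))\<^sup>2)))
    = (LBINT x. indicator A x * Psup x) - (LBINT x. indicator (Ovar \<eta> t) x * Psup x)"
  proof -
    have "(LINT x:A - Ovar \<eta> t|lebesgue. \<gamma> powr (\<gamma> / (\<gamma> - 1)) * ka powr (1 / (\<gamma> - 1)) *
          pressure \<gamma> k0 (gas_density \<gamma> k0 q0 ((norm (grad \<phi>s x))\<^sup>2)))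
      = (LBINT x. indicator A x * Psup x - indicator (Ovar \<eta> t) x * Psup x)"
    proof (rule set_lebesgue_integral_eq_lborel)
      show "(\<lambda>x. indicator A x * Psup x - indicator (Ovar \<eta> t) x * Psup x) \<in> borel_measurable borel"
        using borel_measurable_integrable[OF Psup_integrable] borel_measurable_integrable[OF Pi] by simp
    qed (auto simp: indicator_def Ovar_def Psup_def scale_def rhos_def)
    then show ?thesis using Psup_integrable Pi by simp
  qed
  have "(LBINT x. indicator (Ovar \<eta> t) x * (Fvar \<eta> t x - Psup x))
    = (LBINT x. indicator (Ovar \<eta> t) x * Fvar \<eta> t x) - (LBINT x. indicator (Ovar \<eta> t) x * Psup x)"
    using Fvar_integrable[OF e bd] Pi by (simp add: right_diff_distrib)
  then show ?thesis unfolding functional_def O F1 F2 scale_def by simp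
qed

definition rho where "rho x = gas_density \<gamma> ka q0 ((norm (grad \<Phi> x))\<^sup>2)"

definition mflux where "mflux x = rho x *\<^sub>R grad \<Phi> x"

text \<open>Criticality along a sequence of steps that are small enough for every perturbation to be
  admissible.\<close>

lemma first_variation:
  assumes e: "smooth_on UNIV \<eta>" and K: "compact K" "\<And>x. x \<notin> K ==> \<eta> x = 0" and lt: "\<And>x. x \<in> K ==> norm (grad \<Phi> x) < q0"
  obtains t where "t \<longlonglongrightarrow> 0" "\<And>n. t n > 0"
    "\<And>n. integrable lborel (\<lambda>x. indicator (Ovar \<eta> (t n)) x * Fvar \<eta> (t n) x)"
    "integrable lborel (\<lambda>x. indicator \<Omega> x * Fvar \<eta> 0 x)"
    "\<And>n s x. 0 \<le> s ==> s \<le> t n ==> x \<in> K ==> norm (grad \<Phi> x + s *\<^sub>R grad \<eta> x) < q0"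
    "(\<lambda>n. (- ((LBINT x. indicator (Ovar \<eta> (t n)) x * (Fvar \<eta> (t n) x - Psup x))
        - (LBINT x. indicator \<Omega> x * (Fvar \<eta> 0 x - Psup x)))
      + (surface_integral \<Gamma> (\<lambda>s. scale \<gamma> ka * m s * perturbed \<phi>s \<Phi> \<eta> (t n) s)
        - surface_integral \<Gamma> (\<lambda>s. scale \<gamma> ka * m s * perturbed \<phi>s \<Phi> \<eta> 0 s))) / t n) \<longlonglongrightarrow> 0"
proof -
  obtain \<delta> where d: "\<delta> > 0" "\<And>t. \<bar>t\<bar> < \<delta> ==> perturbed \<phi>s \<Phi> \<eta> t \<in> admissible_set A \<phi>s q0"
    "\<And>t x. \<bar>t\<bar> < \<delta> ==> x \<in> K ==> norm (grad \<Phi> x + t *\<^sub>R grad \<eta> x) < q0"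
    "\<And>t x. \<bar>t\<bar> < \<delta> ==> x \<in> A ==> \<phi>s x < \<Phi> x + t * \<eta> x ==> norm (grad \<Phi> x + t *\<^sub>R grad \<eta> x) \<le> q0"
    by (rule admissible_variation[OF e K lt]) blast+
  define t where "t = (\<lambda>n. (\<delta> / 2) * (1 / real (Suc n)))"
  have "t \<longlonglongrightarrow> (\<delta> / 2) * 0" unfolding t_def by (intro tendsto_intros inverse_Suc_tendsto_0)
  then have t0: "t \<longlonglongrightarrow> 0" by simp
  have tpos: "t n > 0" for n unfolding t_def using d(1) by simp
  have tlt: "t n < \<delta>" for n
  proof -
    have "(\<delta> / 2) * (1 / real (Suc n)) \<le> (\<delta> / 2) * 1" using d(1) by (intro mult_left_mono) auto
    then show ?thesis unfolding t_def using d(1) by linarith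
  qed
  have bd: "norm (grad \<Phi> x + s *\<^sub>R grad \<eta> x) \<le> q0" if "\<bar>s\<bar> < \<delta>" "x \<in> Ovar \<eta> s" for s x
    using d(4)[OF that(1)] that(2) unfolding Ovar_def by blast
  have c1: "\<forall>x\<in>noncoincidence A \<phi>s \<phi>. \<Phi> x = \<phi> x"
    unfolding Om[symmetric] using Phi_phi closure_subset by blast
  have c2: "\<forall>x\<in>closure A - closure (noncoincidence A \<phi>s \<phi>). \<Phi> x < \<phi>s x"
    unfolding Om[symmetric] using below by blast
  have der: "((\<lambda>t. functional \<gamma> k0 ka q0 A \<Gamma> \<phi>s m (perturbed \<phi>s \<Phi> \<eta> t)) has_real_derivative 0) (at 0)"
    using crit Phi e c1 c2 d(1,2) unfolding critical_point_def by blast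
  show ?thesis
  proof (rule that[OF t0 tpos])
    show "integrable lborel (\<lambda>x. indicator (Ovar \<eta> (t n)) x * Fvar \<eta> (t n) x)" for n
      by (rule Fvar_integrable[OF e bd]) (use tpos[of n] tlt[of n] in auto)
    show "integrable lborel (\<lambda>x. indicator \<Omega> x * Fvar \<eta> 0 x)"
      using Fvar_integrable[OF e bd[of 0]] d(1) unfolding Ovar_0 by simp
    show "norm (grad \<Phi> x + s *\<^sub>R grad \<eta> x) < q0" if "0 \<le> s" "s \<le> t n" "x \<in> K" for n s x
      using d(3)[of s x] that tlt[of n] by simp
    have fe: "functional \<gamma> k0 ka q0 A \<Gamma> \<phi>s m (perturbed \<phi>s \<Phi> \<eta> s)
      = - (LBINT x. indicator (Ovar \<eta> s) x * (Fvar \<eta> s x - Psup x)) - (LBINT x. indicator A x * Psup x)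
      + surface_integral \<Gamma> (\<lambda>r. scale \<gamma> ka * m r * perturbed \<phi>s \<Phi> \<eta> s r)" if "\<bar>s\<bar> < \<delta>" for s
      by (rule functional_eq[OF e bd[OF that]])
    have tn: "\<bar>t n\<bar> < \<delta>" for n using tpos[of n] tlt[of n] by simp
    have z: "\<bar>0\<bar> < \<delta>" using d(1) by simp
    show "(\<lambda>n. (- ((LBINT x. indicator (Ovar \<eta> (t n)) x * (Fvar \<eta> (t n) x - Psup x))
        - (LBINT x. indicator \<Omega> x * (Fvar \<eta> 0 x - Psup x)))
      + (surface_integral \<Gamma> (\<lambda>s. scale \<gamma> ka * m s * perturbed \<phi>s \<Phi> \<eta> (t n) s)
        - surface_integral \<Gamma> (\<lambda>s. scale \<gamma> ka * m s * perturbed \<phi>s \<Phi> \<eta> 0 s))) / t n) \<longlonglongrightarrow> 0"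
      using derivative_sequence[OF der t0 tpos] unfolding fe[OF tn] fe[OF z] Ovar_0
      by (simp add: algebra_simps)
  qed
qed

text \<open>The part of the first variation that comes from the change of the energy density. The hypothesis
  \<open>ind\<close> covers both a fixed domain and a moving one.\<close>

lemma Fvar_quotient:
  assumes e: "smooth_on UNIV \<eta>" and K: "compact K" "\<And>x. x \<notin> K ==> \<eta> x = 0"
    and t: "t \<longlonglongrightarrow> 0" "\<And>n. t n > 0" and lt: "\<And>n s x. 0 \<le> s ==> s \<le> t n ==> x \<in> K ==> norm (grad \<Phi> x + s *\<^sub>R grad \<eta> x) < q0"
    and ind: "AE x in lborel. x \<in> K \<longrightarrow> (\<lambda>n. indicat_real (Ovar \<eta> (t n)) x) \<longlonglongrightarrow> indicator \<Omega> x"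
  shows "(\<lambda>n. (LBINT x. indicator (Ovar \<eta> (t n)) x * (Fvar \<eta> (t n) x - Fvar \<eta> 0 x)) / t n)
    \<longlonglongrightarrow> - scale \<gamma> ka * (LBINT x. indicator \<Omega> x * (mflux x \<bullet> grad \<eta> x))"
    "\<And>n. integrable lborel (\<lambda>x. indicator (Ovar \<eta> (t n)) x * (Fvar \<eta> (t n) x - Fvar \<eta> 0 x))"
proof -
  have ge: "grad \<eta> x = 0" if "x \<notin> K" for x by (rule grad_zero_outside[OF K(1) _ that]) (rule K(2))
  have F0: "Fvar \<eta> s x = Fvar \<eta> 0 x" if "x \<notin> K" for x s unfolding Fvar_def using ge[OF that] by simp
  have ce: "continuous_on K (grad \<eta>)"
    using continuous_on_subset[OF continuous_on_grad[OF open_UNIV smooth_onD[OF e]]] by blast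
  have "bounded (grad \<eta> ` K)" using compact_imp_bounded[OF compact_continuous_image[OF ce K(1)]] .
  then obtain H where "\<forall>y\<in>grad \<eta> ` K. norm y \<le> H" unfolding bounded_iff by blast
  then have H: "norm (grad \<eta> x) \<le> H" if "x \<in> K" for x using that by blast
  define L where "L = \<gamma> * ((\<gamma> - 1) / 2 * q0\<^sup>2) powr (1 / (\<gamma> - 1)) * (q0 * H)"
  let ?s = "\<lambda>n x. indicator (Ovar \<eta> (t n)) x * ((Fvar \<eta> (t n) x - Fvar \<eta> 0 x) / t n)"
  let ?l = "\<lambda>x. indicator \<Omega> x * (- scale \<gamma> ka * (mflux x \<bullet> grad \<eta> x))"
  have bd: "\<bar>Fvar \<eta> (t n) x - Fvar \<eta> 0 x\<bar> \<le> t n * (indicator K x * L)" for n x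
  proof (cases "x \<in> K")
    case True
    have "\<bar>Fvar \<eta> (t n) x - Fvar \<eta> 0 x\<bar> \<le> t n * L" unfolding Fvar_def L_def
      using bernoulli_powr_lipschitz[OF gam t(2)[of n], of "grad \<Phi> x" "grad \<eta> x" q0 H] lt[OF _ _ True] H[OF True] by simp
    then show ?thesis using True by simp
  qed (simp add: F0[of _ "t n"])
  have Ob: "Ovar \<eta> s \<in> sets borel" for s by (rule Ovar_borel[OF e])
  note Fb = Fvar_borel[OF e]
  have sm: "?s n \<in> borel_measurable lborel" for n using Ob Fb by simp
  have Ki: "integrable lborel (\<lambda>x. indicator K x * L)"
    using K(1) by (intro integrable_mult_left integrable_real_indicator)
      (auto simp: borel_compact emeasure_compact_finite[unfolded infinity_ennreal_def])
  have bs: "\<bar>?s n x\<bar> \<le> indicator K x * L" for n x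
  proof -
    have "\<bar>Fvar \<eta> (t n) x - Fvar \<eta> 0 x\<bar> / t n \<le> indicator K x * L"
      using bd[of n x] t(2)[of n] by (simp add: pos_divide_le_eq mult.commute)
    then have q: "\<bar>(Fvar \<eta> (t n) x - Fvar \<eta> 0 x) / t n\<bar> \<le> indicator K x * L" using t(2)[of n] by simp
    then have "0 \<le> indicator K x * L" by (rule order_trans[OF abs_ge_zero])
    then show ?thesis using q by (cases "x \<in> Ovar \<eta> (t n)") auto
  qed
  have lim: "AE x in lborel. (\<lambda>n. ?s n x) \<longlonglongrightarrow> ?l x"
    using ind
  proof eventually_elim
    case (elim x)
    show ?case
    proof (cases "x \<in> K")
      case True
      have n0: "norm (grad \<Phi> x) < q0" using lt[of 0 0 x] True t(2)[of 0] by simp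
      have "norm (grad \<Phi> x + 0 *\<^sub>R grad \<eta> x) < q0" using n0 by simp
      from derivative_sequence[OF bernoulli_powr_derivative[OF gam this] t]
      have "(\<lambda>n. (Fvar \<eta> (t n) x - Fvar \<eta> 0 x) / t n) \<longlonglongrightarrow> - (\<gamma> * bernoulli \<gamma> q0 ((norm (grad \<Phi> x))\<^sup>2) powr (1 / (\<gamma> - 1)) * (grad \<Phi> x \<bullet> grad \<eta> x))"
        unfolding Fvar_def by simp
      moreover have "(norm (grad \<Phi> x))\<^sup>2 \<le> q0\<^sup>2" using n0 by (intro power_mono) auto
      ultimately have "(\<lambda>n. (Fvar \<eta> (t n) x - Fvar \<eta> 0 x) / t n) \<longlonglongrightarrow> - scale \<gamma> ka * (mflux x \<bullet> grad \<eta> x)"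
        unfolding bernoulli_density(1)[OF gam ka \<open>(norm (grad \<Phi> x))\<^sup>2 \<le> q0\<^sup>2\<close>] mflux_def rho_def by (simp add: mult.assoc)
      then show ?thesis using elim True by (intro tendsto_mult) auto
    next
      case False
      have "Fvar \<eta> (t n) x - Fvar \<eta> 0 x = 0" for n using F0[OF False, of "t n"] by linarith
      then show ?thesis using ge[OF False] by simp
    qed
  qed
  have gm: "(\<lambda>x. mflux x \<bullet> grad \<eta> x) \<in> borel_measurable borel"
  proof -
    have [measurable]: "grad \<Phi> \<in> borel_measurable borel" "grad \<eta> \<in> borel_measurable borel"
      using cont_grad_Phi continuous_on_grad[OF open_UNIV smooth_onD[OF e]] by (auto intro: borel_measurable_continuous_onI)
    show ?thesis unfolding mflux_def rho_def gas_density_def by measurable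
  qed
  have lm: "?l \<in> borel_measurable lborel" using gm Ob[of 0] unfolding Ovar_0 by simp
  have bs': "AE x in lborel. norm (?s n x) \<le> indicator K x * L" for n
    using bs by (intro AE_I2) (simp only: real_norm_def)
  have "(\<lambda>n. integral\<^sup>L lborel (?s n)) \<longlonglongrightarrow> integral\<^sup>L lborel ?l"
    by (rule integral_dominated_convergence[OF lm sm Ki lim bs'])
  moreover have "integral\<^sup>L lborel (?s n) = (LBINT x. indicator (Ovar \<eta> (t n)) x * (Fvar \<eta> (t n) x - Fvar \<eta> 0 x)) / t n" for n
    by simp
  moreover have "integral\<^sup>L lborel ?l = - scale \<gamma> ka * (LBINT x. indicator \<Omega> x * (mflux x \<bullet> grad \<eta> x))"
    by (subst integral_mult_right_zero[symmetric]) (rule Bochner_Integration.integral_cong, auto simp: mult_ac)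
  ultimately show "(\<lambda>n. (LBINT x. indicator (Ovar \<eta> (t n)) x * (Fvar \<eta> (t n) x - Fvar \<eta> 0 x)) / t n)
    \<longlonglongrightarrow> - scale \<gamma> ka * (LBINT x. indicator \<Omega> x * (mflux x \<bullet> grad \<eta> x))" by (simp only:)
  show "integrable lborel (\<lambda>x. indicator (Ovar \<eta> (t n)) x * (Fvar \<eta> (t n) x - Fvar \<eta> 0 x))" for n
  proof -
    have "integrable lborel (\<lambda>x. t n * ?s n x)"
    proof (rule Bochner_Integration.integrable_mult_right, rule Bochner_Integration.integrable_bound[OF Ki sm])
      have "norm (?s n x) \<le> norm (indicat_real K x * L)" for x
        unfolding real_norm_def by (rule order_trans[OF bs abs_ge_self])
      then show "AE x in lborel. norm (?s n x) \<le> norm (indicat_real K x * L)" by (rule AE_I2)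
    qed
    moreover have "(\<lambda>x. t n * ?s n x) = (\<lambda>x. indicator (Ovar \<eta> (t n)) x * (Fvar \<eta> (t n) x - Fvar \<eta> 0 x))"
      using t(2)[of n] by (intro ext) simp
    ultimately show ?thesis by simp
  qed
qed

section \<open>The equation of motion and the condition on the inner boundary\<close>

lemma Phi_Gamma: "x \<in> \<Gamma> ==> \<Phi> x = \<phi> x" using Phi_phi Gamma_closure by blast

lemma Omega_borel: "\<Omega> \<in> sets borel" using open_Omega by simp

text \<open>For \<open>\<eta> \<ge> 0\<close> whose support meets \<open>A\<close> only inside \<open>\<Omega>\<close>, the domain does not change for
  \<open>t > 0\<close>, and on \<open>\<Gamma>\<close> the maximum in the perturbation is attained by \<open>\<Phi> + t \<eta>\<close>.\<close>

lemma weak_equation: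
  assumes e: "smooth_on UNIV \<eta>" "\<And>x. 0 \<le> \<eta> x" and K: "compact K" "\<And>x. x \<notin> K ==> \<eta> x = 0" "K \<inter> A \<subseteq> \<Omega>"
    and lt: "\<And>x. x \<in> K ==> norm (grad \<Phi> x) < q0"
  shows "(LBINT x. indicator \<Omega> x * (mflux x \<bullet> grad \<eta> x)) + surface_integral \<Gamma> (\<lambda>x. m x * \<eta> x) = 0"
proof -
  obtain t where t: "t \<longlonglongrightarrow> 0" "\<And>n. t n > 0" and "\<And>n. integrable lborel (\<lambda>x. indicator (Ovar \<eta> (t n)) x * Fvar \<eta> (t n) x)"
    and i0: "integrable lborel (\<lambda>x. indicator \<Omega> x * Fvar \<eta> 0 x)"
    and bd: "\<And>n s x. 0 \<le> s ==> s \<le> t n ==> x \<in> K ==> norm (grad \<Phi> x + s *\<^sub>R grad \<eta> x) < q0"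
    and fv: "(\<lambda>n. (- ((LBINT x. indicator (Ovar \<eta> (t n)) x * (Fvar \<eta> (t n) x - Psup x))
        - (LBINT x. indicator \<Omega> x * (Fvar \<eta> 0 x - Psup x)))
      + (surface_integral \<Gamma> (\<lambda>s. scale \<gamma> ka * m s * perturbed \<phi>s \<Phi> \<eta> (t n) s)
        - surface_integral \<Gamma> (\<lambda>s. scale \<gamma> ka * m s * perturbed \<phi>s \<Phi> \<eta> 0 s))) / t n) \<longlonglongrightarrow> 0"
    by (rule first_variation[OF e(1) K(1,2) lt]) blast+
  have O: "Ovar \<eta> (t n) = \<Omega>" for n
  proof
    show "Ovar \<eta> (t n) \<subseteq> \<Omega>"
    proof
      fix x assume x: "x \<in> Ovar \<eta> (t n)"
      then have xA: "x \<in> A" unfolding Ovar_def by blast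
      show "x \<in> \<Omega>"
      proof (cases "x \<in> K")
        case False then show ?thesis using x K(2) Omega_iff[OF xA] unfolding Ovar_def by auto
      qed (use K(3) xA in blast)
    qed
    show "\<Omega> \<subseteq> Ovar \<eta> (t n)"
    proof
      fix x assume x: "x \<in> \<Omega>"
      then have xA: "x \<in> A" using Omega_subset by blast
      have "\<phi>s x < \<Phi> x" using Omega_iff[OF xA] x by blast
      moreover have "0 \<le> t n * \<eta> x" using e(2) t(2)[of n] by simp
      ultimately show "x \<in> Ovar \<eta> (t n)" unfolding Ovar_def using xA by simp
    qed
  qed
  have Pi: "integrable lborel (\<lambda>x. indicator \<Omega> x * Psup x)" using Psup_Ovar_integrable[OF e(1), of 0] unfolding Ovar_0 .
  note fq = Fvar_quotient[OF e(1) K(1,2) t bd, unfolded O]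
  have ql: "(\<lambda>n. (LBINT x. indicator \<Omega> x * (Fvar \<eta> (t n) x - Fvar \<eta> 0 x)) / t n)
    \<longlonglongrightarrow> - scale \<gamma> ka * (LBINT x. indicator \<Omega> x * (mflux x \<bullet> grad \<eta> x))"
    by (rule fq(1)) auto
  have qi: "integrable lborel (\<lambda>x. indicator \<Omega> x * (Fvar \<eta> (t n) x - Fvar \<eta> 0 x))" for n by (rule fq(2)) auto
  have d1: "(LBINT x. indicator \<Omega> x * (Fvar \<eta> (t n) x - Psup x)) - (LBINT x. indicator \<Omega> x * (Fvar \<eta> 0 x - Psup x))
    = (LBINT x. indicator \<Omega> x * (Fvar \<eta> (t n) x - Fvar \<eta> 0 x))" for n
  proof -
    have i: "integrable lborel (\<lambda>x. indicator \<Omega> x * (Fvar \<eta> 0 x - Psup x))"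
      using i0 Pi by (simp add: right_diff_distrib)
    have "(LBINT x. indicator \<Omega> x * (Fvar \<eta> (t n) x - Psup x))
      = (LBINT x. indicator \<Omega> x * (Fvar \<eta> (t n) x - Fvar \<eta> 0 x) + indicator \<Omega> x * (Fvar \<eta> 0 x - Psup x))"
      by (rule Bochner_Integration.integral_cong) (auto simp: algebra_simps)
    also have "\<dots> = (LBINT x. indicator \<Omega> x * (Fvar \<eta> (t n) x - Fvar \<eta> 0 x)) + (LBINT x. indicator \<Omega> x * (Fvar \<eta> 0 x - Psup x))"
      by (rule Bochner_Integration.integral_add[OF qi i])
    finally show ?thesis by simp
  qed
  have cP: "continuous_on \<Gamma> \<Phi>" "continuous_on \<Gamma> \<eta>" using smooth_Phi_cont Phi e(1) by blast+
  let ?M = "surface_integral \<Gamma> (\<lambda>x. m x * \<eta> x)"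
  have sG: "surface_integral \<Gamma> (\<lambda>s. scale \<gamma> ka * m s * perturbed \<phi>s \<Phi> \<eta> r s)
    = surface_integral \<Gamma> (\<lambda>s. scale \<gamma> ka * m s * \<Phi> s) + r * scale \<gamma> ka * ?M" if "r \<ge> 0" for r
  proof -
    have "surface_integral \<Gamma> (\<lambda>s. scale \<gamma> ka * m s * perturbed \<phi>s \<Phi> \<eta> r s)
      = surface_integral \<Gamma> (\<lambda>s. scale \<gamma> ka * m s * \<Phi> s + (r * scale \<gamma> ka) * (m s * \<eta> s))"
    proof (rule surface_integral_cong)
      fix x assume x: "x \<in> \<Gamma>"
      have "0 \<le> r * \<eta> x" using e(2)[of x] that by simp
      then have "\<phi>s x \<le> \<Phi> x + r * \<eta> x" using phi_ge_Gamma[OF x] Phi_Gamma[OF x] by simp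
      then show "scale \<gamma> ka * m x * perturbed \<phi>s \<Phi> \<eta> r x = scale \<gamma> ka * m x * \<Phi> x + (r * scale \<gamma> ka) * (m x * \<eta> x)"
        unfolding perturbed_def by (simp add: max_def algebra_simps)
    qed
    also have "\<dots> = surface_integral \<Gamma> (\<lambda>s. scale \<gamma> ka * m s * \<Phi> s) + surface_integral \<Gamma> (\<lambda>s. (r * scale \<gamma> ka) * (m s * \<eta> s))"
      by (rule surface_integral_add[OF bounds_Omega_Gamma Omega_borel]) (intro continuous_intros m cP)+
    finally show ?thesis by (simp only: surface_integral_cmult)
  qed
  have "(\<lambda>n. - ((LBINT x. indicator \<Omega> x * (Fvar \<eta> (t n) x - Fvar \<eta> 0 x)) / t n) + scale \<gamma> ka * ?M) \<longlonglongrightarrow> 0"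
  proof -
    have "(- (LBINT x. indicator \<Omega> x * (Fvar \<eta> (t n) x - Fvar \<eta> 0 x))
      + (surface_integral \<Gamma> (\<lambda>s. scale \<gamma> ka * m s * perturbed \<phi>s \<Phi> \<eta> (t n) s)
        - surface_integral \<Gamma> (\<lambda>s. scale \<gamma> ka * m s * perturbed \<phi>s \<Phi> \<eta> 0 s))) / t n
      = - ((LBINT x. indicator \<Omega> x * (Fvar \<eta> (t n) x - Fvar \<eta> 0 x)) / t n) + scale \<gamma> ka * ?M" for n
      using sG[of "t n"] sG[of 0] t(2)[of n] by (simp add: field_simps)
    then show ?thesis using fv unfolding O d1 by (simp only:)
  qed
  moreover have "(\<lambda>n. - ((LBINT x. indicator \<Omega> x * (Fvar \<eta> (t n) x - Fvar \<eta> 0 x)) / t n) + scale \<gamma> ka * ?M)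
    \<longlonglongrightarrow> - (- scale \<gamma> ka * (LBINT x. indicator \<Omega> x * (mflux x \<bullet> grad \<eta> x))) + scale \<gamma> ka * ?M"
    by (intro tendsto_intros ql)
  ultimately have "- (- scale \<gamma> ka * (LBINT x. indicator \<Omega> x * (mflux x \<bullet> grad \<eta> x))) + scale \<gamma> ka * ?M = 0"
    using LIMSEQ_unique by blast
  then have "scale \<gamma> ka * ((LBINT x. indicator \<Omega> x * (mflux x \<bullet> grad \<eta> x)) + ?M) = 0" by (simp add: algebra_simps)
  then show ?thesis using scale_pos[OF gam ka] by simp
qed

text \<open>The points without vacuum, where density and mass flux are smooth.\<close>

definition Nsub where "Nsub = {x. norm (grad \<Phi> x) < q0}"

lemma open_Nsub: "open Nsub"
  using open_less_set[OF open_UNIV, of "\<lambda>x. norm (grad \<Phi> x)" "\<lambda>_. q0"] unfolding Nsub_def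
  by (simp add: continuous_on_norm cont_grad_Phi)

lemma Nsub_sq: "x \<in> Nsub ==> (norm (grad \<Phi> x))\<^sup>2 < q0\<^sup>2"
  unfolding Nsub_def by (auto intro: power_strict_mono)

lemma rho_C: "Ck_on k Nsub rho"
  unfolding rho_def
  by (intro gas_density_Ck Ck_on_norm_grad_sq open_Nsub Ck_on_subset[OF Phi_C] Nsub_sq gam ka) auto

lemma mflux_C: "Ck_field k Nsub mflux"
  unfolding mflux_def
  by (intro Ck_field_scaleR open_Nsub rho_C ballI Ck_on_grad_inner Ck_on_subset[OF Phi_C]) auto

lemma rho_pos: "x \<in> Nsub ==> rho x > 0"
  unfolding rho_def by (rule gas_density_pos[OF Nsub_sq gam ka])

lemma plateau_ball:
  fixes a :: "'a"
  assumes "r > 0"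
  shows "smooth_on UNIV (plateau a (r / 4))" "\<And>x. 0 \<le> plateau a (r / 4) x" "compact (cball a (r / 2))" "cball a (r / 2) \<subseteq> ball a r"
    "\<And>x. x \<notin> cball a (r / 2) ==> plateau a (r / 4) x = 0" "\<And>x. x \<in> ball a (r / 4) ==> plateau a (r / 4) x = 1"
  using assms plateau_smooth[of "r / 4" a] plateau_props[of "r / 4" a] by auto

lemma scaled_field:
  assumes U: "open U" and X: "Ck_field 1 U X" and e: "smooth_on UNIV \<eta>" and K: "compact K" "K \<subseteq> U" "\<And>x. x \<notin> K ==> \<eta> x = 0"
  shows "Ck_field 1 UNIV (\<lambda>x. \<eta> x *\<^sub>R X x)" "\<And>x. x \<notin> K ==> \<eta> x *\<^sub>R X x = 0"
    "\<And>x. x \<in> U ==> divergence (\<lambda>x. \<eta> x *\<^sub>R X x) x = \<eta> x * divergence X x + grad \<eta> x \<bullet> X x"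
proof -
  show z: "\<And>x. x \<notin> K ==> \<eta> x *\<^sub>R X x = 0" using K(3) by simp
  have eU: "Ck_on 1 U \<eta>" using smooth_onD[OF e] Ck_on_subset by blast
  show "Ck_field 1 UNIV (\<lambda>x. \<eta> x *\<^sub>R X x)"
    by (rule Ck_field_extend_zero[OF U Ck_field_scaleR[OF U eU X] K(1,2) z])
  fix x assume x: "x \<in> U"
  have "\<eta> differentiable at x" using smooth_onD[OF e, of 1] by simp
  moreover have "X differentiable at x" using Ck_field_differentiable[of 0 U X x] X x by simp
  ultimately show "divergence (\<lambda>x. \<eta> x *\<^sub>R X x) x = \<eta> x * divergence X x + grad \<eta> x \<bullet> X x"
    by (rule divergence_scaleR)
qed

text \<open>Bumps around \<open>x0\<close> in \<open>weak_equation\<close>: if the divergence were positive or negative at \<open>x0\<close>, so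
  would be its integral against a bump.\<close>

lemma equation_of_motion:
  assumes x0: "x0 \<in> \<Omega>" "norm (grad \<Phi> x0) < q0"
  shows "divergence mflux x0 = 0"
proof (rule ccontr)
  assume nz: "divergence mflux x0 \<noteq> 0"
  define s where "s = sgn (divergence mflux x0)"
  have s: "s * divergence mflux x0 > 0" using nz unfolding s_def by (auto simp: sgn_if)
  have cd: "continuous_on Nsub (divergence mflux)" by (rule continuous_divergence[OF open_Nsub mflux_C])
  have "open {x \<in> \<Omega> \<inter> Nsub. 0 < s * divergence mflux x}"
    by (intro open_less_set continuous_intros continuous_on_subset[OF cd] open_Int open_Omega open_Nsub) auto
  moreover have "x0 \<in> {x \<in> \<Omega> \<inter> Nsub. 0 < s * divergence mflux x}" using x0 s unfolding Nsub_def by simp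
  ultimately obtain r where r: "r > 0" "ball x0 r \<subseteq> {x \<in> \<Omega> \<inter> Nsub. 0 < s * divergence mflux x}"
    using open_contains_ball by blast
  note P = plateau_ball[where a = x0, OF r(1)]
  let ?z = "plateau x0 (r / 4)" and ?K = "cball x0 (r / 2)"
  have KN: "?K \<subseteq> Nsub" "?K \<subseteq> \<Omega>" using P(4) r(2) by blast+
  note sf = scaled_field[OF open_Nsub mflux_C P(1) P(3) KN(1) P(5)]
  have "(LBINT x. indicator \<Omega> x * (mflux x \<bullet> grad ?z x)) + surface_integral \<Gamma> (\<lambda>x. m x * ?z x) = 0"
    by (rule weak_equation[OF P(1,2,3,5)]) (use KN in \<open>auto simp: Nsub_def\<close>)
  moreover have "surface_integral \<Gamma> (\<lambda>x. m x * ?z x) = surface_integral \<Gamma> (\<lambda>x. 0)"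
    by (rule surface_integral_cong) (use P(5) KN(2) Gamma_closure(2) in force)
  ultimately have w: "(LBINT x. indicator \<Omega> x * (mflux x \<bullet> grad ?z x)) = 0"
    by (simp add: surface_integral_def)
  have gz: "grad ?z x = 0" if "x \<notin> ?K" for x by (rule grad_zero_outside[OF P(3) _ that]) (rule P(5))
  have dz: "divergence (\<lambda>x. ?z x *\<^sub>R mflux x) x = ?z x * divergence mflux x + indicator \<Omega> x * (mflux x \<bullet> grad ?z x)" for x
  proof (cases "x \<in> ?K")
    case True
    then have "x \<in> Nsub" "x \<in> \<Omega>" using KN by blast+
    then show ?thesis using sf(3)[of x] by (simp add: inner_commute)
  next
    case False
    have "divergence (\<lambda>x. ?z x *\<^sub>R mflux x) x = 0" by (rule divergence_zero_outside[OF P(3) _ False]) (rule sf(2))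
    then show ?thesis using gz[OF False] P(5)[OF False] by simp
  qed
  have cz: "continuous_on UNIV ?z" by (rule Ck_on_imp_continuous[OF smooth_onD[OF P(1)]])
  have zi: "integrable lborel (\<lambda>x. ?z x * divergence mflux x)"
  proof (rule integrable_continuous_support[OF _ P(3)])
    have "continuous_on Nsub (\<lambda>x. ?z x * divergence mflux x)"
      by (intro continuous_intros continuous_on_subset[OF cz] cd) auto
    then have "Ck_on 0 Nsub (\<lambda>x. ?z x * divergence mflux x)" by simp
    from Ck_on_extend_zero[OF open_Nsub this P(3) KN(1)]
    show "continuous_on UNIV (\<lambda>x. ?z x * divergence mflux x)" using P(5) by simp
  qed (simp add: P(5))
  have gi: "integrable lborel (\<lambda>x. indicator \<Omega> x * (mflux x \<bullet> grad ?z x))"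
  proof -
    have "integrable lborel (\<lambda>x. divergence (\<lambda>x. ?z x *\<^sub>R mflux x) x - ?z x * divergence mflux x)"
      by (rule Bochner_Integration.integrable_diff[OF integrable_divergence[OF open_UNIV sf(1) P(3) subset_UNIV sf(2)] zi])
    then show ?thesis by (simp add: dz)
  qed
  have "0 = (LBINT x. ?z x * divergence mflux x + indicator \<Omega> x * (mflux x \<bullet> grad ?z x))"
    using integral_divergence_zero[OF sf(1) P(3) sf(2)] unfolding dz by simp
  also have "\<dots> = (LBINT x. ?z x * divergence mflux x)"
    using Bochner_Integration.integral_add[OF zi gi] w by simp
  finally have I: "(LBINT x. s * (?z x * divergence mflux x)) = 0" by simp
  have nn: "0 \<le> s * (?z x * divergence mflux x)" for x
  proof (cases "x \<in> ball x0 r")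
    case True
    then have "0 < s * divergence mflux x" using r(2) by blast
    then have "0 \<le> ?z x * (s * divergence mflux x)" using P(2)[of x] by simp
    then show ?thesis by (simp add: mult.left_commute)
  next
    case False
    then have "x \<notin> ?K" using P(4) by blast
    then show ?thesis using P(5) by simp
  qed
  have si: "integrable lborel (\<lambda>x. s * (?z x * divergence mflux x))" using zi by simp
  have "AE x in lborel. s * (?z x * divergence mflux x) = 0"
    using integral_nonneg_eq_0_iff_AE[OF si] nn I by simp
  then have "AE x in lborel. x \<notin> ball x0 (r / 4)"
  proof eventually_elim
    case (elim x)
    show ?case
    proof
      assume x: "x \<in> ball x0 (r / 4)"
      then have "?z x = 1" by (rule P(6))
      moreover have "x \<in> ball x0 r" using x r(1) by auto
      ultimately show False using elim r(2) by auto
    qed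
  qed
  then have "AE x in lebesgue. x \<notin> ball x0 (r / 4)" by (rule AE_completion)
  then have "ball x0 (r / 4) = {}" using open_null_empty[of "ball x0 (r / 4)"] by simp
  then show False using r(1) by simp
qed

text \<open>For bumps at \<open>\<Gamma>\<close> the divergence theorem turns \<open>weak_equation\<close> into a surface integral of
  \<open>\<eta> (\<rho> \<nabla>\<Phi> \<bullet> n + m)\<close>.\<close>

lemma inner_boundary_condition:
  assumes x0: "x0 \<in> \<Gamma>" shows "mflux x0 \<bullet> n x0 + m x0 = 0"
proof -
  have GN: "\<Gamma> \<subseteq> Nsub" unfolding Nsub_def using novac grad_Phi Gamma_closure by force
  obtain r0 where r0: "r0 > 0" and div: "\<And>X K. Ck_field 1 UNIV X ==> compact K ==> K \<subseteq> ball x0 r0 ==> (\<And>x. x \<notin> K ==> X x = 0) ==>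
      (LBINT x. indicator \<Omega> x * divergence X x) = surface_integral \<Gamma> (\<lambda>x. X x \<bullet> n x)"
    using local_divergence_theorem[OF bounds_Omega_Gamma Omega_borel x0] by blast
  have "open (Nsub \<inter> inside S)" "x0 \<in> Nsub \<inter> inside S" using open_Nsub open_inside_S GN x0 S(4) by auto
  then obtain r1 where r1: "r1 > 0" "ball x0 r1 \<subseteq> Nsub \<inter> inside S" using open_contains_ball by blast
  define r where "r = min r0 r1"
  have r: "r > 0" "ball x0 r \<subseteq> ball x0 r0" "ball x0 r \<subseteq> ball x0 r1" unfolding r_def using r0 r1 by auto
  have cf: "continuous_on \<Gamma> (\<lambda>x. mflux x \<bullet> n x)"
    by (intro continuous_on_inner continuous_on_subset[OF Ck_field_continuous[OF mflux_C] GN] continuous_on_outer_normal[OF bounds_Omega_Gamma])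
  show ?thesis
  proof (rule surface_density_zero[OF bounds_Omega_Gamma Omega_borel x0 _ r(1)])
    show "continuous_on \<Gamma> (\<lambda>x. mflux x \<bullet> n x + m x)" by (intro continuous_intros cf m)
    fix \<eta> K assume e: "smooth_on UNIV \<eta>" "\<And>x. 0 \<le> \<eta> x" and K: "compact K" "K \<subseteq> ball x0 r" "\<And>x. x \<notin> K ==> \<eta> x = 0"
    have KN: "K \<subseteq> Nsub" "K \<subseteq> inside S" "K \<subseteq> ball x0 r0" using K(2) r(2,3) r1(2) by blast+
    have KO: "K \<inter> A \<subseteq> \<Omega>" unfolding Om_inside using KN(2) by blast
    have w: "(LBINT x. indicator \<Omega> x * (mflux x \<bullet> grad \<eta> x)) + surface_integral \<Gamma> (\<lambda>x. m x * \<eta> x) = 0"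
      by (rule weak_equation[OF e K(1,3) KO]) (use KN(1) in \<open>auto simp: Nsub_def\<close>)
    note sf = scaled_field[OF open_Nsub mflux_C e(1) K(1) KN(1) K(3)]
    have h: "indicator \<Omega> x * divergence (\<lambda>x. \<eta> x *\<^sub>R mflux x) x = indicator \<Omega> x * (mflux x \<bullet> grad \<eta> x)" for x
    proof (cases "x \<in> \<Omega> \<and> x \<in> K")
      case True
      then have "divergence mflux x = 0" using equation_of_motion KN(1) unfolding Nsub_def by blast
      then show ?thesis using sf(3)[of x] True KN(1) by (auto simp: inner_commute)
    next
      case False
      have "divergence (\<lambda>x. \<eta> x *\<^sub>R mflux x) x = 0" if "x \<notin> K" by (rule divergence_zero_outside[OF K(1) _ that]) (rule sf(2))
      moreover have "grad \<eta> x = 0" if "x \<notin> K" by (rule grad_zero_outside[OF K(1) _ that]) (rule K(3))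
      ultimately show ?thesis using False by auto
    qed
    have "(LBINT x. indicator \<Omega> x * (mflux x \<bullet> grad \<eta> x)) = surface_integral \<Gamma> (\<lambda>x. (\<eta> x *\<^sub>R mflux x) \<bullet> n x)"
      using div[OF sf(1) K(1) KN(3) sf(2)] unfolding h .
    then have "surface_integral \<Gamma> (\<lambda>x. (\<eta> x *\<^sub>R mflux x) \<bullet> n x) + surface_integral \<Gamma> (\<lambda>x. m x * \<eta> x) = 0" using w by simp
    moreover have "surface_integral \<Gamma> (\<lambda>x. \<eta> x * (mflux x \<bullet> n x + m x))
      = surface_integral \<Gamma> (\<lambda>x. (\<eta> x *\<^sub>R mflux x) \<bullet> n x) + surface_integral \<Gamma> (\<lambda>x. m x * \<eta> x)"
    proof -
      have "surface_integral \<Gamma> (\<lambda>x. \<eta> x * (mflux x \<bullet> n x + m x)) = surface_integral \<Gamma> (\<lambda>x. (\<eta> x *\<^sub>R mflux x) \<bullet> n x + m x * \<eta> x)"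
        by (rule surface_integral_cong) (simp add: algebra_simps)
      also have "\<dots> = surface_integral \<Gamma> (\<lambda>x. (\<eta> x *\<^sub>R mflux x) \<bullet> n x) + surface_integral \<Gamma> (\<lambda>x. m x * \<eta> x)"
        by (rule surface_integral_add[OF bounds_Omega_Gamma Omega_borel])
          (auto intro!: continuous_on_mult cf m smooth_Phi_cont[OF e(1)])
      finally show ?thesis .
    qed
    ultimately show "surface_integral \<Gamma> (\<lambda>x. \<eta> x * (mflux x \<bullet> n x + m x)) = 0" by simp
  qed
qed

end

section \<open>The shock condition\<close>

lemma divergence_const_direction:
  assumes "f differentiable at x" shows "divergence (\<lambda>y. f y *\<^sub>R b) x = pd b f x"
proof -
  have "divergence (\<lambda>y. f y *\<^sub>R b) x = f x * divergence (\<lambda>y. b) x + grad f x \<bullet> b"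
    by (rule divergence_scaleR[OF assms]) simp
  also have "divergence (\<lambda>y. b) x = 0" unfolding divergence_def by simp
  finally show ?thesis using grad_inner[OF assms] by simp
qed

context extended_potential
begin

definition jump where "jump x = \<Phi> x - \<phi>s x"

text \<open>Up to the factor \<open>scale\<close>, the jump of the integrand of the functional across the shock.\<close>

definition pjump where "pjump x = pressure \<gamma> ka (rho x) - pressure \<gamma> k0 (rhos x)"

lemma A_W: "A \<subseteq> W" using W(2) closure_subset by blast

lemma jump_C: "Ck_on 2 W jump"
  unfolding jump_def[abs_def] by (intro Ck_on_diff W Ck_on_subset[OF Phi_C]) auto

lemma jump_grad: "x \<in> W ==> grad jump x = grad \<Phi> x - grad \<phi>s x"
  unfolding jump_def[abs_def]
  by (rule grad_eq_of_has_derivative)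
    (use has_derivative_diff[OF has_derivative_grad[OF Phi_diff] has_derivative_grad[of \<phi>s x]] W1 in \<open>simp add: inner_diff_left\<close>)

lemma pjump_C1: "Ck_on 1 (Nsub \<inter> Nsup) pjump"
  unfolding pjump_def[abs_def] pressure_def
proof (intro Ck_on_diff Ck_on_mult Ck_on_const open_Int open_Nsub Nsup(1))
  have o: "open (Nsub \<inter> Nsup)" using open_Nsub Nsup(1) by blast
  show "Ck_on 1 (Nsub \<inter> Nsup) (\<lambda>x. rho x powr \<gamma>)"
    by (rule Ck_on_compose_real[OF o Ck_on_subset[OF rho_C] Ck_on_powr]) (auto simp: rho_pos)
  show "Ck_on 1 (Nsub \<inter> Nsup) (\<lambda>x. rhos x powr \<gamma>)"
    by (rule Ck_on_compose_real[OF o Ck_on_subset[OF rhos_C1] Ck_on_powr])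
      (use gas_density_pos[OF Nsup_sq gam k0] in \<open>auto simp: rhos_def\<close>)
qed

lemma integrand_jump: "x \<in> Nsub ==> Fvar \<eta> 0 x - Psup x = scale \<gamma> ka * pjump x"
  using bernoulli_density(2)[OF gam ka less_imp_le[OF Nsub_sq]]
  unfolding Fvar_def Psup_def pjump_def rho_def by (simp add: right_diff_distrib)

lemma Ovar_indicator: "x \<in> A ==> indicat_real (Ovar \<eta> s) x = indicator {x. 0 < x} (jump x + s * \<eta> x)"
  unfolding Ovar_def jump_def by (auto simp: indicator_def)

text \<open>The change of the integral splits into the change of the integrand on the perturbed domain
  (\<open>Fvar_quotient\<close>) and the change of the domain with the unperturbed integrand
  (\<open>moving_domain_variation\<close>). The function \<open>g\<close> is the pressure jump divided by the derivative of the
  jump potential, which is the reciprocal of the rate at which the shock moves in direction \<open>b\<close>.\<close>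

lemma shock_variation:
  assumes b: "b \<in> Basis" and U: "open U" "U \<subseteq> A" "U \<subseteq> Nsub" "\<And>x. x \<in> U ==> pd b jump x \<noteq> 0"
    and g: "Ck_on 1 U g" "compact K'" "K' \<subseteq> U" "\<And>x. x \<notin> K' ==> g x = 0"
    and e: "smooth_on UNIV \<eta>" and K: "compact K" "K \<subseteq> U" "\<And>x. x \<notin> K ==> \<eta> x = 0"
    and gK: "\<And>x. x \<in> K ==> g x * pd b jump x = pjump x"
  shows "(LBINT x. indicator \<Omega> x * (mflux x \<bullet> grad \<eta> x))
    + (LBINT x. indicator \<Omega> x * pd b (\<lambda>x. \<eta> x * g x) x) = 0"
proof -
  have lt: "norm (grad \<Phi> x) < q0" if "x \<in> K" for x using that K(2) U(3) unfolding Nsub_def by blast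
  have KA: "x \<in> A" if "x \<in> K" for x using that K(2) U(2) by blast
  have uU: "Ck_on 1 U jump" using Ck_on_subset[OF Ck_on_le[OF jump_C, of 1]] U(2) A_W by auto
  obtain t where t: "t \<longlonglongrightarrow> 0" "\<And>n. t n > 0"
    and it: "\<And>n. integrable lborel (\<lambda>x. indicator (Ovar \<eta> (t n)) x * Fvar \<eta> (t n) x)"
    and i0: "integrable lborel (\<lambda>x. indicator \<Omega> x * Fvar \<eta> 0 x)"
    and tK: "\<And>n s x. 0 \<le> s ==> s \<le> t n ==> x \<in> K ==> norm (grad \<Phi> x + s *\<^sub>R grad \<eta> x) < q0"
    and fv: "(\<lambda>n. (- ((LBINT x. indicator (Ovar \<eta> (t n)) x * (Fvar \<eta> (t n) x - Psup x))
        - (LBINT x. indicator \<Omega> x * (Fvar \<eta> 0 x - Psup x)))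
      + (surface_integral \<Gamma> (\<lambda>s. scale \<gamma> ka * m s * perturbed \<phi>s \<Phi> \<eta> (t n) s)
        - surface_integral \<Gamma> (\<lambda>s. scale \<gamma> ka * m s * perturbed \<phi>s \<Phi> \<eta> 0 s))) / t n) \<longlonglongrightarrow> 0"
    by (rule first_variation[OF e K(1,3) lt]) blast+
  have sG: "surface_integral \<Gamma> (\<lambda>s. scale \<gamma> ka * m s * perturbed \<phi>s \<Phi> \<eta> (t k) s)
    = surface_integral \<Gamma> (\<lambda>s. scale \<gamma> ka * m s * perturbed \<phi>s \<Phi> \<eta> 0 s)" for k
    by (rule surface_integral_cong) (use KA K(3) Gamma_disjoint(1) in \<open>force simp: perturbed_def\<close>)
  have ind: "AE x in lborel. x \<in> K \<longrightarrow> (\<lambda>n. indicat_real (Ovar \<eta> (t n)) x) \<longlonglongrightarrow> indicator \<Omega> x"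
    using zero_set_null[OF U(1) uU b]
  proof eventually_elim
    case (elim x)
    show ?case
    proof
      assume x: "x \<in> K"
      then have "jump x \<noteq> 0" using elim U(4) K(2) by blast
      from positive_set_limit[OF t(1) this, of "\<eta> x"]
      show "(\<lambda>n. indicat_real (Ovar \<eta> (t n)) x) \<longlonglongrightarrow> indicator \<Omega> x"
        unfolding Ovar_indicator[OF KA[OF x]] using Ovar_indicator[OF KA[OF x], of \<eta> 0] Ovar_0 by simp
    qed
  qed
  note Fq = Fvar_quotient[OF e K(1,3) t tK ind]
  let ?D = "\<lambda>n. LBINT x. indicator (Ovar \<eta> (t n)) x * (Fvar \<eta> (t n) x - Fvar \<eta> 0 x)"
  let ?d = "\<lambda>n x. (indicat_real {x. 0 < x} (jump x + t n * \<eta> x) - indicator {x. 0 < x} (jump x)) * (g x * pd b jump x)"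
  have pt: "indicator (Ovar \<eta> (t n)) x * (Fvar \<eta> (t n) x - Psup x) - indicator \<Omega> x * (Fvar \<eta> 0 x - Psup x)
    = indicator (Ovar \<eta> (t n)) x * (Fvar \<eta> (t n) x - Fvar \<eta> 0 x) + scale \<gamma> ka * ?d n x" for n x
  proof -
    have "(indicat_real (Ovar \<eta> (t n)) x - indicator \<Omega> x) * (Fvar \<eta> 0 x - Psup x) = scale \<gamma> ka * ?d n x"
    proof (cases "x \<in> K")
      case True
      then have N: "x \<in> Nsub" using K(2) U(3) by blast
      have "indicat_real \<Omega> x = indicator {x. 0 < x} (jump x)"
        using Ovar_indicator[OF KA[OF True], of \<eta> 0] Ovar_0 by simp
      then show ?thesis unfolding integrand_jump[OF N] Ovar_indicator[OF KA[OF True]] gK[OF True] by simp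
    next
      case False
      have "x \<in> Ovar \<eta> (t n) \<longleftrightarrow> x \<in> Ovar \<eta> 0" unfolding Ovar_def using K(3)[OF False] by simp
      then have "indicat_real (Ovar \<eta> (t n)) x = indicator \<Omega> x" unfolding Ovar_0 by (simp add: indicator_def)
      then show ?thesis using K(3)[OF False] by simp
    qed
    then show ?thesis by (simp add: algebra_simps)
  qed
  have i1: "integrable lborel (\<lambda>x. indicator (Ovar \<eta> (t n)) x * (Fvar \<eta> (t n) x - Psup x))" for n
    using it[of n] Psup_Ovar_integrable[OF e, of "t n"] by (simp add: right_diff_distrib)
  have i2: "integrable lborel (\<lambda>x. indicator \<Omega> x * (Fvar \<eta> 0 x - Psup x))"
    using i0 Psup_Ovar_integrable[OF e, of 0] unfolding Ovar_0 by (simp add: right_diff_distrib)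
  have i3: "integrable lborel (\<lambda>x. scale \<gamma> ka * ?d n x)" for n
  proof -
    have h: "scale \<gamma> ka * ?d n x = (indicator (Ovar \<eta> (t n)) x * (Fvar \<eta> (t n) x - Psup x) - indicator \<Omega> x * (Fvar \<eta> 0 x - Psup x))
      - indicator (Ovar \<eta> (t n)) x * (Fvar \<eta> (t n) x - Fvar \<eta> 0 x)" for x using pt[of n x] by linarith
    show ?thesis unfolding h
      by (rule Bochner_Integration.integrable_diff[OF Bochner_Integration.integrable_diff[OF i1 i2] Fq(2)])
  qed
  have split: "(LBINT x. indicator (Ovar \<eta> (t n)) x * (Fvar \<eta> (t n) x - Psup x))
        - (LBINT x. indicator \<Omega> x * (Fvar \<eta> 0 x - Psup x)) = ?D n + scale \<gamma> ka * integral\<^sup>L lborel (?d n)" for n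
  proof -
    have "(LBINT x. indicator (Ovar \<eta> (t n)) x * (Fvar \<eta> (t n) x - Psup x))
        - (LBINT x. indicator \<Omega> x * (Fvar \<eta> 0 x - Psup x))
      = (LBINT x. indicator (Ovar \<eta> (t n)) x * (Fvar \<eta> (t n) x - Fvar \<eta> 0 x) + scale \<gamma> ka * ?d n x)"
      unfolding pt[symmetric] by (rule Bochner_Integration.integral_diff[OF i1 i2, symmetric])
    also have "\<dots> = ?D n + (LBINT x. scale \<gamma> ka * ?d n x)"
      by (rule Bochner_Integration.integral_add[OF Fq(2) i3])
    finally show ?thesis by (simp only: integral_mult_right_zero)
  qed
  let ?L1 = "LBINT x. indicator \<Omega> x * (mflux x \<bullet> grad \<eta> x)"
  let ?L2 = "LBINT x. indicator {x. 0 < x} (jump x) * pd b (\<lambda>x. \<eta> x * g x) x"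
  have md: "(\<lambda>n. integral\<^sup>L lborel (?d n) / t n) \<longlonglongrightarrow> - ?L2"
    by (rule moving_domain_variation[OF U(1) uU b U(4) smooth_onD[OF e] g t])
  have "(\<lambda>n. - (?D n / t n + scale \<gamma> ka * (integral\<^sup>L lborel (?d n) / t n))) \<longlonglongrightarrow> - (- scale \<gamma> ka * ?L1 + scale \<gamma> ka * (- ?L2))"
    by (intro tendsto_intros Fq(1) md)
  moreover have "(\<lambda>n. - (?D n / t n + scale \<gamma> ka * (integral\<^sup>L lborel (?d n) / t n))) \<longlonglongrightarrow> 0"
  proof -
    have "(- (X + c * Y) + (G - G)) / s = - (X / s + c * (Y / s))" for X Y c s G :: real
      by (simp add: add_divide_distrib diff_divide_distrib)
    then show ?thesis using fv unfolding split sG by (simp only:)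
  qed
  ultimately have "- (- scale \<gamma> ka * ?L1 + scale \<gamma> ka * (- ?L2)) = 0" using LIMSEQ_unique by blast
  then have "scale \<gamma> ka * (?L1 + ?L2) = 0" by (simp add: algebra_simps)
  then have "?L1 + ?L2 = 0" using scale_pos[OF gam ka] by simp
  moreover have "indicator {x. 0 < x} (jump x) * pd b (\<lambda>x. \<eta> x * g x) x
    = indicator \<Omega> x * pd b (\<lambda>x. \<eta> x * g x) x" for x
  proof (cases "x \<in> K")
    case True
    then show ?thesis using Ovar_indicator[OF KA[OF True], of \<eta> 0] Ovar_0 by simp
  next
    case False
    have "pd b (\<lambda>x. \<eta> x * g x) x = 0" by (rule pd_zero_outside[OF K(1) _ False]) (simp add: K(3))
    then show ?thesis by simp
  qed
  ultimately show ?thesis by simp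
qed

text \<open>By the divergence theorem \<open>shock_variation\<close> says that \<open>\<rho> \<nabla>\<Phi> + g b\<close> has no normal component at the
  shock. As \<open>\<nabla>jump = l n\<close>, the second term contributes \<open>g (b \<bullet> n) = pjump / l\<close>, independently of the
  choice of the basis vector \<open>b\<close>.\<close>

lemma shock_condition:
  assumes x0: "x0 \<in> S"
  shows "pressure \<gamma> ka (rho x0) + rho x0 * (grad \<Phi> x0 \<bullet> n x0)\<^sup>2
    = pressure \<gamma> k0 (rhos x0) + rho x0 * (grad \<Phi> x0 \<bullet> n x0) * (grad \<phi>s x0 \<bullet> n x0)"
proof -
  have c: "x0 \<in> closure \<Omega>" "x0 \<in> A" using x0 S_frontier(1) S_subset_A by blast+
  then have xW: "x0 \<in> W" and xsup: "x0 \<in> Nsup" using A_W Nsup(2) closure_subset by blast+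
  have xsub: "x0 \<in> Nsub" unfolding Nsub_def using novac x0 grad_Phi[OF c(1)] by simp
  define l where "l = (grad \<Phi> x0 - grad \<phi>s x0) \<bullet> n x0"
  have l: "grad jump x0 = l *\<^sub>R n x0" "l < 0"
    using jump_gradient[OF x0] unfolding jump_grad[OF xW] grad_Phi[OF c(1)] l_def by auto
  have n1: "norm (n x0) = 1" by (rule norm_outer_normal[OF bounds_Omega_S x0])
  have "grad jump x0 \<noteq> 0" using l n1 by force
  then obtain b where b: "b \<in> Basis" "grad jump x0 \<bullet> b \<noteq> 0" using euclidean_eq_iff[of "grad jump x0" 0] by auto
  have jd: "jump differentiable at x" if "x \<in> W" for x using jump_C that by (simp add: numeral_2_eq_2)
  have pb: "pd b jump x = grad jump x \<bullet> b" if "x \<in> W" for x using grad_inner[OF jd[OF that]] by simp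
  let ?p = "\<lambda>x. pd b jump x"
  have pC: "Ck_on 1 W ?p" using jump_C b(1) by (simp add: numeral_2_eq_2)
  define U where "U = {x \<in> A \<inter> Nsub \<inter> Nsup. 0 < \<bar>?p x\<bar>}"
  have "open U" unfolding U_def
    by (intro open_less_set open_Int open_A open_Nsub Nsup continuous_intros continuous_on_subset[OF Ck_on_imp_continuous[OF pC]])
      (use A_W in auto)
  moreover have "x0 \<in> U" unfolding U_def using c(2) xsub xsup pb[OF xW] b(2) by simp
  ultimately obtain r where r: "r > 0" "ball x0 r \<subseteq> U" using open_contains_ball by blast
  note U = \<open>open U\<close>
  have UA: "U \<subseteq> A" "U \<subseteq> Nsub" "U \<subseteq> Nsup" "U \<subseteq> Nsub \<inter> Nsup" "U \<subseteq> W" "\<And>x. x \<in> U ==> ?p x \<noteq> 0"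
    unfolding U_def using A_W by auto
  note P = plateau_ball[where a = x0, OF r(1)]
  let ?\<theta> = "plateau x0 (r / 4)" and ?K' = "cball x0 (r / 2)"
  have K'U: "?K' \<subseteq> U" using P(4) r(2) by blast
  define g0 where "g0 x = pjump x / ?p x" for x
  have g0: "Ck_on 1 U g0" unfolding g0_def[abs_def]
    by (intro Ck_on_divide U Ck_on_subset[OF pjump_C1] Ck_on_subset[OF pC] UA)
  (* the cutoff only serves to extend the fields to the whole space; it is 1 on the supports of all bumps below *)
  define g where "g x = ?\<theta> x * g0 x" for x
  have \<theta>U: "Ck_on 1 U ?\<theta>" using smooth_onD[OF P(1)] Ck_on_subset by blast
  have gz: "g x = 0" if "x \<notin> ?K'" for x unfolding g_def using P(5)[OF that] by simp
  have g: "Ck_on 1 U g" unfolding g_def[abs_def] by (rule Ck_on_mult[OF U \<theta>U g0])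
  have gU: "Ck_on 1 UNIV g" by (rule Ck_on_extend_zero[OF U g P(3) K'U gz])
  define Y where "Y x = ?\<theta> x *\<^sub>R mflux x + g x *\<^sub>R b" for x
  have tm: "Ck_field 1 UNIV (\<lambda>x. ?\<theta> x *\<^sub>R mflux x)"
    by (rule scaled_field(1)[OF open_Nsub mflux_C P(1,3) _ P(5)]) (use K'U UA in blast)
  have Y: "Ck_field 1 UNIV Y"
    unfolding Y_def[abs_def] inner_add_left inner_scaleR_left[of "g _"]
    by (intro ballI Ck_on_add Ck_on_mult Ck_on_const gU open_UNIV bspec[OF tm])
  obtain r0 where r0: "r0 > 0" and div: "\<And>X K. Ck_field 1 UNIV X ==> compact K ==> K \<subseteq> ball x0 r0 ==> (\<And>x. x \<notin> K ==> X x = 0) ==>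
      (LBINT x. indicator \<Omega> x * divergence X x) = surface_integral S (\<lambda>x. X x \<bullet> n x)"
    using local_divergence_theorem[OF bounds_Omega_S Omega_borel x0] by blast
  define r1 where "r1 = min r0 (r / 4)"
  have r1: "r1 > 0" "ball x0 r1 \<subseteq> ball x0 r0" "ball x0 r1 \<subseteq> ball x0 (r / 4)" "ball x0 (r / 4) \<subseteq> U"
    unfolding r1_def using r0 r by auto
  have "Y x0 \<bullet> n x0 = 0"
  proof (rule surface_density_zero[OF bounds_Omega_S Omega_borel x0 _ r1(1)])
    show "continuous_on S (\<lambda>x. Y x \<bullet> n x)"
      by (intro continuous_on_inner continuous_on_subset[OF Ck_field_continuous[OF Y]] continuous_on_outer_normal[OF bounds_Omega_S]) auto
    fix \<eta> K assume e: "smooth_on UNIV \<eta>" "\<And>x. 0 \<le> \<eta> x" and K: "compact K" "K \<subseteq> ball x0 r1" "\<And>x. x \<notin> K ==> \<eta> x = 0"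
    have KU: "K \<subseteq> U" "K \<subseteq> ball x0 (r / 4)" "K \<subseteq> ball x0 r0" "K \<subseteq> Nsub" using K(2) r1 UA by blast+
    have "g x * ?p x = pjump x" if "x \<in> K" for x
      unfolding g_def g0_def using P(6)[of x] that KU UA(6)[of x] by auto
    from shock_variation[OF b(1) U UA(1,2,6) g P(3) K'U gz e(1) K(1) KU(1) K(3) this]
    have sv: "(LBINT x. indicator \<Omega> x * (mflux x \<bullet> grad \<eta> x))
      + (LBINT x. indicator \<Omega> x * pd b (\<lambda>x. \<eta> x * g x) x) = 0" .
    note sf = scaled_field[OF open_Nsub mflux_C e(1) K(1) KU(4) K(3)]
    note sY = scaled_field[OF open_UNIV Y e(1) K(1) subset_UNIV K(3)]
    have eg: "Ck_on 1 UNIV (\<lambda>x. \<eta> x * g x)" by (rule Ck_on_mult[OF open_UNIV smooth_onD[OF e(1)] gU])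
    have mz: "mflux x \<bullet> grad \<eta> x = 0" "pd b (\<lambda>x. \<eta> x * g x) x = 0" if "x \<notin> K" for x
    proof -
      show "mflux x \<bullet> grad \<eta> x = 0" using grad_zero_outside[OF K(1) _ that] K(3) by simp
      show "pd b (\<lambda>x. \<eta> x * g x) x = 0" by (rule pd_zero_outside[OF K(1) _ that]) (simp add: K(3))
    qed
    have dv: "indicator \<Omega> x * divergence (\<lambda>x. \<eta> x *\<^sub>R Y x) x
      = indicator \<Omega> x * (mflux x \<bullet> grad \<eta> x) + indicator \<Omega> x * pd b (\<lambda>x. \<eta> x * g x) x" for x
    proof (cases "x \<in> \<Omega> \<and> x \<in> K")
      case True
      then have xb: "x \<in> ball x0 (r / 4)" "x \<in> Nsub" using KU by auto
      have "divergence (\<lambda>x. \<eta> x *\<^sub>R Y x) x = divergence (\<lambda>x. \<eta> x *\<^sub>R mflux x + (\<eta> x * g x) *\<^sub>R b) x"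
        by (rule divergence_cong_open[OF open_ball xb(1)]) (simp add: Y_def P(6) scaleR_add_right)
      also have "\<dots> = divergence (\<lambda>x. \<eta> x *\<^sub>R mflux x) x + divergence (\<lambda>x. (\<eta> x * g x) *\<^sub>R b) x"
        by (rule divergence_add) (use Ck_field_differentiable[of 0 UNIV _ x] sf(1) eg in \<open>auto intro!: differentiable_scaleR\<close>)
      also have "\<dots> = (\<eta> x * divergence mflux x + grad \<eta> x \<bullet> mflux x) + pd b (\<lambda>x. \<eta> x * g x) x"
        using sf(3)[of x] xb(2) divergence_const_direction[of "\<lambda>x. \<eta> x * g x" x b] eg by simp
      also have "divergence mflux x = 0" using equation_of_motion True xb(2) unfolding Nsub_def by blast
      finally show ?thesis using True by (simp add: inner_commute)
    next
      case False
      have "divergence (\<lambda>x. \<eta> x *\<^sub>R Y x) x = 0" if "x \<notin> K" by (rule divergence_zero_outside[OF K(1) _ that]) (rule sY(2))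
      then show ?thesis using False mz[of x] by auto
    qed
    have i1: "integrable lborel (\<lambda>x. indicator \<Omega> x * (mflux x \<bullet> grad \<eta> x))"
    proof (rule integrable_indicator_mult[OF _ Omega_borel], rule integrable_continuous_support[OF _ K(1)])
      have "Ck_on 0 Nsub (\<lambda>x. mflux x \<bullet> grad \<eta> x)"
        using continuous_on_inner[OF Ck_field_continuous[OF mflux_C] continuous_on_subset[OF continuous_on_grad[OF open_UNIV smooth_onD[OF e(1)]]]]
        by simp
      from Ck_on_extend_zero[OF open_Nsub this K(1) KU(4)] mz(1)
      show "continuous_on UNIV (\<lambda>x. mflux x \<bullet> grad \<eta> x)" by simp
    qed (rule mz(1))
    have i2: "integrable lborel (\<lambda>x. indicator \<Omega> x * pd b (\<lambda>x. \<eta> x * g x) x)"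
      by (rule integrable_indicator_mult[OF _ Omega_borel], rule integrable_continuous_support[OF _ K(1)])
        (use eg b(1) mz(2) in auto)
    have "surface_integral S (\<lambda>x. (\<eta> x *\<^sub>R Y x) \<bullet> n x) = (LBINT x. indicator \<Omega> x * divergence (\<lambda>x. \<eta> x *\<^sub>R Y x) x)"
      by (rule div[OF sY(1) K(1) KU(3) sY(2), symmetric])
    also have "\<dots> = 0" unfolding dv using sv Bochner_Integration.integral_add[OF i1 i2] by simp
    finally show "surface_integral S (\<lambda>x. \<eta> x * (Y x \<bullet> n x)) = 0" by simp
  qed
  moreover have "?\<theta> x0 = 1" using P(6)[of x0] r(1) by simp
  moreover have px: "?p x0 = l * (n x0 \<bullet> b)" using pb[OF xW] l(1) by simp
  moreover have "n x0 \<bullet> b \<noteq> 0" using b(2) l(1) by auto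
  ultimately have "rho x0 * (grad \<Phi> x0 \<bullet> n x0) + pjump x0 / l = 0"
    unfolding Y_def g_def g0_def mflux_def by (simp add: inner_add_left inner_commute[of b])
  then have "rho x0 * (grad \<Phi> x0 \<bullet> n x0) * l + pjump x0 = 0" using l(2) by (simp add: field_simps)
  then show ?thesis unfolding l_def pjump_def by (simp add: inner_diff_left algebra_simps power2_eq_square)
qed

end

section \<open>No vacuum\<close>

lemma grad_compose_real:
  assumes "f differentiable at x" "(h has_real_derivative h') (at (f x))"
  shows "grad (\<lambda>y. h (f y)) x = h' *\<^sub>R grad f x"
proof (rule grad_eq_of_has_derivative)
  have "(h has_derivative (\<lambda>z. h' * z)) (at (f x))" using assms(2) by (simp add: has_field_derivative_def)
  from has_derivative_compose[OF has_derivative_grad[OF assms(1)] this]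
  show "((\<lambda>y. h (f y)) has_derivative (\<bullet>) (h' *\<^sub>R grad f x)) (at x)"
    by (rule has_derivative_eq_rhs) (simp add: fun_eq_iff)
qed

lemma grad_mult:
  assumes "f differentiable at x" "g differentiable at x"
  shows "grad (\<lambda>y. f y * g y) x = f x *\<^sub>R grad g x + g x *\<^sub>R grad f x"
proof (rule grad_eq_of_has_derivative)
  from has_derivative_mult[OF has_derivative_grad[OF assms(1)] has_derivative_grad[OF assms(2)]]
  show "((\<lambda>y. f y * g y) has_derivative (\<bullet>) (f x *\<^sub>R grad g x + g x *\<^sub>R grad f x)) (at x)"
    by (rule has_derivative_eq_rhs) (simp add: fun_eq_iff inner_add_left)
qed

context extended_potential
begin

definition excess where "excess x = q0\<^sup>2 - (norm (grad \<Phi> x))\<^sup>2"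

lemma excess_C: "Ck_on k UNIV excess"
  unfolding excess_def[abs_def] by (intro Ck_on_diff Ck_on_const Ck_on_norm_grad_sq open_UNIV Phi_C)

lemma excess_pos_iff: "0 < excess x \<longleftrightarrow> x \<in> Nsub"
  unfolding excess_def Nsub_def using q0 by (auto intro: power_strict_mono dest: power_less_imp_less_base)

lemma grad_Phi_field: "Ck_field k UNIV (grad \<Phi>)"
  by (intro ballI Ck_on_grad_inner open_UNIV Phi_C)

text \<open>The equation of motion divided by \<open>\<rho> / excess\<close>, since \<open>\<rho>\<close> is a constant times
  \<open>excess^(1/(\<gamma>-1))\<close>. In this form nothing blows up or degenerates as \<open>excess\<close> tends to zero.\<close>

lemma excess_equation:
  assumes x: "x \<in> \<Omega>" "x \<in> Nsub"
  shows "excess x * divergence (grad \<Phi>) x + (grad excess x \<bullet> grad \<Phi> x) / (\<gamma> - 1) = 0"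
proof -
  let ?c = "1 / ka * ((\<gamma> - 1) / (2 * \<gamma>))" and ?\<beta> = "1 / (\<gamma> - 1)"
  have c: "?c > 0" using gam ka by simp
  have w: "excess x > 0" using x(2) excess_pos_iff by simp
  have e: "excess differentiable at x" using excess_C[of 1] by simp
  have pw: "((\<lambda>z. (c * z) powr a) has_real_derivative a * (c * y) powr (a - 1) * c) (at y)" if "c > 0" "y > 0" for c a y :: real
    using that by (auto intro!: derivative_eq_intros)
  note pw[OF c w, of ?\<beta>]
  from grad_compose_real[OF e this]
  have "grad rho x = (?\<beta> * (?c * excess x) powr (?\<beta> - 1) * ?c) *\<^sub>R grad excess x"
    unfolding rho_def[abs_def] gas_density_def excess_def .
  moreover have "(?c * excess x) powr (?\<beta> - 1) * ?c = rho x / excess x"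
  proof -
    have h: "(c * y) powr (a - 1) * c = (c * y) powr a / y" if "c > 0" "y > 0" for c a y :: real
      using that by (simp add: powr_diff)
    show ?thesis using h[OF c w, of ?\<beta>] unfolding rho_def gas_density_def excess_def .
  qed
  ultimately have gr: "grad rho x = (?\<beta> * (rho x / excess x)) *\<^sub>R grad excess x" by (simp only: mult.assoc)
  have "rho differentiable at x" using rho_C[of 1] x(2) by simp
  moreover have "grad \<Phi> differentiable at x" by (rule Ck_field_differentiable[of 0 UNIV]) (use grad_Phi_field[of 1] in auto)
  ultimately have "divergence mflux x = rho x * divergence (grad \<Phi>) x + grad rho x \<bullet> grad \<Phi> x"
    unfolding mflux_def by (rule divergence_scaleR)
  also have "\<dots> = rho x / excess x * (excess x * divergence (grad \<Phi>) x + (grad excess x \<bullet> grad \<Phi> x) / (\<gamma> - 1))"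
    unfolding gr inner_scaleR_left using w by (simp add: distrib_left)
  finally have "rho x / excess x * (excess x * divergence (grad \<Phi>) x + (grad excess x \<bullet> grad \<Phi> x) / (\<gamma> - 1)) = 0"
    using equation_of_motion[OF x(1)] x(2) unfolding Nsub_def by simp
  moreover have "rho x / excess x \<noteq> 0" using rho_pos[OF x(2)] w by simp
  ultimately show ?thesis by (metis mult_eq_0_iff)
qed

text \<open>Put \<open>f = excess * exp (- \<mu> \<Phi>)\<close>. Where \<open>excess\<close> is positive and small, \<open>excess_equation\<close> shows that \<open>f\<close>
  strictly decreases in the direction of \<open>\<nabla>\<Phi>\<close>, if \<open>\<mu>\<close> is large. Suppose \<open>f \<le> \<delta>\<close> somewhere, with \<open>\<delta>\<close> so small
  that this excludes the boundary. At a point of \<open>{f \<le> \<delta>}\<close> where \<open>\<Phi>\<close> is maximal, moving along \<open>\<nabla>\<Phi>\<close>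
  increases \<open>\<Phi>\<close> and keeps \<open>f \<le> \<delta>\<close>, a contradiction. Hence \<open>f > \<delta>\<close> everywhere.\<close>

lemma no_vacuum: "closure \<Omega> \<subseteq> Nsub"
proof (cases "\<Omega> = {}")
  case True then show ?thesis by simp
next
  case ne: False
  have ne': "closure \<Omega> \<noteq> {}" using ne by simp
  have cl: "compact (closure \<Omega>)" using bounded_Omega by (simp add: compact_closure)
  have ec: "continuous_on X excess" for X using continuous_on_subset[OF Ck_on_imp_continuous[OF excess_C]] by blast
  have Pc: "continuous_on X \<Phi>" for X by (rule smooth_Phi_cont[OF Phi])
  have "continuous_on (closure \<Omega>) (\<lambda>x. \<bar>divergence (grad \<Phi>) x\<bar>)"
    by (intro continuous_intros continuous_on_subset[OF continuous_divergence[OF open_UNIV grad_Phi_field]]) auto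
  from continuous_attains_sup[OF cl ne' this] obtain L where L: "\<And>x. x \<in> closure \<Omega> ==> \<bar>divergence (grad \<Phi>) x\<bar> \<le> L" by blast
  from continuous_attains_sup[OF cl ne' Pc] obtain B where B: "\<And>x. x \<in> closure \<Omega> ==> \<Phi> x \<le> B" by blast
  (* large enough for the term with \<mu> to dominate that of the Laplacian once |\<nabla>\<Phi>|^2 is at least q0^2 / 2 *)
  define \<mu> where "\<mu> = ((\<gamma> - 1) * L + 1) * 2 / q0\<^sup>2"
  obtain z where "z \<in> closure \<Omega>" using ex_in_conv[of "closure \<Omega>"] ne' by metis
  then have L0: "L \<ge> 0" using L[of z] by linarith
  have mu: "\<mu> > 0" "\<mu> * (q0\<^sup>2 / 2) = (\<gamma> - 1) * L + 1"
  proof -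
    have "(\<gamma> - 1) * L \<ge> 0" using L0 gam by simp
    then show "\<mu> > 0" unfolding \<mu>_def using q0 by simp
    show "\<mu> * (q0\<^sup>2 / 2) = (\<gamma> - 1) * L + 1" unfolding \<mu>_def using q0 by simp
  qed
  define f where "f x = excess x * exp (- \<mu> * \<Phi> x)" for x
  have fc: "continuous_on X f" for X unfolding f_def[abs_def] by (intro continuous_intros ec Pc)
  have "\<exists>d>0. \<forall>x\<in>S \<union> \<Gamma>. d < f x"
  proof (cases "S \<union> \<Gamma> = {}")
    case False
    have "compact (S \<union> \<Gamma>)" using S(3) compact_Gamma by (rule compact_Un)
    from continuous_attains_inf[OF this False fc] obtain z where z: "z \<in> S \<union> \<Gamma>" "\<And>y. y \<in> S \<union> \<Gamma> ==> f z \<le> f y" by blast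
    have "z \<in> closure \<Omega>" using z(1) S_frontier(1) Gamma_closure(1) by blast
    then have "z \<in> Nsub" unfolding Nsub_def using novac[OF z(1)] grad_Phi by simp
    then have "f z > 0" unfolding f_def using excess_pos_iff by simp
    then show ?thesis using z(2) by (intro exI[of _ "f z / 2"]) force
  qed (auto intro: exI[of _ 1])
  then obtain d where d: "d > 0" "\<And>x. x \<in> S \<union> \<Gamma> ==> d < f x" by blast
  (* the second bound makes excess at most q0^2 / 2 on C, so that \<nabla>\<Phi> does not vanish there *)
  define \<delta> where "\<delta> = min d (q0\<^sup>2 / 2 * exp (- \<mu> * B))"
  have del: "\<delta> > 0" "\<delta> \<le> d" "\<delta> \<le> q0\<^sup>2 / 2 * exp (- \<mu> * B)" unfolding \<delta>_def using d(1) q0 by auto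
  define C where "C = {x \<in> closure \<Omega>. f x \<le> \<delta>}"
  have C: "x \<in> C \<longleftrightarrow> x \<in> closure \<Omega> \<and> f x \<le> \<delta>" for x unfolding C_def by simp
  have C\<Omega>: "x \<in> \<Omega>" if "x \<in> C" for x using that closure_Omega d(2)[of x] del(2) unfolding C by force
  have half: "q0\<^sup>2 / 2 \<le> (norm (grad \<Phi> x))\<^sup>2" if "x \<in> C" for x
  proof -
    have "excess x * exp (- \<mu> * \<Phi> x) \<le> q0\<^sup>2 / 2 * exp (- \<mu> * B)" using that del(3) unfolding f_def C by simp
    also have "\<dots> \<le> q0\<^sup>2 / 2 * exp (- \<mu> * \<Phi> x)" using B[of x] that mu(1) unfolding C by (intro mult_left_mono) auto
    finally show ?thesis unfolding excess_def by simp
  qed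
  have "C = {}"
  proof (rule ccontr)
    assume Cne: "C \<noteq> {}"
    have Cc: "compact C"
    proof -
      have "C = closure \<Omega> \<inter> {x. f x \<le> \<delta>}" using C by blast
      moreover have "closed {x. f x \<le> \<delta>}" by (rule closed_Collect_le[OF fc continuous_on_const])
      ultimately show ?thesis using compact_Int_closed[OF cl] by metis
    qed
    obtain x where x: "x \<in> C" "\<And>y. y \<in> C ==> \<Phi> y \<le> \<Phi> x"
    proof -
      from continuous_attains_sup[OF Cc Cne Pc] show ?thesis using that by (elim bexE) blast
    qed
    have xO: "x \<in> \<Omega>" by (rule C\<Omega>[OF x(1)])
    have q2: "0 < q0\<^sup>2 / 2" using q0 by simp
    have gg: "0 < grad \<Phi> x \<bullet> grad \<Phi> x" using half[OF x(1)] q2 unfolding power2_norm_eq_inner by linarith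
    have mP: "(\<lambda>y. - \<Phi> y) differentiable at x" using Phi_diff[of x] by simp
    have "grad (\<lambda>y. - \<Phi> y) x = - grad \<Phi> x"
      by (rule grad_eq_of_has_derivative) (use has_derivative_minus[OF has_derivative_grad[OF Phi_diff]] in simp)
    then obtain e1 where e1: "e1 > 0" "\<And>t. 0 < t ==> t < e1 ==> \<Phi> x < \<Phi> (x + t *\<^sub>R grad \<Phi> x)"
      using decrease_along[OF mP, of "grad \<Phi> x"] gg by auto
    have mv: "\<exists>e>0. \<forall>t. 0 < t \<and> t < e \<longrightarrow> x + t *\<^sub>R grad \<Phi> x \<in> U" if "open U" "x \<in> U" for U
    proof -
      have "((\<lambda>t. x + t *\<^sub>R grad \<Phi> x) \<longlongrightarrow> x + 0 *\<^sub>R grad \<Phi> x) (at_right 0)" by (intro tendsto_intros)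
      then have "\<forall>\<^sub>F t in at_right 0. x + t *\<^sub>R grad \<Phi> x \<in> U" using that by (intro topological_tendstoD) auto
      then show ?thesis unfolding eventually_at_right_field by auto
    qed
    obtain e2 where e2: "e2 > 0" "\<And>t. 0 < t ==> t < e2 ==> x + t *\<^sub>R grad \<Phi> x \<in> \<Omega>" using mv[OF open_Omega xO] by blast
    have "\<exists>e>0. \<forall>t. 0 < t \<and> t < e \<longrightarrow> f (x + t *\<^sub>R grad \<Phi> x) \<le> \<delta>"
    proof (cases "f x < \<delta>")
      case True
      have "open {y \<in> UNIV. f y < \<delta>}" by (intro open_less_set open_UNIV fc continuous_on_const)
      from mv[OF this] True show ?thesis by fastforce
    next
      case False
      then have "f x > 0" using del(1) by simp
      then have w: "excess x > 0" unfolding f_def by (simp add: zero_less_mult_iff)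
      have dE: "excess differentiable at x" using excess_C[of 1] by simp
      have dX: "(\<lambda>y. exp (- \<mu> * \<Phi> y)) differentiable at x" unfolding differentiable_def
        using has_derivative_exp[OF has_derivative_mult_right[OF has_derivative_grad[OF Phi_diff]]] by blast
      have "((\<lambda>z. exp (- \<mu> * z)) has_real_derivative - \<mu> * exp (- \<mu> * \<Phi> x)) (at (\<Phi> x))"
        by (auto intro!: derivative_eq_intros)
      from grad_mult[OF dE dX, unfolded grad_compose_real[OF Phi_diff this]]
      have "grad f x \<bullet> grad \<Phi> x = exp (- \<mu> * \<Phi> x) * (grad excess x \<bullet> grad \<Phi> x - \<mu> * excess x * (grad \<Phi> x \<bullet> grad \<Phi> x))"
        unfolding f_def[abs_def] by (simp only: inner_add_left inner_scaleR_left) (simp add: algebra_simps)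
      moreover have "grad excess x \<bullet> grad \<Phi> x = - (\<gamma> - 1) * (excess x * divergence (grad \<Phi>) x)"
      proof -
        have "x \<in> Nsub" using w excess_pos_iff by simp
        then show ?thesis using excess_equation[OF xO] gam by (simp add: field_simps)
      qed
      moreover have "- (\<gamma> - 1) * (excess x * divergence (grad \<Phi>) x) - \<mu> * excess x * (grad \<Phi> x \<bullet> grad \<Phi> x) < 0"
      proof -
        have "- divergence (grad \<Phi>) x \<le> L" using L[of x] x(1) C by auto
        then have a: "(\<gamma> - 1) * - divergence (grad \<Phi>) x \<le> (\<gamma> - 1) * L" using gam by (intro mult_left_mono) auto
        have "\<mu> * (q0\<^sup>2 / 2) \<le> \<mu> * (grad \<Phi> x \<bullet> grad \<Phi> x)"
          using half[OF x(1)] mu(1) by (intro mult_left_mono) (auto simp: power2_norm_eq_inner)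
        then have "(\<gamma> - 1) * - divergence (grad \<Phi>) x - \<mu> * (grad \<Phi> x \<bullet> grad \<Phi> x) < 0" using a mu(2) by linarith
        then have "excess x * ((\<gamma> - 1) * - divergence (grad \<Phi>) x - \<mu> * (grad \<Phi> x \<bullet> grad \<Phi> x)) < 0"
          using w by (simp add: mult_pos_neg)
        then show ?thesis by (simp add: algebra_simps)
      qed
      ultimately have "grad f x \<bullet> grad \<Phi> x < 0" by (simp add: mult_pos_neg)
      moreover have "f differentiable at x" unfolding f_def[abs_def] by (intro differentiable_mult dE dX)
      ultimately have "\<exists>e>0. \<forall>t. 0 < t \<and> t < e \<longrightarrow> f (x + t *\<^sub>R grad \<Phi> x) < f x" using decrease_along by blast
      moreover have "f x \<le> \<delta>" using x(1) C by simp
      ultimately show ?thesis by (meson less_imp_le less_le_trans)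
    qed
    then obtain e3 where e3: "e3 > 0" "\<And>t. 0 < t ==> t < e3 ==> f (x + t *\<^sub>R grad \<Phi> x) \<le> \<delta>" by blast
    define t where "t = min e1 (min e2 e3) / 2"
    have t: "0 < t" "t < e1" "t < e2" "t < e3" unfolding t_def using e1(1) e2(1) e3(1) by auto
    have "x + t *\<^sub>R grad \<Phi> x \<in> C" using e2(2)[OF t(1,3)] e3(2)[OF t(1,4)] closure_subset unfolding C by blast
    then show False using x(2) e1(2)[OF t(1,2)] by fastforce
  qed
  show ?thesis
  proof
    fix x assume "x \<in> closure \<Omega>"
    then have "\<not> f x \<le> \<delta>" using \<open>C = {}\<close> C[of x] by simp
    then have "f x > 0" using del(1) by linarith
    then have "excess x > 0" unfolding f_def by (simp add: zero_less_mult_iff)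
    then show "x \<in> Nsub" using excess_pos_iff by simp
  qed
qed

section \<open>The fluxes through the shock\<close>

lemma flux_through_shock: "surface_integral S (\<lambda>x. mflux x \<bullet> n x) = - surface_integral \<Gamma> (\<lambda>x. mflux x \<bullet> n x)"
proof -
  have "indicator \<Omega> x * divergence mflux x = 0" for x
    using equation_of_motion[of x] no_vacuum closure_subset unfolding Nsub_def by (fastforce simp: indicator_def)
  then show ?thesis
    using divergence_theorem[OF open_Omega bounded_Omega bounds_Omega_S bounds_Omega_Gamma Gamma_disjoint(3) frontier_Omega
        open_Nsub no_vacuum mflux_C] by (simp only: integral_zero)
qed

text \<open>The region beyond the shock is bounded by the shock, with reversed normal, and by the outer
  sphere.\<close>

lemma supersonic_flux_through_shock:
  assumes mass: "\<And>x. x \<in> A ==> divergence (\<lambda>y. rhos y *\<^sub>R (- grad \<phi>s y)) x = 0"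
  shows "surface_integral S (\<lambda>x. rhos x * (grad \<phi>s x \<bullet> n x))
    = surface_integral (sphere 0 R) (\<lambda>x. rhos x * (grad \<phi>s x \<bullet> outer_normal A x))"
proof -
  let ?E = "A - closure \<Omega>" and ?T = "sphere (0::'a) R"
  let ?X = "\<lambda>y. rhos y *\<^sub>R (- grad \<phi>s y)"
  have R: "R > 0" using D(3,4) closure_subset[of D] by (metis all_not_in_conv ball_eq_empty not_le subset_empty)
  have oE: "open ?E" and bE: "bounded ?E" using open_A bounded_A by (auto intro: bounded_subset)
  have Ab: "A \<subseteq> ball 0 R" unfolding A by blast
  have clO: "closure \<Omega> \<subseteq> ball 0 R"
    using closure_Omega Omega_subset(1) S_subset_A Ab Gamma_closure_D D(4) by blast
  have dis: "S \<inter> ?T = {}" using S_subset_A Ab by auto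
  have fr: "frontier ?E \<subseteq> S \<union> ?T"
  proof
    fix x assume x: "x \<in> frontier ?E"
    have xc: "x \<in> closure ?E" "x \<notin> ?E" using x oE unfolding frontier_def by (auto simp: interior_open)
    have "inside S \<inter> ?E = {}" using closure_subset[of \<Omega>] unfolding Om_inside by blast
    then have xi: "x \<notin> inside S" using open_Int_closure_eq_empty[OF open_inside_S] xc(1) by blast
    have "?E \<subseteq> cball 0 R" using Ab ball_subset_cball by blast
    then have "x \<in> cball 0 R" using xc(1) closure_minimal[OF _ closed_cball] by blast
    then consider "x \<in> ?T" | "x \<in> ball 0 R" by force
    then show "x \<in> S \<union> ?T"
    proof cases
      case 2
      then have "x \<in> A" using xi closure_D_inside unfolding A by blast
      then have "x \<in> closure \<Omega>" using xc(2) by blast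
      then show ?thesis using closure_Omega Omega_subset(2) S(4) xi by blast
    qed simp
  qed
  have chS: "\<exists>U \<psi>. boundary_chart ?E x U \<psi> \<and> outer_normal ?E x = - n x" if x: "x \<in> S" for x
  proof -
    obtain U \<psi> where c: "boundary_chart \<Omega> x U \<psi>" using S(2) x unfolding smooth_boundary_on_def by blast
    have c': "boundary_chart ?E x (U \<inter> A) (\<lambda>y. - \<psi> y)"
      by (rule chart_restrict[OF chart_complement[OF c] open_A]) (use x S_subset_A in auto)
    have "\<psi> differentiable at x" using c smooth_onD[of U \<psi> 1] unfolding boundary_chart_def by auto
    then have "grad (\<lambda>y. - \<psi> y) x = - grad \<psi> x"
      by (intro grad_eq_of_has_derivative) (use has_derivative_minus[OF has_derivative_grad] in auto)
    then have "outer_normal ?E x = - n x" using outer_normal_eq[OF c'] outer_normal_eq[OF c] by (simp add: sgn_minus)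
    then show ?thesis using c' by blast
  qed
  have chT: "\<exists>U \<psi>. boundary_chart ?E x U \<psi> \<and> outer_normal ?E x = outer_normal A x" if x: "x \<in> ?T" for x
  proof -
    (* the origin is removed because the gradient of the squared norm vanishes there *)
    let ?U = "- (closure D \<union> closure \<Omega> \<union> {0})" and ?\<psi> = "\<lambda>y::'a. (y - 0) \<bullet> (y - 0) - R\<^sup>2"
    have g: "grad ?\<psi> y = 2 *\<^sub>R y" for y
    proof (rule grad_eq_of_has_derivative)
      show "(?\<psi> has_derivative (\<bullet>) (2 *\<^sub>R y)) (at y)"
        by (auto intro!: derivative_eq_intros simp: inner_commute fun_eq_iff)
    qed
    have lt: "?\<psi> y < 0 \<longleftrightarrow> y \<in> ball 0 R" for y
      using R by (auto simp: power2_norm_eq_inner[symmetric] intro: power_strict_mono dest: power_less_imp_less_base)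
    have ou: "open ?U" by (rule open_Compl[OF closed_Un[OF closed_Un[OF closed_closure closed_closure] closed_singleton]])
    have sm: "smooth_on ?U ?\<psi>" unfolding smooth_on_def
      by (intro allI Ck_on_diff Ck_on_const Ck_on_subset[OF Ck_on_dist_sq] ou subset_UNIV)
    have xU: "x \<in> ?U" using x D(4) clO R by auto
    have p0: "?\<psi> x = 0" using x by (simp add: power2_norm_eq_inner[symmetric])
    have "?E \<inter> ?U = {y \<in> ?U. y \<in> ball 0 R}" "A \<inter> ?U = {y \<in> ?U. y \<in> ball 0 R}" unfolding A by blast+
    moreover have "\<forall>y\<in>?U. 2 *\<^sub>R y \<noteq> 0" by simp
    ultimately have c: "boundary_chart ?E x ?U ?\<psi>" "boundary_chart A x ?U ?\<psi>"
      unfolding boundary_chart_def g lt using ou xU sm p0 by (simp_all only: simp_thms)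
    show ?thesis using c(1) outer_normal_eq[OF c(1)] outer_normal_eq[OF c(2)] by auto
  qed
  have frI: "x \<in> frontier ?E" if "\<exists>U \<psi>. boundary_chart ?E x U \<psi> \<and> P" for x P
    using that chart_frontier(1) boundary_chartD(2,5) by blast
  have bS: "bounds ?E S"
    by (rule boundsI[OF S(3) _ _ dis fr]) (use chS frI in \<open>auto simp: smooth_boundary_on_def\<close>)
  have bT: "bounds ?E ?T"
    by (rule boundsI[OF compact_sphere _ closed_S]) (use chT frI dis fr in \<open>auto simp: smooth_boundary_on_def\<close>)
  have X: "Ck_field 1 Nsup ?X"
  proof (rule Ck_field_scaleR[OF Nsup(1) rhos_C1], rule ballI)
    fix b :: 'a
    have "Ck_on 1 Nsup (\<lambda>x. grad \<phi>s x \<bullet> b)"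
      by (rule Ck_on_grad_inner[OF Nsup(1) Ck_on_subset[OF W2]]) (auto simp: Nsup_def)
    then show "Ck_on 1 Nsup (\<lambda>x. - grad \<phi>s x \<bullet> b)" unfolding inner_minus_left by (rule Ck_on_minus[OF Nsup(1)])
  qed
  have cl: "closure ?E \<subseteq> Nsup" using closure_mono[of ?E A] Nsup(2) by blast
  have z: "indicator ?E x * divergence ?X x = 0" for x using mass[of x] by (simp add: indicator_def)
  have "surface_integral S (\<lambda>x. ?X x \<bullet> outer_normal ?E x) + surface_integral ?T (\<lambda>x. ?X x \<bullet> outer_normal ?E x) = 0"
    using divergence_theorem[OF oE bE bS bT dis fr Nsup(1) cl X] unfolding z by simp
  moreover have "surface_integral S (\<lambda>x. ?X x \<bullet> outer_normal ?E x) = surface_integral S (\<lambda>x. rhos x * (grad \<phi>s x \<bullet> n x))"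
    by (rule surface_integral_cong) (use chS in force)
  moreover have "surface_integral ?T (\<lambda>x. ?X x \<bullet> outer_normal ?E x)
    = surface_integral ?T (\<lambda>x. (- 1) * (rhos x * (grad \<phi>s x \<bullet> outer_normal A x)))"
    by (rule surface_integral_cong) (use chT in force)
  ultimately show ?thesis unfolding surface_integral_cmult by simp
qed

end

section \<open>One-sided values\<close>

text \<open>A boundary chart places \<open>x\<close> in the closure of \<open>E\<close> but not in \<open>E\<close>, so that the limit within \<open>E\<close> is
  unique.\<close>

lemma trace_grad_eq:
  assumes E: "open E" and \<Phi>: "smooth_on UNIV \<Phi>" "\<And>x. x \<in> E ==> \<Phi> x = \<phi> x" and c: "boundary_chart E x U \<psi>"
  shows "trace_grad E \<phi> x = grad \<Phi> x"
proof -
  have x: "x \<in> frontier E" using chart_frontier(1)[OF c] boundary_chartD(2,5)[OF c] by blast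
  then have xE: "x \<in> closure E" "x \<notin> E" using E unfolding frontier_def by (auto simp: interior_open)
  have "continuous (at x) (grad \<Phi>)"
    using continuous_on_grad[OF open_UNIV smooth_onD[OF \<Phi>(1)]] by (simp add: continuous_on_eq_continuous_at)
  then have "(grad \<Phi> \<longlongrightarrow> grad \<Phi> x) (at x within E)"
    unfolding continuous_at using tendsto_within_subset by blast
  moreover have "\<forall>\<^sub>F y in at x within E. grad \<Phi> y = grad \<phi> y"
    unfolding eventually_at_filter using grad_cong_open[OF E _ \<Phi>(2)] by (intro always_eventually) auto
  ultimately have "(grad \<phi> \<longlongrightarrow> grad \<Phi> x) (at x within E)" by (metis tendsto_cong)
  moreover have "at x within E \<noteq> bot" using xE by (simp add: at_within_eq_bot_iff)
  ultimately show ?thesis unfolding trace_grad_def using tendsto_Lim by blast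
qed

theorem theorem4p2:
  fixes \<gamma> k0 ka q0 M0 R :: real
    and D A \<Gamma> \<Omega> S W V :: "'a::euclidean_space set"
    and \<phi>s \<rho>s ps m \<phi> \<Phi>0 \<rho> p :: "'a \<Rightarrow> real"
    and n \<nu> v :: "'a \<Rightarrow> 'a"
  assumes constants: "\<gamma> > 1" "k0 > 0" "ka > k0" "q0 > 0" "M0 > 0"
    and domain: "open D" "connected D" "D \<noteq> {}" "closure D \<subseteq> ball 0 R"
      "\<Gamma> = frontier D" "smooth_boundary_on D \<Gamma>"
      "A = ball 0 R - closure D"
      "\<nu> = outer_normal A"
    and supersonic_flow:
      "open W" "closure A \<subseteq> W" "Ck_on 2 W \<phi>s"
      "\<forall>x\<in>sphere 0 R. \<phi>s x = 0"
      "\<forall>x\<in>A. critical_speed \<gamma> q0 < norm (grad \<phi>s x)"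
      "\<forall>x\<in>closure A. norm (grad \<phi>s x) < q0"
      "\<rho>s = (\<lambda>x. gas_density \<gamma> k0 q0 ((norm (grad \<phi>s x))\<^sup>2))"
      "ps = (\<lambda>x. pressure \<gamma> k0 (\<rho>s x))"
      "steady_euler \<gamma> A \<rho>s (\<lambda>x. - grad \<phi>s x) ps"
      "\<forall>x\<in>sphere 0 R. - grad \<phi>s x \<bullet> \<nu> x < 0"
      "surface_integral (sphere 0 R) (\<lambda>x. \<rho>s x * (grad \<phi>s x \<bullet> \<nu> x)) = 2 * pi * M0"
    and boundary_flux:
      "open V" "\<Gamma> \<subseteq> V" "smooth_on V m" "surface_integral \<Gamma> m = 2 * pi * M0"
    and critical: "critical_point \<gamma> k0 ka q0 A \<Gamma> \<phi>s m \<phi>"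
    and free_boundary:
      "\<Omega> = noncoincidence A \<phi>s \<phi>"
      "S = shock A \<phi>s \<phi>"
      "smooth_boundary_on \<Omega> S" "compact S" "DIM('a) \<ge> 2 \<longrightarrow> connected S"
      "\<Gamma> \<subseteq> inside S" "\<Omega> = A \<inter> inside S"
      "n = outer_normal \<Omega>"
    and smooth_solution: "smooth_on UNIV \<Phi>0" "\<forall>x\<in>\<Omega>. \<Phi>0 x = \<phi> x"
    and one_sided_values:
      "v = trace_grad \<Omega> \<phi>"
      "\<rho> = (\<lambda>x. gas_density \<gamma> ka q0 ((norm (v x))\<^sup>2))"
      "p = (\<lambda>x. pressure \<gamma> ka (\<rho> x))"
    and displacement_defined: "\<forall>x\<in>S. grad \<phi>s x \<bullet> n x \<noteq> v x \<bullet> n x"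
    and no_vacuum_on_boundary: "\<forall>x\<in>S \<union> \<Gamma>. norm (v x) < q0"
  shows
    "(\<forall>x\<in>A. \<phi> x > \<phi>s x \<and> norm (grad \<phi> x) < q0 \<longrightarrow>
        (\<lambda>y. gas_density \<gamma> ka q0 ((norm (grad \<phi> y))\<^sup>2) *\<^sub>R grad \<phi> y) differentiable (at x) \<and>
        divergence (\<lambda>y. gas_density \<gamma> ka q0 ((norm (grad \<phi> y))\<^sup>2) *\<^sub>R grad \<phi> y) x = 0) \<and>
     (\<forall>x\<in>S. p x + \<rho> x * (v x \<bullet> n x)\<^sup>2
              = ps x + \<rho> x * (v x \<bullet> n x) * (grad \<phi>s x \<bullet> n x)) \<and>
     (\<forall>x\<in>\<Gamma>. \<rho> x * (v x \<bullet> \<nu> x) = - m x) \<and>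
     surface_integral S (\<lambda>x. \<rho> x * (v x \<bullet> n x))
       = - surface_integral \<Gamma> (\<lambda>x. \<rho> x * (v x \<bullet> \<nu> x)) \<and>
     - surface_integral \<Gamma> (\<lambda>x. \<rho> x * (v x \<bullet> \<nu> x)) = surface_integral \<Gamma> m \<and>
     surface_integral \<Gamma> m = 2 * pi * M0 \<and>
     2 * pi * M0 = surface_integral S (\<lambda>x. \<rho>s x * (grad \<phi>s x \<bullet> n x))"
proof -
  have OA: "\<Omega> = (ball 0 R - closure D) \<inter> inside S" using free_boundary(7) domain(7) by simp
  have oi: "open (inside S)" using open_inside compact_imp_closed[OF free_boundary(4)] by blast
  have oO: "open \<Omega>" unfolding OA using oi by (intro open_Int open_Diff) auto
  have ex: "\<And>x. x \<in> \<Omega> \<Longrightarrow> \<Phi>0 x = \<phi> x" using smooth_solution(2) by blast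
  have chart: "\<exists>U \<psi>. boundary_chart \<Omega> x U \<psi>" if x: "x \<in> S \<union> \<Gamma>" for x
  proof (cases "x \<in> S")
    case True
    then show ?thesis using free_boundary(3) unfolding smooth_boundary_on_def by blast
  next
    case False
    then have xG: "x \<in> \<Gamma>" using x by blast
    then obtain U \<psi> where c: "boundary_chart D x U \<psi>" using domain(6) unfolding smooth_boundary_on_def by blast
    have "x \<in> closure D" using xG domain(5) unfolding frontier_def by blast
    then have "x \<in> ball 0 R \<inter> inside S" using xG domain(4) free_boundary(6) by blast
    then show ?thesis using chart_restrict[OF chart_complement[OF c], of "ball 0 R \<inter> inside S" \<Omega>] oi unfolding OA by blast
  qed
  have v: "v x = grad \<Phi>0 x" if "x \<in> S \<union> \<Gamma>" for x
    using chart[OF that] trace_grad_eq[OF oO smooth_solution(1) ex] unfolding one_sided_values(1) by blast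
  have mV: "continuous_on \<Gamma> m"
    using Ck_on_imp_continuous[OF smooth_onD[OF boundary_flux(3)]] boundary_flux(2) continuous_on_subset by blast
  (* the traces are replaced by gradients of \<Phi>0, in which the locale is stated *)
  interpret transonic_shock \<gamma> k0 ka q0 R D A \<Gamma> \<Omega> S W \<phi>s m \<phi> \<Phi>0
  proof
    show "grad \<phi>s x \<bullet> outer_normal \<Omega> x \<noteq> grad \<Phi>0 x \<bullet> outer_normal \<Omega> x" if "x \<in> S" for x
      using displacement_defined v[of x] that unfolding free_boundary(8) by auto
    show "norm (grad \<Phi>0 x) < q0" if "x \<in> S \<union> \<Gamma>" for x using bspec[OF no_vacuum_on_boundary that] v[OF that] by simp
  qed (use assms mV ex in auto)
  obtain \<Phi> N where ext: "smooth_on UNIV \<Phi>" "open N" "closure \<Omega> \<subseteq> N" "\<And>x. x \<in> N \<Longrightarrow> \<Phi> x = \<Phi>0 x"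
    "\<And>x. x \<in> closure A - closure \<Omega> \<Longrightarrow> \<Phi> x < \<phi>s x" by (rule extension_exists) blast
  interpret extended_potential \<gamma> k0 ka q0 R D A \<Gamma> \<Omega> S W \<phi>s m \<phi> \<Phi>0 \<Phi> N
    by unfold_locales (use ext in auto)
  have vb: "v x = grad \<Phi> x" "\<rho> x = rho x" if "x \<in> S \<union> \<Gamma>" for x
  proof -
    have "x \<in> closure \<Omega>" using that S_frontier(1) Gamma_closure(1) by blast
    then show "v x = grad \<Phi> x" using v[OF that] grad_Phi by simp
    then show "\<rho> x = rho x" unfolding one_sided_values(2) rho_def by simp
  qed
  have nu: "\<nu> x = n x" if "x \<in> \<Gamma>" for x
    using outer_normal_Gamma[OF that] unfolding domain(8) free_boundary(8) by simp
  have rs: "\<rho>s = rhos" unfolding supersonic_flow(7) rhos_def by simp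
  have S1: "surface_integral S (\<lambda>x. \<rho> x * (v x \<bullet> n x)) = surface_integral S (\<lambda>x. mflux x \<bullet> outer_normal \<Omega> x)"
    by (rule surface_integral_cong) (simp add: vb mflux_def free_boundary(8))
  have G1: "surface_integral \<Gamma> (\<lambda>x. \<rho> x * (v x \<bullet> \<nu> x)) = surface_integral \<Gamma> (\<lambda>x. mflux x \<bullet> outer_normal \<Omega> x)"
    by (rule surface_integral_cong) (simp add: vb mflux_def nu free_boundary(8))
  have gam_bc: "\<rho> x * (v x \<bullet> \<nu> x) = - m x" if "x \<in> \<Gamma>" for x
    using inner_boundary_condition[OF that] vb[of x] nu[OF that] that unfolding mflux_def free_boundary(8) by simp
  have G2: "- surface_integral \<Gamma> (\<lambda>x. \<rho> x * (v x \<bullet> \<nu> x)) = surface_integral \<Gamma> m"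
  proof -
    have "surface_integral \<Gamma> (\<lambda>x. \<rho> x * (v x \<bullet> \<nu> x)) = surface_integral \<Gamma> (\<lambda>x. (- 1) * m x)"
      by (rule surface_integral_cong) (simp add: gam_bc)
    then show ?thesis unfolding surface_integral_cmult by simp
  qed
  have motion: "(\<lambda>y. gas_density \<gamma> ka q0 ((norm (grad \<phi> y))\<^sup>2) *\<^sub>R grad \<phi> y) differentiable (at x) \<and>
      divergence (\<lambda>y. gas_density \<gamma> ka q0 ((norm (grad \<phi> y))\<^sup>2) *\<^sub>R grad \<phi> y) x = 0"
    if x: "x \<in> A" "\<phi> x > \<phi>s x" "norm (grad \<phi> x) < q0" for x
  proof -
    have xO: "x \<in> \<Omega>" using x(1,2) phi_outside by fastforce
    have g: "grad \<phi> y = grad \<Phi> y" if "y \<in> \<Omega>" for y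
      using grad_cong_open[OF open_Omega that, of \<phi> \<Phi>] Phi_phi closure_subset by fastforce
    have f: "gas_density \<gamma> ka q0 ((norm (grad \<phi> y))\<^sup>2) *\<^sub>R grad \<phi> y = mflux y" if "y \<in> \<Omega>" for y
      unfolding mflux_def rho_def g[OF that] ..
    have xN: "x \<in> Nsub" using x(3) unfolding Nsub_def g[OF xO] by simp
    have "mflux differentiable at x" by (rule Ck_field_differentiable[of 0 Nsub]) (use mflux_C[of 1] xN in auto)
    moreover have "divergence mflux x = 0" using equation_of_motion[OF xO] xN unfolding Nsub_def by simp
    ultimately show ?thesis
      using differentiable_cong_open[OF open_Omega xO f] divergence_cong_open[OF open_Omega xO f] by simp
  qed
  have shk: "p x + \<rho> x * (v x \<bullet> n x)\<^sup>2 = ps x + \<rho> x * (v x \<bullet> n x) * (grad \<phi>s x \<bullet> n x)" if "x \<in> S" for x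
    using shock_condition[OF that] vb[of x] that unfolding one_sided_values(3) supersonic_flow(8) rs free_boundary(8) by simp
  have mass: "divergence (\<lambda>y. rhos y *\<^sub>R (- grad \<phi>s y)) x = 0" if "x \<in> A" for x
    using supersonic_flow(9) that unfolding steady_euler_def rs by blast
  have "surface_integral S (\<lambda>x. \<rho>s x * (grad \<phi>s x \<bullet> n x)) = 2 * pi * M0"
    using supersonic_flux_through_shock[OF mass] supersonic_flow(11) unfolding rs domain(8) free_boundary(8) by simp
  moreover have "surface_integral S (\<lambda>x. \<rho> x * (v x \<bullet> n x)) = - surface_integral \<Gamma> (\<lambda>x. \<rho> x * (v x \<bullet> \<nu> x))"
    using flux_through_shock unfolding S1 G1 .
  ultimately show ?thesis using motion shk gam_bc G2 boundary_flux(4) by (intro conjI ballI impI) auto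
qed

end
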